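(* Let $m=7\cdot 2^s-5$ with $s$ a positive integer. Then: (i) $\dim_{\mathbb F_2}(QP_5)_{m}=191$ for $s=1$, and $\dim_{\mathbb F_2}(QP_5)_{m}=1245$ for any $s\geqslant 2$. (ii) $(QP_5)_{m}^{GL_5}=0$ for any $s\geqslant 1$.
   Context: $\mathcal A$ is the mod-2 Steenrod algebra. $P_5=\mathbb F_2[x_1,\dots,x_5]$ with each $x_i$ of degree 1, with $\mathcal A$-action given by $Sq^0=\mathrm{id}$, $Sq^1x_i=x_i^2$, $Sq^jx_i=0$ for $j>1$, and the Cartan formula. $GL_5=GL_5(\mathbb F_2)$ acts on $P_5$ by linear substitution of the variables; this commutes with the action of $\mathcal A$. $QP_5=\mathbb F_2\otimes_{\mathcal A}P_5=P_5/\mathcal A^+P_5$, where $\mathcal A^+$ is the augmentation ideal of $\mathcal A$; $(QP_5)_m$ is its homogeneous part of degree $m$, and $(QP_5)_m^{GL_5}$ is the subspace of $GL_5$-invariants. *)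

theory Defs
  imports
    "HOL-Analysis.Cartesian_Space"
    "HOL-Computational_Algebra.Formal_Power_Series"
    "HOL-Computational_Algebra.Polynomial"
    "HOL-Library.Numeral_Type"
    "HOL-Library.Poly_Mapping"
    "HOL-Library.Z2"
begin

section \<open>Characteristic two\<close>

class ring_char_two = ring_1 +
  assumes one_plus_one_eq_0: "1 + 1 = 0"
begin

lemma add_self_eq_0 [simp]: "x + x = 0"
proof -
  have "x + x = (1 + 1) * x" by (simp only: distrib_right mult_1_left)
  then show ?thesis by (simp add: one_plus_one_eq_0 del: one_add_one)
qed

lemma uminus_eq_self: "- x = x"
  by (rule minus_unique) simp

lemma minus_eq_plus: "x - y = x + y"
  by (metis add_uminus_conv_diff uminus_eq_self)

lemma of_nat_char_two: "of_nat n = (if even n then 0 else 1)"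
  by (induction n) (auto simp: one_plus_one_eq_0 simp del: one_add_one)

end

instance bit :: ring_char_two
  by standard simp

instance poly_mapping :: (monoid_add, ring_char_two) ring_char_two
  by standard (simp add: one_plus_one_eq_0 single_zero del: one_add_one single_one
      flip: single_one single_add)

instance poly :: ("{comm_ring_1, ring_char_two}") ring_char_two
  by standard (simp add: one_pCons one_plus_one_eq_0 del: one_add_one)

instance fps :: ("{comm_ring_1, ring_char_two}") ring_char_two
  by standard (simp only: fps_const_1_eq_1[symmetric] fps_const_add one_plus_one_eq_0 fps_const_0_eq_0)

text \<open>
  A finitely supported function with values in \<^typ>\<open>bit\<close> is the sum of the basis vectors
  in its support, so the linear extension of \<open>h\<close> needs no coefficients.
\<close>

definition bit_ext :: "('k \<Rightarrow> 'a::comm_monoid_add) \<Rightarrow> ('k \<Rightarrow>\<^sub>0 bit) \<Rightarrow> 'a" where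
  "bit_ext h p = (\<Sum>k\<in>Poly_Mapping.keys p. h k)"

lemma bit_ext_0 [simp]: "bit_ext h 0 = 0"
  by (simp add: bit_ext_def)

lemma bit_ext_single [simp]: "bit_ext h (Poly_Mapping.single k 1) = h k"
  by (simp add: bit_ext_def)

lemma bit_ext_add:
  fixes h :: "'k \<Rightarrow> 'a::ring_char_two"
  shows "bit_ext h (p + q) = bit_ext h p + bit_ext h q"
proof -
  define f where "f k c = (if c = (1::bit) then h k else 0)" for k c
  have eq: "bit_ext h r = (\<Sum>k\<in>Poly_Mapping.keys r. f k (Poly_Mapping.lookup r k))" for r
    unfolding bit_ext_def f_def by (rule sum.cong) (auto simp: in_keys_iff)
  have f_add: "f k (a + b) = f k a + f k b" for k a b
    by (cases a; cases b) (auto simp: f_def)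
  have f_0: "f k 0 = 0" for k by (simp add: f_def)
  show ?thesis
    unfolding eq by (rule setsum_keys_plus_distrib) (rule f_0 f_add)+
qed

lemma bit_poly_mapping_induct [case_names zero single_add]:
  fixes p :: "'k \<Rightarrow>\<^sub>0 bit"
  assumes zero: "P 0" and step: "\<And>k p. P p \<Longrightarrow> P (Poly_Mapping.single k 1 + p)"
  shows "P p"
proof -
  have "P (\<Sum>k\<in>K. Poly_Mapping.single k 1)" if "finite K" for K
    using that by (induction K) (auto intro: zero step)
  moreover have "p = (\<Sum>k\<in>Poly_Mapping.keys p. Poly_Mapping.single k 1)"
    by (rule poly_mapping_eqI)
      (auto simp: lookup_sum lookup_single when_def in_keys_iff sum.If_cases)
  ultimately show ?thesis by (metis finite_keys)
qed

lemma bit_ext_mult: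
  fixes h :: "'k::monoid_add \<Rightarrow> 'a::ring_char_two"
  assumes h: "\<And>k l. h (k + l) = h k * h l"
  shows "bit_ext h (p * q) = bit_ext h p * bit_ext h q"
proof (induction p rule: bit_poly_mapping_induct)
  case (single_add k p)
  have "bit_ext h (Poly_Mapping.single k 1 * q) = h k * bit_ext h q"
    by (induction q rule: bit_poly_mapping_induct)
      (simp_all add: distrib_left bit_ext_add mult_single h)
  with single_add show ?case by (simp add: distrib_right bit_ext_add)
qed simp


section \<open>Polynomials over the field with two elements\<close>

type_synonym 'n pol = "('n \<Rightarrow>\<^sub>0 nat) \<Rightarrow>\<^sub>0 bit"

text \<open>
  The variables are indexed by the finite type \<open>'n\<close>, so that \<open>5 pol\<close> is the polynomial
  algebra in five variables.
\<close>

definition X :: "'n \<Rightarrow> 'n pol" where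
  "X i = Poly_Mapping.single (Poly_Mapping.single i 1) 1"

definition homogeneous :: "nat \<Rightarrow> 'n::finite pol \<Rightarrow> bool" where
  "homogeneous d f \<longleftrightarrow> (\<forall>e\<in>Poly_Mapping.keys f. (\<Sum>i\<in>UNIV. Poly_Mapping.lookup e i) = d)"

definition peval :: "('n::finite \<Rightarrow> 'a::{comm_ring_1, ring_char_two}) \<Rightarrow> 'n pol \<Rightarrow> 'a" where
  "peval x = bit_ext (\<lambda>e. \<Prod>i\<in>UNIV. x i ^ Poly_Mapping.lookup e i)"

lemma peval_0 [simp]: "peval x 0 = 0"
  by (simp add: peval_def)

lemma peval_1 [simp]: "peval x 1 = 1"
  by (simp add: peval_def flip: single_one)

lemma peval_add: "peval x (f + g) = peval x f + peval x g"
  unfolding peval_def by (rule bit_ext_add)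

lemma peval_mult: "peval x (f * g) = peval x f * peval x g"
  unfolding peval_def by (rule bit_ext_mult) (simp add: lookup_add power_add prod.distrib)

lemma peval_X [simp]: "peval x (X i) = x i"
proof -
  have "(\<Prod>j\<in>UNIV. x j ^ Poly_Mapping.lookup (Poly_Mapping.single i (1::nat)) j)
    = (\<Prod>j\<in>UNIV. if j = i then x j else 1)"
    by (rule prod.cong) (auto simp: lookup_single when_def)
  then show ?thesis by (simp add: peval_def X_def)
qed

lemma peval_sum: "peval x (sum f A) = (\<Sum>a\<in>A. peval x (f a))"
  by (induction A rule: infinite_finite_induct) (simp_all add: peval_add)

lemma pol_induct [case_names zero one X add mult]:
  fixes f :: "'n::finite pol"
  assumes "P 0" and one: "P 1" and X: "\<And>i. P (X i)"
    and add: "\<And>f g. P f \<Longrightarrow> P g \<Longrightarrow> P (f + g)" and mult: "\<And>f g. P f \<Longrightarrow> P g \<Longrightarrow> P (f * g)"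
  shows "P f"
proof -
  have pow: "P (Poly_Mapping.single (Poly_Mapping.single i n) 1)" for i n
  proof (induction n)
    case (Suc n)
    have "Poly_Mapping.single (Poly_Mapping.single i (Suc n)) 1
      = X i * Poly_Mapping.single (Poly_Mapping.single i n) 1"
      by (simp add: X_def mult_single flip: Poly_Mapping.single_add)
    then show ?case using Suc X mult by simp
  qed (simp add: one)
  have mono: "P (Poly_Mapping.single e 1)" for e :: "'n \<Rightarrow>\<^sub>0 nat"
  proof -
    have "P (Poly_Mapping.single (\<Sum>i\<in>I. Poly_Mapping.single i (Poly_Mapping.lookup e i)) 1)"
      if "finite I" for I
      using that
    proof (induction I)
      case (insert i I)
      then show ?case using mult[OF pow insert.IH] by (simp add: mult_single)
    qed (simp add: one)
    moreover have "e = (\<Sum>i\<in>UNIV. Poly_Mapping.single i (Poly_Mapping.lookup e i))"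
      by (rule poly_mapping_eqI) (simp add: lookup_sum lookup_single when_def)
    ultimately show ?thesis by (metis finite_class.finite_UNIV)
  qed
  show ?thesis
    by (induction f rule: bit_poly_mapping_induct) (auto intro: assms mono)
qed


section \<open>Steenrod squares on polynomials\<close>

text \<open>
  The total square is the algebra homomorphism sending \<open>x\<close> to \<open>x + x\<^sup>2 u\<close> for every
  variable \<open>x\<close>, and \<open>Sq k\<close> is its coefficient at \<open>u ^ k\<close>. Multiplicativity of the total square
  is the Cartan formula.
\<close>

definition total_square :: "'n::finite pol \<Rightarrow> 'n pol poly" where
  "total_square = peval (\<lambda>i. [:X i, (X i)\<^sup>2:])"

definition Sq :: "nat \<Rightarrow> 'n::finite pol \<Rightarrow> 'n pol" where
  "Sq k f = coeff (total_square f) k"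

lemma Sq_zero [simp]: "Sq k 0 = 0"
  by (simp add: Sq_def total_square_def)

lemma Sq_one: "Sq k 1 = (if k = 0 then 1 else 0)"
  by (simp add: Sq_def total_square_def)

lemma Sq_add: "Sq k (f + g) = Sq k f + Sq k g"
  by (simp add: Sq_def total_square_def peval_add)

lemma Sq_sum: "Sq k (sum f A) = (\<Sum>a\<in>A. Sq k (f a))"
  by (induction A rule: infinite_finite_induct) (simp_all add: Sq_add)

lemma Sq_Cartan: "Sq k (f * g) = (\<Sum>i\<le>k. Sq i f * Sq (k - i) g)"
  by (simp add: Sq_def total_square_def peval_mult coeff_mult)

lemma Sq_X: "Sq k (X i) = (if k = 0 then X i else if k = 1 then (X i)\<^sup>2 else 0)"
  by (auto simp: Sq_def total_square_def coeff_pCons split: nat.split)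

lemma Sq_0: "Sq 0 f = f"
  by (induction f rule: pol_induct) (simp_all add: Sq_one Sq_add Sq_X Sq_Cartan)


subsection \<open>The Adem relations hold on polynomials\<close>

text \<open>
  The relations come from the identity of Bullett and Macdonald, that is
  \<open>(\<Sum>a b. (s + s\<^sup>2) ^ a * Sq a (Sq b f)) = (\<Sum>a b. (1 + s) ^ a * s ^ (2 * b) * Sq a (Sq b f))\<close>,
  in each degree \<open>a + b = n\<close> separately, by comparing residues in \<open>s + s\<^sup>2\<close>.
\<close>

definition SqSq :: "'n pol fps \<Rightarrow> 'n pol fps \<Rightarrow> nat \<Rightarrow> 'n::finite pol \<Rightarrow> 'n pol fps" where
  "SqSq \<alpha> \<beta> n f = (\<Sum>a\<le>n. \<alpha> ^ a * \<beta> ^ (n - a) * fps_const (Sq a (Sq (n - a) f)))"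

lemma SqSq_add: "SqSq \<alpha> \<beta> n (f + g) = SqSq \<alpha> \<beta> n f + SqSq \<alpha> \<beta> n g"
  by (simp add: SqSq_def Sq_add distrib_left sum.distrib flip: fps_const_add)

lemma SqSq_0 [simp]: "SqSq \<alpha> \<beta> n 0 = 0"
  by (simp add: SqSq_def)

lemma SqSq_1: "SqSq \<alpha> \<beta> n 1 = (if n = 0 then 1 else 0)"
proof -
  have "\<alpha> ^ a * \<beta> ^ (n - a) * fps_const (Sq a (Sq (n - a) (1 :: 'a pol)))
    = (if a = 0 then if n = 0 then 1 else 0 else 0)" if "a \<le> n" for a
    using that by (auto simp: Sq_one)
  then have "SqSq \<alpha> \<beta> n 1 = (\<Sum>a\<le>n. if a = 0 then if n = 0 then 1 else 0 else 0)"
    unfolding SqSq_def by (intro sum.cong) auto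
  then show ?thesis by simp
qed

lemma Sq_Sq_mult:
  "Sq a (Sq b (f * g)) = (\<Sum>j\<le>b. \<Sum>i\<le>a. Sq i (Sq j f) * Sq (a - i) (Sq (b - j) g))"
  by (simp add: Sq_Cartan Sq_sum)

lemma fps_const_sum: "fps_const (sum f A) = (\<Sum>a\<in>A. fps_const (f a))"
  by (induction A rule: infinite_finite_induct) (simp_all flip: fps_const_add)

lemma SqSq_mult: "SqSq \<alpha> \<beta> n (f * g) = (\<Sum>p\<le>n. SqSq \<alpha> \<beta> p f * SqSq \<alpha> \<beta> (n - p) g)"
proof -
  define F where "F i j = fps_const (Sq i (Sq j f))" for i j
  define G where "G i j = fps_const (Sq i (Sq j g))" for i j
  let ?S = "SIGMA a:{..n}. SIGMA j:{..n - a}. {..a}"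
  let ?T = "SIGMA p:{..n}. SIGMA i:{..p}. {..n - p}"
  have "SqSq \<alpha> \<beta> n (f * g)
    = (\<Sum>a\<le>n. \<Sum>j\<le>n - a. \<Sum>i\<le>a. \<alpha> ^ a * \<beta> ^ (n - a) * (F i j * G (a - i) (n - a - j)))"
    by (simp add: SqSq_def Sq_Sq_mult F_def G_def fps_const_sum sum_distrib_left)
  also have "\<dots> = (\<Sum>(a, j, i)\<in>?S. \<alpha> ^ a * \<beta> ^ (n - a) * (F i j * G (a - i) (n - a - j)))"
    by (simp add: sum.Sigma)
  also have "\<dots> = (\<Sum>(p, i, k)\<in>?T. (\<alpha> ^ i * \<beta> ^ (p - i) * F i (p - i))
      * (\<alpha> ^ k * \<beta> ^ (n - p - k) * G k (n - p - k)))"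
  proof (rule sum.reindex_bij_witness[of _ "\<lambda>(p, i, k). (i + k, p - i, i)" "\<lambda>(a, j, i). (i + j, i, a - i)"],
      goal_cases)
    case (5 x)
    then obtain a j i where x: "x = (a, j, i)" "a \<le> n" "j \<le> n - a" "i \<le> a" by auto
    have "\<alpha> ^ a = \<alpha> ^ i * \<alpha> ^ (a - i)" using x by (simp flip: power_add)
    moreover have "\<beta> ^ (n - a) = \<beta> ^ j * \<beta> ^ (n - a - j)" using x by (simp flip: power_add)
    moreover have "n - (i + j) - (a - i) = n - a - j" using x by simp
    ultimately show ?case using x by (simp add: ac_simps)
  qed auto
  also have "\<dots> = (\<Sum>p\<le>n. \<Sum>i\<le>p. \<Sum>k\<le>n - p. (\<alpha> ^ i * \<beta> ^ (p - i) * F i (p - i))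
      * (\<alpha> ^ k * \<beta> ^ (n - p - k) * G k (n - p - k)))"
    by (simp add: sum.Sigma)
  also have "\<dots> = (\<Sum>p\<le>n. SqSq \<alpha> \<beta> p f * SqSq \<alpha> \<beta> (n - p) g)"
    by (simp add: SqSq_def F_def G_def sum_product)
  finally show ?thesis .
qed

lemma Sq_X_square: "Sq k ((X i)\<^sup>2) = (if k = 0 then (X i)\<^sup>2 else if k = 2 then (X i) ^ 4 else 0)"
proof -
  have "total_square ((X i)\<^sup>2) = [:X i, (X i)\<^sup>2:]\<^sup>2"
    by (simp add: total_square_def power2_eq_square peval_mult)
  also have "\<dots> = [:(X i)\<^sup>2, 0, (X i) ^ 4:]"
    by (simp add: power2_eq_square power4_eq_xxxx mult.assoc)
  finally show ?thesis
    by (auto simp: Sq_def coeff_pCons numeral_2_eq_2 split: nat.split)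
qed

lemma SqSq_X:
  "SqSq \<alpha> \<beta> n (X i) = (if n = 0 then fps_const (X i)
    else if n = 1 then (\<alpha> + \<beta>) * fps_const ((X i)\<^sup>2)
    else if n = 3 then \<alpha>\<^sup>2 * \<beta> * fps_const ((X i) ^ 4) else 0)"
proof (cases n)
  case 0
  then show ?thesis by (simp add: SqSq_def Sq_0)
next
  case (Suc m)
  have "(\<Sum>a<m. \<alpha> ^ a * \<beta> ^ (n - a) * fps_const (Sq a (Sq (n - a) (X i)))) = 0"
    using Suc by (intro sum.neutral) (auto simp: Sq_X)
  then have "SqSq \<alpha> \<beta> n (X i) = \<alpha> ^ m * \<beta> * fps_const (Sq m ((X i)\<^sup>2))
      + \<alpha> ^ Suc m * fps_const (Sq (Suc m) (X i))"
    using Suc by (simp add: SqSq_def Sq_0 Sq_X flip: lessThan_Suc_atMost)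
  then show ?thesis using Suc
    by (cases "m = 0"; cases "m = 2") (simp_all add: Sq_X Sq_X_square distrib_right add.commute)
qed

lemma Bullett_Macdonald:
  fixes f :: "'n::finite pol"
  shows "SqSq (fps_X + fps_X\<^sup>2) 1 n f = SqSq (1 + fps_X) (fps_X\<^sup>2) n f"
proof (induction f arbitrary: n rule: pol_induct)
  case (X i)
  have "(fps_X + fps_X\<^sup>2)\<^sup>2 = (1 + fps_X)\<^sup>2 * (fps_X\<^sup>2 :: 'n pol fps)"
    by (simp add: power2_eq_square algebra_simps)
  then show ?case by (simp add: SqSq_X add_ac)
qed (simp_all add: SqSq_1 SqSq_add SqSq_mult)

definition fps_V :: "'a::{comm_ring_1, ring_char_two} fps" where
  "fps_V = Abs_fps (\<lambda>_. 1)"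

lemma fps_V_mult: "fps_V * (1 + fps_X) = (1 :: 'a::{comm_ring_1, ring_char_two} fps)"
  by (rule fps_ext) (simp add: fps_V_def distrib_left)

lemma fps_V_power_nth:
  "fps_nth (fps_V ^ Suc m) d = (of_nat ((m + d) choose d) :: 'a::{comm_ring_1, ring_char_two})"
proof (induction m arbitrary: d)
  case 0
  then show ?case by (simp add: fps_V_def)
next
  case (Suc m)
  have "fps_nth (fps_V ^ Suc (Suc m)) d
    = (\<Sum>k=0..d. fps_nth (fps_V ^ Suc m) k * fps_nth (fps_V :: 'a fps) (d - k))"
    by (simp only: power_Suc2[of _ "Suc m"] fps_mult_nth)
  also have "\<dots> = of_nat (\<Sum>k\<le>d. (m + k) choose k)"
    unfolding Suc by (simp add: fps_V_def atLeast0AtMost)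
  also have "(\<Sum>k\<le>d. (m + k) choose k) = (Suc m + d) choose d"
    by (simp add: sum_choose_lower)
  finally show ?case .
qed

lemma one_plus_fps_X_power_nth: "fps_nth ((1 + fps_X) ^ m) k = (of_nat (m choose k) :: 'a::comm_ring_1)"
proof (induction m arbitrary: k)
  case 0
  then show ?case by (cases k) simp_all
next
  case (Suc m)
  then show ?case
    by (cases k) (simp_all add: distrib_right add.commute)
qed

lemma even_central_binomial: "0 < d \<Longrightarrow> even ((d + d) choose d)"
proof -
  assume "0 < d"
  then obtain e where e: "d = Suc e" by (cases d) auto
  have "(d + d) choose d = ((d + e) choose e) + ((d + e) choose d)" by (simp add: e)
  also have "(d + e) choose e = (d + e) choose d"
    by (subst binomial_symmetric) simp_all
  finally show ?thesis by simp
qed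

lemma Adem_relation:
  fixes f :: "'n::finite pol"
  assumes "0 < a" "a < 2 * b"
  shows "Sq a (Sq b f)
    = (\<Sum>j\<le>a div 2. of_nat ((b - 1 - j) choose (a - 2 * j)) * Sq (a + b - j) (Sq j f))"
proof -
  define n where "n = a + b"
  define c where "c k = Sq k (Sq (n - k) f)" for k
  let ?V = "fps_V :: 'n pol fps" and ?s = "fps_X :: 'n pol fps"
  have V1: "(1 + ?s) ^ k * ?V ^ (k + m) = ?V ^ m" for k m
    by (simp add: power_add power_mult_distrib[symmetric] mult.assoc[symmetric]
        mult.commute[of _ ?V] fps_V_mult)
  have V2: "(1 + ?s) ^ (k + m) * ?V ^ k = (1 + ?s) ^ m" for k m
    using V1[of k 0] by (simp only: power_add[of _ k m] add_0_right power_0 mult_1_left mult_1_right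
        mult.assoc mult.commute[of "(1 + ?s) ^ m"] mult.left_commute[of _ "(1 + ?s) ^ m"])
      (simp add: mult.assoc[symmetric])
  have L: "fps_nth ((?s + ?s\<^sup>2) ^ k * ?V ^ Suc a) a = (if k = a then 1 else 0)" for k
  proof -
    have eq: "(?s + ?s\<^sup>2) ^ k * ?V ^ Suc a = ?s ^ k * ((1 + ?s) ^ k * ?V ^ Suc a)"
      by (simp add: power2_eq_square distrib_left flip: power_mult_distrib mult.assoc)
    show ?thesis
    proof (cases "k \<le> a")
      case True
      then have "(?s + ?s\<^sup>2) ^ k * ?V ^ Suc a = ?s ^ k * ?V ^ Suc (a - k)"
        unfolding eq using V1[of k "Suc (a - k)"] by (simp add: Suc_diff_le)
      then show ?thesis
        using True even_central_binomial[of "a - k"]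
        by (simp only: fps_X_power_mult_nth fps_V_power_nth) (auto simp: of_nat_char_two)
    qed (simp add: eq fps_X_power_mult_nth del: power_Suc)
  qed
  have R: "fps_nth ((1 + ?s) ^ (n - j) * (?s\<^sup>2) ^ j * ?V ^ Suc a) a
      = (if j \<le> a div 2 then of_nat ((b - 1 - j) choose (a - 2 * j)) else 0)" for j
  proof -
    have eq: "(1 + ?s) ^ (n - j) * (?s\<^sup>2) ^ j * ?V ^ Suc a = ?s ^ (2 * j) * ((1 + ?s) ^ (n - j) * ?V ^ Suc a)"
      by (simp only: power_mult[symmetric] ac_simps)
    show ?thesis
    proof (cases "j \<le> a div 2")
      case True
      with assms have "n - j = Suc a + (b - 1 - j)" by (simp add: n_def)
      then show ?thesis
        unfolding eq using True V2[of "Suc a" "b - 1 - j"]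
        by (simp only: fps_X_power_mult_nth one_plus_fps_X_power_nth) auto
    qed (auto simp: eq fps_X_power_mult_nth simp del: power_Suc)
  qed
  have "SqSq (?s + ?s\<^sup>2) 1 n f * ?V ^ Suc a
    = (\<Sum>k\<le>n. ((?s + ?s\<^sup>2) ^ k * ?V ^ Suc a) * fps_const (c k))"
    unfolding SqSq_def c_def sum_distrib_right by (intro sum.cong refl) (simp add: ac_simps)
  then have "fps_nth (SqSq (?s + ?s\<^sup>2) 1 n f * ?V ^ Suc a) a
    = (\<Sum>k\<le>n. fps_nth ((?s + ?s\<^sup>2) ^ k * ?V ^ Suc a) a * c k)"
    by (simp only: fps_sum_nth fps_mult_right_const_nth)
  also have "\<dots> = (\<Sum>k\<le>n. if k = a then c k else 0)"
    unfolding L by (intro sum.cong) auto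
  also have "\<dots> = c a" by (simp add: n_def)
  finally have 1: "fps_nth (SqSq (?s + ?s\<^sup>2) 1 n f * ?V ^ Suc a) a = c a" .
  have "SqSq (1 + ?s) (?s\<^sup>2) n f * ?V ^ Suc a
    = (\<Sum>k\<le>n. ((1 + ?s) ^ k * (?s\<^sup>2) ^ (n - k) * ?V ^ Suc a) * fps_const (c k))"
    unfolding SqSq_def c_def sum_distrib_right by (intro sum.cong refl) (simp add: ac_simps)
  also have "\<dots> = (\<Sum>j\<le>n. ((1 + ?s) ^ (n - j) * (?s\<^sup>2) ^ j * ?V ^ Suc a) * fps_const (c (n - j)))"
    by (rule sum.reindex_bij_witness[of _ "\<lambda>j. n - j" "\<lambda>j. n - j"]) auto
  finally have "fps_nth (SqSq (1 + ?s) (?s\<^sup>2) n f * ?V ^ Suc a) a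
    = (\<Sum>j\<le>n. fps_nth ((1 + ?s) ^ (n - j) * (?s\<^sup>2) ^ j * ?V ^ Suc a) a * c (n - j))"
    by (simp only: fps_sum_nth fps_mult_right_const_nth)
  also have "\<dots> = (\<Sum>j\<le>a div 2. of_nat ((b - 1 - j) choose (a - 2 * j)) * c (n - j))"
    unfolding R by (rule sum.mono_neutral_cong_right) (auto simp: n_def)
  also have "\<dots> = (\<Sum>j\<le>a div 2. of_nat ((b - 1 - j) choose (a - 2 * j)) * Sq (a + b - j) (Sq j f))"
    by (intro sum.cong refl) (auto simp: c_def n_def)
  finally show ?thesis
    using 1 by (simp add: Bullett_Macdonald c_def n_def)
qed


section \<open>The Steenrod algebra\<close>

text \<open>
  The mod 2 Steenrod algebra is the free associative algebra on symbols \<open>Sq\<^sup>k\<close>, with \<open>k\<close> a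
  natural number, modulo \<open>Sq\<^sup>0 = 1\<close> and the Adem relations. The free algebra is the monoid
  algebra of the free monoid of words.
\<close>

datatype sq_word = Sq_word (letters: "nat list")

instantiation sq_word :: monoid_add
begin

definition "0 = Sq_word []"

definition "u + v = Sq_word (letters u @ letters v)"

instance
  by standard (simp_all add: zero_sq_word_def plus_sq_word_def)

end

lemma letters_simps [simp]: "letters 0 = []" "letters (u + v) = letters u @ letters v"
  by (simp_all add: zero_sq_word_def plus_sq_word_def)

type_synonym sq_free = "sq_word \<Rightarrow>\<^sub>0 bit"

definition sq_gen :: "nat \<Rightarrow> sq_free" where
  "sq_gen k = Poly_Mapping.single (Sq_word [k]) 1"

definition adem_relators :: "sq_free set" where
  "adem_relators = {sq_gen 0 - 1} \<union>
    {sq_gen a * sq_gen b -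
      (\<Sum>j\<le>a div 2. of_nat ((b - 1 - j) choose (a - 2 * j)) * (sq_gen (a + b - j) * sq_gen j)) | a b.
      0 < a \<and> a < 2 * b}"

inductive_set adem_ideal :: "sq_free set" where
  zero: "0 \<in> adem_ideal"
| add: "x \<in> adem_ideal \<Longrightarrow> y \<in> adem_ideal \<Longrightarrow> x + y \<in> adem_ideal"
| relator: "r \<in> adem_relators \<Longrightarrow> u * r * v \<in> adem_ideal"

lemma adem_ideal_mult_left: "x \<in> adem_ideal \<Longrightarrow> u * x \<in> adem_ideal"
  by (induction rule: adem_ideal.induct)
    (auto simp: distrib_left mult.assoc[symmetric] intro: adem_ideal.intros)

lemma adem_ideal_mult_right: "x \<in> adem_ideal \<Longrightarrow> x * v \<in> adem_ideal"
  by (induction rule: adem_ideal.induct)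
    (auto simp: distrib_right mult.assoc[of _ _ v] intro: adem_ideal.intros)

definition free_aug :: "sq_free \<Rightarrow> bit" where
  "free_aug = bit_ext (\<lambda>w. if set (letters w) \<subseteq> {0} then 1 else 0)"

lemma free_aug_simps:
  "free_aug 0 = 0" "free_aug 1 = 1" "free_aug (x + y) = free_aug x + free_aug y"
  "free_aug (x - y) = free_aug x + free_aug y" "free_aug (x * y) = free_aug x * free_aug y"
  "free_aug (sq_gen k) = (if k = 0 then 1 else 0)"
proof -
  show add: "free_aug (x + y) = free_aug x + free_aug y" for x y
    by (simp add: free_aug_def bit_ext_add)
  then show "free_aug (x - y) = free_aug x + free_aug y"
    by (simp add: minus_eq_plus[of x])
  show "free_aug (x * y) = free_aug x * free_aug y"
    unfolding free_aug_def by (rule bit_ext_mult) auto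
qed (simp_all add: free_aug_def sq_gen_def flip: single_one)

lemma free_aug_sum: "free_aug (sum f A) = (\<Sum>a\<in>A. free_aug (f a))"
  by (induction A rule: infinite_finite_induct) (simp_all add: free_aug_simps)

lemma free_aug_adem_ideal: "x \<in> adem_ideal \<Longrightarrow> free_aug x = 0"
proof (induction rule: adem_ideal.induct)
  case (relator r u v)
  have "free_aug r = 0"
  proof -
    consider "r = sq_gen 0 - 1" | a b where "0 < a" "a < 2 * b"
      "r = sq_gen a * sq_gen b -
        (\<Sum>j\<le>a div 2. of_nat ((b - 1 - j) choose (a - 2 * j)) * (sq_gen (a + b - j) * sq_gen j))"
      using relator unfolding adem_relators_def by blast
    then show ?thesis
    proof cases
      case 2
      have "free_aug (\<Sum>j\<le>a div 2.
          of_nat ((b - 1 - j) choose (a - 2 * j)) * (sq_gen (a + b - j) * sq_gen j)) = 0"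
        unfolding free_aug_sum using 2 by (intro sum.neutral) (auto simp: free_aug_simps)
      with 2 show ?thesis by (simp add: free_aug_simps)
    qed (simp add: free_aug_simps)
  qed
  then show ?case by (simp add: free_aug_simps)
qed (simp_all add: free_aug_simps)

definition free_act :: "sq_free \<Rightarrow> 'n::finite pol \<Rightarrow> 'n pol" where
  "free_act x f = bit_ext (\<lambda>w. foldr Sq (letters w) f) x"

lemma foldr_Sq_zero [simp]: "foldr Sq ks 0 = 0"
  by (induction ks) simp_all

lemma foldr_Sq_add: "foldr Sq ks (f + g) = foldr Sq ks f + foldr Sq ks g"
  by (induction ks) (simp_all add: Sq_add)

lemma free_act_simps:
  fixes f g :: "'n::finite pol"
  shows "free_act 0 f = 0" "free_act 1 f = f" "free_act x 0 = (0 :: 'n pol)"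
  "free_act (x + y) f = free_act x f + free_act y f"
  "free_act (x - y) f = free_act x f + free_act y f"
  "free_act x (f + g) = free_act x f + free_act x g"
  "free_act (x * y) f = free_act x (free_act y f)"
  "free_act (sq_gen k) f = Sq k f"
proof -
  show 0: "free_act 0 f = 0" for f :: "'n pol"
    by (simp add: free_act_def)
  show x0: "free_act x 0 = (0 :: 'n pol)" for x
    by (simp add: free_act_def bit_ext_def)
  show addl: "free_act (x + y) f = free_act x f + free_act y f" for x y and f :: "'n pol"
    by (simp add: free_act_def bit_ext_add)
  show "free_act (x - y) f = free_act x f + free_act y f"
    by (simp add: minus_eq_plus[of x] addl)
  show addr: "free_act x (f + g) = free_act x f + free_act x g" for x and f g :: "'n pol"
    by (simp add: free_act_def bit_ext_def foldr_Sq_add sum.distrib)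
  have single: "free_act (Poly_Mapping.single w 1) f = foldr Sq (letters w) f" for w and f :: "'n pol"
    by (simp add: free_act_def)
  show "free_act 1 f = f" "free_act (sq_gen k) f = Sq k f"
    by (simp_all add: single sq_gen_def flip: single_one)
  show "free_act (x * y) f = free_act x (free_act y f)"
  proof (induction x rule: bit_poly_mapping_induct)
    case (single_add w x)
    have "free_act (Poly_Mapping.single w 1 * y) f = free_act (Poly_Mapping.single w 1) (free_act y f)"
      by (induction y rule: bit_poly_mapping_induct)
        (simp_all add: distrib_left mult_single addl addr single 0 x0)
    with single_add show ?case by (simp add: distrib_right addl)
  qed (simp add: 0)
qed

lemma free_act_sum: "free_act (sum h A) f = (\<Sum>a\<in>A. free_act (h a) f)"
  by (induction A rule: infinite_finite_induct) (simp_all add: free_act_simps)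

lemma free_act_of_nat: "free_act (of_nat n) f = of_nat n * f"
  by (simp add: of_nat_char_two free_act_simps)

lemma free_act_adem_ideal: "x \<in> adem_ideal \<Longrightarrow> free_act x f = 0"
proof (induction arbitrary: f rule: adem_ideal.induct)
  case (relator r u v)
  have "free_act r g = 0" for g :: "'a pol"
    using relator unfolding adem_relators_def
    by (auto simp: free_act_simps free_act_sum free_act_of_nat Sq_0 Adem_relation)
  then show ?case by (simp add: free_act_simps)
qed (simp_all add: free_act_simps)

quotient_type steenrod = sq_free / "\<lambda>x y. x - y \<in> adem_ideal"
proof (rule equivpI)
  show "reflp (\<lambda>x y. x - y \<in> adem_ideal)"
    by (rule reflpI) (simp add: adem_ideal.zero)
  show "symp (\<lambda>x y. x - y \<in> adem_ideal)"
    by (rule sympI) (simp add: minus_eq_plus add.commute)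
  show "transp (\<lambda>x y. x - y \<in> adem_ideal)"
  proof (rule transpI)
    fix x y z :: sq_free
    assume "x - y \<in> adem_ideal" "y - z \<in> adem_ideal"
    then have "(x - y) + (y - z) \<in> adem_ideal" by (rule adem_ideal.add)
    then show "x - z \<in> adem_ideal" by simp
  qed
qed

instantiation steenrod :: ring_1
begin

lift_definition zero_steenrod :: steenrod is 0 .

lift_definition one_steenrod :: steenrod is 1 .

lift_definition plus_steenrod :: "steenrod \<Rightarrow> steenrod \<Rightarrow> steenrod" is "(+)"
  by (metis add_diff_add adem_ideal.add)

lift_definition uminus_steenrod :: "steenrod \<Rightarrow> steenrod" is uminus
  by (simp add: uminus_eq_self)

lift_definition minus_steenrod :: "steenrod \<Rightarrow> steenrod \<Rightarrow> steenrod" is "(-)"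
proof -
  fix x x' y y' :: sq_free
  assume "x - x' \<in> adem_ideal" "y - y' \<in> adem_ideal"
  then have "(x - x') + (y - y') \<in> adem_ideal" by (rule adem_ideal.add)
  then show "(x - y) - (x' - y') \<in> adem_ideal" by (simp add: minus_eq_plus add_ac)
qed

lift_definition times_steenrod :: "steenrod \<Rightarrow> steenrod \<Rightarrow> steenrod" is "(*)"
proof -
  fix x x' y y' :: sq_free
  assume "x - x' \<in> adem_ideal" "y - y' \<in> adem_ideal"
  then have "x * (y - y') + (x - x') * y' \<in> adem_ideal"
    by (intro adem_ideal.add adem_ideal_mult_left adem_ideal_mult_right)
  then show "x * y - x' * y' \<in> adem_ideal" by (simp add: algebra_simps)
qed

instance
proof
  have "1 - 0 \<notin> adem_ideal" using free_aug_adem_ideal[of 1] by (auto simp: free_aug_simps)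
  then show "(0 :: steenrod) \<noteq> 1" by transfer (simp add: minus_eq_plus)
qed (transfer, simp add: algebra_simps adem_ideal.zero)+

end

lift_definition augmentation :: "steenrod \<Rightarrow> bit" is free_aug
proof -
  fix x y assume "x - y \<in> adem_ideal"
  then have "free_aug x + free_aug y = 0" using free_aug_adem_ideal by (metis free_aug_simps(4))
  then show "free_aug x = free_aug y" by (metis add_self_eq_0 add_right_cancel)
qed

definition augmentation_ideal :: "steenrod set" where
  "augmentation_ideal = {a. augmentation a = 0}"

lift_definition steenrod_act :: "steenrod \<Rightarrow> 'n::finite pol \<Rightarrow> 'n pol" is free_act
proof (rule ext)
  fix x y and f :: "'n pol" assume "x - y \<in> adem_ideal"
  then have "free_act x f + free_act y f = 0" by (metis free_act_adem_ideal free_act_simps(5))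
  then show "free_act x f = free_act y f" by (metis add_self_eq_0 add_right_cancel)
qed

lift_definition sq :: "nat \<Rightarrow> steenrod" is sq_gen .

lemma augmentation_simps:
  "augmentation 1 = 1" "augmentation (a + b) = augmentation a + augmentation b"
  "augmentation (a * b) = augmentation a * augmentation b"
  "augmentation (sq k) = (if k = 0 then 1 else 0)"
  by (transfer, simp add: free_aug_simps)+

lemma steenrod_act_simps:
  "steenrod_act 1 f = f" "steenrod_act (sq k) f = Sq k f"
  "steenrod_act (a + b) f = steenrod_act a f + steenrod_act b f"
  "steenrod_act a (f + g) = steenrod_act a f + steenrod_act a g"
  "steenrod_act (a * b) f = steenrod_act a (steenrod_act b f)"
  by (transfer, simp add: free_act_simps)+


section \<open>The space of indecomposables\<close>

definition pol_scale :: "bit \<Rightarrow> 'n pol \<Rightarrow> 'n pol" where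
  "pol_scale c f = Poly_Mapping.single 0 c * f"

lemma pol_scale_simps [simp]: "pol_scale 0 f = 0" "pol_scale 1 f = f"
  by (simp_all add: pol_scale_def)

global_interpretation pol: vector_space pol_scale
proof
  show "pol_scale (a + b) f = pol_scale a f + pol_scale b f" for a b and f :: "'n pol"
    by (cases a; cases b) simp_all
  show "pol_scale a (pol_scale b f) = pol_scale (a * b) f" for a b and f :: "'n pol"
    by (simp add: pol_scale_def mult_single flip: mult.assoc)
qed (simp_all add: pol_scale_def distrib_left)

text \<open>
  \<open>hit\<close> is the image of the augmentation ideal acting on polynomials, and \<open>'n qp\<close>
  is the quotient by it, the tensor product over the Steenrod algebra with the ground field.
\<close>

definition hit :: "'n::finite pol set" where
  "hit = pol.span {steenrod_act a f | a f. a \<in> augmentation_ideal}"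

quotient_type 'n qp = "'n::finite pol" / "\<lambda>f g. f - g \<in> hit"
proof (rule equivpI)
  show "reflp (\<lambda>f g :: 'n pol. f - g \<in> hit)"
    by (rule reflpI) (simp add: hit_def pol.span_zero)
  show "symp (\<lambda>f g :: 'n pol. f - g \<in> hit)"
    by (rule sympI) (simp add: minus_eq_plus add.commute)
  show "transp (\<lambda>f g :: 'n pol. f - g \<in> hit)"
  proof (rule transpI)
    fix f g h :: "'n pol"
    assume "f - g \<in> hit" "g - h \<in> hit"
    then have "(f - g) + (g - h) \<in> hit" unfolding hit_def by (rule pol.span_add)
    then show "f - h \<in> hit" by simp
  qed
qed

instantiation qp :: (finite) ab_group_add
begin

lift_definition zero_qp :: "'a qp" is 0 .

lift_definition plus_qp :: "'a qp \<Rightarrow> 'a qp \<Rightarrow> 'a qp" is "(+)"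
  unfolding hit_def by (subst add_diff_add) (rule pol.span_add)

lift_definition uminus_qp :: "'a qp \<Rightarrow> 'a qp" is uminus
  by (simp add: uminus_eq_self)

lift_definition minus_qp :: "'a qp \<Rightarrow> 'a qp \<Rightarrow> 'a qp" is "(-)"
proof -
  fix f f' g g' :: "'a pol"
  assume "f - f' \<in> hit" "g - g' \<in> hit"
  then have "(f - f') + (g - g') \<in> hit" unfolding hit_def by (rule pol.span_add)
  then show "(f - g) - (f' - g') \<in> hit" by (simp add: minus_eq_plus add_ac)
qed

instance
  by standard (transfer, simp add: add_ac hit_def pol.span_zero)+

end

lift_definition qp_scale :: "bit \<Rightarrow> 'n::finite qp \<Rightarrow> 'n qp" is pol_scale
  unfolding hit_def by (subst pol.scale_right_diff_distrib[symmetric]) (rule pol.span_scale)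

global_interpretation qp: vector_space qp_scale
  by standard (transfer, simp only: pol.scale_right_distrib pol.scale_left_distrib pol.scale_scale
    pol.scale_one diff_self hit_def pol.span_zero)+

text \<open>
  \<open>hit\<close> is spanned by homogeneous elements, so the homogeneous part of degree \<open>d\<close> of the
  quotient consists of the classes of homogeneous polynomials of degree \<open>d\<close>.
\<close>

definition qp_part :: "nat \<Rightarrow> 'n::finite qp set" where
  "qp_part d = abs_qp ` {f. homogeneous d f}"


section \<open>The action of the general linear group\<close>

text \<open>
  A matrix \<open>A\<close> substitutes \<open>\<Sum>i. A $ i $ j * X i\<close> for \<open>X j\<close>, which is a left action on
  polynomials. Using rows instead of columns would give the same invariants.
\<close>

definition lin_subst :: "bit^'n^'n \<Rightarrow> 'n::finite pol \<Rightarrow> 'n pol" where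
  "lin_subst A = peval (\<lambda>j. \<Sum>i\<in>UNIV. pol_scale (A $ i $ j) (X i))"

lemma sum_power2_char_two:
  "(sum f A)\<^sup>2 = (\<Sum>a\<in>A. (f a)\<^sup>2 :: 'a::{comm_ring_1, ring_char_two})"
proof (induction A rule: infinite_finite_induct)
  case (insert a A)
  have "(x + y)\<^sup>2 = x\<^sup>2 + y\<^sup>2" for x y :: 'a
    by (simp add: power2_sum mult_2 distrib_right)
  with insert show ?case by simp
qed simp_all

lemma Sq_lin_subst: "Sq k (lin_subst A f) = lin_subst A (Sq k f)"
proof (induction f arbitrary: k rule: pol_induct)
  case (X j)
  have scale: "Sq k (pol_scale c f) = pol_scale c (Sq k f)" for k c and f :: "'a pol"
    by (cases c) simp_all
  have square: "(pol_scale c f)\<^sup>2 = pol_scale c (f\<^sup>2)" for c and f :: "'a pol"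
    by (cases c) simp_all
  show ?case
    by (simp add: lin_subst_def Sq_sum scale Sq_X power2_eq_square[of "X j"] peval_mult
        power2_eq_square[of "sum _ _", symmetric] sum_power2_char_two square)
qed (simp_all add: lin_subst_def Sq_one Sq_add Sq_Cartan peval_add peval_mult peval_sum)

lemma steenrod_act_lin_subst: "steenrod_act a (lin_subst A f) = lin_subst A (steenrod_act a f)"
proof (transfer fixing: A f)
  have "foldr Sq ks (lin_subst A f) = lin_subst A (foldr Sq ks f)" for ks
    by (induction ks) (simp_all add: Sq_lin_subst)
  then show "free_act x (lin_subst A f) = lin_subst A (free_act x f)" for x
    by (simp add: free_act_def bit_ext_def lin_subst_def peval_sum)
qed

lemma lin_subst_hit: "f \<in> hit \<Longrightarrow> lin_subst A f \<in> hit"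
  unfolding hit_def
proof (induction rule: pol.span_induct_alt)
  case base
  then show ?case by (simp add: lin_subst_def pol.span_zero)
next
  case (step c g h)
  then obtain a f where "g = steenrod_act a f" "a \<in> augmentation_ideal" by blast
  then have "lin_subst A g \<in> pol.span {steenrod_act a f | a f. a \<in> augmentation_ideal}"
    by (auto simp flip: steenrod_act_lin_subst intro: pol.span_base)
  with step show ?case
    by (cases c) (simp_all add: lin_subst_def peval_add pol.span_add)
qed

lift_definition gl_act :: "bit^'n^'n \<Rightarrow> 'n::finite qp \<Rightarrow> 'n qp" is lin_subst
proof -
  fix A :: "bit^'n^'n" and f g :: "'n pol"
  assume "f - g \<in> hit"
  then have "lin_subst A (f - g) \<in> hit" by (rule lin_subst_hit)
  then show "lin_subst A f - lin_subst A g \<in> hit"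
    by (simp add: lin_subst_def peval_add minus_eq_plus)
qed

definition gl_invariants :: "'n::finite qp set \<Rightarrow> 'n qp set" where
  "gl_invariants V = {v \<in> V. \<forall>A. invertible A \<longrightarrow> gl_act A v = v}"

end

(*
The Kameko homomorphism x1 ... x5 y^2 -> y identifies degree m with degree (m - 5) / 2 once every
monomial of degree m with at most four odd exponents is hit. By Wood's theorem this happens for
m = 7 * 2^s - 5 with s >= 3, so everything reduces to the degrees 9 and 23; in degree 23 the kernel
of the Kameko map is spanned by the monomials with three odd exponents.

In these two degrees explicit hit polynomials bound the dimension from above. From below, a linear
form on polynomials that kills the squares Sq^k for k > 0 (a dual class in the Steenrod kernel) is
composed with linear substitutions of the variables, and the resulting functionals are triangular on
a family of monomials of the right size. The functionals of one type form a single orbit under the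
general linear group, so an invariant class has the same value under all of them; since an odd number
of them sums to zero, this value is zero and the class vanishes.
*)
theory Submission
  imports Defs "HOL-Library.List_Lexorder"
begin

text \<open>All computation is rewriting inside the logic, and size shapes the argument. There are
  17550 monomials of degree 23, of which 10010 have three odd exponents; such a monomial is a
  product of three distinct variables times the square of a monomial y of degree 10.
  \<open>Sq (2 * k)\<close> acts on it as \<open>Sq k\<close> acts on y, up to monomials with at
  most one odd exponent, which are hit. Hence one elimination among the 1001 monomials y serves all
  ten choices of the odd variables, and the further relations come from \<open>Sq 1\<close> on
  monomials with four odd exponents. For the lower bound, substituting 0 for the variables off a
  chosen set isolates monomials by their exact support, so one list of tests per support size 3, 4,
  5 is enough: 10 * 7 + 5 * 18 + 31 = 191 in degree 9 and 10 * 14 + 5 * 99 + 419 = 1054 in degree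
  23, where 1054 + 191 = 1245. Tests, functionals and relations are search results that enter as
  certificates: the relations are valid by construction, the functionals are checked to be
  triangular, and the proof closes because the two counts agree.\<close>

abbreviation deg :: "('n::finite \<Rightarrow>\<^sub>0 nat) \<Rightarrow> nat" where
  "deg e \<equiv> \<Sum>i\<in>UNIV. Poly_Mapping.lookup e i"

abbreviation mono :: "('n \<Rightarrow>\<^sub>0 nat) \<Rightarrow> 'n pol" where
  "mono e \<equiv> Poly_Mapping.single e 1"

lemma two_mult_eq_0 [simp]: "2 * x = (0 :: 'a::ring_char_two)"
  by (simp only: mult_2 add_self_eq_0)

lemma add_self_left [simp]: "x + (x + y) = (y :: 'a::ring_char_two)"
  by (simp flip: add.assoc)

section \<open>Hit polynomials as sums of values of positive squares\<close>

lemma hit_0: "0 \<in> hit" by (simp add: hit_def pol.span_zero)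

lemma hit_add: "f \<in> hit \<Longrightarrow> g \<in> hit \<Longrightarrow> f + g \<in> hit" by (simp add: hit_def pol.span_add)

lemma hit_Sq: "k > 0 \<Longrightarrow> Sq k f \<in> hit"
  unfolding hit_def
  by (rule pol.span_base) (auto simp: augmentation_ideal_def augmentation_simps steenrod_act_simps
      intro!: exI[of _ "sq k"] exI[of _ f])

lemma sum_const_char_two: "(\<Sum>a\<in>A. c) = (if even (card A) then 0 else c :: 'a::ring_char_two)"
  using of_nat_char_two[where 'a = 'a, of "card A"] by (simp split: if_splits)

text \<open>Lift an element of the augmentation ideal to a sum of words in the squares. Words with
  letters 0 only act as the identity, and augmentation 0 makes their number even, so they cancel.
  Every other word, after its leading zeros, starts with a positive square.\<close>

lemma hit_induct [consumes 1, case_names zero add Sq]: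
  fixes h :: "'n::finite pol"
  assumes h: "h \<in> hit" and zero: "P 0" and add: "\<And>f g. P f \<Longrightarrow> P g \<Longrightarrow> P (f + g)"
    and Sq: "\<And>k f. k > 0 \<Longrightarrow> P (Sq k f)"
  shows "P h"
proof -
  have sum: "P (sum F A)" if "\<And>a. a \<in> A \<Longrightarrow> P (F a)" for F and A :: "sq_word set"
    using that by (induction A rule: infinite_finite_induct) (auto intro: zero add)
  have word: "P (foldr Sq ks f)" if "\<not> set ks \<subseteq> {0}" for ks and f :: "'n pol"
    using that
  proof (induction ks)
    case (Cons k ks)
    then show ?case by (cases "k = 0") (auto simp: Sq_0 intro: Sq)
  qed simp
  have "P (steenrod_act a f)" if "a \<in> augmentation_ideal" for a and f :: "'n pol"
  proof -
    obtain x where abs_steenrod: "a = abs_steenrod x" using Quotient_abs_rep[OF Quotient_steenrod, of a] by metis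
    then have aug: "free_aug x = 0"
      using that by (simp add: augmentation_ideal_def augmentation.abs_eq)
    let ?K = "Poly_Mapping.keys x"
    let ?A = "{w \<in> ?K. set (letters w) \<subseteq> {0}}"
    have even: "even (card ?A)"
    proof -
      have "(\<Sum>w\<in>?A. 1) = (0 :: bit)"
        using aug unfolding free_aug_def bit_ext_def by (subst sum.inter_filter) simp_all
      then show ?thesis unfolding sum_const_char_two by (simp split: if_splits)
    qed
    have "foldr Sq ks f = f" if "set ks \<subseteq> {0}" for ks and f :: "'n pol"
      using that by (induction ks) (auto simp: Sq_0)
    then have "(\<Sum>w\<in>?A. foldr Sq (letters w) f) = (\<Sum>w\<in>?A. f)"
      by (intro sum.cong) auto
    also have "\<dots> = 0" unfolding sum_const_char_two using even by simp
    finally have A: "(\<Sum>w\<in>?A. foldr Sq (letters w) f) = 0" .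
    have "(\<Sum>w\<in>?K. foldr Sq (letters w) f)
        = (\<Sum>w\<in>?A. foldr Sq (letters w) f) + (\<Sum>w\<in>?K - ?A. foldr Sq (letters w) f)"
      using sum.subset_diff[of ?A ?K "\<lambda>w. foldr Sq (letters w) f"] by (simp add: add.commute)
    then have "steenrod_act a f = (\<Sum>w\<in>?K - ?A. foldr Sq (letters w) f)"
      unfolding abs_steenrod steenrod_act.abs_eq free_act_def bit_ext_def A by simp
    also have "P \<dots>" by (rule sum) (auto intro!: word)
    finally show ?thesis .
  qed
  with h show ?thesis unfolding hit_def
  proof (induction rule: pol.span_induct_alt)
    case (step c g h)
    then show ?case by (cases c) (auto intro: add)
  qed (rule zero)
qed

section \<open>Squares on perfect squares and on squarefree products\<close>

lemma pol_eq_sum: "p = (\<Sum>e\<in>Poly_Mapping.keys p. mono e)" for p :: "'n pol"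
  by (rule poly_mapping_eqI)
    (auto simp: lookup_sum lookup_single when_def in_keys_iff sum.If_cases)

text \<open>The total square is a ring homomorphism and squaring is additive in characteristic two,
  so the total square of a perfect square has the squared coefficients at the even powers of the
  parameter and nothing else.\<close>

lemma Sq_square: "Sq k (g\<^sup>2) = (if even k then (Sq (k div 2) g)\<^sup>2 else 0)"
  for g :: "'n::finite pol"
proof -
  let ?p = "total_square g"
  have "total_square (g\<^sup>2) = ?p\<^sup>2" by (simp add: total_square_def power2_eq_square peval_mult)
  also have "?p = (\<Sum>i\<le>degree ?p. monom (coeff ?p i) i)" by (simp add: poly_as_sum_of_monoms)
  also have "\<dots>\<^sup>2 = (\<Sum>i\<le>degree ?p. monom ((coeff ?p i)\<^sup>2) (2 * i))"
    by (simp add: sum_power2_char_two monom_power mult.commute)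
  finally have "Sq k (g\<^sup>2) = (\<Sum>i\<le>degree ?p. if 2 * i = k then (coeff ?p i)\<^sup>2 else 0)"
    by (simp add: Sq_def coeff_sum)
  also have "\<dots> = (\<Sum>i\<in>{..degree ?p} \<inter> {i. 2 * i = k}. (coeff ?p i)\<^sup>2)"
    by (simp add: sum.inter_restrict)
  also have "\<dots> = (if even k then (coeff ?p (k div 2))\<^sup>2 else 0)"
  proof (cases "even k \<and> k div 2 \<le> degree ?p")
    case True
    then have "{..degree ?p} \<inter> {i. 2 * i = k} = {k div 2}" by auto
    then show ?thesis using True by simp
  next
    case False
    then have "{..degree ?p} \<inter> {i. 2 * i = k} = {}" by auto
    then show ?thesis using False by (auto simp: coeff_eq_0)
  qed
  finally show ?thesis by (simp add: Sq_def)
qed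

lemma square_add: "(f + g)\<^sup>2 = f\<^sup>2 + g\<^sup>2" for f g :: "'a::{comm_ring_1, ring_char_two}"
  by (simp add: power2_sum mult_2 distrib_right)

definition sqfree :: "'n::finite set \<Rightarrow> 'n pol" where
  "sqfree S = (\<Prod>i\<in>S. X i)"

lemma mono_mult: "mono (a + b) = mono a * mono b" by (simp add: mult_single)

lemma sqfree_mono: "sqfree S = mono (\<Sum>i\<in>S. Poly_Mapping.single i 1)"
proof -
  have "finite S" by simp
  then show ?thesis unfolding sqfree_def
    by (induction S) (simp_all add: mult_single X_def)
qed

lemma lookup_indicator: "Poly_Mapping.lookup (\<Sum>i\<in>S. Poly_Mapping.single i (1::nat)) j = of_bool (j \<in> S)"
  for S :: "'n::finite set"
  by (simp add: lookup_sum lookup_single when_def)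

lemmas lookup_indicators = lookup_indicator lookup_indicator[unfolded One_nat_def]

text \<open>Each factor x contributes either x or x squared times the parameter; T collects the
  variables for which the second term is chosen.\<close>

lemma Sq_sqfree: "Sq k (sqfree S) = (\<Sum>T\<in>{T. T \<subseteq> S \<and> card T = k}. sqfree S * sqfree T)"
proof -
  have "total_square (sqfree S) = (\<Prod>i\<in>S. [:X i, (X i)\<^sup>2:])"
  proof -
    have "finite S" by simp
    then show ?thesis unfolding sqfree_def total_square_def
      by (induction S) (simp_all add: peval_mult)
  qed
  also have "\<dots> = (\<Prod>i\<in>S. monom ((X i)\<^sup>2) 1 + [:X i:])"
    by (intro prod.cong) (simp_all add: monom_altdef)
  also have "\<dots> = (\<Sum>T\<in>Pow S. (\<Prod>i\<in>T. monom ((X i)\<^sup>2) 1) * (\<Prod>i\<in>S-T. [:X i:]))"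
    by (rule prod_add) simp
  also have "\<dots> = (\<Sum>T\<in>Pow S. monom (sqfree S * sqfree T) (card T))"
  proof (rule sum.cong)
    fix T assume T: "T \<in> Pow S"
    have "finite T" by simp
    then have 1: "(\<Prod>i\<in>T. monom ((X i)\<^sup>2) 1) = monom (\<Prod>i\<in>T. (X i)\<^sup>2) (card T)"
      by (induction T) (simp_all add: mult_monom)
    have "(\<Prod>i\<in>A. [:X i:]) = [:\<Prod>i\<in>A. X i:]" if "finite A" for A :: "'a set"
      using that by (induction A) (simp_all add: one_pCons)
    then have 2: "(\<Prod>i\<in>S-T. [:X i:]) = [:\<Prod>i\<in>S-T. X i:]" by simp
    have "(\<Prod>i\<in>T. (X i)\<^sup>2) * (\<Prod>i\<in>S-T. X i) = sqfree S * sqfree T"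
      using T prod.subset_diff[of T S X] by (auto simp: sqfree_def prod_power_distrib power2_eq_square prod.distrib ac_simps)
    then show "(\<Prod>i\<in>T. monom ((X i)\<^sup>2) 1) * (\<Prod>i\<in>S-T. [:X i:]) = monom (sqfree S * sqfree T) (card T)"
      unfolding 1 2 by (simp add: smult_monom mult.commute)
  qed simp
  finally have "Sq k (sqfree S) = (\<Sum>T\<in>Pow S. if card T = k then sqfree S * sqfree T else 0)"
    by (simp add: Sq_def coeff_sum)
  also have "\<dots> = (\<Sum>T\<in>{T. T \<subseteq> S \<and> card T = k}. sqfree S * sqfree T)"
    by (simp add: sum.If_cases Int_def Pow_def)
  finally show ?thesis .
qed

subsection \<open>Filtration by the number of odd exponents\<close>

definition odds :: "('n::finite \<Rightarrow>\<^sub>0 nat) \<Rightarrow> 'n set" where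
  "odds e = {i. odd (Poly_Mapping.lookup e i)}"

definition odd_le :: "nat \<Rightarrow> 'n::finite pol set" where
  "odd_le r = {p. \<forall>e\<in>Poly_Mapping.keys p. card (odds e) \<le> r}"

lemma odd_le_0: "0 \<in> odd_le r" by (simp add: odd_le_def)

lemma odd_le_add: "p \<in> odd_le r \<Longrightarrow> q \<in> odd_le r \<Longrightarrow> p + q \<in> odd_le r"
  using Poly_Mapping.keys_add[of p q] by (auto simp: odd_le_def)

lemma odd_le_sum: "(\<And>a. a \<in> A \<Longrightarrow> F a \<in> odd_le r) \<Longrightarrow> sum F A \<in> odd_le r"
  by (induction A rule: infinite_finite_induct) (auto intro: odd_le_0 odd_le_add)

lemma odd_le_mono: "p \<in> odd_le r \<Longrightarrow> r \<le> r' \<Longrightarrow> p \<in> odd_le r'"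
  by (fastforce simp: odd_le_def)

lemma odds_add_double: "odds (a + (m + m)) = odds a"
  by (simp add: odds_def lookup_add)

lemma odd_le_mult_square: "p \<in> odd_le r \<Longrightarrow> p * q\<^sup>2 \<in> odd_le r"
proof (induction q rule: bit_poly_mapping_induct)
  case (single_add m q)
  have "p * (mono m)\<^sup>2 \<in> odd_le r"
    unfolding odd_le_def
  proof (safe)
    fix e assume "e \<in> Poly_Mapping.keys (p * (mono m)\<^sup>2)"
    then obtain a where "a \<in> Poly_Mapping.keys p" "e = a + (m + m)"
      using keys_mult[of p "mono (m + m)"] by (auto simp: power2_eq_square mult_single)
    then show "card (odds e) \<le> r" using single_add.prems by (auto simp: odds_add_double odd_le_def)
  qed
  then show ?case using single_add by (simp add: square_add distrib_left odd_le_add)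
qed (simp add: odd_le_0)

text \<open>Each variable in T passes from an odd to an even exponent, so exactly k odd exponents
  are lost.\<close>

lemma Sq_sqfree_odd_le: "Sq k (sqfree S) \<in> odd_le (card S - k)"
  unfolding Sq_sqfree
proof (rule odd_le_sum)
  fix T assume T: "T \<in> {T. T \<subseteq> S \<and> card T = k}"
  have "odds ((\<Sum>i\<in>S. Poly_Mapping.single i 1) + (\<Sum>i\<in>T. Poly_Mapping.single i 1)) = S - T"
    using T by (auto simp: odds_def lookup_add lookup_indicators)
  then show "sqfree S * sqfree T \<in> odd_le (card S - k)"
    using T by (simp add: odd_le_def sqfree_mono mult_single card_Diff_subset)
qed

text \<open>Odd squares of a perfect square vanish, so only even i occur in the Cartan sum; i = 0 is
  the main term, and i at least 2 costs two odd exponents. This congruence drives both the Kameko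
  map and the reduction of degree 23 to degree 10.\<close>

lemma Sq_even_sqfree_mult_square:
  "Sq (2 * a) (sqfree S * g\<^sup>2) + sqfree S * (Sq a g)\<^sup>2 \<in> odd_le (card S - 2)"
proof -
  let ?t = "\<lambda>i. Sq i (sqfree S) * Sq (2 * a - i) (g\<^sup>2)"
  have "Sq (2 * a) (sqfree S * g\<^sup>2) = ?t 0 + (\<Sum>i\<in>{0<..2*a}. ?t i)"
    by (simp add: Sq_Cartan sum.atMost_shift atLeast0AtMost atLeastSucAtMost_greaterThanAtMost sum.head flip: atLeast0AtMost)
  then have "Sq (2 * a) (sqfree S * g\<^sup>2) + sqfree S * (Sq a g)\<^sup>2
      = (\<Sum>i\<in>{0<..2*a}. ?t i) + (sqfree S * (Sq a g)\<^sup>2 + sqfree S * (Sq a g)\<^sup>2)"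
    by (simp add: Sq_0 Sq_square add_ac del: add_self_eq_0)
  then have "Sq (2 * a) (sqfree S * g\<^sup>2) + sqfree S * (Sq a g)\<^sup>2 = (\<Sum>i\<in>{0<..2*a}. ?t i)"
    by simp
  also have "\<dots> \<in> odd_le (card S - 2)"
  proof (rule odd_le_sum)
    fix i assume i: "i \<in> {0<..2*a}"
    show "?t i \<in> odd_le (card S - 2)"
    proof (cases "even i")
      case True
      then have "i \<ge> 2" using i by (auto elim: evenE)
      then have "Sq i (sqfree S) \<in> odd_le (card S - 2)"
        by (intro odd_le_mono[OF Sq_sqfree_odd_le]) simp
      then show ?thesis by (auto simp: Sq_square odd_le_0 intro: odd_le_mult_square)
    qed (use i in \<open>simp add: Sq_square odd_le_0\<close>)
  qed
  finally show ?thesis .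
qed

lemma Sq_odd_sqfree_mult_square:
  assumes "odd k" shows "Sq k (sqfree S * g\<^sup>2) \<in> odd_le (card S - 1)"
  unfolding Sq_Cartan
proof (rule odd_le_sum)
  fix i assume i: "i \<in> {..k}"
  show "Sq i (sqfree S) * Sq (k - i) (g\<^sup>2) \<in> odd_le (card S - 1)"
  proof (cases "even i")
    case True
    then show ?thesis using i assms by (simp add: Sq_square odd_le_0)
  next
    case False
    then have "Sq i (sqfree S) \<in> odd_le (card S - 1)"
      using Sq_sqfree_odd_le[of i S] by (elim odd_le_mono) (auto elim: oddE)
    then show ?thesis by (auto simp: Sq_square odd_le_0 intro: odd_le_mult_square)
  qed
qed

subsection \<open>Wood's theorem\<close>

text \<open>Moving a power of \<open>Sq\<close> across a variable; a special case of the \<open>\<chi>\<close>-trick.\<close>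

lemma X_mult_Sq:
  "X x * Sq k v = (\<Sum>a\<in>{a. 2 ^ a - 1 \<le> k}. Sq (k - (2 ^ a - 1)) (X x ^ 2 ^ a * v))"
  for v :: "'n::finite pol"
proof -
  have pow: "Sq j (X x ^ 2 ^ a) = (if j = 0 then X x ^ 2 ^ a else if j = 2 ^ a then X x ^ 2 ^ Suc a else 0 :: 'n pol)" for j a
  proof (induction a arbitrary: j)
    case 0
    then show ?case by (simp add: Sq_X)
  next
    case (Suc a)
    have "Sq j (X x ^ 2 ^ Suc a) = Sq j ((X x ^ 2 ^ a)\<^sup>2)" by (simp add: power_mult[symmetric] mult.commute)
    also have "\<dots> = (if j = 0 then X x ^ 2 ^ Suc a else if j = 2 ^ Suc a then X x ^ 2 ^ Suc (Suc a) else 0)"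
      unfolding Sq_square Suc by (auto simp: power_mult[symmetric] mult.commute elim!: evenE)
    finally show ?case .
  qed
  define t where "t a = (if 2 ^ a - 1 \<le> k then X x ^ 2 ^ a * Sq (k - (2 ^ a - 1)) v else 0)" for a
  \<comment> \<open>The power \<open>X x ^ 2 ^ a\<close> has only two nonzero squares, so its Cartan
    sum has two terms and the sum over a telescopes; the guard in \<open>t\<close> makes the last
    term vanish.\<close>
  have step: "Sq (k - (2 ^ a - 1)) (X x ^ 2 ^ a * v) = t a + t (Suc a)" if a: "2 ^ a - 1 \<le> k" for a
  proof -
    let ?m = "k - (2 ^ a - 1)"
    have "Sq ?m (X x ^ 2 ^ a * v) = (\<Sum>i\<le>?m. (if i = 0 then X x ^ 2 ^ a * Sq ?m v else 0)
        + (if i = 2 ^ a then X x ^ 2 ^ Suc a * Sq (?m - 2 ^ a) v else 0))"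
      unfolding Sq_Cartan pow by (intro sum.cong) auto
    also have "\<dots> = X x ^ 2 ^ a * Sq ?m v + (if 2 ^ a \<le> ?m then X x ^ 2 ^ Suc a * Sq (?m - 2 ^ a) v else 0)"
      by (simp add: sum.distrib)
    also have "\<dots> = t a + t (Suc a)"
    proof -
      have "(2 ^ a \<le> ?m) = (2 ^ Suc a - 1 \<le> k)" using a by auto
      moreover have "?m - 2 ^ a = k - (2 ^ Suc a - 1)" by auto
      ultimately show ?thesis using a by (simp add: t_def)
    qed
    finally show ?thesis .
  qed
  have below: "2 ^ a - 1 \<le> k" if "2 ^ b - 1 \<le> k" "a \<le> b" for a b :: nat
    using that power_increasing[of a b "2::nat"] by linarith
  have "(\<Sum>a<b. Sq (k - (2 ^ a - 1)) (X x ^ 2 ^ a * v)) = t 0 + t b" if "b = 0 \<or> 2 ^ (b - 1) - 1 \<le> k" for b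
    using that
  proof (induction b)
    case (Suc b)
    then have b: "2 ^ b - 1 \<le> k" by simp
    then have "b = 0 \<or> 2 ^ (b - 1) - 1 \<le> k" using below[of b "b - 1"] by auto
    with Suc.IH step[OF b] show ?case by (simp add: add.assoc)
  qed simp
  note sum = this
  have ex: "\<exists>b. \<not> 2 ^ b - 1 \<le> k"
  proof
    have "k < 2 ^ k" "2 ^ Suc k = 2 ^ k + (2 ^ k :: nat)" by simp_all
    then show "\<not> 2 ^ Suc k - 1 \<le> k" by linarith
  qed
  define b where "b = (LEAST b. \<not> 2 ^ b - 1 \<le> k)"
  have nb: "\<not> 2 ^ b - 1 \<le> k" unfolding b_def using ex by (rule LeastI_ex)
  then have b0: "b \<noteq> 0" by (intro notI) simp
  have lt: "2 ^ a - 1 \<le> k" if "a < b" for a using not_less_Least[of a "\<lambda>b. \<not> 2 ^ b - 1 \<le> k"] that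
    unfolding b_def by blast
  have "{a. 2 ^ a - 1 \<le> k} = {..<b}" using nb lt below by (auto simp: not_less) (meson leI)
  then have "(\<Sum>a\<in>{a. 2 ^ a - 1 \<le> k}. Sq (k - (2 ^ a - 1)) (X x ^ 2 ^ a * v)) = t 0 + t b"
    using sum[of b] lt[of "b - 1"] b0 by simp
  also have "\<dots> = X x * Sq k v" using nb by (simp add: t_def)
  finally show ?thesis by simp
qed

lemma hit_sum: "(\<And>a. a \<in> A \<Longrightarrow> F a \<in> hit) \<Longrightarrow> sum F A \<in> hit"
  by (induction A rule: infinite_finite_induct) (auto intro: hit_0 hit_add)

text \<open>\<open>X_mult_Sq\<close> takes the variables into the square one at a time, each
  lowering the index k by some 2 ^ a - 1. As k is not a sum of such numbers, the index left at the
  end is positive.\<close>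

lemma prod_X_mult_Sq_hit:
  fixes v :: "'n::finite pol"
  assumes "\<And>as. length as = length xs \<Longrightarrow> (\<Sum>a\<leftarrow>as. 2 ^ a - 1) \<noteq> k"
  shows "prod_list (map X xs) * Sq k v \<in> hit"
  using assms
proof (induction xs arbitrary: k v)
  case Nil
  from Nil[of "[]"] show ?case by (auto intro: hit_Sq)
next
  case (Cons x xs)
  have "prod_list (map X xs) * Sq (k - (2 ^ a - 1)) (X x ^ 2 ^ a * v) \<in> hit" if a: "2 ^ a - 1 \<le> k" for a
  proof (rule Cons.IH)
    fix as :: "nat list" assume "length as = length xs"
    then have "(\<Sum>a\<leftarrow>a#as. 2 ^ a - 1) \<noteq> k" by (intro Cons.prems) simp
    then show "(\<Sum>a\<leftarrow>as. 2 ^ a - 1) \<noteq> k - (2 ^ a - 1)" using a by auto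
  qed
  then have "(\<Sum>a\<in>{a. 2 ^ a - 1 \<le> k}. prod_list (map X xs) * Sq (k - (2 ^ a - 1)) (X x ^ 2 ^ a * v)) \<in> hit"
    by (intro hit_sum) simp
  moreover have "prod_list (map X (x # xs)) * Sq k v = prod_list (map X xs) * (X x * Sq k v)"
    by (simp add: ac_simps)
  ultimately show ?case by (simp only: X_mult_Sq[of x k v] sum_distrib_left)
qed

lemma Sq_mono_top: "Sq (deg e) (mono e) = (mono e)\<^sup>2"
  for e :: "'n::finite \<Rightarrow>\<^sub>0 nat"
proof -
  \<comment> \<open>The vanishing above d is carried along, since it leaves the single term i = c in
    the Cartan sum of a product.\<close>
  define top where "top d v \<longleftrightarrow> Sq d v = v\<^sup>2 \<and> (\<forall>k>d. Sq k v = 0)" for d and v :: "'n pol"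
  have mult: "top (c + d) (v * w)" if v: "top c v" and w: "top d w" for c d v w
  proof -
    have z: "Sq i v * Sq (k - i) w = 0" if "k \<ge> c + d" "i \<le> k" "(k, i) \<noteq> (c + d, c)" for i k
      using that v w by (cases "i > c") (auto simp: top_def)
    have "Sq (c + d) (v * w) = (\<Sum>i\<le>c+d. if i = c then v\<^sup>2 * w\<^sup>2 else 0)"
      unfolding Sq_Cartan using v w by (intro sum.cong) (auto simp: top_def z)
    then show ?thesis by (simp add: top_def Sq_Cartan z power_mult_distrib)
  qed
  have X: "top 1 (X i)" for i by (simp add: top_def Sq_X)
  have 1: "top 0 1" by (simp add: top_def Sq_one)
  have pow: "top n (mono (Poly_Mapping.single i n))" for i n
  proof (induction n)
    case (Suc n)
    have "mono (Poly_Mapping.single i (Suc n)) = X i * (mono (Poly_Mapping.single i n) :: 'n pol)"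
      by (simp add: X_def mult_single flip: Poly_Mapping.single_add)
    then show ?case using mult[OF X Suc] by simp
  qed (simp add: 1)
  have "top (\<Sum>i\<in>I. Poly_Mapping.lookup e i) (mono (\<Sum>i\<in>I. Poly_Mapping.single i (Poly_Mapping.lookup e i)))"
    if "finite I" for I
    using that
  proof (induction I)
    case (insert i I)
    then show ?case using mult[OF pow insert.IH] by (simp add: mult_single)
  qed (simp add: 1)
  moreover have "e = (\<Sum>i\<in>UNIV. Poly_Mapping.single i (Poly_Mapping.lookup e i))"
    by (rule poly_mapping_eqI) (simp add: lookup_sum lookup_single when_def)
  ultimately show ?thesis by (metis top_def finite_class.finite_UNIV)
qed

definition half :: "('n \<Rightarrow>\<^sub>0 nat) \<Rightarrow> ('n \<Rightarrow>\<^sub>0 nat)" where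
  "half e = Poly_Mapping.map (\<lambda>n. n div 2) e"

lemma lookup_half: "Poly_Mapping.lookup (half e) i = Poly_Mapping.lookup e i div 2"
  by (simp add: half_def Poly_Mapping.map.rep_eq when_def)

lemma mono_eq_sqfree_mult_square: "mono e = sqfree (odds e) * (mono (half e))\<^sup>2"
  for e :: "'n::finite \<Rightarrow>\<^sub>0 nat"
proof -
  have "e = (\<Sum>i\<in>odds e. Poly_Mapping.single i 1) + (half e + half e)"
    by (rule poly_mapping_eqI) (simp add: lookup_add lookup_half lookup_indicators odds_def of_bool_def, presburger)
  then show ?thesis by (metis mono_mult sqfree_mono power2_eq_square)
qed

lemma deg_eq_odds_half: "deg e = card (odds e) + 2 * deg (half e)"
  for e :: "'n::finite \<Rightarrow>\<^sub>0 nat"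
proof -
  have "deg e = (\<Sum>i\<in>UNIV. of_bool (i \<in> odds e) + 2 * Poly_Mapping.lookup (half e) i)"
    by (intro sum.cong) (auto simp: lookup_half odds_def)
  then show ?thesis by (simp add: sum.distrib sum_distrib_left)
qed

text \<open>The square of \<open>mono (half e)\<close> is its top square, so the monomial has the
  form treated in \<open>prod_X_mult_Sq_hit\<close>, with k the degree of the half.\<close>

theorem Wood:
  fixes e :: "'n::finite \<Rightarrow>\<^sub>0 nat"
  assumes "\<And>as. length as = card (odds e) \<Longrightarrow> (\<Sum>a\<leftarrow>as. 2 ^ a - 1) \<noteq> deg (half e)"
  shows "mono e \<in> hit"
proof -
  obtain xs where xs: "set xs = odds e" "distinct xs" using finite_distinct_list[of "odds e"] by auto
  then have "prod_list (map X xs) = sqfree (odds e)"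
    by (simp add: sqfree_def flip: prod.distinct_set_conv_list)
  moreover have "prod_list (map X xs) * Sq (deg (half e)) (mono (half e)) \<in> hit"
    using assms distinct_card[OF xs(2)] xs(1) by (intro prod_X_mult_Sq_hit) simp
  ultimately show ?thesis by (simp add: Sq_mono_top flip: mono_eq_sqfree_mult_square)
qed

subsection \<open>Homogeneous polynomials\<close>

lemma exponent_induct [case_names zero add]:
  fixes e :: "'n::finite \<Rightarrow>\<^sub>0 nat"
  assumes "P 0" and step: "\<And>i e. P e \<Longrightarrow> P (Poly_Mapping.single i 1 + e)"
  shows "P e"
proof (induction "deg e" arbitrary: e)
  case 0
  then have "e = 0" by (intro poly_mapping_eqI) simp
  then show ?case using assms(1) by simp
next
  case (Suc d)
  then obtain i where i: "Poly_Mapping.lookup e i > 0" by (metis gr0I nat.distinct(1) sum.neutral)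
  define e' where "e' = e - Poly_Mapping.single i 1"
  have e: "e = Poly_Mapping.single i 1 + e'"
    using i by (intro poly_mapping_eqI) (auto simp: e'_def lookup_add lookup_minus lookup_single when_def)
  have "deg e = Suc (deg e')"
    by (subst e) (simp add: lookup_add sum.distrib lookup_single when_def)
  then have "P e'" using Suc by simp
  then show ?case by (subst e) (rule step)
qed

lemma homogeneous_0: "homogeneous d 0" by (simp add: homogeneous_def)

lemma homogeneous_add: "homogeneous d p \<Longrightarrow> homogeneous d q \<Longrightarrow> homogeneous d (p + q)"
  using Poly_Mapping.keys_add[of p q] by (auto simp: homogeneous_def)

lemma homogeneous_sum: "(\<And>a. a \<in> A \<Longrightarrow> homogeneous d (F a)) \<Longrightarrow> homogeneous d (sum F A)"
  by (induction A rule: infinite_finite_induct) (auto intro: homogeneous_0 homogeneous_add)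

lemma homogeneous_mono: "deg e = d \<Longrightarrow> homogeneous d (mono e)"
  by (simp add: homogeneous_def)

lemma deg_add: "deg (a + b) = deg a + deg b"
  by (simp add: lookup_add sum.distrib)

lemma homogeneous_mult: "homogeneous c p \<Longrightarrow> homogeneous d q \<Longrightarrow> homogeneous (c + d) (p * q)"
  using keys_mult[of p q] by (fastforce simp: homogeneous_def deg_add)

lemma homogeneous_square: "homogeneous d p \<Longrightarrow> homogeneous (2 * d) (p\<^sup>2)"
  using homogeneous_mult[of d p d p] by (simp add: power2_eq_square mult_2)

lemma homogeneous_X: "homogeneous 1 (X i)"
  by (simp add: homogeneous_def X_def lookup_single when_def)

lemma homogeneous_sqfree: "homogeneous (card S) (sqfree S)"
  by (simp add: sqfree_mono homogeneous_def lookup_indicators)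

lemma homogeneous_Sq_mono: "homogeneous (deg e + k) (Sq k (mono e))"
proof (induction e arbitrary: k rule: exponent_induct)
  case zero
  then show ?case by (simp add: Sq_one homogeneous_0 homogeneous_mono[of 0, simplified])
next
  case (add i e)
  have "homogeneous (1 + deg e + k) (Sq k (X i * mono e))"
    unfolding Sq_Cartan
  proof (rule homogeneous_sum)
    fix j assume j: "j \<in> {..k}"
    have "homogeneous (1 + j) (Sq j (X i))"
      using homogeneous_X[of i] homogeneous_square[OF homogeneous_X[of i]]
      by (auto simp: Sq_X homogeneous_0 numeral_2_eq_2)
    from homogeneous_mult[OF this add.IH[of "k - j"]]
    show "homogeneous (1 + deg e + k) (Sq j (X i) * Sq (k - j) (mono e))" using j by simp
  qed
  moreover have "deg (Poly_Mapping.single i 1 + e) = 1 + deg e"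
    by (simp add: deg_add lookup_single when_def)
  ultimately show ?case by (simp add: X_def mono_mult)
qed

lemma homogeneous_induct [consumes 1, case_names zero add]:
  assumes "homogeneous d p" and "P 0"
    and "\<And>e p. deg e = d \<Longrightarrow> homogeneous d p \<Longrightarrow> P p \<Longrightarrow> P (mono e + p)"
  shows "P p"
proof -
  have "P (\<Sum>e\<in>A. mono e) \<and> homogeneous d (\<Sum>e\<in>A. mono e)" if "finite A" "\<And>e. e \<in> A \<Longrightarrow> deg e = d" for A
    using that
  proof (induction A)
    case (insert e A)
    then show ?case using assms(3)[of e "\<Sum>e\<in>A. mono e"] by (simp add: homogeneous_add homogeneous_mono)
  qed (simp add: assms(2) homogeneous_0)
  from this[of "Poly_Mapping.keys p"] show ?thesis
    using assms(1) pol_eq_sum[of p] by (simp add: homogeneous_def)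
qed

lemma homogeneous_Sq: "homogeneous d p \<Longrightarrow> homogeneous (d + k) (Sq k p)"
  by (induction rule: homogeneous_induct) (auto simp: Sq_add homogeneous_0 intro: homogeneous_add homogeneous_Sq_mono)

definition part :: "nat \<Rightarrow> 'n::finite pol \<Rightarrow> 'n pol" where
  "part d = bit_ext (\<lambda>e. if deg e = d then mono e else 0)"

lemma part_add: "part d (p + q) = part d p + part d q"
  by (simp add: part_def bit_ext_add)

lemma part_0 [simp]: "part d 0 = 0" by (simp add: part_def)

lemma part_mono: "part d (mono e) = (if deg e = d then mono e else 0)"
  by (simp add: part_def)

lemma part_homogeneous: "homogeneous c p \<Longrightarrow> part d p = (if c = d then p else 0)"
  by (induction rule: homogeneous_induct) (auto simp: part_add part_mono)

lemma homogeneous_part: "homogeneous d (part d p)"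
  by (induction p rule: bit_poly_mapping_induct) (auto simp: part_add part_mono homogeneous_0 intro: homogeneous_add homogeneous_mono)

lemma part_Sq: "part d (Sq k p) = (if k \<le> d then Sq k (part (d - k) p) else 0)"
proof (induction p rule: bit_poly_mapping_induct)
  case (single_add e p)
  have "part d (Sq k (mono e)) = (if k \<le> d then Sq k (part (d - k) (mono e)) else 0)"
    by (auto simp: part_homogeneous[OF homogeneous_Sq_mono] part_mono)
  with single_add show ?case by (auto simp: part_add Sq_add)
qed simp

text \<open>Squares shift degrees, so a decomposition into squares can be projected to degree d.
  This keeps the correction terms in \<open>kameko_up_hit\<close> homogeneous.\<close>

lemma hit_homogeneous_induct [consumes 2, case_names zero add Sq]:
  assumes h: "h \<in> hit" "homogeneous d h" and zero: "P 0" and add: "\<And>f g. P f \<Longrightarrow> P g \<Longrightarrow> P (f + g)"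
    and Sq: "\<And>k f. 0 < k \<Longrightarrow> k \<le> d \<Longrightarrow> homogeneous (d - k) f \<Longrightarrow> P (Sq k f)"
  shows "P h"
proof -
  from h(1) have "P (part d h)"
    by (induction rule: hit_induct) (auto simp: part_add part_Sq intro: zero add Sq homogeneous_part)
  then show ?thesis using h(2) by (simp add: part_homogeneous)
qed

subsection \<open>The Kameko map\<close>

definition kameko :: "'n::finite pol \<Rightarrow> 'n pol" where
  "kameko = bit_ext (\<lambda>e. if odds e = UNIV then mono (half e) else 0)"

lemma kameko_add: "kameko (p + q) = kameko p + kameko q"
  by (simp add: kameko_def bit_ext_add)

lemma kameko_0 [simp]: "kameko 0 = 0" by (simp add: kameko_def)

lemma kameko_mono: "kameko (mono e) = (if odds e = UNIV then mono (half e) else 0)"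
  by (simp add: kameko_def)

lemma kameko_sum: "kameko (sum F A) = (\<Sum>a\<in>A. kameko (F a))"
  by (induction A rule: infinite_finite_induct) (simp_all add: kameko_add)

lemma half_add_double: "half (a + (m + m)) = half a + m"
  by (rule poly_mapping_eqI) (simp add: lookup_half lookup_add)

text \<open>The map is linear over squares, a square being read as its root. As every monomial is a
  squarefree product times a square, its properties reduce to squarefree products.\<close>

lemma kameko_mult_square: "kameko (p * q\<^sup>2) = kameko p * q"
proof (induction p rule: bit_poly_mapping_induct)
  case (single_add e p)
  have "kameko (mono e * q\<^sup>2) = kameko (mono e) * q"
  proof (induction q rule: bit_poly_mapping_induct)
    case (single_add m q)
    have "kameko (mono e * (mono m)\<^sup>2) = kameko (mono e) * mono m"
      by (simp add: power2_eq_square mult_single kameko_mono odds_add_double half_add_double)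
    with single_add show ?case by (simp add: square_add distrib_left kameko_add)
  qed simp
  with single_add show ?case by (simp add: distrib_right kameko_add)
qed simp

lemma kameko_odd_le:
  fixes p :: "'n::finite pol"
  assumes "p \<in> odd_le r" "r < CARD('n)"
  shows "kameko p = 0"
proof -
  have "kameko (mono e) = 0" if "e \<in> Poly_Mapping.keys p" for e
    using that assms by (auto simp: kameko_mono odd_le_def)
  then have "kameko (\<Sum>e\<in>Poly_Mapping.keys p. mono e) = 0" unfolding kameko_sum by (rule sum.neutral[OF ballI])
  then show ?thesis by (simp flip: pol_eq_sum)
qed

lemma kameko_sqfree: "kameko (sqfree S) = (if S = UNIV then 1 else 0)" for S :: "'n::finite set"
proof -
  have "odds (\<Sum>i\<in>S. Poly_Mapping.single i (1::nat)) = S" by (auto simp: odds_def lookup_indicators)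
  moreover have "half (\<Sum>i\<in>S. Poly_Mapping.single i (1::nat)) = 0"
    by (rule poly_mapping_eqI) (simp add: lookup_half lookup_indicators)
  ultimately show ?thesis by (cases "S = UNIV") (simp_all add: sqfree_mono kameko_mono)
qed

text \<open>The map kills monomials with an even exponent. Modulo these, \<open>Sq (2 * a)\<close>
  acts as \<open>Sq a\<close> on the root of the square factor, while an odd square always destroys
  an odd exponent.\<close>

lemma kameko_Sq:
  fixes f :: "'n::finite pol"
  shows "kameko (Sq k f) = (if even k then Sq (k div 2) (kameko f) else 0)"
proof (induction f rule: bit_poly_mapping_induct)
  case (single_add e f)
  define S and g where "S = odds e" and "g = (mono (half e) :: 'n pol)"
  have e: "mono e = sqfree S * g\<^sup>2" by (simp add: S_def g_def flip: mono_eq_sqfree_mult_square)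
  have le: "card S \<le> CARD('n)" by (simp add: card_mono)
  \<comment> \<open>Gives \<open>card S - 2 < CARD('n)\<close> also when the subtraction
    truncates.\<close>
  have pos: "0 < CARD('n)" by simp
  have "kameko (Sq k (mono e)) = (if even k then Sq (k div 2) (kameko (mono e)) else 0)"
  proof (cases "even k")
    case True
    then obtain a where k: "k = 2 * a" by auto
    have "kameko (Sq k (mono e) + sqfree S * (Sq a g)\<^sup>2) = 0"
      unfolding k e by (rule kameko_odd_le[OF Sq_even_sqfree_mult_square]) (use le pos in linarith)
    then have "kameko (Sq k (mono e)) = kameko (sqfree S) * Sq a g"
      by (simp add: kameko_add kameko_mult_square) (metis add_self_eq_0 add_right_cancel)
    moreover have "kameko (mono e) = kameko (sqfree S) * g" by (simp add: e kameko_mult_square)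
    ultimately show ?thesis using k by (simp add: kameko_sqfree)
  next
    case False
    moreover have "card S - 1 < CARD('n)" using le pos by linarith
    ultimately show ?thesis unfolding e
      using kameko_odd_le[OF Sq_odd_sqfree_mult_square[of k S g]] by simp
  qed
  with single_add show ?case by (auto simp: Sq_add kameko_add)
qed simp

lemma kameko_hit: "h \<in> hit \<Longrightarrow> kameko h \<in> hit"
  by (induction rule: hit_induct) (auto simp: kameko_add kameko_Sq hit_0 intro: hit_add hit_Sq elim!: evenE)

lemma kameko_homogeneous:
  fixes p :: "'n::finite pol"
  assumes "homogeneous (2 * d + CARD('n)) p"
  shows "homogeneous d (kameko p)"
  using assms
proof (induction rule: homogeneous_induct)
  case (add e p)
  then show ?case using deg_eq_odds_half[of e]
    by (auto simp: kameko_add kameko_mono intro!: homogeneous_add homogeneous_mono homogeneous_0)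
qed (simp add: homogeneous_0)

definition kameko_up :: "'n::finite pol \<Rightarrow> 'n pol" where
  "kameko_up f = sqfree UNIV * f\<^sup>2"

lemma kameko_up_add: "kameko_up (f + g) = kameko_up f + kameko_up g"
  by (simp add: kameko_up_def square_add distrib_left)

lemma kameko_kameko_up [simp]: "kameko (kameko_up f) = f"
  by (simp add: kameko_up_def kameko_mult_square kameko_sqfree)

lemma homogeneous_kameko_up:
  fixes f :: "'n::finite pol"
  shows "homogeneous d f \<Longrightarrow> homogeneous (2 * d + CARD('n)) (kameko_up f)"
  unfolding kameko_up_def
  by (subst add.commute) (intro homogeneous_mult homogeneous_square homogeneous_sqfree)

lemma kameko_up_kameko:
  fixes p :: "'n::finite pol"
  shows "p + kameko_up (kameko p) \<in> odd_le (CARD('n) - 1)"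
proof (induction p rule: bit_poly_mapping_induct)
  case zero
  then show ?case by (simp add: kameko_up_def odd_le_0)
next
  case (single_add e p)
  have "mono e + kameko_up (kameko (mono e)) \<in> odd_le (CARD('n) - 1)"
  proof (cases "odds e = UNIV")
    case True
    then have "kameko_up (kameko (mono e)) = mono e"
      by (simp only: kameko_mono kameko_up_def if_True) (metis mono_eq_sqfree_mult_square)
    then show ?thesis by (simp add: odd_le_0)
  next
    case False
    then have "card (odds e) < CARD('n)" by (intro psubset_card_mono) auto
    then show ?thesis using False by (auto simp: kameko_mono kameko_up_def odd_le_def)
  qed
  from odd_le_add[OF this single_add] show ?case by (simp add: kameko_add kameko_up_add add_ac)
qed

text \<open>\<open>Sq k f\<close> lifts to \<open>Sq (2 * k)\<close> of the lift of f, so the lift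
  of a hit polynomial is hit up to r. For five variables the bound on r means at most three odd
  exponents.\<close>

lemma kameko_up_hit:
  fixes h :: "'n::finite pol"
  assumes "h \<in> hit" "homogeneous d h"
  shows "\<exists>r. r \<in> odd_le (CARD('n) - 2) \<and> homogeneous (2 * d + CARD('n)) r \<and> kameko_up h + r \<in> hit"
  using assms
proof (induction rule: hit_homogeneous_induct)
  case zero
  show ?case by (rule exI[of _ 0]) (simp add: odd_le_0 homogeneous_0 kameko_up_def hit_0)
next
  case (add f g)
  then obtain r s where "r \<in> odd_le (CARD('n) - 2)" "homogeneous (2 * d + CARD('n)) r" "kameko_up f + r \<in> hit"
    "s \<in> odd_le (CARD('n) - 2)" "homogeneous (2 * d + CARD('n)) s" "kameko_up g + s \<in> hit" by blast
  then show ?case using hit_add[of "kameko_up f + r" "kameko_up g + s"]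
    by (intro exI[of _ "r + s"]) (simp add: odd_le_add homogeneous_add kameko_up_add add_ac)
next
  case (Sq k f)
  let ?r = "Sq (2 * k) (kameko_up f) + kameko_up (Sq k f)"
  have "homogeneous (2 * (d - k) + CARD('n) + 2 * k) (Sq (2 * k) (kameko_up f))"
    using Sq by (intro homogeneous_Sq homogeneous_kameko_up)
  moreover have "homogeneous (2 * (d - k + k) + CARD('n)) (kameko_up (Sq k f))"
    using Sq by (intro homogeneous_Sq homogeneous_kameko_up)
  ultimately have "homogeneous (2 * d + CARD('n)) ?r" using Sq by (intro homogeneous_add) (simp_all add: algebra_simps)
  moreover have "?r \<in> odd_le (CARD('n) - 2)"
    using Sq_even_sqfree_mult_square[of k UNIV f] by (simp add: kameko_up_def)
  moreover have "kameko_up (Sq k f) + ?r \<in> hit"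
    using hit_Sq[of "2 * k" "kameko_up f"] Sq by (simp add: add_ac flip: add.assoc)
  ultimately show ?case by blast
qed

lemma hit_if_monos_hit: "(\<And>e. e \<in> Poly_Mapping.keys p \<Longrightarrow> mono e \<in> hit) \<Longrightarrow> p \<in> hit"
  by (subst pol_eq_sum) (rule hit_sum)

text \<open>p agrees with the lift of its Kameko image up to monomials with an even exponent. These
  are hit by assumption, and so is the correction term of \<open>kameko_up_hit\<close>.\<close>

lemma kameko_hit_iff:
  fixes p :: "'n::finite pol"
  assumes small: "\<And>e::'n \<Rightarrow>\<^sub>0 nat. deg e = 2 * d + CARD('n) \<Longrightarrow> card (odds e) < CARD('n) \<Longrightarrow> mono e \<in> hit"
    and p: "homogeneous (2 * d + CARD('n)) p"
  shows "kameko p \<in> hit \<longleftrightarrow> p \<in> hit"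
proof
  have le: "r \<in> hit" if "r \<in> odd_le (CARD('n) - 1)" "homogeneous (2 * d + CARD('n)) r" for r :: "'n pol"
  proof (rule hit_if_monos_hit)
    fix e assume "e \<in> Poly_Mapping.keys r"
    moreover have "0 < CARD('n)" by simp
    ultimately show "mono e \<in> hit" using that
      by (intro small) (auto simp: odd_le_def homogeneous_def simp del: zero_less_card_finite)
  qed
  assume "kameko p \<in> hit"
  then obtain r where r: "r \<in> odd_le (CARD('n) - 2)" "homogeneous (2 * d + CARD('n)) r" "kameko_up (kameko p) + r \<in> hit"
    using kameko_up_hit kameko_homogeneous[OF p] by blast
  have "r \<in> hit" using r(1,2) by (intro le) (auto elim: odd_le_mono)
  moreover have "p + kameko_up (kameko p) \<in> hit"
    using p by (intro le kameko_up_kameko homogeneous_add homogeneous_kameko_up kameko_homogeneous)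
  ultimately have "(p + kameko_up (kameko p)) + ((kameko_up (kameko p) + r) + r) \<in> hit"
    using hit_add[OF _ hit_add[OF r(3)]] by blast
  moreover have "(p + kameko_up (kameko p)) + ((kameko_up (kameko p) + r) + r) = p"
    by (simp add: add.assoc)
  ultimately show "p \<in> hit" by metis
qed (rule kameko_hit)

subsection \<open>Linear substitutions\<close>

lemma lin_subst_0 [simp]: "lin_subst A 0 = 0" and lin_subst_1 [simp]: "lin_subst A 1 = 1"
  and lin_subst_add: "lin_subst A (p + q) = lin_subst A p + lin_subst A q"
  and lin_subst_mult: "lin_subst A (p * q) = lin_subst A p * lin_subst A q"
  and lin_subst_X: "lin_subst A (X j) = (\<Sum>i\<in>UNIV. pol_scale (A $ i $ j) (X i))"
  by (simp_all add: lin_subst_def peval_add peval_mult)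

lemma lin_subst_sum: "lin_subst A (sum F I) = (\<Sum>i\<in>I. lin_subst A (F i))"
  by (induction I rule: infinite_finite_induct) (simp_all add: lin_subst_add)

lemma lin_subst_scale: "lin_subst A (pol_scale c p) = pol_scale c (lin_subst A p)"
  by (cases c) simp_all

lemma lin_subst_square: "lin_subst A (p\<^sup>2) = (lin_subst A p)\<^sup>2"
  by (simp add: power2_eq_square lin_subst_mult)

lemma lin_subst_lin_subst: "lin_subst A (lin_subst B p) = lin_subst (A ** B) p"
proof (induction p rule: pol_induct)
  case (X j)
  have "lin_subst A (lin_subst B (X j)) = (\<Sum>i\<in>UNIV. \<Sum>k\<in>UNIV. pol_scale (B $ i $ j * A $ k $ i) (X k))"
    by (simp add: lin_subst_X lin_subst_sum lin_subst_scale pol.scale_sum_right)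
  also have "\<dots> = lin_subst (A ** B) (X j)"
    by (subst sum.swap) (simp only: lin_subst_X matrix_matrix_mult_def vec_lambda_beta pol.scale_sum_left mult.commute)
  finally show ?case .
qed (simp_all add: lin_subst_add lin_subst_mult)

lemma lin_subst_mat_1: "lin_subst (mat 1) p = p"
proof (induction p rule: pol_induct)
  case (X j)
  have "lin_subst (mat 1) (X j) = (\<Sum>i\<in>UNIV. if i = j then X i else 0)"
    unfolding lin_subst_X by (intro sum.cong) (auto simp: mat_def)
  then show ?case by simp
qed (simp_all add: lin_subst_add lin_subst_mult)

lemma homogeneous_scale: "homogeneous d p \<Longrightarrow> homogeneous d (pol_scale c p)"
  by (cases c) (simp_all add: homogeneous_0)

lemma homogeneous_lin_subst:
  assumes "homogeneous d p" shows "homogeneous d (lin_subst A p)"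
proof -
  have "homogeneous (deg e) (lin_subst A (mono e))" for e
  proof (induction e rule: exponent_induct)
    case zero
    show ?case using homogeneous_mono[of 0 0] by simp
  next
    case (add i e)
    have "homogeneous 1 (lin_subst A (X i))"
      unfolding lin_subst_X by (intro homogeneous_sum homogeneous_scale homogeneous_X)
    from homogeneous_mult[OF this add] show ?case
      by (simp add: mono_mult X_def lin_subst_mult deg_add lookup_single when_def)
  qed
  with assms show ?thesis
    by (induction rule: homogeneous_induct) (auto simp: lin_subst_add homogeneous_0 intro: homogeneous_add)
qed

lemma kameko_eq_0_if_low_degree:
  fixes p :: "'n::finite pol"
  assumes "homogeneous d p" "d < CARD('n)"
  shows "kameko p = 0"
  using assms(1)
proof (induction rule: homogeneous_induct)
  case (add e p)
  then have "odds e \<noteq> UNIV" using assms(2) deg_eq_odds_half[of e] by auto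
  with add show ?case by (simp add: kameko_add kameko_mono)
qed simp

text \<open>A product of fewer than n variables is sent to a polynomial of degree below n, which has
  no monomial with all exponents odd. Hence only the full squarefree part contributes.\<close>

lemma kameko_lin_subst_mult:
  fixes p :: "'n::finite pol"
  shows "kameko (lin_subst A p) = kameko (lin_subst A (sqfree UNIV)) * lin_subst A (kameko p)"
proof (induction p rule: bit_poly_mapping_induct)
  case (single_add e p)
  define S and g where "S = odds e" and "g = (mono (half e) :: 'n pol)"
  have e: "mono e = sqfree S * g\<^sup>2" by (simp add: S_def g_def flip: mono_eq_sqfree_mult_square)
  have "kameko (lin_subst A (mono e)) = kameko (lin_subst A (sqfree S)) * lin_subst A g"
    by (simp add: e lin_subst_mult lin_subst_square kameko_mult_square)
  also have "\<dots> = kameko (lin_subst A (sqfree UNIV)) * lin_subst A (kameko (mono e))"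
  proof (cases "S = UNIV")
    case False
    then have "card S < CARD('n)" by (intro psubset_card_mono) auto
    then have "kameko (lin_subst A (sqfree S)) = 0"
      by (intro kameko_eq_0_if_low_degree[OF homogeneous_lin_subst[OF homogeneous_sqfree]])
    then show ?thesis using False by (simp add: e kameko_mult_square kameko_sqfree)
  qed (simp add: e kameko_mult_square kameko_sqfree)
  finally show ?case using single_add by (simp add: lin_subst_add kameko_add distrib_left)
qed simp

text \<open>The scalar is the coefficient of the full product of variables in a product of linear
  forms: a permanent, hence the determinant in characteristic two. Here it is 0 or 1 by degree, and
  composing with the inverse matrix excludes 0.\<close>

lemma kameko_lin_subst:
  fixes p :: "'n::finite pol"
  assumes "invertible A"
  shows "kameko (lin_subst A p) = lin_subst A (kameko p)"
proof -
  define c where "c B = kameko (lin_subst B (sqfree UNIV :: 'n pol))" for B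
  obtain A' where A': "A' ** A = mat 1" using assms by (auto simp: invertible_def)
  have "homogeneous 0 (c A)"
    unfolding c_def
    by (rule kameko_homogeneous) (use homogeneous_lin_subst[OF homogeneous_sqfree[of "UNIV :: 'n set"]] in simp)
  then have "c A = 0 \<or> c A = 1"
  proof (induction rule: homogeneous_induct)
    case (add e p)
    then have "e = 0" by (intro poly_mapping_eqI) simp
    then show ?case using add by auto
  qed simp
  moreover have "c A \<noteq> 0"
  proof
    assume "c A = 0"
    have "1 = kameko (lin_subst A' (lin_subst A (sqfree UNIV :: 'n pol)))"
      by (simp add: lin_subst_lin_subst A' lin_subst_mat_1 kameko_sqfree)
    also have "\<dots> = c A' * lin_subst A' (c A)" unfolding c_def by (rule kameko_lin_subst_mult)
    finally show False using \<open>c A = 0\<close> by simp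
  qed
  ultimately have "c A = 1" by blast
  then show ?thesis using kameko_lin_subst_mult[of A p] by (simp only: c_def mult_1_left)
qed

subsection \<open>The Kameko map on indecomposables\<close>

lemma abs_qp_eq_0_iff: "abs_qp f = 0 \<longleftrightarrow> f \<in> hit"
  unfolding zero_qp_def qp.abs_eq_iff by simp

lemma abs_qp_0: "abs_qp 0 = 0"
  unfolding abs_qp_eq_0_iff by (rule hit_0)

lemma abs_qp_add: "abs_qp f + abs_qp g = abs_qp (f + g)" by (rule plus_qp.abs_eq)

lemma abs_qp_sum: "abs_qp (sum F A) = (\<Sum>a\<in>A. abs_qp (F a))"
proof (induction A rule: infinite_finite_induct)
  case (insert a A)
  then show ?case by (simp only: sum.insert[OF insert(1,2)] abs_qp_add[symmetric])
qed (simp_all add: abs_qp_0)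

lemma qp_add_self [simp]: "v + v = (0 :: 'n::finite qp)"
  by transfer (simp add: hit_0)

lemma qp_scale_simps [simp]: "qp_scale 0 v = 0" "qp_scale 1 v = v"
  by (transfer, simp add: hit_0)+

lift_definition qp_kameko :: "'n::finite qp \<Rightarrow> 'n qp" is kameko
proof -
  fix f g :: "'n pol" assume "f - g \<in> hit"
  then have "kameko (f - g) \<in> hit" by (rule kameko_hit)
  then show "kameko f - kameko g \<in> hit" by (simp add: minus_eq_plus kameko_add)
qed

lemma qp_kameko_linear: "Vector_Spaces.linear qp_scale qp_scale qp_kameko"
proof -
  have "qp_kameko (x + y) = qp_kameko x + qp_kameko y" for x y :: "'a qp"
    by transfer (simp add: kameko_add hit_0)
  moreover have "qp_kameko (qp_scale c x) = qp_scale c (qp_kameko x)" for c and x :: "'a qp"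
    by (cases c) (simp_all, transfer, simp add: hit_0)
  ultimately show ?thesis
    unfolding Vector_Spaces.linear_iff by (intro conjI qp.vector_space_axioms) blast+
qed

lemma qp_part_subspace: "qp.subspace (qp_part d)"
proof (rule qp.subspaceI)
  show "0 \<in> qp_part d" unfolding qp_part_def zero_qp_def using homogeneous_0 by auto
  show "v + w \<in> qp_part d" if "v \<in> qp_part d" "w \<in> qp_part d" for v w :: "'a qp"
    using that unfolding qp_part_def by (auto simp: abs_qp_add intro!: imageI homogeneous_add)
  then show "qp_scale c v \<in> qp_part d" if "v \<in> qp_part d" for c and v :: "'a qp"
    using that \<open>0 \<in> qp_part d\<close> by (cases c) simp_all
qed

lemma qp_kameko_image: "qp_kameko ` (qp_part (2 * d + CARD('n)) :: 'n::finite qp set) = qp_part d"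
proof
  show "qp_kameko ` (qp_part (2 * d + CARD('n)) :: 'n qp set) \<subseteq> qp_part d"
    by (auto simp: qp_part_def qp_kameko.abs_eq intro: kameko_homogeneous)
  show "(qp_part d :: 'n qp set) \<subseteq> qp_kameko ` qp_part (2 * d + CARD('n))"
  proof
    fix v :: "'n qp" assume "v \<in> qp_part d"
    then obtain f where "v = abs_qp f" "homogeneous d f" by (auto simp: qp_part_def)
    then show "v \<in> qp_kameko ` qp_part (2 * d + CARD('n))"
      by (intro image_eqI[of _ _ "abs_qp (kameko_up f)"])
        (auto simp: qp_kameko.abs_eq qp_part_def intro: homogeneous_kameko_up)
  qed
qed

text \<open>Serves both above degree 23, where the map is injective, and in degree 23, where it has
  a kernel.\<close>

lemma qp_kameko_invariants:
  fixes v :: "'n::finite qp"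
  assumes "v \<in> gl_invariants (qp_part (2 * d + CARD('n)))"
  shows "qp_kameko v \<in> gl_invariants (qp_part d)"
proof -
  have comm: "gl_act A (qp_kameko v) = qp_kameko (gl_act A v)" if "invertible A" for A :: "bit^'n^'n"
    using that by transfer (simp add: kameko_lin_subst hit_0)
  have v: "v \<in> qp_part (2 * d + CARD('n))" and inv: "\<And>A. invertible A \<Longrightarrow> gl_act A v = v"
    using assms unfolding gl_invariants_def by blast+
  have "qp_kameko v \<in> qp_part d"
    using imageI[OF v, of qp_kameko] unfolding qp_kameko_image .
  then show ?thesis
    unfolding gl_invariants_def by (simp add: comm inv)
qed

context
  fixes d :: nat and ty :: "'n::finite itself"
  assumes small: "\<And>e::'n \<Rightarrow>\<^sub>0 nat. deg e = 2 * d + CARD('n) \<Longrightarrow> card (odds e) < CARD('n) \<Longrightarrow> mono e \<in> hit"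
begin

lemma qp_kameko_eq_0:
  assumes "v \<in> (qp_part (2 * d + CARD('n)) :: 'n qp set)" "qp_kameko v = 0" shows "v = 0"
proof -
  obtain p where p: "v = abs_qp p" "homogeneous (2 * d + CARD('n)) p" using assms(1) unfolding qp_part_def by blast
  have "kameko p \<in> hit" using assms(2) unfolding p(1) qp_kameko.abs_eq abs_qp_eq_0_iff .
  then show ?thesis unfolding p(1) abs_qp_eq_0_iff using kameko_hit_iff[OF small p(2)] by blast
qed

lemma qp_part_dim_Kameko: "qp.dim (qp_part (2 * d + CARD('n)) :: 'n qp set) = qp.dim (qp_part d :: 'n qp set)"
proof -
  let ?V = "qp_part (2 * d + CARD('n)) :: 'n qp set"
  interpret k: Vector_Spaces.linear qp_scale qp_scale "qp_kameko :: 'n qp \<Rightarrow> 'n qp" by (rule qp_kameko_linear)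
  obtain B where B: "B \<subseteq> ?V" "qp.independent B" "?V \<subseteq> qp.span B" "card B = qp.dim ?V"
    using qp.basis_exists[of ?V] by blast
  have span: "qp.span B = ?V" using B(1,3) qp.span_minimal[OF B(1) qp_part_subspace] by blast
  have inj: "inj_on qp_kameko (qp.span B)"
    using k.inj_on_iff_eq_0[OF qp_part_subspace[of "2 * d + CARD('n)"]] qp_kameko_eq_0 span by auto
  have "qp.independent (qp_kameko ` B)"
    using B(2) inj by (rule k.independent_injective_image)
  moreover have "qp_part d \<subseteq> qp.span (qp_kameko ` B)"
    using k.span_image[of B] span qp_kameko_image[where 'n = 'n and d = d] by simp
  moreover have "qp_kameko ` B \<subseteq> qp_part d"
    using B(1) qp_kameko_image[where 'n = 'n and d = d] by blast
  moreover have "card (qp_kameko ` B) = card B"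
    using inj_on_subset[OF inj qp.span_superset] by (rule card_image)
  ultimately show ?thesis using B(4) qp.dim_unique by metis
qed

lemma gl_invariants_Kameko:
  assumes "gl_invariants (qp_part d :: 'n qp set) = {0}"
  shows "gl_invariants (qp_part (2 * d + CARD('n)) :: 'n qp set) = {0}"
proof -
  have "gl_act A 0 = (0 :: 'n qp)" for A by transfer (simp add: hit_0)
  then have "0 \<in> gl_invariants (qp_part (2 * d + CARD('n)) :: 'n qp set)"
    unfolding gl_invariants_def using qp.subspace_0[OF qp_part_subspace] by blast
  moreover have "v = 0" if "v \<in> gl_invariants (qp_part (2 * d + CARD('n)) :: 'n qp set)" for v
  proof (rule qp_kameko_eq_0)
    show "v \<in> qp_part (2 * d + CARD('n))" using that unfolding gl_invariants_def by blast
    show "qp_kameko v = 0" using qp_kameko_invariants[OF that] unfolding assms by blast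
  qed
  ultimately show ?thesis by blast
qed

end

declare [[show_results = false]]

section \<open>Sparse vectors\<close>

text \<open>
  A vector over the field with two elements is a binary trie whose positions are bit lists;
  the flag at a node is the coefficient of its path.
\<close>

datatype fvec = VZ | VN bool fvec fvec

fun bxor :: "bool \<Rightarrow> bool \<Rightarrow> bool" where
  "bxor True True = False" | "bxor True False = True" | "bxor False b = b"

text \<open>Cancelled subtries collapse to \<open>VZ\<close>, so tries built from
  \<open>vsingle\<close> by \<open>vadd\<close> have a unique form and a vanishing sum is
  recognised.\<close>

fun vnode :: "bool \<Rightarrow> fvec \<Rightarrow> fvec \<Rightarrow> fvec" where
  "vnode True l r = VN True l r"
| "vnode False VZ VZ = VZ"
| "vnode False VZ (VN b l r) = VN False VZ (VN b l r)"
| "vnode False (VN b l r) t = VN False (VN b l r) t"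

fun vadd :: "fvec \<Rightarrow> fvec \<Rightarrow> fvec" where
  "vadd VZ t = t"
| "vadd (VN a l r) VZ = VN a l r"
| "vadd (VN a l r) (VN b l' r') = vnode (bxor a b) (vadd l l') (vadd r r')"

fun vsum :: "('a \<Rightarrow> fvec) \<Rightarrow> 'a list \<Rightarrow> fvec" where
  "vsum g [] = VZ" | "vsum g (x # xs) = vadd (g x) (vsum g xs)"

fun vsingle :: "bool list \<Rightarrow> fvec" where
  "vsingle [] = VN True VZ VZ"
| "vsingle (False # p) = VN False (vsingle p) VZ"
| "vsingle (True # p) = VN False VZ (vsingle p)"

text \<open>Appends \<open>u\<close> to every position. For positions \<open>enc y\<close> this
  multiplies a relation between squares of monomials y by the squarefree part that \<open>u\<close>
  encodes.\<close>

fun vshift :: "fvec \<Rightarrow> bool list \<Rightarrow> fvec" where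
  "vshift VZ u = VZ"
| "vshift (VN True l r) u = vadd (vsingle u) (VN False (vshift l u) (vshift r u))"
| "vshift (VN False l r) u = VN False (vshift l u) (vshift r u)"

text \<open>The least position with coefficient 1 in the lexicographic order of bit lists.\<close>

fun vlead :: "fvec \<Rightarrow> bool list option" where
  "vlead VZ = None"
| "vlead (VN b l r) = (if b then Some [] else case vlead l of Some p \<Rightarrow> Some (False # p)
     | None \<Rightarrow> map_option (Cons True) (vlead r))"

definition vlead' where
  "vlead' x r = (case x of Some p \<Rightarrow> Some (False # p) | None \<Rightarrow> map_option (Cons True) (vlead r))"

text \<open>
  The \<open>_code\<close> equations rewrite a call only after its arguments are in constructor form, so that
  the simplifier does not descend into branches that are not taken.
\<close>

lemma vlead_code:
  "vlead VZ = None" "vlead (VN True l r) = Some []"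
  "vlead (VN False VZ r) = map_option (Cons True) (vlead r)"
  "vlead (VN False (VN b x y) r) = vlead' (vlead (VN b x y)) r"
  "vlead' (Some p) r = Some (False # p)" "vlead' None r = map_option (Cons True) (vlead r)"
  by (simp_all add: vlead'_def)

fun vinsert :: "bool list \<Rightarrow> fvec \<Rightarrow> fvec" where
  "vinsert p VZ = vsingle p"
| "vinsert [] (VN b l r) = VN True l r"
| "vinsert (False # p) (VN b l r) = VN b (vinsert p l) r"
| "vinsert (True # p) (VN b l r) = VN b l (vinsert p r)"

fun vmem :: "bool list \<Rightarrow> fvec \<Rightarrow> bool" where
  "vmem p VZ = False"
| "vmem [] (VN b l r) = b"
| "vmem (False # p) (VN b l r) = vmem p l"
| "vmem (True # p) (VN b l r) = vmem p r"

fun vset :: "bool list option list \<Rightarrow> fvec" where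
  "vset [] = VZ" | "vset (None # ks) = vset ks" | "vset (Some k # ks) = vinsert k (vset ks)"

text \<open>The trie as a formal sum of positions, evaluated linearly. The operations are specified
  through it for arbitrary \<open>f\<close>, so one result serves polynomials, coefficients and
  values modulo a subspace.\<close>

fun veval :: "(bool list \<Rightarrow> 'a::ring_char_two) \<Rightarrow> fvec \<Rightarrow> 'a" where
  "veval f VZ = 0"
| "veval f (VN b l r) = (if b then f [] else 0) + veval (\<lambda>p. f (False # p)) l + veval (\<lambda>p. f (True # p)) r"

lemma veval_vnode: "veval f (vnode b l r) = veval f (VN b l r)"
  by (cases "(b, l, r)" rule: vnode.cases) auto

lemma veval_vadd [simp]: "veval f (vadd v w) = veval f v + veval f w"
proof (induction v w arbitrary: f rule: vadd.induct)
  case (3 a l r b l' r')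
  then show ?case by (cases a; cases b) (simp_all add: veval_vnode add_ac)
qed auto

lemma veval_vsum: "veval f (vsum g xs) = (\<Sum>x\<leftarrow>xs. veval f (g x))"
  by (induction xs) simp_all

lemma veval_vsingle [simp]: "veval f (vsingle p) = f p"
  by (induction p arbitrary: f rule: vsingle.induct) auto

lemma veval_vshift: "veval f (vshift v u) = veval (\<lambda>p. f (p @ u)) v"
  by (induction v u arbitrary: f rule: vshift.induct) (auto simp: add_ac)

lemma vmem_vsingle: "vmem q (vsingle p) \<Longrightarrow> q = p"
proof (induction p arbitrary: q rule: vsingle.induct)
  case 1 then show ?case by (cases "(q, VN True VZ VZ)" rule: vmem.cases) auto
next
  case (2 p) then show ?case by (cases "(q, VN False (vsingle p) VZ)" rule: vmem.cases) auto
next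
  case (3 p) then show ?case by (cases "(q, VN False VZ (vsingle p))" rule: vmem.cases) auto
qed

lemma vmem_vinsert: "vmem q (vinsert p v) \<Longrightarrow> q = p \<or> vmem q v"
proof (induction p v arbitrary: q rule: vinsert.induct)
  case (1 p) then show ?case using vmem_vsingle by auto
next
  case (2 b l r) then show ?case by (cases "(q, VN b l r)" rule: vmem.cases) auto
next
  case (3 p b l r) then show ?case by (cases "(q, VN b l r)" rule: vmem.cases) auto
next
  case (4 p b l r) then show ?case by (cases "(q, VN b l r)" rule: vmem.cases) auto
qed

lemma vmem_vset: "vmem k (vset ks) \<Longrightarrow> Some k \<in> set ks"
  by (induction ks rule: vset.induct) (auto dest: vmem_vinsert)

text \<open>Over two elements an additive subgroup is a subspace. The elimination works modulo any
  \<open>H\<close> that contains the hit polynomials, so the candidate generators enter only through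
  the choice of \<open>H\<close>.\<close>

definition add_closed :: "'a::ring_char_two set \<Rightarrow> bool" where
  "add_closed H \<longleftrightarrow> 0 \<in> H \<and> (\<forall>x\<in>H. \<forall>y\<in>H. x + y \<in> H)"

lemma add_closed_0: "add_closed H \<Longrightarrow> 0 \<in> H"
  and add_closed_add: "add_closed H \<Longrightarrow> x \<in> H \<Longrightarrow> y \<in> H \<Longrightarrow> x + y \<in> H"
  by (auto simp: add_closed_def)

lemma add_closed_cancel: "add_closed H \<Longrightarrow> x + y \<in> H \<Longrightarrow> x \<in> H \<Longrightarrow> y \<in> H"
  using add_closed_add[of H x "x + y"] by simp

lemma add_closed_sum_list: "add_closed H \<Longrightarrow> (\<And>x. x \<in> set xs \<Longrightarrow> g x \<in> H) \<Longrightarrow> sum_list (map g xs) \<in> H"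
  by (induction xs) (auto simp: add_closed_0 intro: add_closed_add)

lemma veval_in: "add_closed H \<Longrightarrow> (\<And>k. f k \<in> H) \<Longrightarrow> veval f v \<in> H"
  by (induction v arbitrary: f) (auto simp: add_closed_0 intro!: add_closed_add)

lemma veval_vlead_None: "vlead v = None \<Longrightarrow> veval f v = 0"
  by (induction v arbitrary: f) (auto split: if_splits option.splits)

text \<open>All other positions of the trie are greater than the least one and evaluate into H, so
  modulo H the row is its leading term.\<close>

lemma veval_vlead:
  assumes H: "add_closed H"
  shows "vlead v = Some k \<Longrightarrow> (\<And>k'. k < k' \<Longrightarrow> f k' \<in> H) \<Longrightarrow> veval f v + f k \<in> H"
proof (induction v arbitrary: f k)
  case (VN b l r)
  show ?case
  proof (cases b)
    case True
    then have eq: "veval f (VN b l r) + f k = veval (\<lambda>p. f (False # p)) l + veval (\<lambda>p. f (True # p)) r"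
      using VN.prems by (simp add: add_ac)
    have "k = []" using True VN.prems(1) by simp
    then show ?thesis unfolding eq using VN.prems(2) H by (intro add_closed_add veval_in) auto
  next
    case False
    show ?thesis
    proof (cases "vlead l")
      case None
      then obtain k' where k: "vlead r = Some k'" "k = True # k'" using VN.prems False by auto
      then have "veval (\<lambda>p. f (True # p)) r + f (True # k') \<in> H" using VN.prems by (intro VN.IH) auto
      then show ?thesis using k False None by (simp add: veval_vlead_None)
    next
      case (Some k')
      then have k: "k = False # k'" using VN.prems False by auto
      then have "veval (\<lambda>p. f (False # p)) l + f (False # k') \<in> H" using VN.prems Some by (intro VN.IH) auto
      moreover have "veval (\<lambda>p. f (True # p)) r \<in> H" using VN.prems k H by (intro veval_in) auto
      ultimately have "(veval (\<lambda>p. f (False # p)) l + f (False # k')) + veval (\<lambda>p. f (True # p)) r \<in> H"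
        using add_closed_add[OF H] by blast
      then show ?thesis using k False by (simp add: add_ac)
    qed
  qed
qed simp

text \<open>Back substitution: a value outside \<open>H\<close> at the greatest possible position is a contradiction.\<close>

lemma position_induct:
  fixes f :: "bool list \<Rightarrow> 'a"
  assumes fin: "finite {k. f k \<notin> H}" and step: "\<And>k. (\<And>k'. k < k' \<Longrightarrow> f k' \<in> H) \<Longrightarrow> f k \<in> H"
  shows "f k \<in> H"
proof (rule ccontr)
  let ?B = "{k. f k \<notin> H}"
  assume "f k \<notin> H"
  then have ne: "?B \<noteq> {}" by auto
  define m where "m = Max ?B"
  have "m \<in> ?B" unfolding m_def using fin ne by (rule Max_in)
  moreover have "f m \<in> H"
  proof (rule step)
    fix k' assume "m < k'"
    then show "f k' \<in> H" using Max_ge[OF fin, of k'] unfolding m_def by force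
  qed
  ultimately show False by simp
qed

text \<open>A row that evaluates into H rewrites its leading position as a sum of greater
  ones.\<close>

lemma in_add_closed_if_lead:
  assumes "add_closed H" "vlead v = Some k" "veval f v \<in> H" "\<And>k'. k < k' \<Longrightarrow> f k' \<in> H"
  shows "f k \<in> H"
  using veval_vlead[OF assms(1,2,4)] assms(3) by (rule add_closed_cancel[OF assms(1)])

subsection \<open>Reduction by a table of rows\<close>

datatype store = SZ | SN fvec store store

fun sinsert :: "bool list \<Rightarrow> fvec \<Rightarrow> store \<Rightarrow> store" where
  "sinsert [] v SZ = SN v SZ SZ"
| "sinsert (False # p) v SZ = SN VZ (sinsert p v SZ) SZ"
| "sinsert (True # p) v SZ = SN VZ SZ (sinsert p v SZ)"
| "sinsert [] v (SN w a b) = SN v a b"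
| "sinsert (False # p) v (SN w a b) = SN w (sinsert p v a) b"
| "sinsert (True # p) v (SN w a b) = SN w a (sinsert p v b)"

fun slookup :: "bool list \<Rightarrow> store \<Rightarrow> fvec" where
  "slookup p SZ = VZ"
| "slookup [] (SN w a b) = w"
| "slookup (False # p) (SN w a b) = slookup p a"
| "slookup (True # p) (SN w a b) = slookup p b"

definition sinsert' where "sinsert' x v S = (case x of None \<Rightarrow> S | Some k \<Rightarrow> sinsert k v S)"

lemma sinsert'_code: "sinsert' None v S = S" "sinsert' (Some k) v S = sinsert k v S"
  by (simp_all add: sinsert'_def)

fun sbuild :: "fvec list \<Rightarrow> store" where
  "sbuild [] = SZ" | "sbuild (v # vs) = sinsert' (vlead v) v (sbuild vs)"

lemma slookup_sinsert: "slookup q (sinsert p v S) \<in> {v, slookup q S, VZ}"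
proof (induction p v S arbitrary: q rule: sinsert.induct)
  case (1 v) then show ?case by (cases "(q, SN v SZ SZ)" rule: slookup.cases) auto
next
  case (2 p v)
  have "slookup q (sinsert p v SZ) \<in> {v, VZ}" for q using 2[of q] by simp
  then show ?case by (cases "(q, SN VZ (sinsert p v SZ) SZ)" rule: slookup.cases) auto
next
  case (3 p v)
  have "slookup q (sinsert p v SZ) \<in> {v, VZ}" for q using 3[of q] by simp
  then show ?case by (cases "(q, SN VZ SZ (sinsert p v SZ))" rule: slookup.cases) auto
next
  case (4 v w a b) then show ?case by (cases "(q, SN w a b)" rule: slookup.cases) auto
next
  case (5 p v w a b) then show ?case by (cases "(q, SN w a b)" rule: slookup.cases) auto
next
  case (6 p v w a b) then show ?case by (cases "(q, SN w a b)" rule: slookup.cases) auto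
qed

text \<open>Every nonzero entry of the store is one of the rows, hence a valid relation; adding any
  entry preserves values modulo H.\<close>

lemma slookup_sbuild: "slookup q (sbuild vs) \<in> insert VZ (set vs)"
proof (induction vs)
  case (Cons v vs)
  show ?case
  proof (cases "vlead v")
    case (Some k)
    then show ?thesis using Cons slookup_sinsert[of q k v "sbuild vs"] by (auto simp: sinsert'_def)
  qed (use Cons in \<open>auto simp: sinsert'_def\<close>)
qed simp

text \<open>Elimination with n as fuel. An empty table entry marks a position that leads no row, and
  the position moves to \<open>acc\<close>. A remainder left when the fuel ends is added back, so
  the result is congruent to the input for every n.\<close>

fun vreduce :: "(bool list \<Rightarrow> fvec) \<Rightarrow> nat \<Rightarrow> fvec \<Rightarrow> fvec \<Rightarrow> fvec" where
  "vreduce tab 0 v acc = vadd v acc"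
| "vreduce tab (Suc n) v acc = (case vlead v of None \<Rightarrow> acc | Some k \<Rightarrow>
     if tab k = VZ then vreduce tab n (vadd v (vsingle k)) (vadd acc (vsingle k))
     else vreduce tab n (vadd v (tab k)) acc)"

definition vreduce1 where
  "vreduce1 tab n v acc x = (case x of None \<Rightarrow> acc | Some k \<Rightarrow>
     if tab k = VZ then vreduce tab n (vadd v (vsingle k)) (vadd acc (vsingle k))
     else vreduce tab n (vadd v (tab k)) acc)"

definition vreduce2 where
  "vreduce2 tab n v acc k w = (if w = VZ then vreduce tab n (vadd v (vsingle k)) (vadd acc (vsingle k))
     else vreduce tab n (vadd v w) acc)"

lemma vreduce_code:
  "vreduce tab 0 v acc = vadd v acc" "vreduce tab (Suc n) v acc = vreduce1 tab n v acc (vlead v)"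
  "vreduce1 tab n v acc None = acc" "vreduce1 tab n v acc (Some k) = vreduce2 tab n v acc k (tab k)"
  "vreduce2 tab n v acc k VZ = vreduce tab n (vadd v (vsingle k)) (vadd acc (vsingle k))"
  "vreduce2 tab n v acc k (VN b l r) = vreduce tab n (vadd v (VN b l r)) acc"
  by (simp_all add: vreduce1_def vreduce2_def)

lemma veval_vreduce:
  assumes H: "add_closed H" and tab: "\<And>k. veval f (tab k) \<in> H"
  shows "veval f (vreduce tab n v acc) + (veval f v + veval f acc) \<in> H"
proof (induction n arbitrary: v acc)
  case 0
  then show ?case using H by (simp add: add_closed_0)
next
  case (Suc n)
  show ?case
  proof (cases "vlead v")
    case None
    then show ?thesis using H by (simp add: veval_vlead_None add_closed_0)
  next
    case (Some k)
    show ?thesis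
    proof (cases "tab k = VZ")
      case True
      then show ?thesis using Some Suc[of "vadd v (vsingle k)" "vadd acc (vsingle k)"]
        by (simp add: add.assoc add.left_commute[of "f k"])
    next
      case False
      have eq: "(veval f (vreduce tab (Suc n) v acc) + (veval f v + veval f acc)) =
        (veval f (vreduce tab n (vadd v (tab k)) acc) + (veval f (vadd v (tab k)) + veval f acc)) + veval f (tab k)"
        using Some False by (simp add: add_ac)
      show ?thesis unfolding eq by (rule add_closed_add[OF H Suc tab])
    qed
  qed
qed

section \<open>Monomials as exponent lists\<close>

text \<open>Unary digits closed by \<open>False\<close>: the code is injective, turns concatenation
  into concatenation, and on lists of one length the lexicographic order of the codes compares the
  exponents from the left.\<close>

fun enc :: "nat list \<Rightarrow> bool list" where
  "enc [] = []"
| "enc (0 # x) = False # enc x"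
| "enc (Suc a # x) = True # enc (a # x)"

lemma enc_append: "enc (x @ y) = enc x @ enc y"
  by (induction x rule: enc.induct) auto

lemma enc_inject: "enc x = enc y \<longleftrightarrow> x = y"
proof (induction x arbitrary: y rule: enc.induct)
  case 1 then show ?case by (cases y rule: enc.cases) auto
next
  case (2 x) then show ?case by (cases y rule: enc.cases) auto
next
  case (3 a x) then show ?case by (cases y rule: enc.cases) auto
qed

definition at_key :: "nat list set \<Rightarrow> (nat list \<Rightarrow> 'a) \<Rightarrow> bool list \<Rightarrow> 'a::ring_char_two" where
  "at_key E g k = (if k \<in> enc ` E then g (inv_into E enc k) else 0)"

lemma at_key_enc: "at_key E g (enc e) = (if e \<in> E then g e else 0)"
proof -
  have "inj_on enc E" by (simp add: inj_on_def enc_inject)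
  then show ?thesis by (auto simp: at_key_def enc_inject)
qed

fun incr_hd :: "nat list \<Rightarrow> nat list" where
  "incr_hd [] = []" | "incr_hd (a # x) = Suc a # x"

fun exps :: "nat \<Rightarrow> nat \<Rightarrow> nat list list" where
  "exps 0 0 = [[]]"
| "exps 0 (Suc d) = []"
| "exps (Suc n) 0 = map (Cons 0) (exps n 0)"
| "exps (Suc n) (Suc d) = map (Cons 0) (exps n (Suc d)) @ map incr_hd (exps (Suc n) d)"

lemma set_exps: "set (exps n d) = {e. length e = n \<and> sum_list e = d}"
proof (induction n d rule: exps.induct)
  case (4 n d)
  have "{e. length e = Suc n \<and> sum_list e = Suc d} =
    Cons 0 ` {e. length e = n \<and> sum_list e = Suc d} \<union> incr_hd ` {e. length e = Suc n \<and> sum_list e = d}"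
    (is "?L = ?A \<union> ?B")
  proof (intro set_eqI iffI)
    fix e assume e: "e \<in> ?L"
    then obtain a x where ax: "e = a # x" by (cases e) auto
    show "e \<in> ?A \<union> ?B"
    proof (cases a)
      case (Suc b)
      then have "e = incr_hd (b # x)" "b # x \<in> {e. length e = Suc n \<and> sum_list e = d}" using e ax by auto
      then show ?thesis by blast
    qed (use e ax in auto)
  next
    fix e assume "e \<in> ?A \<union> ?B"
    then show "e \<in> ?L" by (auto simp: length_Suc_conv)
  qed
  then show ?case using 4 by simp
qed (auto simp: length_Suc_conv image_iff)

fun mn :: "'n list \<Rightarrow> nat list \<Rightarrow> 'n::finite pol" where
  "mn (x # xs) (a # e) = X x ^ a * mn xs e"
| "mn _ _ = 1"

fun pascal_next :: "bool \<Rightarrow> bool list \<Rightarrow> bool list" where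
  "pascal_next p [] = [p]" | "pascal_next p (b # bs) = bxor p b # pascal_next b bs"

fun pascal :: "nat \<Rightarrow> bool list" where
  "pascal 0 = [True]" | "pascal (Suc a) = pascal_next False (pascal a)"

text \<open>With c = a and \<open>bs\<close> row a of Pascal's triangle modulo two, these are the
  pairs (a + i, k - i) for which \<open>Sq i\<close> takes x ^ a to x ^ (a + i), the second entry
  being the index left for the remaining variables.\<close>

fun splits :: "nat \<Rightarrow> nat \<Rightarrow> bool list \<Rightarrow> (nat \<times> nat) list" where
  "splits c k [] = []"
| "splits c 0 (True # bs) = [(c, 0)]"
| "splits c 0 (False # bs) = []"
| "splits c (Suc k) (True # bs) = (c, Suc k) # splits (Suc c) k bs"
| "splits c (Suc k) (False # bs) = splits (Suc c) k bs"

fun sq_exps :: "nat list \<Rightarrow> nat \<Rightarrow> nat list list" where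
  "sq_exps [] 0 = [[]]"
| "sq_exps [] (Suc k) = []"
| "sq_exps (a # x) k = concat (map (\<lambda>(c, j). map (Cons c) (sq_exps x j)) (splits a k (pascal a)))"

lemma bxor_eq: "bxor a b = (a \<noteq> b)" by (cases a; cases b) auto

lemma nth_pascal_next: "i \<le> length bs \<Longrightarrow>
    pascal_next p bs ! i = ((if i = 0 then p else bs ! (i - 1)) \<noteq> (if i < length bs then bs ! i else False))"
proof (induction p bs arbitrary: i rule: pascal_next.induct)
  case (2 p b bs)
  then show ?case by (cases i) (auto simp: bxor_eq nth_Cons')
qed auto

lemma length_pascal_next: "length (pascal_next p bs) = Suc (length bs)"
  by (induction p bs rule: pascal_next.induct) auto

lemma length_pascal: "length (pascal a) = Suc a"
  by (induction a) (auto simp: length_pascal_next)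

lemma nth_pascal: "i \<le> a \<Longrightarrow> pascal a ! i = odd (a choose i)"
proof (induction a arbitrary: i)
  case (Suc a)
  have z: "odd (a choose i) = False" if "i = Suc a" using that by (simp add: binomial_eq_0)
  show ?case
  proof (cases i)
    case 0
    then show ?thesis using Suc.IH[of 0] by (simp add: nth_pascal_next length_pascal)
  next
    case (Suc j)
    then show ?thesis using Suc.prems Suc.IH[of j] Suc.IH[of "Suc j"] z
      by (auto simp: nth_pascal_next length_pascal)
  qed
qed simp

lemma splits_sum:
  "sum_list (map (\<lambda>(c, j). h c j) (splits c k bs)) = (\<Sum>i<length bs. if i \<le> k \<and> bs ! i then h (c + i) (k - i) else 0)"
  for h :: "nat \<Rightarrow> nat \<Rightarrow> 'a::comm_monoid_add"
proof (induction c k bs rule: splits.induct)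
  case (4 c k bs)
  then show ?case by (simp add: sum.lessThan_Suc_shift del: sum.lessThan_Suc cong: if_cong)
next
  case (5 c k bs)
  then show ?case by (simp add: sum.lessThan_Suc_shift del: sum.lessThan_Suc cong: if_cong)
qed (simp_all add: sum.lessThan_Suc_shift del: sum.lessThan_Suc cong: if_cong)

lemma splits_elem: "(c', j) \<in> set (splits c k bs) \<Longrightarrow> c' + j = c + k"
  by (induction c k bs rule: splits.induct) auto

lemma sq_exps_elem: "c \<in> set (sq_exps e k) \<Longrightarrow> length c = length e \<and> sum_list c = sum_list e + k"
proof (induction e k arbitrary: c rule: sq_exps.induct)
  case (3 a x k)
  then show ?case by (fastforce dest: splits_elem)
qed auto

lemma Sq_X_power: "Sq k (X x ^ a) = of_nat (a choose k) * X x ^ (a + k)"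
proof (induction a arbitrary: k)
  case 0
  then show ?case by (auto simp: Sq_one binomial_eq_0)
next
  case (Suc a)
  show ?case
  proof (cases k)
    case 0
    then show ?thesis by (simp add: Sq_0)
  next
    case (Suc j)
    have "Sq k (X x * X x ^ a) = (\<Sum>i\<le>k. (if i = 0 then X x * Sq k (X x ^ a) else 0)
        + (if i = 1 then (X x)\<^sup>2 * Sq j (X x ^ a) else 0))"
      unfolding Sq_Cartan using Suc by (intro sum.cong) (auto simp: Sq_X)
    also have "\<dots> = X x * Sq k (X x ^ a) + (X x)\<^sup>2 * Sq j (X x ^ a)"
      using Suc by (simp add: sum.distrib)
    finally show ?thesis
      using Suc by (simp add: Suc.IH power2_eq_square algebra_simps)
  qed
qed

lemma of_nat_char_two_if: "of_nat n * x = (if odd n then x else (0 :: 'a::ring_char_two))"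
  by (simp add: of_nat_char_two)

lemma sum_list_concat_map: "sum_list (map h (concat (map g xs))) = sum_list (map (\<lambda>x. sum_list (map h (g x))) xs)"
  by (induction xs) simp_all

lemma Sq_mn: "length e = length xs \<Longrightarrow> Sq k (mn xs e) = sum_list (map (mn xs) (sq_exps e k))"
proof (induction e k arbitrary: xs rule: sq_exps.induct)
  case (1 xs) then show ?case by (simp add: Sq_one)
next
  case (2 k xs) then show ?case by (simp add: Sq_one)
next
  case (3 a e k)
  then obtain x ys where xs: "xs = x # ys" "length e = length ys" by (cases xs) auto
  define h where "h c j = X x ^ c * Sq j (mn ys e)" for c j
  have "sum_list (map (mn xs) (sq_exps (a # e) k))
      = sum_list (map (\<lambda>(c, j). sum_list (map (mn xs) (map (Cons c) (sq_exps e j)))) (splits a k (pascal a)))"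
    by (simp add: sum_list_concat_map case_prod_unfold)
  also have "\<dots> = sum_list (map (\<lambda>(c, j). h c j) (splits a k (pascal a)))"
  proof (intro arg_cong[where f = sum_list] map_cong refl, clarify)
    fix c j assume cj: "(c, j) \<in> set (splits a k (pascal a))"
    have "Sq j (mn ys e) = sum_list (map (mn ys) (sq_exps e j))"
      using 3(1)[OF cj refl] xs by blast
    then show "sum_list (map (mn xs) (map (Cons c) (sq_exps e j))) = h c j"
      by (simp add: h_def xs o_def sum_list_const_mult)
  qed
  also have "\<dots> = (\<Sum>i\<le>a. if i \<le> k \<and> odd (a choose i) then h (a + i) (k - i) else 0)"
    unfolding splits_sum length_pascal lessThan_Suc_atMost by (intro sum.cong) (auto simp: nth_pascal)
  also have "\<dots> = (\<Sum>i\<in>{..a} \<inter> {..k}. if odd (a choose i) then h (a + i) (k - i) else 0)"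
    by (rule sum.mono_neutral_cong_right) auto
  also have "\<dots> = (\<Sum>i\<le>k. if odd (a choose i) then h (a + i) (k - i) else 0)"
    by (rule sum.mono_neutral_left) (auto simp: binomial_eq_0)
  also have "\<dots> = Sq k (X x ^ a * mn ys e)"
    unfolding Sq_Cartan Sq_X_power by (intro sum.cong) (auto simp: h_def of_nat_char_two_if mult.assoc of_nat_char_two)
  finally show ?case using xs by simp
qed

fun vexps :: "nat list list \<Rightarrow> fvec" where
  "vexps [] = VZ" | "vexps (e # es) = vadd (vsingle (enc e)) (vexps es)"

lemma veval_vexps: "veval f (vexps es) = sum_list (map (\<lambda>e. f (enc e)) es)"
  by (induction es) simp_all

text \<open>The list \<open>k # e\<close> stands for the image of the monomial \<open>e\<close> under \<open>Sq k\<close>.\<close>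

fun sq_row :: "nat list \<Rightarrow> fvec" where
  "sq_row (Suc k # e) = vexps (sq_exps e (Suc k))" | "sq_row _ = VZ"

text \<open>The additive map g is kept general to cover both the identity and p \<mapsto>
  \<open>sqfree S * p\<^sup>2\<close>. Entries of a degree other than d evaluate to 0, so every list
  r gives a value in H.\<close>

lemma veval_sq_row:
  assumes H: "add_closed H" and g: "\<And>e c. f (enc (e :: nat list)) = (if length e = length xs \<and> sum_list e = d then g (mn xs e) else 0)"
    and add: "\<And>p q. g (p + q) = g p + g q" and hit: "\<And>k p. 0 < k \<Longrightarrow> k \<le> d \<Longrightarrow> homogeneous (d - k) p \<Longrightarrow> g (Sq k p) \<in> H"
    and hom: "\<And>e. length e = length xs \<Longrightarrow> homogeneous (sum_list e) (mn xs e)"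
  shows "veval f (sq_row r) \<in> H"
proof (cases r rule: sq_row.cases)
  case (1 k e)
  have g0: "g 0 = 0" using add[of 0 0] by simp
  show ?thesis
  proof (cases "length e = length xs \<and> sum_list e + Suc k = d")
    case True
    have "veval f (sq_row r) = sum_list (map (\<lambda>c. g (mn xs c)) (sq_exps e (Suc k)))"
      unfolding 1 using True
      by (auto simp: veval_vexps g dest!: sq_exps_elem intro!: arg_cong[where f = sum_list] map_cong)
    also have "\<dots> = g (sum_list (map (mn xs) (sq_exps e (Suc k))))"
    proof -
      have "sum_list (map (\<lambda>c. g (mn xs c)) cs) = g (sum_list (map (mn xs) cs))" for cs
        by (induction cs) (simp_all add: g0 add)
      then show ?thesis .
    qed
    also have "\<dots> = g (Sq (Suc k) (mn xs e))" using True by (simp add: Sq_mn)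
    also have "\<dots> \<in> H" using True hom[of e] by (intro hit) auto
    finally show ?thesis .
  next
    case False
    then have "f (enc c) \<in> H" if "c \<in> set (sq_exps e (Suc k))" for c
      using sq_exps_elem[OF that] H by (auto simp: g add_closed_0)
    then show ?thesis unfolding 1 using H by (simp add: veval_vexps add_closed_sum_list)
  qed
qed (use H in \<open>simp_all add: add_closed_0\<close>)

section \<open>Numbers of the form 7 * 2 ^ r and sums of powers of two\<close>

lemma two_power_plus_1: "2 ^ a + 1 \<noteq> 7 * (2 ^ r :: nat)"
proof
  have parity: "2 * x + 1 \<noteq> 14 * y" "2 * x \<noteq> 3" "Suc (Suc 0) \<noteq> 14 * y" for x y :: nat by presburger+
  assume eq: "2 ^ a + 1 = 7 * (2 ^ r :: nat)"
  show False
  proof (cases a; cases r)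
    fix b assume "a = Suc b" "r = 0"
    then have "2 ^ b = (3::nat)" using eq by simp
    then show False using parity(2) by (cases b) auto
  next
    fix b t assume "a = Suc b" "r = Suc t"
    then show False using eq parity(1)[of "2 ^ b" "2 ^ t"] by simp
  next
    fix t assume "a = 0" "r = Suc t"
    then show False using eq parity(3)[of "2 ^ t"] by simp
  qed (use eq in auto)
qed

lemma two_power_plus_2: "2 ^ a + 2 \<noteq> 7 * (2 ^ r :: nat)"
proof
  have parity: "2 * x + 2 \<noteq> 7" "3 \<noteq> 14 * x" for x :: nat by presburger+
  assume eq: "2 ^ a + 2 = 7 * (2 ^ r :: nat)"
  show False
  proof (cases a; cases r)
    fix b t assume "a = Suc b" "r = Suc t"
    then show False using eq two_power_plus_1[of b t] by simp
  next
    fix b assume "a = Suc b" "r = 0"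
    then show False using eq parity(1)[of "2 ^ b"] by simp
  next
    fix t assume "a = 0" "r = Suc t"
    then show False using eq parity(2)[of "2 ^ t"] by simp
  qed (use eq in auto)
qed

text \<open>In binary, 7 * 2 ^ r - 1 is 110 followed by r ones. For r at least 2 it has more than
  three ones, whereas a sum of three powers of two has at most three. The proof reads this off by
  parity and halving.\<close>

lemma three_two_powers_plus_1:
  assumes "2 \<le> r" shows "2 ^ a + 2 ^ b + 2 ^ c + 1 \<noteq> 7 * (2 ^ r :: nat)"
proof -
  have parity: "2 * x + 2 * y + 1 \<noteq> 14 * z" "3 \<noteq> 14 * z" "2 * x + 2 * y + 2 * z + 1 \<noteq> 28 * w"
    "2 * x + 3 \<noteq> 28 * w" "Suc (Suc (Suc (Suc 0))) \<noteq> 28 * w" for x y z w :: nat by presburger+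
  have two: "2 ^ a + 2 ^ b + 1 \<noteq> 14 * (2 ^ t :: nat)" for a b t :: nat
  proof (cases a; cases b)
    fix a' b' assume "a = Suc a'" "b = Suc b'"
    then show ?thesis using parity(1)[of "2 ^ a'" "2 ^ b'" "2 ^ t"] by simp
  next
    assume "a = 0" "b = 0"
    then show ?thesis using parity(2)[of "2 ^ t"] by simp
  qed (use two_power_plus_2[of a "Suc t"] two_power_plus_2[of b "Suc t"] in auto)
  obtain t where r: "r = Suc (Suc t)" using assms by (metis Suc_le_D numeral_2_eq_2 Suc_le_mono)
  show ?thesis
  proof (cases a; cases b; cases c)
    fix a' b' c' assume "a = Suc a'" "b = Suc b'" "c = Suc c'"
    then show ?thesis using parity(3)[of "2 ^ a'" "2 ^ b'" "2 ^ c'" "2 ^ t"] unfolding r by simp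
  qed (use two[of "a - 1" "b - 1" t] two[of "a - 1" "c - 1" t] two[of "b - 1" "c - 1" t]
      parity(4)[of "2 ^ (a - 1)" "2 ^ t"] parity(4)[of "2 ^ (b - 1)" "2 ^ t"] parity(4)[of "2 ^ (c - 1)" "2 ^ t"]
      parity(5)[of "2 ^ t"] in \<open>auto simp: r\<close>)
qed

text \<open>The degree is odd, hence so is the number of odd exponents. Put s = r + 1. For one odd
  exponent Wood's criterion asks for 2 ^ a + 2 = 7 * 2 ^ r, for three it asks for 2 ^ a + 2 ^ b + 2
  ^ c + 1 = 7 * 2 ^ r. For r = 1 the latter is solvable, as 8 + 4 + 1 + 1 = 14, which makes degree
  23 exceptional.\<close>

lemma few_odds_hit:
  fixes e :: "'n::finite \<Rightarrow>\<^sub>0 nat"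
  assumes d: "deg e + 5 = 7 * 2 ^ s" and s: "1 \<le> s" and c: "card (odds e) \<le> 2 \<or> 3 \<le> s \<and> card (odds e) < 5"
  shows "mono e \<in> hit"
proof (rule Wood)
  fix as :: "nat list"
  assume len: "length as = card (odds e)"
  obtain r where r: "s = Suc r" using s by (cases s) auto
  have e: "card (odds e) + 2 * deg (half e) + 5 = 14 * 2 ^ r" using d r deg_eq_odds_half[of e] by simp
  then have "odd (card (odds e))" by presburger
  then consider "card (odds e) = 1" | "card (odds e) = 3" "2 \<le> r"
    using c r by (cases "card (odds e) \<in> {0,2,4}") force+
  then show "(\<Sum>a\<leftarrow>as. 2 ^ a - 1) \<noteq> deg (half e)"
  proof cases
    case 1
    then obtain a where a: "as = [a]" using len by (auto simp: length_Suc_conv)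
    have "1 \<le> (2::nat) ^ a" by simp
    moreover have "deg (half e) + 3 = 7 * 2 ^ r" using e 1 by simp
    ultimately have "2 ^ a - 1 \<noteq> deg (half e)" using two_power_plus_2[of a r] by linarith
    then show ?thesis by (simp add: a)
  next
    case 2
    then obtain a b c where a: "as = [a, b, c]" using len by (auto simp: length_Suc_conv numeral_3_eq_3)
    have "1 \<le> (2::nat) ^ a" "1 \<le> (2::nat) ^ b" "1 \<le> (2::nat) ^ c" by simp_all
    moreover have "deg (half e) + 4 = 7 * 2 ^ r" using e 2 by simp
    ultimately have "(2 ^ a - 1) + ((2 ^ b - 1) + (2 ^ c - 1)) \<noteq> deg (half e)"
      using three_two_powers_plus_1[OF 2(2), of a b c] by linarith
    then show ?thesis by (simp add: a)
  qed
qed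

subsection \<open>Monomials as products over a list of variables\<close>

lemma homogeneous_mn: "length e = length xs \<Longrightarrow> homogeneous (sum_list e) (mn xs e)"
proof (induction xs e rule: mn.induct)
  case (1 x xs a e)
  have "homogeneous a (X x ^ a)"
  proof (induction a)
    case (Suc a)
    then show ?case using homogeneous_mult[OF homogeneous_X Suc] by simp
  qed (use homogeneous_mono[of 0 0] in simp)
  then show ?case using 1 by (auto intro: homogeneous_mult)
qed (use homogeneous_mono[of 0 0] in auto)

lemma mono_eq_prod: "mono e = (\<Prod>i\<in>UNIV. X i ^ Poly_Mapping.lookup e i)" for e :: "'n::finite \<Rightarrow>\<^sub>0 nat"
proof (induction e rule: exponent_induct)
  case (add j e)
  have "(\<Prod>i\<in>UNIV. X i ^ Poly_Mapping.lookup (Poly_Mapping.single j (1::nat)) i) = (\<Prod>i\<in>UNIV. if i = j then X j else (1 :: 'n pol))"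
    by (intro prod.cong) (auto simp: lookup_single when_def)
  then show ?case using add by (simp add: mono_mult lookup_add power_add prod.distrib X_def)
qed simp

lemma mn_map: "distinct xs \<Longrightarrow> mn xs (map f xs) = (\<Prod>x\<in>set xs. X x ^ f x)"
  by (induction xs) simp_all

lemma mono_eq_mn:
  assumes "distinct xs" "set xs = UNIV"
  shows "mono e = mn xs (map (Poly_Mapping.lookup e) xs)"
  using assms by (simp add: mono_eq_prod mn_map)

lemma deg_eq_sum_list: "distinct xs \<Longrightarrow> set xs = UNIV \<Longrightarrow> deg e = sum_list (map (Poly_Mapping.lookup e) xs)"
  by (simp add: sum_list_distinct_conv_sum_set)

fun sub01 :: "nat \<Rightarrow> nat \<Rightarrow> nat list list" where
  "sub01 0 0 = [[]]"
| "sub01 0 (Suc r) = []"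
| "sub01 (Suc n) 0 = map (Cons 0) (sub01 n 0)"
| "sub01 (Suc n) (Suc r) = map (Cons (Suc 0)) (sub01 n r) @ map (Cons 0) (sub01 n (Suc r))"

lemma set_sub01: "set (sub01 n r) = {u. length u = n \<and> set u \<subseteq> {0, 1} \<and> sum_list u = r}"
proof (induction n r rule: sub01.induct)
  case (3 n)
  then show ?case by (auto simp: length_Suc_conv image_iff)
next
  case (4 n r)
  have "{u. length u = Suc n \<and> set u \<subseteq> {0, 1} \<and> sum_list u = Suc r} =
    Cons 1 ` {u. length u = n \<and> set u \<subseteq> {0, 1} \<and> sum_list u = r} \<union>
    Cons 0 ` {u. length u = n \<and> set u \<subseteq> {0, 1} \<and> sum_list u = Suc r}"
    by (auto simp: length_Suc_conv image_iff)
  then show ?case using 4 by simp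
qed (auto simp: length_Suc_conv)

lemma mn_sqfree:
  "distinct xs \<Longrightarrow> length u = length xs \<Longrightarrow> set u \<subseteq> {0, 1} \<Longrightarrow> \<exists>S \<subseteq> set xs. card S = sum_list u \<and> mn xs u = sqfree S"
proof (induction xs u rule: mn.induct)
  case (1 x xs a u)
  then obtain S where S: "S \<subseteq> set xs" "card S = sum_list u" "mn xs u = sqfree S" by auto
  have x: "x \<notin> S" using S(1) 1(2) by auto
  show ?case
  proof (cases "a = 0")
    case False
    then have "a = 1" using 1(4) by auto
    then show ?thesis using S x by (intro exI[of _ "insert x S"]) (auto simp: sqfree_def)
  qed (use S in auto)
qed (auto simp: sqfree_def)

text \<open>A pair (u, y) stands for the squarefree product u times the square of y. One variable of
  u is squared away and raises its exponent in y by one.\<close>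

fun moves :: "nat list \<Rightarrow> nat list \<Rightarrow> (nat list \<times> nat list) list" where
  "moves [] y = []"
| "moves (a # u) [] = []"
| "moves (0 # u) (b # y) = map (map_prod (Cons 0) (Cons b)) (moves u y)"
| "moves (Suc a # u) (b # y) = (a # u, Suc b # y) # map (map_prod (Cons (Suc a)) (Cons b)) (moves u y)"

lemma Sq_1_mult: "Sq 1 (p * q) = Sq 1 p * q + p * Sq 1 q"
  by (simp add: Sq_Cartan Sq_0 add.commute)

text \<open>\<open>Sq 1\<close> is a derivation that vanishes on squares, so it acts on the
  squarefree factor one variable at a time.\<close>

lemma Sq_1_moves:
  "length u = length xs \<Longrightarrow> length y = length xs \<Longrightarrow> set u \<subseteq> {0, 1} \<Longrightarrow>
    Sq 1 (mn xs u * (mn xs y)\<^sup>2) = (\<Sum>(u', y')\<leftarrow>moves u y. mn xs u' * (mn xs y')\<^sup>2)"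
proof (induction u y arbitrary: xs rule: moves.induct)
  case (1 y) then show ?case by (simp add: Sq_one)
next
  case (3 u b y)
  then obtain x ys where xs: "xs = x # ys" by (cases xs) auto
  have "Sq 1 (mn xs (0 # u) * (mn xs (b # y))\<^sup>2) = Sq 1 ((X x ^ b)\<^sup>2 * (mn ys u * (mn ys y)\<^sup>2))"
    by (simp add: xs power_mult_distrib ac_simps)
  also have "\<dots> = (X x ^ b)\<^sup>2 * (\<Sum>(u', y')\<leftarrow>moves u y. mn ys u' * (mn ys y')\<^sup>2)"
    unfolding Sq_1_mult[of "(X x ^ b)\<^sup>2"] using 3 xs by (simp add: Sq_square)
  finally show ?case
    by (simp add: xs o_def case_prod_unfold sum_list_const_mult power_mult_distrib ac_simps flip: sum_list_const_mult)
next
  case (4 a u b y)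
  then obtain x ys where xs: "xs = x # ys" by (cases xs) auto
  have a: "a = 0" using 4 by auto
  have "Sq 1 (mn xs (Suc a # u) * (mn xs (b # y))\<^sup>2) = Sq 1 ((X x * (X x ^ b)\<^sup>2) * (mn ys u * (mn ys y)\<^sup>2))"
    by (simp add: xs a power_mult_distrib ac_simps)
  also have "\<dots> = (X x * X x ^ b)\<^sup>2 * (mn ys u * (mn ys y)\<^sup>2)
     + X x * (X x ^ b)\<^sup>2 * (\<Sum>(u', y')\<leftarrow>moves u y. mn ys u' * (mn ys y')\<^sup>2)"
    unfolding Sq_1_mult[of "X x * _"] Sq_1_mult[of "X x"] using 4 xs by (simp add: Sq_square Sq_X power_mult_distrib)
  finally show ?case
    by (simp add: xs a o_def case_prod_unfold power_mult_distrib ac_simps flip: sum_list_const_mult)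
qed auto

lemma moves_elem: "(u', y') \<in> set (moves u y) \<Longrightarrow> length u' = length u \<and> length y' = length y \<and>
    sum_list u = Suc (sum_list u') \<and> sum_list y' = Suc (sum_list y) \<and> (set u \<subseteq> {0, 1} \<longrightarrow> set u' \<subseteq> {0, 1})"
  by (induction u y arbitrary: u' y' rule: moves.induct) fastforce+

lemma enc_less_append: "length x = length y \<Longrightarrow> enc x < enc y \<Longrightarrow> enc x @ p < enc y @ q"
proof (induction x arbitrary: y rule: enc.induct)
  case 1 then show ?case by simp
next
  case (2 x) then show ?case by (cases y rule: enc.cases) auto
next
  case (3 a x) then show ?case by (cases y rule: enc.cases) fastforce+
qed

text \<open>For n = 5 these are the squarefree parts with four variables, which \<open>Sq 1\<close>
  brings down to three.\<close>

fun skip :: "nat \<Rightarrow> nat \<Rightarrow> nat list" where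
  "skip 0 t = []"
| "skip (Suc n) 0 = 0 # map (\<lambda>_. Suc 0) (skip n 0)"
| "skip (Suc n) (Suc t) = Suc 0 # skip n t"

lemma skip: "length (skip n t) = n" "set (skip n t) \<subseteq> {0, 1}"
  by (induction n t rule: skip.induct) auto

fun shifted_sum :: "(bool list \<Rightarrow> fvec) \<Rightarrow> nat \<Rightarrow> (nat list \<times> nat list) list \<Rightarrow> fvec" where
  "shifted_sum tab n [] = VZ"
| "shifted_sum tab n ((u, y) # ps) = vadd (vshift (vreduce tab n (vsingle (enc y)) VZ) (enc u)) (shifted_sum tab n ps)"

text \<open>The list \<open>t # y\<close> names \<open>Sq 1\<close> of the product of all variables
  but the t-th times the square of y. Each root that arises is at once reduced by the relations of
  degree 10.\<close>

fun sq1_row :: "(bool list \<Rightarrow> fvec) \<Rightarrow> nat \<Rightarrow> nat list \<Rightarrow> fvec" where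
  "sq1_row tab n [] = VZ" | "sq1_row tab n (t # y) = shifted_sum tab n (moves (skip 5 t) y)"

fun nonleads :: "nat list list \<Rightarrow> fvec \<Rightarrow> nat list list" where
  "nonleads [] L = []" | "nonleads (e # es) L = (if vmem (enc e) L then nonleads es L else e # nonleads es L)"

definition "nonleads' b e es L = (if b then nonleads es L else e # nonleads es L)"

lemma nonleads_code:
  "nonleads [] L = []" "nonleads (e # es) L = nonleads' (vmem (enc e) L) e es L"
  "nonleads' True e es L = nonleads es L" "nonleads' False e es L = e # nonleads es L"
  by (simp_all add: nonleads'_def)

lemma set_nonleads: "set (nonleads es L) = {e \<in> set es. \<not> vmem (enc e) L}"
  by (induction es) auto

fun prefix_all :: "'a list \<Rightarrow> 'a list list \<Rightarrow> 'a list list" where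
  "prefix_all [] ys = []" | "prefix_all (x # xs) ys = map (Cons x) ys @ prefix_all xs ys"

definition vars :: "5 list" where "vars = [0, 1, 2, 3, 4]"

lemma exhaust_5: "x \<in> set vars" for x :: 5
proof (induct x)
  case (of_int z)
  then have "z = 0 \<or> z = 1 \<or> z = 2 \<or> z = 3 \<or> z = 4" by fastforce
  then show ?case by (auto simp: vars_def)
qed

lemma vars: "set vars = UNIV" "length vars = 5" "distinct vars"
proof -
  show set: "set vars = UNIV" using exhaust_5 by auto
  show len: "length vars = 5" by (simp add: vars_def)
  show "distinct vars" by (rule card_distinct) (simp add: set len)
qed

definition span_of :: "'n::finite pol set \<Rightarrow> 'n pol set" where
  "span_of C = {p. abs_qp p \<in> qp.span (abs_qp ` C)}"

lemma add_closed_span_of: "add_closed (span_of C)"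
  unfolding add_closed_def span_of_def
  by (auto simp: qp.span_zero abs_qp_eq_0_iff[THEN iffD2, OF hit_0] qp.span_add simp flip: plus_qp.abs_eq)

lemma hit_subset_span_of: "p \<in> hit \<Longrightarrow> p \<in> span_of C"
  unfolding span_of_def using abs_qp_eq_0_iff[of p] by (simp add: qp.span_zero)

lemma subset_span_of: "p \<in> C \<Longrightarrow> p \<in> span_of C"
  unfolding span_of_def by (auto intro: qp.span_base)

lemma veval_vsum_in: "add_closed H \<Longrightarrow> (\<And>x. veval f (g x) \<in> H) \<Longrightarrow> veval f (vsum g xs) \<in> H"
  by (induction xs) (auto simp: add_closed_0 intro: add_closed_add)

lemma finite_at_key: "finite E \<Longrightarrow> 0 \<in> H \<Longrightarrow> finite {k. at_key E g k \<notin> H}"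
  by (rule finite_subset[of _ "enc ` E"]) (auto simp: at_key_def)

text \<open>Each leading monomial is congruent to a sum of later ones, and only finitely many
  positions carry a value. Induction from the last position downwards leaves the monomials that lead
  no row as generators.\<close>

lemma in_add_closed_if_nonleads:
  assumes H: "add_closed H" and rows: "\<And>v. v \<in> set rs \<Longrightarrow> veval (at_key (set es) g) v \<in> H"
    and nonleads: "\<And>e. e \<in> set (nonleads es (vset (map vlead rs))) \<Longrightarrow> g e \<in> H" and e: "e \<in> set es"
  shows "g e \<in> H"
proof -
  have "at_key (set es) g k \<in> H" for k
  proof (rule position_induct[OF finite_at_key])
    fix k assume above: "\<And>k'. k < k' \<Longrightarrow> at_key (set es) g k' \<in> H"
    show "at_key (set es) g k \<in> H"
    proof (cases "k \<in> enc ` set es")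
      case True
      then obtain e where e: "e \<in> set es" "k = enc e" by auto
      show ?thesis
      proof (cases "vmem k (vset (map vlead rs))")
        case True
        then obtain v where "v \<in> set rs" "vlead v = Some k" using vmem_vset by fastforce
        then show ?thesis using in_add_closed_if_lead[OF H _ rows above] by blast
      qed (use e nonleads in \<open>auto simp: at_key_enc set_nonleads\<close>)
    qed (use H in \<open>auto simp: at_key_def add_closed_0\<close>)
  qed (use H in \<open>auto simp: add_closed_0\<close>)
  then show ?thesis using e by (metis at_key_enc)
qed

subsection \<open>Degrees 9 and 10\<close>

lemma Sq_row_hit:
  fixes r :: "nat list"
  assumes "add_closed H" "hit \<subseteq> H"
  shows "veval (at_key (set (exps 5 d)) (mn vars)) (sq_row r) \<in> H"
  using assms hit_Sq by (intro veval_sq_row[where g = "\<lambda>p. p" and xs = vars and d = d])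
    (auto simp: at_key_enc set_exps vars homogeneous_mn)

lemma rows_span:
  assumes rs: "\<And>v. v \<in> set rs \<Longrightarrow> (\<exists>r. v = sq_row r) \<or> (\<exists>r. v = vsum sq_row r)"
    and H: "add_closed H" "hit \<subseteq> H"
  shows "v \<in> set rs \<Longrightarrow> veval (at_key (set (exps 5 d)) (mn vars)) v \<in> H"
  using rs[of v] Sq_row_hit[OF H] by (auto intro: veval_vsum_in[OF H(1)])

lemma mono_in_span_of_nonleads:
  assumes "\<And>v. v \<in> set rs \<Longrightarrow> (\<exists>r. v = sq_row r) \<or> (\<exists>r. v = vsum sq_row r)" "deg e = d"
  shows "mono e \<in> span_of (mn vars ` set (nonleads (exps 5 d) (vset (map vlead rs))))"
proof -
  let ?H = "span_of (mn vars ` set (nonleads (exps 5 d) (vset (map vlead rs))))"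
  have "mn vars (map (Poly_Mapping.lookup e) vars) \<in> ?H"
  proof (rule in_add_closed_if_nonleads[where rs = rs])
    show "map (Poly_Mapping.lookup e) vars \<in> set (exps 5 d)"
      using assms(2) by (simp add: set_exps vars deg_eq_sum_list[of vars])
    show "veval (at_key (set (exps 5 d)) (mn vars)) v \<in> ?H" if "v \<in> set rs" for v
      using rows_span[OF assms(1) add_closed_span_of _ that] hit_subset_span_of by blast
  qed (auto simp: add_closed_span_of intro: subset_span_of)
  then show ?thesis by (simp add: mono_eq_mn[of vars] vars)
qed

subsection \<open>Degree 23\<close>

definition pair_mn :: "nat list \<Rightarrow> nat list \<Rightarrow> 5 pol" where
  "pair_mn u y = mn vars u * (mn vars y)\<^sup>2"

context
  fixes rs10 rs23 :: "fvec list" and H :: "5 pol set" and tab :: "bool list \<Rightarrow> fvec" and n :: nat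
  assumes H: "add_closed H" and hit: "hit \<subseteq> H"
    and rs10: "\<And>v. v \<in> set rs10 \<Longrightarrow> (\<exists>r. v = sq_row r) \<or> (\<exists>r. v = vsum sq_row r)"
    and tab: "\<And>k. tab k \<in> insert VZ (set rs10)"
    and rs23: "\<And>v. v \<in> set rs23 \<Longrightarrow> (\<exists>r. v = sq1_row tab n r) \<or> (\<exists>r. v = vsum (sq1_row tab n) r)"
begin

definition "keys23 = {y @ u | y u. y \<in> set (exps 5 10) \<and> u \<in> set (sub01 5 3)}"
definition "val23 = at_key keys23 (\<lambda>z. pair_mn (drop 5 z) (take 5 z))"

lemma val23_enc: "length u = 5 \<Longrightarrow> val23 (enc (y @ u)) = (if y \<in> set (exps 5 10) \<and> u \<in> set (sub01 5 3) then pair_mn u y else 0)"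
proof -
  assume u: "length u = 5"
  have "y @ u \<in> keys23 \<longleftrightarrow> y \<in> set (exps 5 10) \<and> u \<in> set (sub01 5 3)"
    using u by (auto simp: keys23_def set_sub01)
  then show ?thesis using u by (auto simp: val23_def at_key_enc set_exps)
qed

text \<open>Carries relations from degree 10 to degree 23: the error of \<open>Sq (2 * k)\<close>
  has at most one odd exponent and is therefore hit.\<close>

lemma sqfree_mult_Sq_square_hit:
  fixes p :: "5 pol"
  assumes "0 < k" "k \<le> 10" "homogeneous (10 - k) p" "card S = 3"
  shows "sqfree S * (Sq k p)\<^sup>2 \<in> H"
proof -
  let ?q = "Sq (2 * k) (sqfree S * p\<^sup>2)" and ?r = "Sq (2 * k) (sqfree S * p\<^sup>2) + sqfree S * (Sq k p)\<^sup>2"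
  have "homogeneous (3 + 2 * (10 - k) + 2 * k) ?q"
    using assms homogeneous_sqfree[of S] by (intro homogeneous_Sq homogeneous_mult homogeneous_square) simp_all
  also have "3 + 2 * (10 - k) + 2 * k = 23" using assms(2) by simp
  finally have "homogeneous 23 ?q" .
  moreover have "homogeneous (3 + 2 * (10 - k + k)) (sqfree S * (Sq k p)\<^sup>2)"
    using assms homogeneous_sqfree[of S] by (intro homogeneous_mult homogeneous_square homogeneous_Sq) simp_all
  ultimately have hom: "homogeneous 23 ?r" using assms(2) by (intro homogeneous_add) simp_all
  have odd: "?r \<in> odd_le 1" using Sq_even_sqfree_mult_square[of k S p] assms(4) by simp
  have "?r \<in> hit"
  proof (rule hit_if_monos_hit)
    fix e assume "e \<in> Poly_Mapping.keys ?r"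
    then have "deg e = 23" "card (odds e) \<le> 1" using hom odd by (auto simp: homogeneous_def odd_le_def)
    then show "mono e \<in> hit" by (intro few_odds_hit[of e 2]) auto
  qed
  moreover have "?q \<in> hit" using assms(1) by (intro hit_Sq) simp
  ultimately have "?q + ?r \<in> hit" using hit_add by blast
  then show ?thesis using hit by auto
qed

text \<open>The alternative in the first assumption covers lists u of weight other than three: they
  stand for no monomial in question, and \<open>val23\<close> is 0 there.\<close>

lemma row10_in:
  assumes "u \<in> set (sub01 5 3) \<or> (\<forall>e. f (enc e) = 0)"
    and f: "\<And>e. u \<in> set (sub01 5 3) \<Longrightarrow> f (enc e) = (if length e = 5 \<and> sum_list e = 10 then pair_mn u e else 0)"
    and v: "v \<in> insert VZ (set rs10)"
  shows "veval f v \<in> H"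
proof -
  have "veval f (sq_row r) \<in> H" for r
  proof (cases "u \<in> set (sub01 5 3)")
    case True
    obtain S where S: "card S = 3" "mn vars u = sqfree S"
      using mn_sqfree[of vars u] True vars by (auto simp: set_sub01)
    show ?thesis
      using f[OF True] S sqfree_mult_Sq_square_hit
      by (intro veval_sq_row[OF H, where g = "\<lambda>p. sqfree S * p\<^sup>2" and xs = vars and d = 10])
        (auto simp: vars pair_mn_def square_add distrib_left homogeneous_mn)
  next
    case False
    then have "f (enc e) = 0" for e using assms(1) by blast
    then show ?thesis using H
      by (intro veval_sq_row[OF H, where g = "\<lambda>p. 0" and xs = vars and d = 10]) (auto simp: homogeneous_mn add_closed_0)
  qed
  then show ?thesis using v rs10[of v] H by (auto simp: add_closed_0 intro: veval_vsum_in)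
qed

lemma shifted_sum_in:
  assumes "\<And>u y. (u, y) \<in> set ps \<Longrightarrow> length u = 5"
  shows "veval val23 (shifted_sum tab n ps) + (\<Sum>(u, y)\<leftarrow>ps. val23 (enc (y @ u))) \<in> H"
  using assms
proof (induction ps)
  case Nil then show ?case using H by (simp add: add_closed_0)
next
  case (Cons uy ps)
  obtain u y where uy: "uy = (u, y)" by (cases uy)
  have u: "length u = 5" using Cons.prems uy by auto
  let ?f = "\<lambda>p. val23 (p @ enc u)"
  have f: "?f (enc e) = (if e \<in> set (exps 5 10) \<and> u \<in> set (sub01 5 3) then pair_mn u e else 0)" for e
    using val23_enc[OF u, of e] by (simp add: enc_append)
  have "veval ?f (tab k) \<in> H" for k
    by (rule row10_in[of u]) (use tab f in \<open>auto simp: set_exps\<close>)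
  from veval_vreduce[OF H this, where n = n and v = "vsingle (enc y)" and acc = VZ]
  have 1: "veval ?f (vreduce tab n (vsingle (enc y)) VZ) + val23 (enc (y @ u)) \<in> H" by (simp add: enc_append)
  have 2: "veval val23 (shifted_sum tab n ps) + (\<Sum>(u, y)\<leftarrow>ps. val23 (enc (y @ u))) \<in> H"
    using Cons by auto
  show ?case using add_closed_add[OF H 1 2] by (simp add: uy veval_vshift add_ac)
qed

lemma row23_in: "v \<in> set rs23 \<Longrightarrow> veval val23 v \<in> H"
proof -
  have "veval val23 (sq1_row tab n r) \<in> H" for r
  proof (cases r)
    case Nil then show ?thesis using H by (simp add: add_closed_0)
  next
    case (Cons t y)
    let ?ps = "moves (skip 5 t) y"
    have len: "length u' = 5" if "(u', y') \<in> set ?ps" for u' y'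
      using moves_elem[OF that] by (simp add: skip)
    have "(\<Sum>(u', y')\<leftarrow>?ps. val23 (enc (y' @ u'))) \<in> H"
    proof (cases "length y = 5 \<and> sum_list y = 9 \<and> sum_list (skip 5 t) = 4")
      case True
      have "(\<Sum>(u', y')\<leftarrow>?ps. val23 (enc (y' @ u'))) = (\<Sum>(u', y')\<leftarrow>?ps. mn vars u' * (mn vars y')\<^sup>2)"
      proof (intro arg_cong[where f = sum_list] map_cong refl, clarify)
        fix u' y' assume uy: "(u', y') \<in> set ?ps"
        then show "val23 (enc (y' @ u')) = mn vars u' * (mn vars y')\<^sup>2"
          using True moves_elem[OF uy] skip[of 5 t] by (simp add: val23_enc set_exps set_sub01 pair_mn_def)
      qed
      also have "\<dots> = Sq 1 (mn vars (skip 5 t) * (mn vars y)\<^sup>2)"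
        using True skip[of 5 t] by (intro Sq_1_moves[symmetric]) (simp_all add: vars)
      also have "\<dots> \<in> H" using hit hit_Sq by auto
      finally show ?thesis .
    next
      case False
      have "val23 (enc (y' @ u')) = 0" if "(u', y') \<in> set ?ps" for u' y'
        using False len[OF that] moves_elem[OF that] by (auto simp: val23_enc set_exps set_sub01)
      then show ?thesis using H by (intro add_closed_sum_list) (auto simp: add_closed_0)
    qed
    moreover have "veval val23 (shifted_sum tab n ?ps) + (\<Sum>(u', y')\<leftarrow>?ps. val23 (enc (y' @ u'))) \<in> H"
      by (rule shifted_sum_in) (use len in blast)
    ultimately show ?thesis
      using add_closed_cancel[OF H, of "\<Sum>(u', y')\<leftarrow>?ps. val23 (enc (y' @ u'))"] by (simp add: Cons add.commute)
  qed
  then show "v \<in> set rs23 \<Longrightarrow> veval val23 v \<in> H"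
    using rs23[of v] by (auto intro: veval_vsum_in[OF H])
qed

text \<open>Induction from the greatest key downwards. If y leads a row of degree 10, y is rewritten
  with u kept; otherwise the whole key leads a row of degree 23 or is one of the base pairs.\<close>

lemma pair_mn_in:
  assumes base: "\<And>y u. y \<in> set (nonleads (exps 5 10) (vset (map vlead rs10))) \<Longrightarrow> u \<in> set (sub01 5 3) \<Longrightarrow>
      \<not> vmem (enc (y @ u)) (vset (map vlead rs23)) \<Longrightarrow> pair_mn u y \<in> H"
    and y: "y \<in> set (exps 5 10)" and u: "u \<in> set (sub01 5 3)"
  shows "pair_mn u y \<in> H"
proof -
  have fin: "finite keys23"
    unfolding keys23_def by (rule finite_subset[of _ "(\<lambda>(y, u). y @ u) ` (set (exps 5 10) \<times> set (sub01 5 3))"]) auto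
  have "val23 k \<in> H" for k
  proof (rule position_induct[where H = H])
    show "finite {k. val23 k \<notin> H}" unfolding val23_def using H by (intro finite_at_key fin) (simp add: add_closed_0)
  next
    fix k assume above: "\<And>k'. k < k' \<Longrightarrow> val23 k' \<in> H"
    show "val23 k \<in> H"
    proof (cases "k \<in> enc ` keys23")
      case False then show ?thesis using H by (simp add: val23_def at_key_def add_closed_0)
    next
      case True
      then obtain y u where y: "y \<in> set (exps 5 10)" and u: "u \<in> set (sub01 5 3)" and k: "k = enc (y @ u)"
        by (auto simp: keys23_def)
      have len: "length u = 5" using u by (simp add: set_sub01)
      have val: "val23 k = pair_mn u y" using y u k len by (simp add: val23_enc)
      consider "vmem (enc y) (vset (map vlead rs10))" | "vmem k (vset (map vlead rs23))"
        | "\<not> vmem (enc y) (vset (map vlead rs10))" "\<not> vmem k (vset (map vlead rs23))" by blast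
      then show ?thesis
      proof cases
        case 1
        then obtain v where v: "v \<in> set rs10" "vlead v = Some (enc y)" using vmem_vset by fastforce
        let ?f = "at_key (set (exps 5 10)) (pair_mn u)"
        have "?f (enc y) \<in> H"
        proof (rule in_add_closed_if_lead[OF H v(2)])
          show "veval ?f v \<in> H" by (rule row10_in[of u]) (use u v in \<open>auto simp: at_key_enc set_exps\<close>)
          fix k' assume k': "enc y < k'"
          show "?f k' \<in> H"
          proof (cases "k' \<in> enc ` set (exps 5 10)")
            case True
            then obtain y' where y': "y' \<in> set (exps 5 10)" "k' = enc y'" by auto
            \<comment> \<open>The root stands first in the key, so a greater root gives a greater
              key.\<close>
            then have "k < enc (y' @ u)" using k k' y by (auto simp: enc_append set_exps intro: enc_less_append)
            from above[OF this] show ?thesis using y' u len by (simp add: val23_enc at_key_enc)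
          qed (use H in \<open>simp add: at_key_def add_closed_0\<close>)
        qed
        then show ?thesis using val y by (simp add: at_key_enc)
      next
        case 2
        then obtain v where "v \<in> set rs23" "vlead v = Some k" using vmem_vset by fastforce
        then show ?thesis using in_add_closed_if_lead[OF H _ row23_in above] by blast
      next
        case 3
        then show ?thesis using base[of y u] y u k val by (simp add: set_nonleads)
      qed
    qed
  qed
  from this[of "enc (y @ u)"] show ?thesis using y u by (simp add: val23_enc set_sub01)
qed

end

section \<open>Coefficients after a linear substitution\<close>

fun ex :: "'n list \<Rightarrow> nat list \<Rightarrow> ('n::finite \<Rightarrow>\<^sub>0 nat)" where
  "ex (x # xs) (a # c) = Poly_Mapping.single x a + ex xs c" | "ex _ _ = 0"

lemma X_power: "X x ^ a = mono (Poly_Mapping.single x a)"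
  by (induction a) (simp_all add: X_def mult_single flip: Poly_Mapping.single_add)

lemma mn_eq_mono: "mn xs c = mono (ex xs c)"
  by (induction xs c rule: mn.induct) (simp_all add: X_power mult_single)

lemma lookup_ex_notin: "x \<notin> set xs \<Longrightarrow> Poly_Mapping.lookup (ex xs c) x = 0"
  by (induction xs c rule: ex.induct) (auto simp: lookup_add lookup_single when_def)

lemma lookup_X_power_mult:
  fixes p :: "'n::finite pol"
  shows "Poly_Mapping.lookup (X x ^ q * p) e =
    (if q \<le> Poly_Mapping.lookup e x then Poly_Mapping.lookup p (e - Poly_Mapping.single x q) else 0)"
proof (induction p rule: bit_poly_mapping_induct)
  case (single_add k p)
  have "(Poly_Mapping.single x q + k = e) \<longleftrightarrow> q \<le> Poly_Mapping.lookup e x \<and> k = e - Poly_Mapping.single x q"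
  proof (intro iffI conjI)
    assume e: "Poly_Mapping.single x q + k = e"
    then show "q \<le> Poly_Mapping.lookup e x" by (auto simp: lookup_add)
    show "k = e - Poly_Mapping.single x q" using e by auto
  next
    assume "q \<le> Poly_Mapping.lookup e x \<and> k = e - Poly_Mapping.single x q"
    then show "Poly_Mapping.single x q + k = e"
      by (intro poly_mapping_eqI) (auto simp: lookup_add lookup_minus lookup_single when_def)
  qed
  then have "Poly_Mapping.lookup (X x ^ q * mono k) e =
    (if q \<le> Poly_Mapping.lookup e x then Poly_Mapping.lookup (mono k) (e - Poly_Mapping.single x q) else 0)"
    by (simp add: X_power mult_single lookup_single when_def eq_commute[of e])
  then show ?case using single_add by (simp add: distrib_left lookup_add)
qed simp

fun form :: "nat \<Rightarrow> 'n list \<Rightarrow> bool list \<Rightarrow> 'n::finite pol" where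
  "form q (x # xs) (b # L) = (if b then X x ^ q else 0) + form q xs L" | "form q _ _ = 0"

fun sub :: "nat \<Rightarrow> nat \<Rightarrow> nat option" where
  "sub x 0 = Some x" | "sub 0 (Suc q) = None" | "sub (Suc x) (Suc q) = sub x q"

lemma sub: "sub x q = (if q \<le> x then Some (x - q) else None)"
  by (induction x q rule: sub.induct) auto

fun cons_opt :: "nat option \<Rightarrow> nat list \<Rightarrow> nat list list \<Rightarrow> nat list list" where
  "cons_opt None c cs = cs" | "cons_opt (Some y) c cs = (y # c) # cs"

text \<open>The exponent lists left when one term x ^ q of the form is taken out of the monomial c,
  one for each variable of the form whose exponent allows it.\<close>

fun choices :: "nat \<Rightarrow> bool list \<Rightarrow> nat list \<Rightarrow> nat list list" where
  "choices q [] c = []"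
| "choices q (b # L) [] = []"
| "choices q (True # L) (x # c) = cons_opt (sub x q) c (map (Cons x) (choices q L c))"
| "choices q (False # L) (x # c) = map (Cons x) (choices q L c)"

lemma length_choices: "c' \<in> set (choices q L c) \<Longrightarrow> length c' = length c"
  by (induction q L c arbitrary: c' rule: choices.induct) (auto simp: sub split: if_splits)

text \<open>The offset \<open>e\<close> holds the exponents of the variables that the recursion has
  already passed.\<close>

lemma choices_eq:
  fixes p :: "'n::finite pol"
  assumes "0 < q" "distinct xs" "length c = length xs" "\<And>x. x \<in> set xs \<Longrightarrow> Poly_Mapping.lookup e x = 0"
  shows "Poly_Mapping.lookup (form q xs L * p) (e + ex xs c) =
    (\<Sum>c'\<leftarrow>choices q L c. Poly_Mapping.lookup p (e + ex xs c'))"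
  using assms
proof (induction q L c arbitrary: xs e rule: choices.induct)
  case (1 q c)
  then show ?case by (cases xs) auto
next
  case (2 q b L)
  then show ?case by simp
next
  case (3 q L x c)
  then obtain t ts where xs: "xs = t # ts" by (cases xs) auto
  have ext: "Poly_Mapping.lookup (ex ts c) t = 0" for c
    using 3(3) xs by (simp add: lookup_ex_notin)
  have t: "Poly_Mapping.lookup e t = 0" using 3(5) xs by auto
  have "Poly_Mapping.lookup (form q ts L * p) ((e + Poly_Mapping.single t x) + ex ts c) =
    (\<Sum>c'\<leftarrow>choices q L c. Poly_Mapping.lookup p ((e + Poly_Mapping.single t x) + ex ts c'))"
    using 3 xs by (intro 3(1)) (auto simp: lookup_add lookup_single when_def)
  moreover have "Poly_Mapping.lookup (X t ^ q * p) (e + ex xs (x # c)) =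
    (if q \<le> x then Poly_Mapping.lookup p (e + ex xs ((x - q) # c)) else 0)"
  proof -
    have "q \<le> x \<Longrightarrow> e + ex xs (x # c) - Poly_Mapping.single t q = e + ex xs ((x - q) # c)"
      using xs t ext by (intro poly_mapping_eqI) (auto simp: lookup_add lookup_minus lookup_single when_def)
    then show ?thesis using xs t ext by (simp add: lookup_X_power_mult lookup_add)
  qed
  ultimately show ?case by (simp add: xs sub distrib_right lookup_add add.assoc o_def)
next
  case (4 q L x c)
  then obtain t ts where xs: "xs = t # ts" by (cases xs) auto
  have "Poly_Mapping.lookup (form q ts L * p) ((e + Poly_Mapping.single t x) + ex ts c) =
    (\<Sum>c'\<leftarrow>choices q L c. Poly_Mapping.lookup p ((e + Poly_Mapping.single t x) + ex ts c'))"
    using 4 xs by (intro 4(1)) (auto simp: lookup_add lookup_single when_def)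
  then show ?case by (simp add: xs add.assoc o_def)
qed

fun all_zero :: "nat list \<Rightarrow> bool" where
  "all_zero [] = True" | "all_zero (0 # c) = all_zero c" | "all_zero (Suc a # c) = False"

fun parity :: "nat list list \<Rightarrow> bool" where
  "parity [] = False" | "parity (c # cs) = bxor (all_zero c) (parity cs)"

text \<open>Reads a coefficient of a product without multiplying it out: the target monomials are
  divided by the terms of one factor after another, and those that end as 1 are counted modulo
  two.\<close>

fun expand :: "(nat \<times> bool list) list \<Rightarrow> nat list list \<Rightarrow> bool" where
  "expand [] cs = parity cs"
| "expand ((q, L) # fs) cs = expand fs (concat (map (choices q L) cs))"

definition coef_sum :: "'n list \<Rightarrow> nat list list \<Rightarrow> 'n::finite pol \<Rightarrow> bit" where
  "coef_sum xs cs p = (\<Sum>c\<leftarrow>cs. Poly_Mapping.lookup p (ex xs c))"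

lemma coef_sum_add: "coef_sum xs cs (p + q) = coef_sum xs cs p + coef_sum xs cs q"
  by (simp only: coef_sum_def lookup_add sum_list_addf)

lemma coef_sum_0 [simp]: "coef_sum xs cs 0 = 0"
  by (induction cs) (simp_all add: coef_sum_def)

lemma coef_sum_form_mult:
  assumes "0 < q" "distinct xs" "\<And>c. c \<in> set cs \<Longrightarrow> length c = length xs"
  shows "coef_sum xs cs (form q xs L * p) = coef_sum xs (concat (map (choices q L) cs)) p"
  using assms(3)
proof (induction cs)
  case (Cons c cs)
  have "Poly_Mapping.lookup (form q xs L * p) (0 + ex xs c) = (\<Sum>c'\<leftarrow>choices q L c. Poly_Mapping.lookup p (0 + ex xs c'))"
    using assms Cons by (intro choices_eq) auto
  then show ?case using Cons by (simp add: coef_sum_def)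
qed (simp add: coef_sum_def)

lemma ex_eq_0: "length c = length xs \<Longrightarrow> ex xs c = 0 \<longleftrightarrow> all_zero c"
proof (induction c arbitrary: xs rule: all_zero.induct)
  case (2 c)
  then show ?case by (cases xs) auto
next
  case (3 a c)
  then obtain x ys where xs: "xs = x # ys" by (cases xs) auto
  have "Poly_Mapping.lookup (ex xs (Suc a # c)) x \<noteq> 0" by (simp add: xs lookup_add)
  then show ?case by auto
qed auto

lemma coef_sum_1: "(\<And>c. c \<in> set cs \<Longrightarrow> length c = length xs) \<Longrightarrow> coef_sum xs cs 1 = of_bool (parity cs)"
proof (induction cs)
  case (Cons c cs)
  have "Poly_Mapping.lookup (1 :: 'a pol) (ex xs c) = of_bool (all_zero c)"
    using ex_eq_0[of c xs] Cons by (auto simp: lookup_one when_def)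
  then show ?case using Cons by (auto simp: coef_sum_def bxor_eq)
qed (simp add: coef_sum_def)

lemma coef_sum_expand:
  assumes "distinct xs" "\<And>q L. (q, L) \<in> set fs \<Longrightarrow> 0 < q" "\<And>c. c \<in> set cs \<Longrightarrow> length c = length xs"
  shows "coef_sum xs cs (\<Prod>(q, L)\<leftarrow>fs. form q xs L) = of_bool (expand fs cs)"
  using assms(2,3)
proof (induction fs cs rule: expand.induct)
  case (2 q L fs cs)
  have "coef_sum xs (concat (map (choices q L) cs)) (\<Prod>(q, L)\<leftarrow>fs. form q xs L) =
     of_bool (expand fs (concat (map (choices q L) cs)))"
    using 2 by (intro 2(1)) (auto dest: length_choices)
  moreover have "coef_sum xs cs (form q xs L * (\<Prod>(q, L)\<leftarrow>fs. form q xs L)) =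
      coef_sum xs (concat (map (choices q L) cs)) (\<Prod>(q, L)\<leftarrow>fs. form q xs L)"
    using 2 assms(1) by (intro coef_sum_form_mult) auto
  ultimately show ?case by (simp only: list.map prod_list.Cons prod.case expand.simps)
qed (simp add: coef_sum_1)

text \<open>
  A monomial is given by the bits of its exponents: the list \<open>m\<close> at position \<open>b\<close> tells in which
  exponents the bit \<open>b\<close> is set. Its image under a substitution is a product of forms in powers of
  two of the variables.
\<close>

fun bit_exps :: "nat \<Rightarrow> bool list list \<Rightarrow> nat list" where
  "bit_exps n [] = replicate n 0"
| "bit_exps n (m # ms) = map2 (\<lambda>b a. of_bool b + 2 * a) m (bit_exps n ms)"

fun select :: "nat \<Rightarrow> bool list \<Rightarrow> bool list list \<Rightarrow> (nat \<times> bool list) list \<Rightarrow> (nat \<times> bool list) list" where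
  "select q (True # m) (L # Ls) fs = (q, L) # select q m Ls fs"
| "select q (False # m) (L # Ls) fs = select q m Ls fs"
| "select q _ _ fs = fs"

fun double :: "nat \<Rightarrow> nat" where "double 0 = 0" | "double (Suc n) = Suc (Suc (double n))"

lemma double: "double n = 2 * n" by (induction n) simp_all

fun factors :: "nat \<Rightarrow> bool list list \<Rightarrow> bool list list \<Rightarrow> (nat \<times> bool list) list \<Rightarrow> (nat \<times> bool list) list" where
  "factors q [] Ls fs = fs"
| "factors q (m # ms) Ls fs = factors (double q) ms Ls (select q m Ls fs)"

lemma form_square: "(form q xs L)\<^sup>2 = form (2 * q) xs L"
  by (induction q xs L rule: form.induct) (auto simp: square_add power_mult[symmetric] mult.commute)

lemma prod_select:
  "length m = length Ls \<Longrightarrow> (\<Prod>(q, L)\<leftarrow>select q m Ls fs. form q xs L) =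
    (\<Prod>(q, L)\<leftarrow>fs. form q xs L) * (\<Prod>(b, L)\<leftarrow>zip m Ls. form q xs L ^ of_bool b)"
  by (induction q m Ls fs rule: select.induct) (auto simp: ac_simps)

lemma prod_zip_double:
  "length m = length Ls \<Longrightarrow> length e = length Ls \<Longrightarrow>
    (\<Prod>(b, L)\<leftarrow>zip m Ls. g L ^ of_bool b) * (\<Prod>(a, L)\<leftarrow>zip e Ls. (g L)\<^sup>2 ^ a) =
    (\<Prod>(a, L)\<leftarrow>zip (map2 (\<lambda>b a. of_bool b + 2 * a) m e) Ls. g L ^ a :: 'a::comm_monoid_mult)"
proof (induction Ls arbitrary: m e)
  case (Cons L Ls)
  obtain b m' a e' where "m = b # m'" "e = a # e'" using Cons.prems by (cases m; cases e) auto
  moreover have "g L ^ (of_bool b + 2 * a) = g L ^ of_bool b * (g L)\<^sup>2 ^ a" by (simp only: power_add power_mult)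
  ultimately show ?case using Cons.IH[of m' e', symmetric] Cons.prems by (simp add: ac_simps)
qed simp

lemma length_bit_exps: "(\<And>m. m \<in> set ms \<Longrightarrow> length m = n) \<Longrightarrow> length (bit_exps n ms) = n"
  by (induction ms) auto

lemma prod_factors:
  "(\<And>m. m \<in> set ms \<Longrightarrow> length m = length Ls) \<Longrightarrow> (\<Prod>(q, L)\<leftarrow>factors q ms Ls fs. form q xs L) =
    (\<Prod>(q, L)\<leftarrow>fs. form q xs L) * (\<Prod>(a, L)\<leftarrow>zip (bit_exps (length Ls) ms) Ls. form q xs L ^ a)"
proof (induction q ms Ls fs rule: factors.induct)
  case (1 q Ls fs)
  have "(\<Prod>(a, L)\<leftarrow>zip (replicate (length Ls) 0) Ls. form q xs L ^ a) = 1"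
    by (induction Ls) auto
  then show ?case by simp
next
  case (2 q m ms Ls fs)
  then show ?case
    using prod_zip_double[of m Ls "bit_exps (length Ls) ms" "form q xs"]
    by (simp add: double prod_select length_bit_exps mult.assoc flip: form_square)
qed

lemma factors_pos: "0 < q \<Longrightarrow> (\<And>q L. (q, L) \<in> set fs \<Longrightarrow> 0 < q) \<Longrightarrow> (q', L) \<in> set (factors q ms Ls fs) \<Longrightarrow> 0 < q'"
proof (induction q ms Ls fs arbitrary: q' L rule: factors.induct)
  case (2 q m ms Ls fs)
  have "0 < q'" if "(q', L) \<in> set (select q m Ls fs)" for q' L
    using that 2(2,3) by (induction q m Ls fs rule: select.induct) auto
  then show ?case using 2 by (auto simp: double)
qed auto

lemma coef_sum_factors:
  assumes "distinct xs" "\<And>c. c \<in> set cs \<Longrightarrow> length c = length xs" "\<And>m. m \<in> set ms \<Longrightarrow> length m = length Ls"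
  shows "coef_sum xs cs (\<Prod>(a, L)\<leftarrow>zip (bit_exps (length Ls) ms) Ls. form 1 xs L ^ a) = of_bool (expand (factors 1 ms Ls []) cs)"
proof -
  have "coef_sum xs cs (\<Prod>(q, L)\<leftarrow>factors 1 ms Ls []. form q xs L) = of_bool (expand (factors 1 ms Ls []) cs)"
    using assms by (intro coef_sum_expand) (auto intro: factors_pos[where q = 1 and fs = "[]"])
  moreover have "(\<Prod>(q, L)\<leftarrow>factors 1 ms Ls []. form q xs L) = (\<Prod>(a, L)\<leftarrow>zip (bit_exps (length Ls) ms) Ls. form 1 xs L ^ a)"
    using prod_factors[where ms = ms and Ls = Ls and q = 1 and fs = "[]" and xs = xs] assms(3) by simp
  ultimately show ?thesis by simp
qed

subsection \<open>Targets that annihilate the hit polynomials\<close>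

fun dual_sq :: "nat list \<Rightarrow> nat list \<Rightarrow> bool" where
  "dual_sq [] [] = True"
| "dual_sq (a # e) (b # c) = (a \<le> b \<and> odd (a choose (b - a)) \<and> dual_sq e c)"
| "dual_sq _ _ = False"

lemma dual_sq_le: "dual_sq e c \<Longrightarrow> sum_list e \<le> sum_list c"
  by (induction e c rule: dual_sq.induct) auto

lemma sum_of_bool_Cons: "(\<Sum>c'\<leftarrow>cs. of_bool (x # c' = y # c)) = (if x = y then \<Sum>c'\<leftarrow>cs. of_bool (c' = c) else (0 :: 'a::semiring_1))"
  by (induction cs) auto

lemma sq_exps_dual_sq:
  "length c = length e \<Longrightarrow> (\<Sum>c'\<leftarrow>sq_exps e k. of_bool (c' = c)) = (of_bool (dual_sq e c \<and> sum_list c = sum_list e + k) :: bit)"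
proof (induction e k arbitrary: c rule: sq_exps.induct)
  case (3 a e k)
  then obtain b d where c: "c = b # d" "length d = length e" by (cases c) auto
  let ?h = "\<lambda>c0 j. if c0 = b then of_bool (dual_sq e d \<and> sum_list d = sum_list e + j) else (0 :: bit)"
  have "(\<Sum>c'\<leftarrow>sq_exps (a # e) k. of_bool (c' = c)) = (\<Sum>(c0, j)\<leftarrow>splits a k (pascal a). ?h c0 j)"
  proof -
    have "(\<Sum>c'\<leftarrow>map (Cons c0) (sq_exps e j). of_bool (c' = c)) = ?h c0 j" if "(c0, j) \<in> set (splits a k (pascal a))" for c0 j
      using 3(1)[OF that refl c(2)] by (simp add: c(1) o_def sum_of_bool_Cons del: list.inject)
    then show ?thesis
      unfolding sq_exps.simps sum_list_concat_map by (intro arg_cong[where f = sum_list] map_cong refl) auto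
  qed
  also have "\<dots> = (\<Sum>i<Suc a. if i = b - a then (if a \<le> b \<and> i \<le> k \<and> odd (a choose i) then of_bool (dual_sq e d \<and> sum_list d = sum_list e + (k - i)) else 0) else 0)"
    unfolding splits_sum length_pascal by (intro sum.cong) (auto simp: nth_pascal less_Suc_eq_le)
  also have "\<dots> = of_bool (dual_sq (a # e) c \<and> sum_list c = sum_list (a # e) + k)"
    using dual_sq_le[of e d] by (auto simp: c(1) binomial_eq_0)
  finally show ?case .
qed (auto simp: length_Suc_conv)

fun preds1 :: "nat \<Rightarrow> nat list" where
  "preds1 b = filter (\<lambda>a. odd (a choose (b - a))) [0..<Suc b]"

declare preds1.simps [simp del]

text \<open>All e whose total square contains c; c itself is among them because of
  \<open>Sq 0\<close>.\<close>

fun preds :: "nat list \<Rightarrow> nat list list" where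
  "preds [] = [[]]" | "preds (b # c) = prefix_all (preds1 b) (preds c)"

lemma preds_dual_sq: "length e = length c \<Longrightarrow> (\<Sum>e'\<leftarrow>preds c. of_bool (e' = e)) = (of_bool (dual_sq e c) :: bit)"
proof (induction c arbitrary: e)
  case (Cons b c)
  then obtain a d where e: "e = a # d" "length d = length c" by (cases e) auto
  have "(\<Sum>e'\<leftarrow>prefix_all xs (preds c). of_bool (e' = e)) = (\<Sum>x\<leftarrow>xs. if x = a then of_bool (dual_sq d c) else (0 :: bit))" for xs
    using Cons.IH[OF e(2)] by (induction xs) (simp_all add: e(1) o_def sum_of_bool_Cons del: list.inject)
  also have "(\<Sum>x\<leftarrow>preds1 b. if x = a then of_bool (dual_sq d c) else (0 :: bit)) = of_bool (dual_sq e (b # c))"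
    by (simp add: preds1.simps sum_list_distinct_conv_sum_set e(1))
  finally show ?case by simp
qed auto

definition annihilates_hits :: "nat list list \<Rightarrow> bool" where
  "annihilates_hits cs \<longleftrightarrow> (\<forall>h\<in>hit. coef_sum vars cs (h :: 5 pol) = 0)"

lemma ex_inject: "distinct xs \<Longrightarrow> length c = length xs \<Longrightarrow> length d = length xs \<Longrightarrow> ex xs c = ex xs d \<longleftrightarrow> c = d"
proof (induction xs c arbitrary: d rule: ex.induct)
  case (1 x xs a c)
  then obtain b d' where d: "d = b # d'" by (cases d) auto
  have "a = b \<and> ex xs c = ex xs d'" if eq: "Poly_Mapping.single x a + ex xs c = Poly_Mapping.single x b + ex xs d'"
  proof -
    have "Poly_Mapping.lookup (Poly_Mapping.single x a + ex xs c) x = Poly_Mapping.lookup (Poly_Mapping.single x b + ex xs d') x"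
      using eq by simp
    then have "a = b" using 1(2) by (simp add: lookup_add lookup_ex_notin)
    then show ?thesis using eq by simp
  qed
  then show ?case using 1 d by auto
qed auto

text \<open>By \<open>eq\<close> the transposed total square fixes the target: modulo two, all
  predecessors except those from \<open>Sq 0\<close> cancel. Hence the positive squares have
  coefficient sum 0 on the target.\<close>

lemma annihilates_hits:
  assumes len: "\<And>c. c \<in> set cs \<Longrightarrow> length c = 5" and sum: "\<And>c. c \<in> set cs \<Longrightarrow> sum_list c = d"
    and eq: "vsum (\<lambda>e. vsingle (enc e)) (concat (map preds cs)) = vsum (\<lambda>e. vsingle (enc e)) cs"
  shows "annihilates_hits cs"
  unfolding annihilates_hits_def
proof
  fix h :: "5 pol" assume "h \<in> hit"
  then show "coef_sum vars cs h = 0"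
  proof (induction rule: hit_induct)
    case (Sq k f)
    have mn: "coef_sum vars cs (Sq k (mn vars e)) = 0" if e: "length e = 5" for e
    proof -
      define f where "f = at_key {e} (\<lambda>_. of_bool (d = sum_list e + k) :: bit)"
      have f: "f (enc e') = of_bool (e' = e) * of_bool (d = sum_list e + k)" for e'
        by (simp add: f_def at_key_enc)
      have "Poly_Mapping.lookup (Sq k (mn vars e)) (ex vars c) = (\<Sum>e'\<leftarrow>preds c. f (enc e'))" if c: "c \<in> set cs" for c
      proof -
        have "Poly_Mapping.lookup (Sq k (mn vars e)) (ex vars c) = (\<Sum>c'\<leftarrow>sq_exps e k. Poly_Mapping.lookup (mn vars c') (ex vars c))"
        proof -
          have "Poly_Mapping.lookup (sum_list (map (mn vars) cs)) (ex vars c) = (\<Sum>c'\<leftarrow>cs. Poly_Mapping.lookup (mn vars c') (ex vars c))" for cs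
            by (induction cs) (simp_all only: list.map sum_list.Nil sum_list.Cons lookup_add lookup_zero)
          then show ?thesis using e by (simp add: Sq_mn vars)
        qed
        also have "\<dots> = (\<Sum>c'\<leftarrow>sq_exps e k. of_bool (c' = c))"
        proof (intro arg_cong[where f = sum_list] map_cong refl)
          fix c' assume "c' \<in> set (sq_exps e k)"
          then have "length c' = 5" using sq_exps_elem e by auto
          then show "Poly_Mapping.lookup (mn vars c') (ex vars c) = of_bool (c' = c)"
            using ex_inject[of vars c' c] len[OF c] by (simp add: mn_eq_mono lookup_single when_def vars)
        qed
        also have "\<dots> = of_bool (dual_sq e c) * of_bool (d = sum_list e + k)"
          using sq_exps_dual_sq[of c e k] len[OF c] e sum[OF c] by simp
        also have "\<dots> = (\<Sum>e'\<leftarrow>preds c. f (enc e'))"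
          unfolding f sum_list_mult_const using preds_dual_sq[of e c] len[OF c] e by simp
        finally show ?thesis .
      qed
      then have "coef_sum vars cs (Sq k (mn vars e)) = (\<Sum>c\<leftarrow>cs. \<Sum>e'\<leftarrow>preds c. f (enc e'))"
        unfolding coef_sum_def by (intro arg_cong[where f = sum_list] map_cong refl)
      also have "\<dots> = veval f (vsum (\<lambda>e. vsingle (enc e)) (concat (map preds cs)))"
        by (simp add: veval_vsum sum_list_concat_map)
      also have "\<dots> = (\<Sum>c\<leftarrow>cs. f (enc c))" unfolding eq by (simp add: veval_vsum)
      \<comment> \<open>Only c = e could contribute, but then \<open>Sq k\<close> would preserve the
        degree although k is positive.\<close>
      also have "\<dots> = (\<Sum>c\<leftarrow>cs. 0)"
      proof (intro arg_cong[where f = sum_list] map_cong refl)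
        fix c assume "c \<in> set cs"
        then have "c = e \<Longrightarrow> d \<noteq> sum_list e + k" using sum[of c] Sq by simp
        then show "f (enc c) = 0" unfolding f by simp
      qed
      finally show ?thesis by (simp only: sum_list_0)
    qed
    have "coef_sum vars cs (Sq k (mono m)) = 0" for m
      unfolding mono_eq_mn[OF vars(3,1)] by (rule mn) (simp add: vars)
    then show ?case
      by (induction f rule: bit_poly_mapping_induct) (simp_all only: Sq_add coef_sum_add Sq_zero coef_sum_0 add_0_left)
  qed (simp_all only: coef_sum_0 coef_sum_add add_0_left)
qed

subsection \<open>Matrices with given rows\<close>

text \<open>Missing rows are zero: with r rows every variable is sent to a form in the first r
  variables.\<close>

definition rows_mat :: "(bit^5) list \<Rightarrow> bit^5^5" where
  "rows_mat ws = (\<chi> j. case map_of (zip vars ws) j of None \<Rightarrow> 0 | Some w \<Rightarrow> w)"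

lemma lin_subst_rows_mat: "lin_subst (rows_mat ws) (X i) = form 1 vars (map (\<lambda>w. w $ i = 1) ws)"
proof -
  have "(\<Sum>j\<in>set xs. pol_scale ((case map_of (zip xs ws) j of None \<Rightarrow> 0 | Some w \<Rightarrow> w) $ i) (X j))
      = form 1 xs (map (\<lambda>w. w $ i = 1) ws)" if "distinct xs" for xs :: "5 list"
    using that
  proof (induction xs arbitrary: ws)
    case (Cons x xs)
    show ?case
    proof (cases ws)
      case (Cons w ws')
      have "(\<Sum>j\<in>set xs. pol_scale ((case map_of (zip (x # xs) ws) j of None \<Rightarrow> 0 | Some w \<Rightarrow> w) $ i) (X j))
        = (\<Sum>j\<in>set xs. pol_scale ((case map_of (zip xs ws') j of None \<Rightarrow> 0 | Some w \<Rightarrow> w) $ i) (X j))"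
        using \<open>distinct (x # xs)\<close> Cons by (intro sum.cong) auto
      moreover have "pol_scale (w $ i) (X x) = (if w $ i = 1 then X x ^ 1 else 0)"
        by (cases "w $ i") simp_all
      ultimately show ?thesis using Cons \<open>distinct (x # xs)\<close> Cons.IH[of ws'] by simp
    qed simp
  qed simp
  from this[OF vars(3)] show ?thesis by (simp add: lin_subst_X rows_mat_def vars)
qed

lemma lin_subst_mn: "length e = length S \<Longrightarrow> lin_subst A (mn S e) = (\<Prod>(a, i)\<leftarrow>zip e S. lin_subst A (X i) ^ a)"
proof (induction S e rule: mn.induct)
  case (1 x xs a e)
  have "lin_subst A (X x ^ a) = lin_subst A (X x) ^ a" by (induction a) (simp_all add: lin_subst_mult)
  then show ?case using 1 by (simp add: lin_subst_mult)
qed auto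

lemma map_of_zip_nth': "distinct xs \<Longrightarrow> b < length xs \<Longrightarrow>
    map_of (zip xs us) (xs ! b) = (if b < length us then Some (us ! b) else None)"
proof (induction xs arbitrary: us b)
  case (Cons x xs)
  then show ?case by (cases us; cases b) auto
qed simp

text \<open>Zero off S, so that the substitution sends the variables outside S to 0.\<close>

definition extend :: "5 list \<Rightarrow> bool list \<Rightarrow> bit^5" where
  "extend S v = (\<chi> i. of_bool (map_of (zip S v) i = Some True))"

lemma extend_nth: "distinct S \<Longrightarrow> length v = length S \<Longrightarrow> b < length S \<Longrightarrow> extend S v $ (S ! b) = of_bool (v ! b)"
  using map_of_zip_nth'[of S b v] by (simp add: extend_def del: map_of_eq_Some_iff)

lemma extend_notin: "i \<notin> set S \<Longrightarrow> extend S v $ i = 0"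
  by (auto simp: extend_def dest!: map_of_SomeD set_zip_leftD)

text \<open>Transposition of the rows: the i-th list has the coefficients of the linear form
  substituted for the i-th variable.\<close>

fun forms :: "nat \<Rightarrow> bool list list \<Rightarrow> bool list list" where
  "forms 0 vs = []" | "forms (Suc n) vs = map hd vs # forms n (map tl vs)"

lemma forms_eq: "(\<And>v. v \<in> set vs \<Longrightarrow> length v = n) \<Longrightarrow> forms n vs = map (\<lambda>b. map (\<lambda>v. v ! b) vs) [0..<n]"
proof (induction n arbitrary: vs)
  case (Suc n)
  have ne: "v \<noteq> []" if "v \<in> set vs" for v using Suc.prems[OF that] by auto
  have "forms n (map tl vs) = map (\<lambda>b. map (\<lambda>v. v ! b) (map tl vs)) [0..<n]"
    by (rule Suc.IH) (use Suc.prems in auto)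
  also have "\<dots> = map (\<lambda>b. map (\<lambda>v. v ! Suc b) vs) [0..<n]"
  proof -
    have "tl v ! b = v ! Suc b" if "v \<in> set vs" for v b using ne[OF that] by (cases v) auto
    then show ?thesis by simp
  qed
  also have "\<dots> = map (\<lambda>b. map (\<lambda>v. v ! b) vs) (map Suc [0..<n])" by (simp add: o_def)
  finally have "forms n (map tl vs) = map (\<lambda>b. map (\<lambda>v. v ! b) vs) [1..<Suc n]" by (simp only: map_Suc_upt One_nat_def)
  moreover have "[0..<Suc n] = 0 # [1..<Suc n]" by (subst upt_conv_Cons) auto
  moreover have "map hd vs = map (\<lambda>v. v ! 0) vs" using ne by (auto simp: hd_conv_nth)
  ultimately show ?case by (simp only: forms.simps list.map)
qed simp

text \<open>The matrix may be singular, with zero rows or columns. Every substitution commutes with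
  the squares, so the functional kills hit polynomials as soon as the target does.\<close>

definition functional :: "nat list list \<Rightarrow> (bit^5) list \<Rightarrow> 5 pol \<Rightarrow> bit" where
  "functional cs ws p = coef_sum vars cs (lin_subst (rows_mat ws) p)"

lemma functional_add: "functional cs ws (p + q) = functional cs ws p + functional cs ws q"
  by (simp only: functional_def lin_subst_add coef_sum_add)

lemma functional_0 [simp]: "functional cs ws 0 = 0" by (simp add: functional_def)

lemma functional_sum: "functional cs ws (sum F A) = (\<Sum>a\<in>A. functional cs ws (F a))"
  by (induction A rule: infinite_finite_induct) (simp_all only: functional_add functional_0 sum.infinite sum.empty sum.insert not_False_eq_True)

lemma ex_append_0: "ex xs (c @ replicate k 0) = ex xs c"
proof (induction xs arbitrary: c k)
  case (Cons x xs)
  have "ex xs (replicate k 0) = 0" for k using Cons[of "[]" k] by (cases xs) simp_all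
  then show ?case using Cons.IH by (cases c) (cases k, simp_all)
qed simp

lemma functional_hit: "annihilates_hits cs \<Longrightarrow> h \<in> hit \<Longrightarrow> functional cs ws h = 0"
  by (simp add: functional_def annihilates_hits_def lin_subst_hit)

lemma form_take: "length L \<le> r \<Longrightarrow> form q (take r xs) L = form q xs L"
proof (induction q xs L arbitrary: r rule: form.induct)
  case (1 q x xs b L)
  then show ?case by (cases r) auto
qed auto

lemma ex_take: "length c \<le> r \<Longrightarrow> ex (take r xs) c = ex xs c"
proof (induction xs c arbitrary: r rule: ex.induct)
  case (1 x xs a c)
  then show ?case by (cases r) auto
qed auto

lemma functional_mn:
  assumes S: "distinct S" "length S = n" and vs: "\<And>v. v \<in> set vs \<Longrightarrow> length v = n" "length vs \<le> 5"
    and cs: "\<And>c. c \<in> set cs \<Longrightarrow> length c = length vs" and ms: "\<And>m. m \<in> set ms \<Longrightarrow> length m = n"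
  shows "functional cs (map (extend S) vs) (mn S (bit_exps n ms)) = of_bool (expand (factors 1 ms (forms n vs) []) cs)"
proof -
  let ?r = "length vs"
  have forms: "forms n vs = map (\<lambda>i. map (\<lambda>w. w $ i = 1) (map (extend S) vs)) S"
  proof (rule nth_equalityI)
    show "length (forms n vs) = length (map (\<lambda>i. map (\<lambda>w. w $ i = 1) (map (extend S) vs)) S)"
      using vs S by (simp add: forms_eq)
    fix b assume "b < length (forms n vs)"
    then show "forms n vs ! b = map (\<lambda>i. map (\<lambda>w. w $ i = 1) (map (extend S) vs)) S ! b"
      using vs S by (simp add: forms_eq extend_nth)
  qed
  have len: "length (bit_exps n ms) = n" using ms by (rule length_bit_exps)
  have "lin_subst (rows_mat (map (extend S) vs)) (mn S (bit_exps n ms)) =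
    (\<Prod>(a, i)\<leftarrow>zip (bit_exps n ms) S. form 1 vars (map (\<lambda>w. w $ i = 1) (map (extend S) vs)) ^ a)"
    using len S(2) by (simp only: lin_subst_mn lin_subst_rows_mat)
  also have "\<dots> = (\<Prod>(a, L)\<leftarrow>zip (bit_exps n ms) (forms n vs). form 1 vars L ^ a)"
    unfolding forms zip_map2 by (simp add: o_def case_prod_unfold)
  also have "\<dots> = (\<Prod>(a, L)\<leftarrow>zip (bit_exps n ms) (forms n vs). form 1 (take ?r vars) L ^ a)"
  proof (intro arg_cong[where f = prod_list] map_cong refl, clarify)
    fix a L assume "(a, L) \<in> set (zip (bit_exps n ms) (forms n vs))"
    then have "L \<in> set (forms n vs)" by (rule set_zip_rightD)
    then have "length L \<le> ?r" unfolding forms by auto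
    then show "form 1 vars L ^ a = form 1 (take ?r vars) L ^ a" by (simp add: form_take)
  qed
  finally have eq: "lin_subst (rows_mat (map (extend S) vs)) (mn S (bit_exps n ms)) =
     (\<Prod>(a, L)\<leftarrow>zip (bit_exps n ms) (forms n vs). form 1 (take ?r vars) L ^ a)" .
  \<comment> \<open>Targets of length r and forms with r coefficients see the first r variables
    only.\<close>
  have "coef_sum vars cs p = coef_sum (take ?r vars) cs p" for p
    unfolding coef_sum_def using cs by (intro arg_cong[where f = sum_list] map_cong refl) (simp add: ex_take)
  moreover have "length (forms n vs) = n" using vs by (simp add: forms_eq)
  ultimately show ?thesis
    unfolding functional_def eq
    using coef_sum_factors[of "take ?r vars" cs ms "forms n vs"] cs ms vs vars by simp
qed

lemma functional_mn_0:
  assumes "i \<notin> set S" "i \<in> set S'" "length e = length S'" "\<And>a. a \<in> set e \<Longrightarrow> 0 < a"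
  shows "functional cs (map (extend S) vs) (mn S' e) = 0"
proof -
  have "form 1 xs (map (\<lambda>w. w $ i = 1) (map (extend S) vs)) = 0" for xs :: "5 list"
    using assms(1) by (induction vs arbitrary: xs; case_tac xs) (auto simp: extend_notin)
  then have "lin_subst (rows_mat (map (extend S) vs)) (X i) = 0" by (simp add: lin_subst_rows_mat)
  moreover obtain b where b: "b < length S'" "S' ! b = i" using assms(2) by (auto simp: in_set_conv_nth)
  moreover have "(e ! b, i) \<in> set (zip e S')" "0 < e ! b" using b assms(3,4) by (auto simp: in_set_zip)
  ultimately have "0 \<in> set (map (\<lambda>(a, i). lin_subst (rows_mat (map (extend S) vs)) (X i) ^ a) (zip e S'))"
    by force
  then have "lin_subst (rows_mat (map (extend S) vs)) (mn S' e) = 0"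
    using assms(3) by (simp only: lin_subst_mn prod_list_zero_iff)
  then show ?thesis by (simp add: functional_def)
qed

subsection \<open>Completing independent rows\<close>

fun subset_sums :: "(bit^5) list \<Rightarrow> (bit^5) list" where
  "subset_sums [] = [0]" | "subset_sums (w # ws) = subset_sums ws @ map ((+) w) (subset_sums ws)"

fun indep :: "(bit^5) list \<Rightarrow> bool" where
  "indep [] = True" | "indep (w # ws) = (w \<notin> set (subset_sums ws) \<and> indep ws)"

lemma bit_neq_0: "c \<noteq> 0 \<Longrightarrow> c = (1 :: bit)" by (cases c) auto

lemma set_sums: "set (subset_sums ws) = vec.span (set ws)"
proof (induction ws)
  case (Cons w ws)
  have "vec.span (insert w (set ws)) = vec.span (set ws) \<union> (+) w ` vec.span (set ws)"
  proof (intro set_eqI iffI)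
    fix x assume "x \<in> vec.span (insert w (set ws))"
    then obtain k where k: "x - k *s w \<in> vec.span (set ws)" using vec.span_breakdown_eq by metis
    show "x \<in> vec.span (set ws) \<union> (+) w ` vec.span (set ws)"
    proof (cases "k = 0")
      case False
      then have "x - w \<in> vec.span (set ws)" using k bit_neq_0[OF False] by simp
      then show ?thesis by (intro UnI2 image_eqI[of _ _ "x - w"]) simp_all
    qed (use k in simp)
  next
    fix x assume "x \<in> vec.span (set ws) \<union> (+) w ` vec.span (set ws)"
    then show "x \<in> vec.span (insert w (set ws))"
      by (auto intro: vec.span_add vec.span_base subsetD[OF vec.span_mono[of "set ws" "insert w (set ws)"]])
  qed
  then show ?case using Cons by simp
qed simp

lemma indep: "indep ws \<Longrightarrow> distinct ws \<and> vec.independent (set ws)"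
proof (induction ws)
  case (Cons w ws)
  then have "w \<notin> vec.span (set ws)" by (simp add: set_sums)
  then show ?case using Cons vec.span_base[of w "set ws"] by (auto simp: vec.independent_insert)
qed (simp add: vec.independent_empty)

definition unit_rows :: "nat \<Rightarrow> (bit^5) list" where
  "unit_rows r = map (\<lambda>j. axis j 1) (take r vars)"

lemma rows_mat_nth: "b < 5 \<Longrightarrow> rows_mat us $ (vars ! b) = (if b < length us then us ! b else 0)"
  using map_of_zip_nth'[of vars b us] vars by (simp add: rows_mat_def)

text \<open>The rows are completed to a basis, which gives A, and unit rows pick them out again. So
  the functionals of one target with independent rows are translates of a single one under the
  group.\<close>

lemma indep_complete:
  assumes "indep ws" shows "\<exists>A. invertible A \<and> rows_mat ws = rows_mat (unit_rows (length ws)) ** A"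
proof -
  obtain B where B: "set ws \<subseteq> B" "vec.independent B" "vec.span B = UNIV"
    using vec.maximal_independent_subset_extend[of "set ws" UNIV] indep[OF assms] by (metis top.extremum top.extremum_uniqueI)
  have finB: "finite B" using vec.finiteI_independent[OF B(2)] .
  have "card B = 5" using vec.basis_card_eq_dim[of B UNIV] B by (simp add: card_cart_basis)
  obtain zs where zs: "set zs = B - set ws" "distinct zs" using finite_distinct_list[of "B - set ws"] finB by auto
  let ?L = "ws @ zs"
  have L: "distinct ?L" "set ?L = B" using zs B indep[OF assms] by auto
  then have len: "length ?L = 5" using distinct_card[OF L(1)] \<open>card B = 5\<close> by simp
  define A where "A = rows_mat ?L"
  have A: "A $ (vars ! b) = ?L ! b" if "b < 5" for b
    unfolding A_def using rows_mat_nth[OF that] that len by simp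
  have "B \<subseteq> rows A"
  proof
    fix w assume "w \<in> B"
    then obtain b where "b < 5" "?L ! b = w" using L len by (metis in_set_conv_nth)
    then show "w \<in> rows A" using A[of b] by (auto simp: rows_def row_def vec_eq_iff intro!: exI[of _ "vars ! b"])
  qed
  then have "vec.span (rows A) = UNIV" using B(3) vec.span_mono[of B "rows A"] by auto
  then have "invertible A" unfolding invertible_left_inverse matrix_left_invertible_span_rows_gen .
  moreover have "rows_mat ws = rows_mat (unit_rows (length ws)) ** A"
  proof (rule vec_eq_iff[THEN iffD2], rule allI)
    fix j
    obtain b where b: "b < 5" "vars ! b = j" using vars by (metis UNIV_I in_set_conv_nth)
    have row: "(C ** A) $ j = C $ j v* A" for C :: "bit^5^5"
      by (simp add: vec_eq_iff matrix_matrix_mult_def vector_matrix_mult_def)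
    have if_mult: "(if P then 1 else 0) * c = (if P then c else 0)" for P and c :: bit by simp
    have axis: "axis j 1 v* A = A $ j"
      by (simp only: vec_eq_iff vector_matrix_mult_def axis_def vec_lambda_beta if_mult
          sum.delta finite UNIV_I if_True simp_thms)
    have "length (unit_rows (length ws)) = length ws" using len vars by (simp add: unit_rows_def)
    moreover have "b < length ws \<Longrightarrow> unit_rows (length ws) ! b = axis j 1"
      using b len vars by (simp add: unit_rows_def)
    moreover have "b < length ws \<Longrightarrow> A $ j = ws ! b" using A[OF b(1)] b(2) by (simp add: nth_append)
    ultimately show "rows_mat ws $ j = (rows_mat (unit_rows (length ws)) ** A) $ j"
      unfolding row using rows_mat_nth[OF b(1), of ws] rows_mat_nth[OF b(1), of "unit_rows (length ws)"]
      by (cases "b < length ws") (simp_all only: b(2) axis if_True if_False vector_matrix_mult_0)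
  qed
  ultimately show ?thesis by blast
qed

lemma functional_invariant:
  assumes cs: "annihilates_hits cs" and ws: "indep ws" "length ws = r"
    and inv: "\<And>A. invertible A \<Longrightarrow> lin_subst A p + p \<in> hit"
  shows "functional cs ws p = functional cs (unit_rows r) p"
proof -
  obtain A where A: "invertible A" "rows_mat ws = rows_mat (unit_rows r) ** A" using indep_complete ws by blast
  have "functional cs ws p = functional cs (unit_rows r) (lin_subst A p)"
    by (simp add: functional_def A(2) lin_subst_lin_subst)
  moreover have "functional cs (unit_rows r) (lin_subst A p) + functional cs (unit_rows r) p = 0"
    using functional_hit[OF cs inv[OF A(1)]] by (simp only: functional_add)
  ultimately show ?thesis by (metis add_self_eq_0 add_right_cancel)
qed

text \<open>Over two elements a linear combination is a sum over a subset, hence the form of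
  \<open>indep\<close>. An independent family at least as large as a generating set is a
  basis.\<close>

lemma qp_basis:
  fixes g :: "'i \<Rightarrow> 'n::finite qp"
  assumes fin: "finite I" and indep: "\<And>D. D \<subseteq> I \<Longrightarrow> (\<Sum>i\<in>D. g i) = 0 \<Longrightarrow> D = {}"
    and W: "g ` I \<subseteq> W" "W \<subseteq> qp.span U" and U: "finite U" "card U \<le> card I"
  shows "qp.dim W = card I" "w \<in> W \<Longrightarrow> \<exists>D\<subseteq>I. w = (\<Sum>i\<in>D. g i)"
proof -
  have inj: "inj_on g I"
  proof (rule inj_onI, rule ccontr)
    fix i j assume "i \<in> I" "j \<in> I" "g i = g j" "i \<noteq> j"
    moreover from this have "(\<Sum>i\<in>{i, j}. g i) = 0" by simp
    ultimately show False using indep[of "{i, j}"] by blast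
  qed
  have combination: "\<exists>D\<subseteq>I. (\<Sum>v\<in>g ` I. qp_scale (u v) v) = (\<Sum>i\<in>D. g i) \<and> (\<forall>i\<in>I. u (g i) \<noteq> 0 \<longrightarrow> i \<in> D)" for u
  proof (intro exI[of _ "{i \<in> I. u (g i) = 1}"] conjI ballI impI)
    have "(\<Sum>v\<in>g ` I. qp_scale (u v) v) = (\<Sum>i\<in>I. qp_scale (u (g i)) (g i))"
      by (subst sum.reindex[OF inj]) (simp only: o_def)
    also have "\<dots> = (\<Sum>i\<in>I. if u (g i) = 1 then g i else 0)"
    proof (intro sum.cong refl)
      fix i show "qp_scale (u (g i)) (g i) = (if u (g i) = 1 then g i else 0)" by (cases "u (g i)") simp_all
    qed
    also have "\<dots> = (\<Sum>i\<in>{i \<in> I. u (g i) = 1}. g i)" using fin by (simp only: sum.inter_filter)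
    finally show "(\<Sum>v\<in>g ` I. qp_scale (u v) v) = (\<Sum>i\<in>{i \<in> I. u (g i) = 1}. g i)" .
  next
    fix i assume "i \<in> I" "u (g i) \<noteq> 0"
    then show "i \<in> {i \<in> I. u (g i) = 1}" by (intro CollectI conjI bit_neq_0)
  qed blast
  have "qp.independent (g ` I)"
  proof
    assume "qp.dependent (g ` I)"
    then obtain u v where u: "v \<in> g ` I" "u v \<noteq> 0" "(\<Sum>v\<in>g ` I. qp_scale (u v) v) = 0"
      unfolding qp.dependent_finite[OF finite_imageI[OF fin]] by blast
    obtain D where D: "D \<subseteq> I" "(\<Sum>v\<in>g ` I. qp_scale (u v) v) = (\<Sum>i\<in>D. g i)" "\<forall>i\<in>I. u (g i) \<noteq> 0 \<longrightarrow> i \<in> D"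
      using combination by blast
    have "D = {}" by (rule indep[OF D(1)]) (simp only: D(2)[symmetric] u(3))
    then show False using D(3) u(1,2) by blast
  qed
  moreover have span: "W \<subseteq> qp.span (g ` I)"
  proof (rule subsetI, rule ccontr)
    fix w assume w: "w \<in> W" "w \<notin> qp.span (g ` I)"
    then have "qp.independent (insert w (g ` I))"
      using \<open>qp.independent (g ` I)\<close> by (simp add: qp.independent_insert)
    moreover have "insert w (g ` I) \<subseteq> qp.span U" using w(1) W by blast
    ultimately have "card (insert w (g ` I)) \<le> card U"
      using qp.independent_span_bound[OF U(1)] by simp
    moreover have "w \<notin> g ` I" using w(2) qp.span_base by blast
    ultimately show False using U(2) fin card_image[OF inj] by simp
  qed
  ultimately show "qp.dim W = card I"
    using W(1) card_image[OF inj] by (intro qp.dim_unique)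
  show "\<exists>D\<subseteq>I. w = (\<Sum>i\<in>D. g i)" if "w \<in> W"
  proof -
    have "w \<in> range (\<lambda>u. \<Sum>v\<in>g ` I. qp_scale (u v) v)"
      using span that unfolding qp.span_finite[OF finite_imageI[OF fin]] by (rule subsetD)
    then obtain u where "w = (\<Sum>v\<in>g ` I. qp_scale (u v) v)" by (rule rangeE)
    then show ?thesis using combination[of u] by blast
  qed
qed

section \<open>Families of monomials detected by functionals\<close>

definition cnt :: "bool list \<Rightarrow> nat" where "cnt m = length (filter id m)"

lemma cnt_simps [simp]: "cnt [] = 0" "cnt (True # m) = Suc (cnt m)" "cnt (False # m) = cnt m"
  by (simp_all add: cnt_def)

fun compress :: "bool list \<Rightarrow> 'a list \<Rightarrow> 'a list" where
  "compress (True # m) (x # xs) = x # compress m xs"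
| "compress (False # m) (x # xs) = compress m xs"
| "compress _ _ = []"

lemma length_compress: "length m = length xs \<Longrightarrow> length (compress m xs) = cnt m"
  by (induction m xs rule: compress.induct) auto

lemma set_compress: "set (compress m xs) \<subseteq> set xs"
  by (induction m xs rule: compress.induct) auto

lemma distinct_compress: "distinct xs \<Longrightarrow> distinct (compress m xs)"
  using set_compress by (induction m xs rule: compress.induct) fastforce+

lemma compress_inject:
  "distinct xs \<Longrightarrow> length m = length xs \<Longrightarrow> length m' = length xs \<Longrightarrow>
    set (compress m xs) \<subseteq> set (compress m' xs) \<Longrightarrow> cnt m' \<le> cnt m \<Longrightarrow> m = m'"
proof (induction xs arbitrary: m m')
  case (Cons x xs)
  obtain b n b' n' where m: "m = b # n" "m' = b' # n'" "length n = length xs" "length n' = length xs"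
    using Cons.prems(2,3) by (cases m; cases m') auto
  have "x \<notin> set (compress n xs)" "x \<notin> set (compress n' xs)"
    using Cons.prems(1) set_compress[of _ xs] by auto
  then show ?case using Cons.IH[of n n'] Cons.prems m by (cases b; cases b') (auto simp: subset_insert)
qed simp

lemma map_of_zip_compress:
  "distinct xs \<Longrightarrow> length m = length xs \<Longrightarrow> length v = length xs \<Longrightarrow> i \<in> set (compress m xs) \<Longrightarrow>
    map_of (zip (compress m xs) (compress m v)) i = map_of (zip xs v) i"
proof (induction xs arbitrary: m v)
  case (Cons x xs)
  obtain b n y w where m: "m = b # n" "v = y # w" "length n = length xs" "length w = length xs"
    using Cons.prems(2,3) by (cases m; cases v) auto
  have "i \<in> set (compress n xs) \<Longrightarrow> i \<noteq> x" using Cons.prems(1) set_compress[of n xs] by auto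
  then show ?case using Cons.IH[of n w] Cons.prems m by (cases b) auto
qed simp

lemma extend_compress:
  assumes "length m = 5" "length v = 5" "i \<in> set (compress m vars)"
  shows "extend (compress m vars) (compress m v) $ i = extend vars v $ i"
  using map_of_zip_compress[of vars m v i] assms vars by (simp add: extend_def)

lemma functional_cong:
  assumes "length e = length S" and w: "\<And>i. i \<in> set S \<Longrightarrow> map (\<lambda>w. w $ i) ws = map (\<lambda>w. w $ i) ws'"
  shows "functional cs ws (mn S e) = functional cs ws' (mn S e)"
proof -
  have "map (\<lambda>w. w $ i = 1) ws = map (\<lambda>w. w $ i = 1) ws'" if "i \<in> set S" for i
    using arg_cong[OF w[OF that], of "map (\<lambda>b. b = 1)"] by (simp add: o_def)
  then have "lin_subst (rows_mat ws) (mn S e) = lin_subst (rows_mat ws') (mn S e)"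
    using assms(1) unfolding lin_subst_mn[OF assms(1)] lin_subst_rows_mat
    by (intro arg_cong[where f = prod_list] map_cong refl) (auto dest: set_zip_rightD)
  then show ?thesis by (simp add: functional_def)
qed

fun masks :: "nat \<Rightarrow> nat \<Rightarrow> bool list list" where
  "masks 0 0 = [[]]"
| "masks 0 (Suc r) = []"
| "masks (Suc n) 0 = map (Cons False) (masks n 0)"
| "masks (Suc n) (Suc r) = map (Cons True) (masks n r) @ map (Cons False) (masks n (Suc r))"

lemma set_masks: "m \<in> set (masks n r) \<Longrightarrow> length m = n \<and> cnt m = r"
  by (induction n r arbitrary: m rule: masks.induct) auto

lemma distinct_masks: "distinct (masks n r)"
  by (induction n r rule: masks.induct) (auto simp: distinct_map)

lemma length_masks: "length (masks n r) = n choose r"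
  by (induction n r rule: masks.induct) auto

text \<open>Smaller supports yield nothing in these degrees: a monomial in at most two variables has
  at most two odd exponents and is hit by \<open>few_odds_hit\<close>.\<close>

definition "supports = set (masks 5 3) \<union> set (masks 5 4) \<union> set (masks 5 5)"

lemma supports: "m \<in> supports \<Longrightarrow> length m = 5"
  by (auto simp: supports_def dest: set_masks)

fun evaluate :: "(bool list list \<times> nat list list) list \<Rightarrow> bool list list \<Rightarrow> bool" where
  "evaluate [] ms = False"
| "evaluate ((Ls, cs) # C) ms = bxor (expand (factors 1 ms Ls []) cs) (evaluate C ms)"

definition prepare :: "nat \<Rightarrow> (nat list list \<times> bool list list) list \<Rightarrow> (bool list list \<times> nat list list) list" where
  "prepare n C = map (\<lambda>(cs, vs). (forms n vs, cs)) C"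

definition total :: "5 list \<Rightarrow> (nat list list \<times> bool list list) list \<Rightarrow> 5 pol \<Rightarrow> bit" where
  "total S C p = (\<Sum>(cs, vs)\<leftarrow>C. functional cs (map (extend S) vs) p)"

lemma total_sum: "total S C (sum F A) = (\<Sum>a\<in>A. total S C (F a))"
proof (induction C)
  case (Cons x C)
  obtain cs vs where x: "x = (cs, vs)" by (cases x)
  show ?case using Cons by (simp only: x total_def list.map sum_list.Cons prod.case functional_sum sum.distrib)
qed (simp add: total_def)

lemma total_0: "(\<And>cs vs. (cs, vs) \<in> set C \<Longrightarrow> functional cs (map (extend S) vs) p = 0) \<Longrightarrow> total S C p = 0"
  by (induction C) (auto simp: total_def)

definition valid :: "nat \<Rightarrow> (nat list list \<times> bool list list) \<Rightarrow> bool" where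
  "valid n x = (case x of (cs, vs) \<Rightarrow> length vs \<le> 5 \<and> (\<forall>v\<in>set vs. length v = n) \<and> (\<forall>c\<in>set cs. length c = length vs))"

lemma total_mn:
  assumes "distinct S" "length S = n" "\<And>x. x \<in> set C \<Longrightarrow> valid n x" "\<And>m. m \<in> set ms \<Longrightarrow> length m = n"
  shows "total S C (mn S (bit_exps n ms)) = of_bool (evaluate (prepare n C) ms)"
  using assms(3)
proof (induction C)
  case (Cons x C)
  obtain cs vs where x: "x = (cs, vs)" by (cases x)
  have "functional cs (map (extend S) vs) (mn S (bit_exps n ms)) = of_bool (expand (factors 1 ms (forms n vs) []) cs)"
    using Cons.prems[of x] assms by (intro functional_mn) (auto simp: x valid_def)
  then show ?case using Cons by (auto simp: total_def prepare_def x bxor_eq)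
qed (simp add: total_def prepare_def)

fun member :: "bool list \<times> bool list list \<Rightarrow> 5 pol" where
  "member (m, ms) = mn (compress m vars) (bit_exps (cnt m) ms)"

text \<open>A search that ends at x also tells that the predicate fails on everything before x; this
  is how triangularity is read off.\<close>

lemma find_first: "find P (ys @ x # zs) = Some x \<Longrightarrow> x \<notin> set ys \<Longrightarrow> P x \<and> (\<forall>y\<in>set ys. \<not> P y)"
proof (induction ys)
  case Nil
  then show ?case by (cases "P x") (auto simp: find_Some_iff)
qed (auto split: if_splits)

text \<open>All supports of one size share the same tests, the variables being matched in
  order.\<close>

definition family :: "(nat \<Rightarrow> bool list list list) \<Rightarrow> (bool list \<times> bool list list) set" where
  "family tests = (SIGMA m:supports. set (tests (cnt m)))"

lemma finite_family: "finite (family tests)"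
  by (simp add: family_def supports_def)

lemma card_family:
  assumes "\<And>n. distinct (tests n)"
  shows "card (family tests) = 10 * length (tests 3) + 5 * length (tests 4) + length (tests 5)"
proof -
  have "card (family tests) = (\<Sum>m\<in>supports. length (tests (cnt m)))"
    using assms by (simp add: family_def supports_def distinct_card)
  moreover have "(\<Sum>m\<in>set (masks 5 r). length (tests (cnt m))) = (5 choose r) * length (tests r)" for r
  proof -
    have "(\<Sum>m\<in>set (masks 5 r). length (tests (cnt m))) = (\<Sum>m\<in>set (masks 5 r). length (tests r))"
      by (intro sum.cong) (auto dest: set_masks)
    then show ?thesis by (simp add: distinct_card distinct_masks length_masks)
  qed
  moreover have "set (masks 5 3) \<inter> set (masks 5 4) = {}" "(set (masks 5 3) \<union> set (masks 5 4)) \<inter> set (masks 5 5) = {}"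
    by (auto dest!: set_masks)
  ultimately show ?thesis
    unfolding supports_def by (simp only: sum.union_disjoint finite_set finite_Un) (simp add: numeral_eq_Suc)
qed

context
  fixes tests :: "nat \<Rightarrow> bool list list list" and combos :: "nat \<Rightarrow> (nat list list \<times> bool list list) list list"
  assumes ms: "\<And>n ms. ms \<in> set (tests n) \<Longrightarrow> (\<forall>m\<in>set ms. length m = n) \<and> 0 \<notin> set (bit_exps n ms)"
    and distinct_tests: "\<And>n. distinct (tests n)"
    and valid: "\<And>n C x. C \<in> set (combos n) \<Longrightarrow> x \<in> set C \<Longrightarrow> valid n x"
    and lead: "\<And>n. map (\<lambda>C. find (evaluate (prepare n C)) (tests n)) (combos n) = map Some (tests n)"
begin

lemma family_member: "(m, ms) \<in> family tests \<Longrightarrow> length m = 5 \<and> ms \<in> set (tests (cnt m))"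
  by (simp add: family_def supports)

text \<open>Take a smallest support m that occurs in D, and the last test x on m that occurs. The
  functionals on the variables of m kill all members with another support. The combination that
  belongs to x vanishes on the tests before x, and those after x are absent, so its value on the sum
  is 1.\<close>

lemma family_eq_empty:
  assumes D: "D \<subseteq> family tests"
    and zero: "\<And>m C x. length m = 5 \<Longrightarrow> C \<in> set (combos (cnt m)) \<Longrightarrow> total (compress m vars) C (\<Sum>i\<in>D. member i) = 0"
  shows "D = {}"
proof (rule ccontr)
  assume "D \<noteq> {}"
  then obtain i0 where "i0 \<in> D" by blast
  then obtain i where i: "i \<in> D" "\<And>j. j \<in> D \<Longrightarrow> cnt (fst i) \<le> cnt (fst j)"
    using ex_has_least_nat[of "\<lambda>i. i \<in> D" i0 "\<lambda>i. cnt (fst i)"] by blast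
  obtain m ms0 where im: "i = (m, ms0)" by (cases i)
  let ?n = "cnt m" let ?S = "compress m vars"
  have finD: "finite D" using D finite_family finite_subset by blast
  have m: "length m = 5" "ms0 \<in> set (tests ?n)" using family_member[of m ms0] i(1) D im by auto
  have S: "distinct ?S" "length ?S = ?n" using m by (simp_all add: distinct_compress vars length_compress)
  obtain ys x zs where split: "tests ?n = ys @ x # zs" "(m, x) \<in> D" "\<And>z. z \<in> set zs \<Longrightarrow> (m, z) \<notin> D"
    using split_list_last_prop[of "tests ?n" "\<lambda>x. (m, x) \<in> D"] m(2) i(1) im by blast
  have len: "length (combos ?n) = length (tests ?n)" using arg_cong[OF lead[of ?n], of length] by simp
  define C where "C = combos ?n ! length ys"
  have C: "C \<in> set (combos ?n)" unfolding C_def using len split(1) by simp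
  have "map (\<lambda>C. find (evaluate (prepare ?n C)) (tests ?n)) (combos ?n) ! length ys = map Some (tests ?n) ! length ys"
    by (simp only: lead)
  then have "find (evaluate (prepare ?n C)) (tests ?n) = Some x" using len split(1) by (simp add: C_def nth_append)
  then have first: "evaluate (prepare ?n C) x" "\<And>y. y \<in> set ys \<Longrightarrow> \<not> evaluate (prepare ?n C) y"
    using find_first[of _ ys x zs] split(1) distinct_tests[of ?n] by auto
  have "total ?S C (member j) = of_bool (j = (m, x))" if j: "j \<in> D" for j
  proof -
    obtain m' y where jm: "j = (m', y)" by (cases j)
    have m': "length m' = 5" "y \<in> set (tests (cnt m'))" using family_member[of m' y] j D jm by auto
    have S': "length (compress m' vars) = cnt m'" using m' by (simp add: vars length_compress)
    show ?thesis
    proof (cases "m' = m")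
      case True
      have "y \<in> set ys \<or> y = x" using m'(2) split j jm True by auto
      moreover have "total ?S C (member j) = of_bool (evaluate (prepare ?n C) y)"
        using total_mn[OF S, of C y] valid[OF C] ms[of y ?n] m'(2) True by (auto simp: jm)
      moreover have "x \<notin> set ys" using split(1) distinct_tests[of ?n] by auto
      ultimately show ?thesis using first jm True by auto
    next
      case False
      \<comment> \<open>A support other than m of at least the same size has a variable outside m,
        for which 0 is substituted.\<close>
      then obtain k where k: "k \<in> set (compress m' vars)" "k \<notin> set ?S"
        using compress_inject[of vars m' m] m m' i(2)[OF j] im jm vars by auto
      have "0 \<notin> set (bit_exps (cnt m') y)" "length (bit_exps (cnt m') y) = length (compress m' vars)"
        using ms[OF m'(2)] S' by (auto simp: length_bit_exps)
      then have "functional cs (map (extend ?S) vs) (member j) = 0" for cs vs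
        using functional_mn_0[OF k(2,1)] by (metis jm member.simps neq0_conv)
      then show ?thesis using False jm by (simp add: total_def case_prod_unfold)
    qed
  qed
  then have "total ?S C (\<Sum>j\<in>D. member j) = (\<Sum>j\<in>D. if j = (m, x) then 1 else 0)"
    unfolding total_sum by (intro sum.cong refl) auto
  then show False using zero[OF m(1) C] split(2) finD by simp
qed

lemma family_independent:
  assumes D: "D \<subseteq> family tests" and hit: "(\<Sum>i\<in>D. member i) \<in> hit"
    and cs: "\<And>n C cs vs. C \<in> set (combos n) \<Longrightarrow> (cs, vs) \<in> set C \<Longrightarrow> annihilates_hits cs"
  shows "D = {}"
proof (rule family_eq_empty[OF D])
  fix m C assume "C \<in> set (combos (cnt m))"
  then have "functional cs (map (extend (compress m vars)) vs) (\<Sum>i\<in>D. member i) = 0" if "(cs, vs) \<in> set C" for cs vs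
    using functional_hit[OF cs hit] that by blast
  then show "total (compress m vars) C (\<Sum>i\<in>D. member i) = 0"
    by (rule total_0)
qed

text \<open>
  The list \<open>R\<close> gives an odd number of equal values of an invariant functional with vanishing sum.
\<close>

lemma family_invariant:
  assumes D: "D \<subseteq> family tests"
    and inv: "\<And>A. invertible A \<Longrightarrow> lin_subst A (\<Sum>i\<in>D. member i) + (\<Sum>i\<in>D. member i) \<in> hit"
    and cs: "\<And>n C cs vs. C \<in> set (combos n) \<Longrightarrow> (cs, vs) \<in> set C \<Longrightarrow> annihilates_hits cs
      \<and> (\<forall>S. distinct S \<longrightarrow> length S = n \<longrightarrow> indep (map (extend S) vs))
      \<and> (\<exists>R. odd (length R) \<and> (\<forall>us\<in>set R. length us = length vs \<and> (\<forall>u\<in>set us. length u = 5) \<and> indep (map (extend vars) us))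
        \<and> (\<forall>m\<in>supports. \<forall>ms\<in>set (tests (cnt m)). \<not> evaluate (prepare (cnt m) (map (\<lambda>us. (cs, map (compress m) us)) R)) ms))"
  shows "D = {}"
proof (rule family_eq_empty[OF D])
  fix m C assume m: "length m = 5" and C: "C \<in> set (combos (cnt m))"
  let ?p = "\<Sum>i\<in>D. member i" let ?S = "compress m vars"
  have "functional cs (map (extend ?S) vs) ?p = 0" if x: "(cs, vs) \<in> set C" for cs vs
  proof -
    obtain R where R: "odd (length R)"
        "\<And>us. us \<in> set R \<Longrightarrow> length us = length vs \<and> (\<forall>u\<in>set us. length u = 5) \<and> indep (map (extend vars) us)"
        "\<And>m ms. m \<in> supports \<Longrightarrow> ms \<in> set (tests (cnt m)) \<Longrightarrow> \<not> evaluate (prepare (cnt m) (map (\<lambda>us. (cs, map (compress m) us)) R)) ms"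
      using cs[OF C x] by blast
    have ann: "annihilates_hits cs" using cs[OF C x] by blast
    have cvalid: "valid (cnt m) (cs, vs)" using valid[OF C x] .
    define c where "c = functional cs (unit_rows (length vs)) ?p"
    have const: "functional cs ws ?p = c" if "indep ws" "length ws = length vs" for ws
      unfolding c_def using functional_invariant[OF ann that(1) that(2) inv] .
    have "(\<Sum>us\<leftarrow>R. functional cs (map (extend vars) us) (member i)) = 0" if "i \<in> D" for i
    proof -
      obtain m' ms' where i: "i = (m', ms')" by (cases i)
      have "(m', ms') \<in> family tests" using that D i by auto
      then have m': "m' \<in> supports" "length m' = 5" "ms' \<in> set (tests (cnt m'))" by (auto simp: family_def supports)
      have len: "length (bit_exps (cnt m') ms') = length (compress m' vars)"
        using ms[OF m'(3)] m' by (simp add: length_bit_exps length_compress vars)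
      have "functional cs (map (extend vars) us) (member i) = functional cs (map (extend (compress m' vars)) (map (compress m') us)) (member i)"
        if "us \<in> set R" for us
        unfolding i member.simps using R(2)[OF that] m'(2) by (intro functional_cong len) (simp add: extend_compress)
      then have "(\<Sum>us\<leftarrow>R. functional cs (map (extend vars) us) (member i)) =
          total (compress m' vars) (map (\<lambda>us. (cs, map (compress m') us)) R) (member i)"
        unfolding total_def by (simp add: o_def cong: map_cong)
      also have "\<dots> = of_bool (evaluate (prepare (cnt m') (map (\<lambda>us. (cs, map (compress m') us)) R)) ms')"
        unfolding i member.simps using R(2) cvalid m' ms[OF m'(3)]
        by (intro total_mn) (auto simp: valid_def distinct_compress vars length_compress)
      also have "\<dots> = 0" using R(3)[OF m'(1,3)] by simp
      finally show ?thesis .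
    qed
    then have "(\<Sum>i\<in>D. \<Sum>us\<leftarrow>R. functional cs (map (extend vars) us) (member i)) = 0" by (intro sum.neutral) blast
    moreover have "(\<Sum>i\<in>D. \<Sum>us\<leftarrow>R. functional cs (map (extend vars) us) (member i)) = (\<Sum>us\<leftarrow>R. functional cs (map (extend vars) us) ?p)" for R
      by (induction R) (simp_all only: list.map sum_list.Nil sum_list.Cons sum.neutral_const sum.distrib functional_sum)
    moreover have "(\<Sum>us\<leftarrow>R. functional cs (map (extend vars) us) ?p) = (\<Sum>us\<leftarrow>R. c)"
      using R(2) by (intro arg_cong[where f = sum_list] map_cong refl const) auto
    moreover have "(\<Sum>us\<leftarrow>R. c) = c"
      using R(1) by (simp add: sum_list_triv of_nat_char_two)
    ultimately have "c = 0" by simp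
    moreover have "functional cs (map (extend ?S) vs) ?p = c"
      using cs[OF C x] m by (intro const) (auto simp: distinct_compress vars length_compress)
    ultimately show ?thesis by simp
  qed
  then show "total ?S C ?p = 0" by (rule total_0)
qed

end

section \<open>Dimension and invariants from a detected family\<close>

lemma mem_span_of_add: "p \<in> span_of U \<Longrightarrow> q \<in> span_of U \<Longrightarrow> p + q \<in> span_of U"
  using add_closed_span_of add_closed_add by blast

lemma mem_span_of_sum: "(\<And>a. a \<in> A \<Longrightarrow> F a \<in> span_of U) \<Longrightarrow> sum F A \<in> span_of U"
proof (induction A rule: infinite_finite_induct)
  case (insert a A)
  then show ?case by (simp only: sum.insert mem_span_of_add insert_iff simp_thms)
qed (use add_closed_span_of add_closed_0 in auto)

lemma homogeneous_in_span_of: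
  assumes "homogeneous d p" "\<And>e. deg e = d \<Longrightarrow> mono e \<in> span_of U"
  shows "p \<in> span_of U"
  using assms(1) by (induction rule: homogeneous_induct)
    (use add_closed_span_of add_closed_0 assms(2) in \<open>auto intro: mem_span_of_add\<close>)

context
  fixes I :: "'i set" and g :: "'i \<Rightarrow> 'n::finite pol" and d :: nat
  assumes fin: "finite I" and indep: "\<And>D. D \<subseteq> I \<Longrightarrow> (\<Sum>i\<in>D. g i) \<in> hit \<Longrightarrow> D = {}"
    and hom: "\<And>i. i \<in> I \<Longrightarrow> homogeneous d (g i)"
begin

context
  fixes U :: "'n pol set"
  assumes U: "finite U" "card U \<le> card I" "\<And>e. deg e = d \<Longrightarrow> mono e \<in> span_of U"
begin

lemma part_basis:
  shows "qp.dim (qp_part d :: 'n qp set) = card I"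
    and "homogeneous d p \<Longrightarrow> \<exists>D\<subseteq>I. p + (\<Sum>i\<in>D. g i) \<in> hit"
proof -
  have 1: "D = {}" if "D \<subseteq> I" "(\<Sum>i\<in>D. abs_qp (g i)) = 0" for D
    using indep[OF that(1)] that(2) by (simp only: abs_qp_sum[symmetric] abs_qp_eq_0_iff)
  have 2: "(\<lambda>i. abs_qp (g i)) ` I \<subseteq> qp_part d" unfolding qp_part_def using hom by blast
  have 3: "(qp_part d :: 'n qp set) \<subseteq> qp.span (abs_qp ` U)"
  proof
    fix v :: "'n qp" assume "v \<in> qp_part d"
    then obtain p where p: "v = abs_qp p" "homogeneous d p" unfolding qp_part_def by blast
    show "v \<in> qp.span (abs_qp ` U)" using homogeneous_in_span_of[OF p(2) U(3)] p(1) by (simp add: span_of_def)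
  qed
  have 4: "finite (abs_qp ` U)" "card (abs_qp ` U) \<le> card I"
    using U(1,2) card_image_le[OF U(1), of abs_qp] by auto
  show "qp.dim (qp_part d :: 'n qp set) = card I" by (rule qp_basis(1)[OF fin 1 2 3 4])
  assume "homogeneous d p"
  then have "abs_qp p \<in> qp_part d" unfolding qp_part_def by blast
  then obtain D where D: "D \<subseteq> I" "abs_qp p = (\<Sum>i\<in>D. abs_qp (g i))"
    using qp_basis(2)[OF fin 1 2 3 4] by blast
  have "abs_qp (p + (\<Sum>i\<in>D. g i)) = 0" by (simp only: abs_qp_add[symmetric] abs_qp_sum D(2) qp_add_self)
  then show "\<exists>D\<subseteq>I. p + (\<Sum>i\<in>D. g i) \<in> hit" using D(1) abs_qp_eq_0_iff by blast
qed

lemma part_invariants: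
  assumes inv: "\<And>D. D \<subseteq> I \<Longrightarrow> homogeneous d (\<Sum>i\<in>D. g i) \<Longrightarrow>
    (\<And>A. invertible A \<Longrightarrow> lin_subst A (\<Sum>i\<in>D. g i) + (\<Sum>i\<in>D. g i) \<in> hit) \<Longrightarrow> D = {}"
  shows "gl_invariants (qp_part d :: 'n qp set) = {0}"
proof -
  have "gl_act A 0 = (0 :: 'n qp)" for A by transfer (simp add: hit_0)
  then have "0 \<in> gl_invariants (qp_part d :: 'n qp set)"
    unfolding gl_invariants_def using qp.subspace_0[OF qp_part_subspace] by blast
  moreover have "v = 0" if v: "v \<in> gl_invariants (qp_part d :: 'n qp set)" for v
  proof -
    obtain p where p: "v = abs_qp p" "homogeneous d p" using v unfolding gl_invariants_def qp_part_def by blast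
    obtain D where D: "D \<subseteq> I" "p + (\<Sum>i\<in>D. g i) \<in> hit" using part_basis(2)[OF p(2)] by blast
    let ?s = "\<Sum>i\<in>D. g i"
    have v_eq: "v = abs_qp ?s"
      unfolding p(1) using D(2) by (simp add: qp.abs_eq_iff minus_eq_plus)
    have "lin_subst A ?s + ?s \<in> hit" if "invertible A" for A
    proof -
      have "gl_act A v = v" using v that unfolding gl_invariants_def by blast
      then show ?thesis unfolding v_eq by (simp add: gl_act.abs_eq qp.abs_eq_iff minus_eq_plus)
    qed
    moreover have "homogeneous d ?s" using hom D(1) by (intro homogeneous_sum) auto
    ultimately have "D = {}" using inv[OF D(1)] by blast
    then show "v = 0" unfolding v_eq by (simp add: abs_qp_0)
  qed
  ultimately show ?thesis by blast
qed

end

end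

subsection \<open>Degree 23\<close>

context
  fixes I9 I23 :: "'i set" and g :: "'i \<Rightarrow> 5 pol"
  assumes fin: "finite I9" "finite I23"
    and indep9: "\<And>D. D \<subseteq> I9 \<Longrightarrow> (\<Sum>i\<in>D. g i) \<in> hit \<Longrightarrow> D = {}"
    and indep23: "\<And>D. D \<subseteq> I23 \<Longrightarrow> (\<Sum>i\<in>D. g i) \<in> hit \<Longrightarrow> D = {}"
    and hom9: "\<And>i. i \<in> I9 \<Longrightarrow> homogeneous 9 (g i)" and hom23: "\<And>i. i \<in> I23 \<Longrightarrow> homogeneous 23 (g i)"
    and kameko23: "\<And>i. i \<in> I23 \<Longrightarrow> kameko (g i) = 0"
begin

text \<open>\<open>Inl\<close> marks members in the kernel of the Kameko map, \<open>Inr\<close> the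
  lifts of degree 9 members.\<close>

definition "g23 = case_sum g (\<lambda>i. kameko_up (g i))"

lemma sum_g23:
  assumes "D \<subseteq> I23 <+> I9"
  shows "(\<Sum>i\<in>D. g23 i) = (\<Sum>i\<in>Inl -` D. g i) + (\<Sum>i\<in>Inr -` D. kameko_up (g i))"
    "Inl -` D \<subseteq> I23" "Inr -` D \<subseteq> I9"
proof -
  show sub: "Inl -` D \<subseteq> I23" "Inr -` D \<subseteq> I9" using assms by auto
  have D: "D = (Inl -` D) <+> (Inr -` D)" by (auto simp: Plus_def image_iff) (metis sum.exhaust)
  have "finite (Inl -` D)" "finite (Inr -` D)" using sub fin finite_subset by blast+
  then have "(\<Sum>i\<in>(Inl -` D) <+> (Inr -` D). g23 i) = (\<Sum>i\<in>Inl -` D. g23 (Inl i)) + (\<Sum>i\<in>Inr -` D. g23 (Inr i))"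
    by (simp only: sum.Plus o_def)
  then show "(\<Sum>i\<in>D. g23 i) = (\<Sum>i\<in>Inl -` D. g i) + (\<Sum>i\<in>Inr -` D. kameko_up (g i))"
    by (simp only: D[symmetric] g23_def sum.case)
qed

lemma kameko_up_sum: "kameko_up (sum F A) = (\<Sum>a\<in>A. kameko_up (F a :: 5 pol))"
proof (induction A rule: infinite_finite_induct)
  case (insert a A)
  then show ?case by (simp only: sum.insert kameko_up_add not_False_eq_True)
qed (simp_all add: kameko_up_def)

lemma kameko_sum_g23:
  assumes D: "D \<subseteq> I23 <+> I9" shows "kameko (\<Sum>i\<in>D. g23 i) = (\<Sum>i\<in>Inr -` D. g i)"
proof -
  have "kameko (\<Sum>i\<in>Inl -` D. g i) = (\<Sum>i\<in>Inl -` D. 0)"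
    unfolding kameko_sum using kameko23 sum_g23(2)[OF D] by (intro sum.cong) auto
  then show ?thesis unfolding sum_g23(1)[OF D] kameko_add kameko_sum kameko_kameko_up by simp
qed

text \<open>The Kameko map kills the kernel members and returns the degree 9 members, whose
  independence empties the lifted part of D.\<close>

lemma sum_g23_if_kameko:
  assumes D: "D \<subseteq> I23 <+> I9" and k: "kameko (\<Sum>i\<in>D. g23 i) \<in> hit"
  shows "(\<Sum>i\<in>D. g23 i) = (\<Sum>i\<in>Inl -` D. g i)" "D = Inl ` (Inl -` D)"
proof -
  have empty: "Inr -` D = {}" using indep9[OF sum_g23(3)[OF D]] k unfolding kameko_sum_g23[OF D] by blast
  then show "(\<Sum>i\<in>D. g23 i) = (\<Sum>i\<in>Inl -` D. g i)" unfolding sum_g23(1)[OF D] by simp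
  show "D = Inl ` (Inl -` D)"
  proof
    show "D \<subseteq> Inl ` (Inl -` D)"
    proof
      fix x assume "x \<in> D" then show "x \<in> Inl ` (Inl -` D)" using empty by (cases x) auto
    qed
  qed auto
qed

lemma indep_g23:
  assumes D: "D \<subseteq> I23 <+> I9" and hit: "(\<Sum>i\<in>D. g23 i) \<in> hit"
  shows "D = {}"
proof -
  note s = sum_g23_if_kameko[OF D kameko_hit[OF hit]]
  have "Inl -` D = {}" using indep23[OF sum_g23(2)[OF D]] hit unfolding s(1) by blast
  then show ?thesis using s(2) by simp
qed

lemma hom_g23: "i \<in> I23 <+> I9 \<Longrightarrow> homogeneous 23 (g23 i)"
  using hom23 homogeneous_kameko_up[where 'n = 5 and d = 9] hom9 by (cases i) (auto simp: g23_def)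

context
  fixes C :: "(nat list \<times> nat list) set"
  assumes C: "finite C" "card C \<le> card I23"
    and pairs: "\<And>H u y. add_closed H \<Longrightarrow> hit \<subseteq> H \<Longrightarrow> (\<And>u y. (u, y) \<in> C \<Longrightarrow> pair_mn u y \<in> H) \<Longrightarrow>
      y \<in> set (exps 5 10) \<Longrightarrow> u \<in> set (sub01 5 3) \<Longrightarrow> pair_mn u y \<in> H"
    and span9: "\<And>p. homogeneous 9 p \<Longrightarrow> \<exists>D\<subseteq>I9. p + (\<Sum>i\<in>D. g i) \<in> hit"
begin

definition "U23 = (\<lambda>(u, y). pair_mn u y) ` C \<union> (\<lambda>i. kameko_up (g i)) ` I9"

lemma U23: "finite U23" "card U23 \<le> card (I23 <+> I9)"
proof -
  show "finite U23" unfolding U23_def using C(1) fin by blast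
  have "card U23 \<le> card ((\<lambda>(u, y). pair_mn u y) ` C) + card ((\<lambda>i. kameko_up (g i)) ` I9)"
    unfolding U23_def by (rule card_Un_le)
  also have "\<dots> \<le> card C + card I9" using C(1) fin(1) by (intro add_mono card_image_le)
  finally show "card U23 \<le> card (I23 <+> I9)" using C(2) fin by (simp add: card_Plus)
qed

lemma low_in_span:
  fixes e :: "5 \<Rightarrow>\<^sub>0 nat"
  assumes e: "deg e = 23" and odds: "card (odds e) \<le> 4" shows "mono e \<in> span_of U23"
proof (cases "card (odds e) = 3")
  case True
  let ?u = "map (\<lambda>i. of_bool (i \<in> odds e)) vars :: nat list" and ?y = "map (Poly_Mapping.lookup (half e)) vars"
  have "sum_list ?u = (\<Sum>i\<in>UNIV. of_bool (i \<in> odds e) :: nat)"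
    using vars by (simp add: sum_list_distinct_conv_sum_set)
  also have "\<dots> = 3" using True by (simp add: Int_def)
  finally have u: "?u \<in> set (sub01 5 3)" using vars by (auto simp: set_sub01)
  have "deg (half e) = 10" using e True deg_eq_odds_half[of e] by simp
  then have y: "?y \<in> set (exps 5 10)" using vars by (simp add: set_exps deg_eq_sum_list[of vars])
  have "pair_mn ?u ?y \<in> span_of U23"
  proof (rule pairs[OF add_closed_span_of _ _ y u])
    show "hit \<subseteq> span_of U23" using hit_subset_span_of by blast
    show "pair_mn u y \<in> span_of U23" if "(u, y) \<in> C" for u y
      using that by (intro subset_span_of) (auto simp: U23_def)
  qed
  moreover have "mn vars ?u = sqfree (odds e)"
  proof -
    have "mn vars ?u = (\<Prod>x\<in>UNIV. X x ^ of_bool (x \<in> odds e))" using vars by (simp add: mn_map)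
    also have "\<dots> = (\<Prod>x\<in>UNIV. if x \<in> odds e then X x else 1)" by (intro prod.cong) auto
    also have "\<dots> = sqfree (odds e)" by (simp add: sqfree_def flip: prod.inter_filter)
    finally show ?thesis .
  qed
  ultimately show ?thesis
    using mono_eq_mn[of vars "half e"] vars mono_eq_sqfree_mult_square[of e] by (simp add: pair_mn_def)
next
  case False
  \<comment> \<open>The degree 23 is odd, which excludes four odd exponents.\<close>
  have "odd (card (odds e))" using deg_eq_odds_half[of e] e by presburger
  then have "card (odds e) \<noteq> 4" by auto
  then have "card (odds e) \<le> 2" using odds False by linarith
  then show ?thesis using few_odds_hit[of e 2] e by (intro hit_subset_span_of) simp
qed

text \<open>A monomial with all exponents odd is the lift of its half. The half is a sum of degree 9
  members modulo hits, and lifting this congruence costs a term r with at most three odd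
  exponents.\<close>

lemma mono_in_span_of_U23:
  fixes e :: "5 \<Rightarrow>\<^sub>0 nat"
  assumes e: "deg e = 23" shows "mono e \<in> span_of U23"
proof (cases "odds e = UNIV")
  case False
  then have "card (odds e) < CARD(5)" by (intro psubset_card_mono) auto
  then show ?thesis using low_in_span[OF e] by simp
next
  case True
  let ?p = "mono (half e) :: 5 pol"
  have d9: "deg (half e) = 9" using deg_eq_odds_half[of e] True e by simp
  obtain D where D: "D \<subseteq> I9" "?p + (\<Sum>i\<in>D. g i) \<in> hit" using span9[OF homogeneous_mono[OF d9]] by blast
  let ?s = "\<Sum>i\<in>D. g i"
  have "homogeneous 9 (?p + ?s)"
    using D(1) hom9 d9 by (intro homogeneous_add homogeneous_mono homogeneous_sum) auto
  then obtain r where r: "r \<in> odd_le (CARD(5) - 2)" "homogeneous (2 * 9 + CARD(5)) r" "kameko_up (?p + ?s) + r \<in> hit"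
    using kameko_up_hit[OF D(2)] by blast
  have r_in: "r \<in> span_of U23"
  proof -
    have "mono e' \<in> span_of U23" if "e' \<in> Poly_Mapping.keys r" for e'
      using that r(1,2) by (intro low_in_span) (auto simp: odd_le_def homogeneous_def)
    then show ?thesis by (subst pol_eq_sum) (rule mem_span_of_sum)
  qed
  have s_in: "kameko_up ?s \<in> span_of U23"
    unfolding kameko_up_sum using D(1) by (intro mem_span_of_sum subset_span_of) (auto simp: U23_def)
  have "(kameko_up (?p + ?s) + r) + (r + kameko_up ?s) \<in> span_of U23"
    by (rule mem_span_of_add[OF hit_subset_span_of[OF r(3)] mem_span_of_add[OF r_in s_in]])
  also have "(kameko_up (?p + ?s) + r) + (r + kameko_up ?s) = kameko_up ?p"
    by (simp only: kameko_up_add add.assoc add_self_left add_self_eq_0 add_0_right)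
  also have "kameko_up ?p = mono e"
    unfolding kameko_up_def using True by (metis mono_eq_sqfree_mult_square)
  finally show ?thesis .
qed

lemma dim_23: "qp.dim (qp_part 23 :: 5 qp set) = card I23 + card I9"
proof -
  have "finite (I23 <+> I9)" using fin by simp
  from part_basis(1)[OF this indep_g23 hom_g23 U23 mono_in_span_of_U23]
  show ?thesis using fin by (simp add: card_Plus)
qed

text \<open>The Kameko image of an invariant class is invariant of degree 9, hence zero. So only
  kernel members occur in the class, and \<open>inv23\<close> applies to them.\<close>

lemma invariants_23:
  assumes inv9: "gl_invariants (qp_part 9 :: 5 qp set) = {0}"
    and inv23: "\<And>D. D \<subseteq> I23 \<Longrightarrow> (\<And>A. invertible A \<Longrightarrow> lin_subst A (\<Sum>i\<in>D. g i) + (\<Sum>i\<in>D. g i) \<in> hit) \<Longrightarrow> D = {}"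
  shows "gl_invariants (qp_part 23 :: 5 qp set) = {0}"
proof -
  have fin23: "finite (I23 <+> I9)" using fin by simp
  show ?thesis
  proof (rule part_invariants[OF fin23 indep_g23 hom_g23 U23 mono_in_span_of_U23])
    fix D assume D: "D \<subseteq> I23 <+> I9" and hom: "homogeneous 23 (\<Sum>i\<in>D. g23 i)"
      and inv: "\<And>A. invertible A \<Longrightarrow> lin_subst A (\<Sum>i\<in>D. g23 i) + (\<Sum>i\<in>D. g23 i) \<in> hit"
    have "gl_act A (abs_qp (\<Sum>i\<in>D. g23 i)) = abs_qp (\<Sum>i\<in>D. g23 i)" if "invertible A" for A
      using inv[OF that] by (simp add: gl_act.abs_eq qp.abs_eq_iff minus_eq_plus)
    then have "abs_qp (\<Sum>i\<in>D. g23 i) \<in> gl_invariants (qp_part 23)"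
      using hom unfolding gl_invariants_def qp_part_def by blast
    then have "qp_kameko (abs_qp (\<Sum>i\<in>D. g23 i)) = 0"
      using qp_kameko_invariants[where 'n = 5 and d = 9] inv9 by auto
    then have k: "kameko (\<Sum>i\<in>D. g23 i) \<in> hit" unfolding qp_kameko.abs_eq abs_qp_eq_0_iff .
    note s = sum_g23_if_kameko[OF D k]
    have "Inl -` D = {}" using inv by (intro inv23 sum_g23(2)[OF D]) (simp only: s(1))
    then show "D = {}" using s(2) by simp
  qed
qed

end

end

text \<open>Above degree 23 the Kameko map is an isomorphism.\<close>

lemma theorem_from_9_23:
  assumes "qp.dim (qp_part 9 :: 5 qp set) = 191" "gl_invariants (qp_part 9 :: 5 qp set) = {0}"
    and "qp.dim (qp_part 23 :: 5 qp set) = 1245" "gl_invariants (qp_part 23 :: 5 qp set) = {0}"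
  shows "s > 0 \<Longrightarrow> m + 5 = 7 * 2 ^ s \<Longrightarrow> qp.dim (qp_part m :: 5 qp set) = (if s = 1 then 191 else 1245)
    \<and> gl_invariants (qp_part m :: 5 qp set) = {0}"
proof (induction s arbitrary: m)
  case (Suc s)
  consider "s = 0" | "s = 1" | "2 \<le> s" by linarith
  then show ?case
  proof cases
    case 1
    then have "m = 9" using Suc.prems by simp
    then show ?thesis using assms 1 by simp
  next
    case 2
    then have "m = 23" using Suc.prems by simp
    then show ?thesis using assms 2 by simp
  next
    case 3
    have "(2::nat) ^ 1 \<le> 2 ^ s" using 3 by (intro power_increasing) auto
    then have "5 \<le> 7 * (2::nat) ^ s" by simp
    then obtain d :: nat where d: "d + 5 = 7 * 2 ^ s" by (metis le_add_diff_inverse2)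
    then have m: "m = 2 * d + CARD(5)" using Suc.prems by simp
    have small: "mono e \<in> hit" if "deg e = 2 * d + CARD(5)" "card (odds e) < CARD(5)" for e :: "5 \<Rightarrow>\<^sub>0 nat"
      using that d 3 by (intro few_odds_hit[of e "Suc s"]) auto
    show ?thesis unfolding m
      using qp_part_dim_Kameko[OF small] gl_invariants_Kameko[OF small] Suc.IH[OF _ d] 3 by simp
  qed
qed simp

section \<open>Evaluation of encoded certificates\<close>

text \<open>Numerals in the data stand for bit vectors, least significant bit first: matrix rows by
  their entries, tests by the masks of bits 0, 1, 2, ... of their exponents.\<close>

fun bits :: "nat \<Rightarrow> nat \<Rightarrow> bool list" where
  "bits 0 x = []" | "bits (Suc n) x = odd x # bits n (x div 2)"

declare bits.simps(2) [simp del]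

lemma bits_code:
  "bits 0 x = []" "bits (Suc n) 0 = False # bits n 0" "bits (Suc n) 1 = True # bits n 0"
  "bits (Suc n) (numeral num.One) = True # bits n 0"
  "bits (Suc n) (numeral (num.Bit0 k)) = False # bits n (numeral k)"
  "bits (Suc n) (numeral (num.Bit1 k)) = True # bits n (numeral k)"
  by (simp_all add: bits.simps)

lemma length_bits [simp]: "length (bits n x) = n"
  by (induction n arbitrary: x) (simp_all add: bits.simps)

definition "fnd P n ts = find (\<lambda>t. evaluate P (map (bits n) t)) ts"
definition "fnd' b P n t ts = (if b then Some t else fnd P n ts)"
definition "fndb P n T = fnd P n (concat T)"
definition "fndb' x P n T = (case x of None \<Rightarrow> fndb P n T | Some t \<Rightarrow> Some t)"

lemma find_append: "find P (xs @ ys) = (case find P xs of None \<Rightarrow> find P ys | Some x \<Rightarrow> Some x)"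
  by (induction xs) auto

lemma fnd_code:
  "fnd P n [] = None" "fnd P n (t # ts) = fnd' (evaluate P (map (bits n) t)) P n t ts"
  "fnd' True P n t ts = Some t" "fnd' False P n t ts = fnd P n ts"
  "fndb P n [] = None" "fndb P n (b # T) = fndb' (fnd P n b) P n T"
  "fndb' None P n T = fndb P n T" "fndb' (Some t) P n T = Some t"
  by (simp_all add: fnd_def fnd'_def fndb_def fndb'_def find_append split: option.split)

text \<open>Unfolds a block of tests when the search reaches it, so that later blocks stay folded as
  constants.\<close>

lemma fnd_block: "b = ts \<Longrightarrow> fnd P n b = fnd P n ts" by simp

lemma evaluate_code:
  "evaluate [] ms = False" "evaluate ((Ls, cs) # C) ms = bxor (expand (factors (Suc 0) ms Ls []) cs) (evaluate C ms)"
  by simp_all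

text \<open>The list \<open>t # vs\<close> stands for the target with number \<open>t\<close> and the rows \<open>vs\<close>.\<close>

fun dec :: "(nat \<Rightarrow> nat list list) \<Rightarrow> nat \<Rightarrow> nat list \<Rightarrow> nat list list \<times> bool list list" where
  "dec tg n (t # vs) = (tg t, map (bits n) vs)" | "dec tg n [] = ([], [])"

fun pref :: "(nat \<Rightarrow> nat list list) \<Rightarrow> nat \<Rightarrow> nat list \<Rightarrow> bool list list \<times> nat list list" where
  "pref tg n (t # vs) = (forms n (map (bits n) vs), tg t)" | "pref tg n [] = (forms n [], [])"

lemma prepare_dec: "prepare n (map (dec tg n) C) = map (pref tg n) C"
proof -
  have "(case dec tg n r of (cs, vs) \<Rightarrow> (forms n vs, cs)) = pref tg n r" for r by (cases r) auto
  then show ?thesis by (simp add: prepare_def)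
qed

section \<open>Linear independence of bit vectors\<close>

fun xorl :: "bool list \<Rightarrow> bool list \<Rightarrow> bool list" where
  "xorl (a # v) (b # w) = bxor a b # xorl v w" | "xorl _ _ = []"

fun anyl :: "bool list \<Rightarrow> bool" where
  "anyl [] = False" | "anyl (True # v) = True" | "anyl (False # v) = anyl v"

text \<open>Tests that v is no subset sum of \<open>ws\<close>: adding each w or leaving it out runs
  through all subsets.\<close>

fun free_over :: "bool list \<Rightarrow> bool list list \<Rightarrow> bool" where
  "free_over v [] = anyl v" | "free_over v (w # ws) = (free_over v ws \<and> free_over (xorl v w) ws)"

fun free :: "bool list list \<Rightarrow> bool" where
  "free [] = True" | "free (v # vs) = (free_over v vs \<and> free vs)"

lemma length_xorl: "length v = length w \<Longrightarrow> length (xorl v w) = length v"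
  by (induction v w rule: xorl.induct) auto

lemma of_bool_bxor: "(of_bool (bxor a b) :: bit) = of_bool a + of_bool b"
  by (cases a; cases b) simp_all

lemma map_of_zip_xorl:
  "length v = length S \<Longrightarrow> length w = length S \<Longrightarrow>
    (of_bool (map_of (zip S (xorl v w)) i = Some True) :: bit) =
    of_bool (map_of (zip S v) i = Some True) + of_bool (map_of (zip S w) i = Some True)"
proof (induction S arbitrary: v w)
  case (Cons x S)
  obtain a v' b w' where "v = a # v'" "w = b # w'" "length v' = length S" "length w' = length S"
    using Cons.prems by (cases v; cases w) auto
  then show ?case using Cons.IH[of v' w'] of_bool_bxor[of a b] by (cases "x = i") simp_all
qed simp

lemma extend_xorl: "length v = length S \<Longrightarrow> length w = length S \<Longrightarrow> extend S (xorl v w) = extend S v + extend S w"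
  by (simp only: vec_eq_iff extend_def vec_lambda_beta vector_add_component map_of_zip_xorl simp_thms)

lemma anyl_nth: "anyl v \<Longrightarrow> \<exists>b<length v. v ! b"
  by (induction v rule: anyl.induct) force+

lemma extend_neq_0: "distinct S \<Longrightarrow> length v = length S \<Longrightarrow> anyl v \<Longrightarrow> extend S v \<noteq> 0"
  using anyl_nth[of v] extend_nth[of S v] by fastforce

lemma free_over:
  assumes "distinct S"
  shows "free_over v ws \<Longrightarrow> length v = length S \<Longrightarrow> (\<And>w. w \<in> set ws \<Longrightarrow> length w = length S) \<Longrightarrow>
    extend S v \<notin> set (subset_sums (map (extend S) ws))"
proof (induction ws arbitrary: v)
  case Nil
  then show ?case using extend_neq_0[OF assms, of v] by simp
next
  case (Cons w ws)
  have 1: "extend S v \<notin> set (subset_sums (map (extend S) ws))" using Cons by simp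
  have "extend S (xorl v w) \<notin> set (subset_sums (map (extend S) ws))"
    using Cons by (intro Cons.IH) (simp_all add: length_xorl)
  then have 2: "extend S v + extend S w \<notin> set (subset_sums (map (extend S) ws))"
    using Cons.prems by (simp add: extend_xorl)
  have "extend S v \<noteq> extend S w + s" if "s \<in> set (subset_sums (map (extend S) ws))" for s
  proof
    assume "extend S v = extend S w + s"
    then have "extend S v + extend S w = s + (extend S w + extend S w)" by (simp only: add_ac)
    also have "extend S w + extend S w = 0"
      by (simp only: vec_eq_iff vector_add_component add_self_eq_0 zero_index simp_thms)
    finally show False using 2 that by simp
  qed
  then show ?case using 1 by auto
qed

lemma indep_if_free:
  "distinct S \<Longrightarrow> free vs \<Longrightarrow> (\<And>v. v \<in> set vs \<Longrightarrow> length v = length S) \<Longrightarrow> indep (map (extend S) vs)"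
  by (induction vs) (simp_all add: free_over)

fun same_len :: "'a list \<Rightarrow> 'b list \<Rightarrow> bool" where
  "same_len [] [] = True" | "same_len (x # xs) (y # ys) = same_len xs ys"
| "same_len [] (y # ys) = False" | "same_len (x # xs) [] = False"

lemma same_len: "same_len xs ys \<longleftrightarrow> length xs = length ys"
  by (induction xs ys rule: same_len.induct) auto

fun okref :: "(nat \<Rightarrow> nat list list) \<Rightarrow> (nat \<Rightarrow> bool) \<Rightarrow> nat \<Rightarrow> nat list \<Rightarrow> bool" where
  "okref tg kn n [] = False"
| "okref tg kn n (t # vs) = (kn t \<and> same_len vs (hd (tg t)) \<and> free (map (bits n) vs))"

fun incr :: "bool list \<Rightarrow> nat list \<Rightarrow> nat list" where
  "incr (True # m) (a # e) = Suc (double a) # incr m e"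
| "incr (False # m) (a # e) = double a # incr m e"
| "incr _ _ = []"

lemma bit_exps_code: "bit_exps n [] = replicate n 0" "bit_exps n (m # ms) = incr m (bit_exps n ms)"
proof -
  have "map2 (\<lambda>b a. of_bool b + 2 * a) m e = incr m e" for e by (induction m e rule: incr.induct) (auto simp: double)
  then show "bit_exps n (m # ms) = incr m (bit_exps n ms)" by simp
qed simp

text \<open>One pass counts d down in unary; \<open>good_rest\<close> holds what is left of the
  current entry, and an entry 0 fails at once.\<close>

fun good :: "nat \<Rightarrow> nat list \<Rightarrow> bool" and good_rest :: "nat \<Rightarrow> nat \<Rightarrow> nat list \<Rightarrow> bool" where
  "good 0 [] = True" | "good (Suc d) [] = False" | "good d (0 # e) = False"
| "good 0 (Suc a # e) = False" | "good (Suc d) (Suc a # e) = good_rest d a e"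
| "good_rest d 0 e = good d e" | "good_rest 0 (Suc a) e = False" | "good_rest (Suc d) (Suc a) e = good_rest d a e"

lemma good: "good d e \<Longrightarrow> 0 \<notin> set e \<and> sum_list e = d"
  and good_rest: "good_rest d a e \<Longrightarrow> 0 \<notin> set e \<and> a + sum_list e = d"
  by (induction d e and d a e rule: good_good_rest.induct) auto

lemma vmem_vsingle_same: "vmem p (vsingle p)"
  by (induction p rule: vsingle.induct) auto

lemma vmem_vinsert_same: "vmem p (vinsert p v)"
  by (induction p v rule: vinsert.induct) (auto simp: vmem_vsingle_same)

lemma vmem_vinsert_mono: "vmem q v \<Longrightarrow> vmem q (vinsert p v)"
proof (induction p v arbitrary: q rule: vinsert.induct)
  case (2 b l r) then show ?case by (cases q rule: vsingle.cases) auto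
next
  case (3 p b l r) then show ?case by (cases q rule: vsingle.cases) auto
next
  case (4 p b l r) then show ?case by (cases q rule: vsingle.cases) auto
qed auto

fun dist :: "bool list list \<Rightarrow> fvec \<Rightarrow> bool" where
  "dist [] L = True" | "dist (k # ks) L = (\<not> vmem k L \<and> dist ks (vinsert k L))"

definition "dist' b k ks L = (\<not> b \<and> dist ks (vinsert k L))"

lemma dist_code: "dist [] L = True" "dist (k # ks) L = dist' (vmem k L) k ks L"
  "dist' False k ks L = dist ks (vinsert k L)"
  by (simp_all add: dist'_def)

lemma dist: "dist ks L \<Longrightarrow> distinct ks \<and> (\<forall>k\<in>set ks. \<not> vmem k L)"
  using vmem_vinsert_same vmem_vinsert_mono by (induction ks arbitrary: L) fastforce+

text \<open>A target lists only the variables it uses; the other exponents are 0.\<close>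

lemma annihilates_hits_pad:
  assumes "annihilates_hits (map (\<lambda>c. c @ replicate (5 - length c) 0) cs)" shows "annihilates_hits cs"
  using assms by (simp add: annihilates_hits_def coef_sum_def o_def ex_append_0)

definition tests :: "(nat \<Rightarrow> nat list list list) \<Rightarrow> nat \<Rightarrow> bool list list list" where
  "tests T n = map (map (bits n)) (concat (T n))"

section \<open>From checked certificates to independence and vanishing of invariants\<close>

context
  fixes d :: nat and tg :: "nat \<Rightarrow> nat list list" and kn :: "nat \<Rightarrow> bool"
    and T :: "nat \<Rightarrow> nat list list list" and K :: "nat \<Rightarrow> nat list list list" and R :: "nat \<Rightarrow> nat list list"
  assumes other: "\<And>n. n \<notin> {3, 4, 5} \<Longrightarrow> T n = [] \<and> K n = []"
    and leads: "\<And>n. n \<in> {3, 4, 5} \<Longrightarrow> map (\<lambda>C. fndb (map (pref tg n) C) n (T n)) (K n) = map Some (concat (T n))"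
    and ok: "\<And>n. n \<in> {3, 4, 5} \<Longrightarrow> list_all (list_all (okref tg kn n)) (K n)"
    and goods: "\<And>n. n \<in> {3, 4, 5} \<Longrightarrow> list_all (\<lambda>t. good d (bit_exps n (map (bits n) t))) (concat (T n))"
    and dists: "\<And>n. n \<in> {3, 4, 5} \<Longrightarrow> dist (map (\<lambda>t. concat (map (bits n) t)) (concat (T n))) VZ"
    and tgt: "\<And>t. kn t \<Longrightarrow> annihilates_hits (tg t) \<and> (\<forall>c\<in>set (tg t). length c = length (hd (tg t))) \<and> length (hd (tg t)) \<le> 5"
    and R: "\<And>t. kn t \<Longrightarrow> odd (length (R t)) \<and> list_all (\<lambda>us. same_len us (hd (tg t)) \<and> free (map (bits 5) us)) (R t)"
    and rel: "\<And>t n. kn t \<Longrightarrow> n \<in> {3, 4, 5} \<Longrightarrow> list_all (\<lambda>m. fndb (map (\<lambda>us. (forms n (map (compress m) (map (bits 5) us)), tg t)) (R t)) n (T n) = None) (masks 5 n)"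
begin

definition "combos n = map (map (dec tg n)) (K n)"

lemma tests_elem: "ms \<in> set (tests T n) \<Longrightarrow> (\<forall>m\<in>set ms. length m = n) \<and> 0 \<notin> set (bit_exps n ms) \<and> sum_list (bit_exps n ms) = d"
proof (cases "n \<in> {3, 4, 5}")
  case True
  assume "ms \<in> set (tests T n)"
  then obtain t where t: "t \<in> set (concat (T n))" "ms = map (bits n) t" unfolding tests_def by auto
  have "good d (bit_exps n ms)" using goods[OF True] t unfolding list_all_iff by blast
  then show ?thesis using good t(2) by auto
qed (use other in \<open>simp add: tests_def\<close>)

lemma distinct_tests: "distinct (tests T n)"
proof (cases "n \<in> {3, 4, 5}")
  case True
  have "map (\<lambda>t. concat (map (bits n) t)) (concat (T n)) = map concat (tests T n)" by (simp add: tests_def)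
  then have "distinct (map concat (tests T n))" using dist[OF dists[OF True]] by simp
  then show ?thesis by (simp add: distinct_map)
qed (use other in \<open>simp add: tests_def\<close>)

lemma combos_elem:
  assumes "C \<in> set (combos n)" "(cs, vs) \<in> set C"
  shows "n \<in> {3, 4, 5} \<and> (\<exists>t us. kn t \<and> cs = tg t \<and> vs = map (bits n) us \<and> length us = length (hd (tg t)) \<and> free vs)"
proof (cases "n \<in> {3, 4, 5}")
  case True
  obtain C' r where r: "C' \<in> set (K n)" "r \<in> set C'" "(cs, vs) = dec tg n r"
    using assms unfolding combos_def by auto
  then have "okref tg kn n r" using ok[OF True] unfolding list_all_iff by blast
  then show ?thesis using r(3) True by (cases r) (auto simp: same_len)
qed (use assms other in \<open>simp add: combos_def\<close>)

lemma combos_valid: "C \<in> set (combos n) \<Longrightarrow> x \<in> set C \<Longrightarrow> valid n x"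
proof -
  assume C: "C \<in> set (combos n)" "x \<in> set C"
  obtain cs vs where x: "x = (cs, vs)" by (cases x)
  obtain t us where "kn t" "cs = tg t" "vs = map (bits n) us" "length us = length (hd (tg t))"
    using combos_elem[of C n cs vs] C x by blast
  then show "valid n x" using tgt[of t] by (auto simp: x valid_def)
qed

lemma find_map: "find P (map f xs) = map_option f (find (\<lambda>x. P (f x)) xs)"
  by (induction xs) auto

lemma combos_lead: "map (\<lambda>C. find (evaluate (prepare n C)) (tests T n)) (combos n) = map Some (tests T n)"
proof (cases "n \<in> {3, 4, 5}")
  case True
  have "map (\<lambda>C. find (evaluate (prepare n C)) (tests T n)) (combos n) =
      map (map_option (map (bits n))) (map (\<lambda>C. fndb (map (pref tg n) C) n (T n)) (K n))"
    by (simp add: combos_def tests_def prepare_dec find_map fndb_def fnd_def)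
  also have "\<dots> = map Some (tests T n)" unfolding leads[OF True] by (simp add: tests_def)
  finally show ?thesis .
qed (use other in \<open>simp add: combos_def tests_def\<close>)

lemma data_independent:
  assumes D: "D \<subseteq> family (tests T)" and hit: "(\<Sum>i\<in>D. member i) \<in> hit" shows "D = {}"
proof (rule family_independent[OF _ distinct_tests combos_valid combos_lead D hit])
  show "annihilates_hits cs" if "C \<in> set (combos n)" "(cs, vs) \<in> set C" for n C cs vs
    using combos_elem[OF that] tgt by blast
qed (use tests_elem in blast)

lemma data_invariant:
  assumes D: "D \<subseteq> family (tests T)"
    and inv: "\<And>A. invertible A \<Longrightarrow> lin_subst A (\<Sum>i\<in>D. member i) + (\<Sum>i\<in>D. member i) \<in> hit"
  shows "D = {}"
proof (rule family_invariant[OF _ distinct_tests combos_valid combos_lead D inv])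
  fix n C cs vs assume "C \<in> set (combos n)" "(cs, vs) \<in> set C"
  then obtain t us where t: "n \<in> {3, 4, 5}" "kn t" "cs = tg t" "vs = map (bits n) us" "length us = length (hd (tg t))" "free vs"
    using combos_elem by blast
  have indep: "indep (map (extend S) vs)" if "distinct S" "length S = n" for S
    using that t(4,6) by (intro indep_if_free) auto
  let ?R = "map (map (bits 5)) (R t)"
  have R': "length u = length vs \<and> (\<forall>v\<in>set u. length v = 5) \<and> indep (map (extend vars) u)" if "u \<in> set ?R" for u
  proof -
    obtain w where w: "w \<in> set (R t)" "u = map (bits 5) w" using \<open>u \<in> set ?R\<close> by auto
    then have "same_len w (hd (tg t)) \<and> free u" using R[OF t(2)] by (auto simp: list_all_iff)
    moreover have "indep (map (extend vars) u)"
      using calculation w(2) vars by (intro indep_if_free) auto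
    ultimately show ?thesis using w t(4,5) by (auto simp: same_len)
  qed
  have zero: "\<not> evaluate (prepare (cnt m) (map (\<lambda>us. (cs, map (compress m) us)) ?R)) ms"
    if m: "m \<in> supports" and ms: "ms \<in> set (tests T (cnt m))" for m ms
  proof -
    let ?n = "cnt m"
    have n: "?n \<in> {3, 4, 5}" "m \<in> set (masks 5 ?n)"
    proof -
      obtain r where r: "r \<in> {3, 4, 5}" "m \<in> set (masks 5 r)" using m unfolding supports_def by blast
      then have "?n = r" using set_masks by blast
      then show "?n \<in> {3, 4, 5}" "m \<in> set (masks 5 ?n)" using r by simp_all
    qed
    obtain s where s: "s \<in> set (concat (T ?n))" "ms = map (bits ?n) s" using ms unfolding tests_def by auto
    have "fndb (map (\<lambda>us. (forms ?n (map (compress m) (map (bits 5) us)), tg t)) (R t)) ?n (T ?n) = None"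
      using rel[OF t(2) n(1)] n(2) unfolding list_all_iff by blast
    then have "\<not> evaluate (map (\<lambda>us. (forms ?n (map (compress m) (map (bits 5) us)), tg t)) (R t)) ms"
      using s unfolding fndb_def fnd_def find_None_iff by blast
    then show ?thesis by (simp add: prepare_def o_def t(3))
  qed
  show "annihilates_hits cs \<and> (\<forall>S. distinct S \<longrightarrow> length S = n \<longrightarrow> indep (map (extend S) vs))
      \<and> (\<exists>R. odd (length R) \<and> (\<forall>us\<in>set R. length us = length vs \<and> (\<forall>u\<in>set us. length u = 5) \<and> indep (map (extend vars) us))
        \<and> (\<forall>m\<in>supports. \<forall>ms\<in>set (tests T (cnt m)). \<not> evaluate (prepare (cnt m) (map (\<lambda>us. (cs, map (compress m) us)) R)) ms))"
    using tgt[OF t(2)] t(3) indep R' zero R[OF t(2)] by (intro conjI exI[of _ ?R]) auto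
qed (use tests_elem in blast)

lemma data_homogeneous: "i \<in> family (tests T) \<Longrightarrow> homogeneous d (member i)"
proof -
  assume i: "i \<in> family (tests T)"
  obtain m ms where im: "i = (m, ms)" by (cases i)
  have "ms \<in> set (tests T (cnt m))" "length m = 5" using i im by (auto simp: family_def supports)
  then show "homogeneous d (member i)"
    using homogeneous_mn[of "bit_exps (cnt m) ms" "compress m vars"] tests_elem[of ms "cnt m"]
    by (auto simp: im length_bit_exps length_compress vars)
qed

lemma data_card: "card (family (tests T)) = 10 * length (concat (T 3)) + 5 * length (concat (T 4)) + length (concat (T 5))"
  unfolding card_family[of "tests T", OF distinct_tests] by (simp add: tests_def)

end

fun vat :: "bool list \<Rightarrow> fvec \<Rightarrow> fvec" where
  "vat [] L = L" | "vat (b # p) VZ = VZ" | "vat (False # p) (VN b l r) = vat p l" | "vat (True # p) (VN b l r) = vat p r"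

lemma vmem_append: "vmem (p @ q) L = vmem q (vat p L)"
  by (induction p L rule: vat.induct) auto

lemma kameko_mn_0:
  assumes "distinct xs" "length e = length xs" "x \<notin> set xs \<or> (\<exists>b<length e. even (e ! b))"
  shows "kameko (mn xs e) = (0 :: 'n::finite pol)"
proof -
  have "\<exists>x. even (Poly_Mapping.lookup (ex xs e) (x :: 'n))"
    using assms
  proof (induction xs e rule: ex.induct)
    case (1 y xs a c)
    show ?case
    proof (cases "x \<noteq> y \<and> x \<notin> set xs")
      case True
      then have "Poly_Mapping.lookup (ex (y # xs) (a # c)) x = 0" by (intro lookup_ex_notin) auto
      then show ?thesis by (metis even_zero)
    next
      case False
      then obtain b where b: "b < length (a # c)" "even ((a # c) ! b)" using 1(4) by auto
      have nth: "Poly_Mapping.lookup (ex zs f) (zs ! b) = f ! b" if "distinct zs" "length f = length zs" "b < length zs" for zs :: "'n list" and f b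
        using that
      proof (induction zs f arbitrary: b rule: ex.induct)
        case (1 z zs f0 f)
        then show ?case by (cases b) (auto simp: lookup_add lookup_single when_def lookup_ex_notin)
      qed auto
      show ?thesis using b nth[of "y # xs" "a # c" b] 1(2,3) by metis
    qed
  qed auto
  then show ?thesis by (auto simp: mn_eq_mono kameko_mono odds_def)
qed

section \<open>Computations\<close>

lemma num_unary: "(1::nat) = (Suc 0)"
  "(2::nat) = (Suc (Suc 0))"
  "(3::nat) = (Suc (Suc (Suc 0)))"
  "(4::nat) = (Suc (Suc (Suc (Suc 0))))"
  "(5::nat) = (Suc (Suc (Suc (Suc (Suc 0)))))"
  "(6::nat) = (Suc (Suc (Suc (Suc (Suc (Suc 0))))))"
  "(7::nat) = (Suc (Suc (Suc (Suc (Suc (Suc (Suc 0)))))))"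
  "(8::nat) = (Suc (Suc (Suc (Suc (Suc (Suc (Suc (Suc 0))))))))"
  "(9::nat) = (Suc (Suc (Suc (Suc (Suc (Suc (Suc (Suc (Suc 0)))))))))"
  "(10::nat) = (Suc (Suc (Suc (Suc (Suc (Suc (Suc (Suc (Suc (Suc 0))))))))))"
  "(11::nat) = (Suc (Suc (Suc (Suc (Suc (Suc (Suc (Suc (Suc (Suc (Suc 0)))))))))))"
  "(12::nat) = (Suc (Suc (Suc (Suc (Suc (Suc (Suc (Suc (Suc (Suc (Suc (Suc 0))))))))))))"
  "(13::nat) = (Suc (Suc (Suc (Suc (Suc (Suc (Suc (Suc (Suc (Suc (Suc (Suc (Suc 0)))))))))))))"
  "(14::nat) = (Suc (Suc (Suc (Suc (Suc (Suc (Suc (Suc (Suc (Suc (Suc (Suc (Suc (Suc 0))))))))))))))"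
  "(15::nat) = (Suc (Suc (Suc (Suc (Suc (Suc (Suc (Suc (Suc (Suc (Suc (Suc (Suc (Suc (Suc 0)))))))))))))))"
  by simp_all

lemma n3: "3 = Suc (Suc (Suc 0))" and n4: "4 = Suc (Suc (Suc (Suc 0)))" and n5: "5 = Suc (Suc (Suc (Suc (Suc 0))))"
  and n9: "9 = Suc (Suc (Suc (Suc (Suc (Suc (Suc (Suc (Suc 0))))))))"
  and n23: "23 = Suc (Suc (Suc (Suc (Suc (Suc (Suc (Suc (Suc (Suc (Suc (Suc (Suc (Suc (Suc (Suc (Suc (Suc (Suc (Suc (Suc (Suc (Suc 0))))))))))))))))))))))"
  by simp_all

text \<open>The guard keeps the index b - a inside row a of Pascal's triangle; beyond it the
  binomial coefficient is 0.\<close>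

lemma preds1_pascal: "preds1 b = filter (\<lambda>a. b \<le> a + a \<and> pascal a ! (b - a)) [0..<Suc b]"
  unfolding preds1.simps
proof (rule filter_cong)
  fix a assume "a \<in> set [0..<Suc b]"
  then show "odd (a choose (b - a)) = (b \<le> a + a \<and> pascal a ! (b - a))"
    by (cases "b \<le> a + a") (simp_all add: nth_pascal binomial_eq_0)
qed simp

lemma preds1_values: "preds1 0 = [0]" "preds1 1 = [1]" "preds1 2 = [1, 2]" "preds1 3 = [3]" "preds1 4 = [2, 3, 4]"
  "preds1 5 = [3, 5]" "preds1 6 = [3, 5, 6]" "preds1 7 = [7]" "preds1 15 = [15]"
  by (simp_all add: preds1_pascal numeral_eq_Suc)

lemmas preds1_unary = preds1_values[unfolded num_unary]

lemma list_allD: "list_all P xs \<Longrightarrow> x \<in> set xs \<Longrightarrow> P x"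
  by (simp add: list_all_iff)

lemmas low = bxor.simps vsingle.simps vinsert.simps vmem.simps dist_code fnd_code evaluate_code expand.simps choices.simps
  cons_opt.simps sub.simps parity.simps all_zero.simps factors.simps select.simps double.simps forms.simps pref.simps
  bits_code compress.simps masks.simps xorl.simps anyl.simps free_over.simps free.simps same_len.simps okref.simps
  bit_exps_code incr.simps good.simps good_rest.simps replicate.simps list.map append.simps concat.simps list.sel
  list.pred_inject simp_thms

lemmas comp = bxor.simps vnode.simps vadd.simps enc.simps vsingle.simps vshift.simps vlead_code vinsert.simps vmem.simps
  vset.simps sinsert.simps slookup.simps sinsert'_code sbuild.simps vreduce_code incr_hd.simps exps.simps pascal_next.simps
  pascal.simps splits.simps sq_exps.simps vexps.simps sq_row.simps moves.simps shifted_sum.simps skip.simps sub01.simps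
  sq1_row.simps vsum.simps nonleads_code prefix_all.simps vat.simps list.map append.simps concat.simps prod.case option.map
  map_prod_simp num_unary

section \<open>Degree 9: targets, tests and functionals\<close>

definition tg9 :: "nat \<Rightarrow> nat list list" where
  "tg9 t = (if t = 0 then [[7,1,1]] else (if t = 1 then [[3,3,3]] else (if t = 2 then [[3,3,1,1,1]] else [[1,3,3,2],[1,3,4,1],[1,5,2,1],[1,6,1,1]])))"

lemma tg9: "tg9 0 = [[7,1,1]]" "tg9 1 = [[3,3,3]]" "tg9 2 = [[3,3,1,1,1]]" "tg9 3 = [[1,3,3,2],[1,3,4,1],[1,5,2,1],[1,6,1,1]]"
  by (simp_all add: tg9_def)

schematic_goal tg9_0: "tg9 0 = ?x"
  by (rule trans[OF tg9(1)]) (simp only: num_unary)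
schematic_goal tg9_1: "tg9 1 = ?x"
  by (rule trans[OF tg9(2)]) (simp only: num_unary)
schematic_goal tg9_2: "tg9 2 = ?x"
  by (rule trans[OF tg9(3)]) (simp only: num_unary)
schematic_goal tg9_3: "tg9 3 = ?x"
  by (rule trans[OF tg9(4)]) (simp only: num_unary)

lemmas tg9_unary = tg9_0 tg9_1 tg9_2 tg9_3

definition kn9 :: "nat \<Rightarrow> bool" where "kn9 t \<longleftrightarrow> t \<in> set [0,1,2,3]"

lemma kn9_iff: "kn9 t \<longleftrightarrow> t \<in> set [0,1,2,3]" by (simp only: kn9_def)

lemma kn9: "kn9 0" "kn9 1" "kn9 2" "kn9 3"
  by (simp_all add: kn9_def)

text \<open>Odd lists of matrices whose functionals sum to zero. A target exponent 1 makes the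
  functional linear in its row, so rows v, w, v + w cancel: 4, 8, 12 for target 0 and 1, 2, 3 for
  target 3. For the exponents 3 and 1 of target 2 the values at the rows (v, w), (v + w, w), (w, v)
  cancel. The seven matrices of target 1 satisfy a relation on the tests.\<close>

definition R9 :: "nat \<Rightarrow> nat list list" where
  "R9 t = (if t = 0 then [[1,2,4],[1,2,8],[1,2,12]]
    else (if t = 1 then [[2,5,9],[1,2,8],[3,5,9],[1,6,8],[3,4,9],[2,4,9],[1,4,8]]
    else (if t = 2 then [[1,2,4,8,16],[5,2,4,8,16],[4,2,1,8,16]]
    else [[1,4,8,16],[2,4,8,16],[3,4,8,16]])))"

lemma R9: "R9 0 = [[1,2,4],[1,2,8],[1,2,12]]"
    "R9 1 = [[2,5,9],[1,2,8],[3,5,9],[1,6,8],[3,4,9],[2,4,9],[1,4,8]]"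
    "R9 2 = [[1,2,4,8,16],[5,2,4,8,16],[4,2,1,8,16]]"
    "R9 3 = [[1,4,8,16],[2,4,8,16],[3,4,8,16]]"
  by (simp_all add: R9_def)

text \<open>All exponents are of the form 2 ^ a - 1, and such an exponent has itself as its only
  predecessor; so this monomial, a spike, occurs in no positive square.\<close>

lemma ann9_0: "annihilates_hits (tg9 0)"
  unfolding tg9
  by (rule annihilates_hits_pad, rule annihilates_hits[where d = 9]) (auto simp: preds1_unary numeral_eq_Suc)

lemma ann9_1: "annihilates_hits (tg9 1)"
  unfolding tg9
  by (rule annihilates_hits_pad, rule annihilates_hits[where d = 9]) (auto simp: preds1_unary numeral_eq_Suc)

lemma ann9_2: "annihilates_hits (tg9 2)"
  unfolding tg9
  by (rule annihilates_hits_pad, rule annihilates_hits[where d = 9]) (auto simp: preds1_unary numeral_eq_Suc)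

text \<open>The leading exponent 1 has itself as its only predecessor. In the other three exponents
  the lower predecessors 331, 321, 311 and 511 arise twice each and cancel.\<close>

lemma ann9_3: "annihilates_hits (tg9 3)"
  unfolding tg9
  by (rule annihilates_hits_pad, rule annihilates_hits[where d = 9]) (auto simp: preds1_unary numeral_eq_Suc)

lemmas ann9 = ann9_0 ann9_1 ann9_2 ann9_3

text \<open>For instance \<open>[7,1,4]\<close> is the monomial with exponents 3, 1, 5: bit 0 in all
  three, bit 1 in the first, bit 2 in the third.\<close>

definition b9_3_a :: "nat list list" where
  "b9_3_a = [[7,1,4],[7,1,2],[7,1,1],[7,7],[7,2,4],[7,4,4],[7,2,2]]"

definition T9_3 :: "nat list list list" where
  "T9_3 = [b9_3_a]"

text \<open>The i-th entry is a sum of functionals that is 0 on the tests before the i-th and 1 on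
  the i-th. The summand \<open>[0,5,1,2]\<close> has the target \<open>tg9 0\<close> and the rows 5,
  1, 2.\<close>

definition K9_3 :: "nat list list list" where
  "K9_3 = [[[0,5,1,2]],[[0,3,1,4]],[[0,1,2,4]],[[1,1,2,4]],[[0,6,1,2]],[[0,4,1,2]],[[0,2,1,4]]]"

lemmas blocks9_3 = b9_3_a_def

lemmas fnd9_3 = b9_3_a_def[THEN fnd_block]

schematic_goal leads9_3: "map (\<lambda>C. fndb (map (pref tg9 (Suc (Suc (Suc 0)))) C) (Suc (Suc (Suc 0))) T9_3) K9_3 = ?x"
  by (simp only: low tg9_unary T9_3_def fnd9_3 K9_3_def)

lemma ok9_3: "list_all (list_all (okref tg9 kn9 (Suc (Suc (Suc 0))))) K9_3"
  by (simp only: low tg9_unary kn9 K9_3_def)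

schematic_goal some9_3: "map Some (concat T9_3) = ?x"
  by (simp only: list.map concat.simps append.simps T9_3_def blocks9_3)

lemma leads9_3_eq: "map (\<lambda>C. fndb (map (pref tg9 (Suc (Suc (Suc 0)))) C) (Suc (Suc (Suc 0))) T9_3) K9_3 = map Some (concat T9_3)"
  by (rule trans[OF leads9_3 some9_3[symmetric]])

lemma good9_3: "list_all (\<lambda>t. good (Suc (Suc (Suc (Suc (Suc (Suc (Suc (Suc (Suc 0))))))))) (bit_exps (Suc (Suc (Suc 0))) (map (bits (Suc (Suc (Suc 0)))) t))) (concat T9_3)"
  by (simp only: low T9_3_def blocks9_3)

lemma dist9_3: "dist (map (\<lambda>t. concat (map (bits (Suc (Suc (Suc 0)))) t)) (concat T9_3)) VZ"
  by (simp only: low T9_3_def blocks9_3)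

lemma rel9_3: "list_all (\<lambda>t. list_all (\<lambda>m. fndb (map (\<lambda>us. (forms (Suc (Suc (Suc 0))) (map (compress m) (map (bits (Suc (Suc (Suc (Suc (Suc 0)))))) us)), tg9 t)) (R9 t)) (Suc (Suc (Suc 0))) T9_3 = None) (masks (Suc (Suc (Suc (Suc (Suc 0))))) (Suc (Suc (Suc 0))))) [0,1,2,3]"
  by (simp only: low tg9_unary R9 T9_3_def fnd9_3)

lemma len9_3: "length (concat T9_3) = 7"
  by (simp add: T9_3_def blocks9_3)

definition b9_4_a :: "nat list list" where
  "b9_4_a = [[14,1,1],[14,1,2],[14,1,8],[14,1,4],[13,1,2],[13,7],[13,11],[11,1,4],[7,11],[14,11],[14,13],[14,7],[13,2,4],
  [13,2,8],[13,14],[7,2,8],[11,4,8],[13,2,2]]"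

definition T9_4 :: "nat list list list" where
  "T9_4 = [b9_4_a]"

definition K9_4 :: "nat list list list" where
  "K9_4 = [[[0,9,2,4]],[[3,10,2,1,6]],[[3,2,8,9,13]],[[3,6,4,5,9]],[[0,7,1,8]],[[1,1,4,10]],[[1,1,6,8]],[[0,13,1,2]],
  [[1,1,2,12]],[[1,2,5,8]],[[3,6,4,9,5]],[[1,2,4,9]],[[0,6,1,8]],[[0,10,1,4]],[[3,11,4,8,2]],[[0,14,1,2]],
  [[0,12,1,2]],[[3,3,2,13,11]]]"

lemmas blocks9_4 = b9_4_a_def

lemmas fnd9_4 = b9_4_a_def[THEN fnd_block]

schematic_goal leads9_4: "map (\<lambda>C. fndb (map (pref tg9 (Suc (Suc (Suc (Suc 0))))) C) (Suc (Suc (Suc (Suc 0)))) T9_4) K9_4 = ?x"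
  by (simp only: low tg9_unary T9_4_def fnd9_4 K9_4_def)

lemma ok9_4: "list_all (list_all (okref tg9 kn9 (Suc (Suc (Suc (Suc 0)))))) K9_4"
  by (simp only: low tg9_unary kn9 K9_4_def)

schematic_goal some9_4: "map Some (concat T9_4) = ?x"
  by (simp only: list.map concat.simps append.simps T9_4_def blocks9_4)

lemma leads9_4_eq: "map (\<lambda>C. fndb (map (pref tg9 (Suc (Suc (Suc (Suc 0))))) C) (Suc (Suc (Suc (Suc 0)))) T9_4) K9_4 = map Some (concat T9_4)"
  by (rule trans[OF leads9_4 some9_4[symmetric]])

lemma good9_4: "list_all (\<lambda>t. good (Suc (Suc (Suc (Suc (Suc (Suc (Suc (Suc (Suc 0))))))))) (bit_exps (Suc (Suc (Suc (Suc 0)))) (map (bits (Suc (Suc (Suc (Suc 0))))) t))) (concat T9_4)"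
  by (simp only: low T9_4_def blocks9_4)

lemma dist9_4: "dist (map (\<lambda>t. concat (map (bits (Suc (Suc (Suc (Suc 0))))) t)) (concat T9_4)) VZ"
  by (simp only: low T9_4_def blocks9_4)

lemma rel9_4: "list_all (\<lambda>t. list_all (\<lambda>m. fndb (map (\<lambda>us. (forms (Suc (Suc (Suc (Suc 0)))) (map (compress m) (map (bits (Suc (Suc (Suc (Suc (Suc 0)))))) us)), tg9 t)) (R9 t)) (Suc (Suc (Suc (Suc 0)))) T9_4 = None) (masks (Suc (Suc (Suc (Suc (Suc 0))))) (Suc (Suc (Suc (Suc 0)))))) [0,1,2,3]"
  by (simp only: low tg9_unary R9 T9_4_def fnd9_4)

lemma len9_4: "length (concat T9_4) = 18"
  by (simp add: T9_4_def blocks9_4)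

definition b9_5_a :: "nat list list" where
  "b9_5_a = [[21,2,8],[21,14],[21,11],[21,26],[28,11],[13,26],[13,2,16],[13,19],[13,22],[25,7],[25,22],[11,22],[14,19],
  [31,0,2],[11,4,16],[26,1,4],[19,13],[26,21],[22,1,8],[14,25]]"

definition b9_5_b :: "nat list list" where
  "b9_5_b = [[14,21],[31,5],[31,20],[31,12],[31,6],[31,24],[31,17],[31,9],[31,18],[31,3],[31,10]]"

definition T9_5 :: "nat list list list" where
  "T9_5 = [b9_5_a,b9_5_b]"

definition K9_5 :: "nat list list list" where
  "K9_5 = [[[0,14,1,16]],[[3,25,13,9,23]],[[1,1,12,18]],[[3,30,16,10,25]],[[0,15,5,16]],[[0,30,1,10]],[[0,19,4,8]],
  [[3,9,1,6,28]],[[1,4,10,17]],[[0,7,8,16]],[[1,5,10,16]],[[0,31,2,12]],[[0,31,2,9]],[[0,15,2,16]],[[0,28,1,2]],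
  [[0,29,2,9]],[[3,26,21,20,12]],[[3,26,16,28,31]],[[0,25,2,4]],[[3,3,8,13,31]],[[3,18,4,17,9]],[[1,1,4,26]],
  [[1,4,11,16]],[[1,4,8,19]],[[1,2,4,25]],[[1,7,8,16]],[[1,1,14,16]],[[1,1,8,22]],[[1,2,13,16]],[[1,1,2,28]],
  [[1,2,8,21]]]"

lemmas blocks9_5 = b9_5_a_def b9_5_b_def

lemmas fnd9_5 = b9_5_a_def[THEN fnd_block] b9_5_b_def[THEN fnd_block]

schematic_goal leads9_5: "map (\<lambda>C. fndb (map (pref tg9 (Suc (Suc (Suc (Suc (Suc 0)))))) C) (Suc (Suc (Suc (Suc (Suc 0))))) T9_5) K9_5 = ?x"
  by (simp only: low tg9_unary T9_5_def fnd9_5 K9_5_def)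

lemma ok9_5: "list_all (list_all (okref tg9 kn9 (Suc (Suc (Suc (Suc (Suc 0))))))) K9_5"
  by (simp only: low tg9_unary kn9 K9_5_def)

schematic_goal some9_5: "map Some (concat T9_5) = ?x"
  by (simp only: list.map concat.simps append.simps T9_5_def blocks9_5)

lemma leads9_5_eq: "map (\<lambda>C. fndb (map (pref tg9 (Suc (Suc (Suc (Suc (Suc 0)))))) C) (Suc (Suc (Suc (Suc (Suc 0))))) T9_5) K9_5 = map Some (concat T9_5)"
  by (rule trans[OF leads9_5 some9_5[symmetric]])

lemma good9_5: "list_all (\<lambda>t. good (Suc (Suc (Suc (Suc (Suc (Suc (Suc (Suc (Suc 0))))))))) (bit_exps (Suc (Suc (Suc (Suc (Suc 0))))) (map (bits (Suc (Suc (Suc (Suc (Suc 0)))))) t))) (concat T9_5)"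
  by (simp only: low T9_5_def blocks9_5)

lemma dist9_5: "dist (map (\<lambda>t. concat (map (bits (Suc (Suc (Suc (Suc (Suc 0)))))) t)) (concat T9_5)) VZ"
  by (simp only: low T9_5_def blocks9_5)

lemma rel9_5: "list_all (\<lambda>t. list_all (\<lambda>m. fndb (map (\<lambda>us. (forms (Suc (Suc (Suc (Suc (Suc 0))))) (map (compress m) (map (bits (Suc (Suc (Suc (Suc (Suc 0)))))) us)), tg9 t)) (R9 t)) (Suc (Suc (Suc (Suc (Suc 0))))) T9_5 = None) (masks (Suc (Suc (Suc (Suc (Suc 0))))) (Suc (Suc (Suc (Suc (Suc 0))))))) [0,1,2,3]"
  by (simp only: low tg9_unary R9 T9_5_def fnd9_5)

lemma len9_5: "length (concat T9_5) = 31"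
  by (simp add: T9_5_def blocks9_5)

definition "T9 n = (if n = 3 then T9_3 else if n = 4 then T9_4 else if n = 5 then T9_5 else [])" for n :: nat

definition "K9 n = (if n = 3 then K9_3 else if n = 4 then K9_4 else if n = 5 then K9_5 else [])" for n :: nat

lemma TK9: "T9 3 = T9_3" "T9 4 = T9_4" "T9 5 = T9_5" "K9 3 = K9_3" "K9 4 = K9_4" "K9 5 = K9_5"
  by (simp_all add: T9_def K9_def)

lemma other9: "n \<notin> {3, 4, 5} \<Longrightarrow> T9 n = [] \<and> K9 n = []"
  by (simp add: T9_def K9_def)

lemma leads9: "n \<in> {3, 4, 5} \<Longrightarrow> map (\<lambda>C. fndb (map (pref tg9 n) C) n (T9 n)) (K9 n) = map Some (concat (T9 n))"
  by (elim insertE emptyE; simp only: TK9 leads9_3_eq[folded n3 ] leads9_4_eq[folded n4 ] leads9_5_eq[folded n5 ])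

lemma ok9: "n \<in> {3, 4, 5} \<Longrightarrow> list_all (list_all (okref tg9 kn9 n)) (K9 n)"
  by (elim insertE emptyE; simp only: TK9 ok9_3[folded n3 ] ok9_4[folded n4 ] ok9_5[folded n5 ])

lemma good9: "n \<in> {3, 4, 5} \<Longrightarrow> list_all (\<lambda>t. good 9 (bit_exps n (map (bits n) t))) (concat (T9 n))"
  by (elim insertE emptyE; simp only: TK9 good9_3[folded n9 n3] good9_4[folded n9 n4] good9_5[folded n9 n5])

lemma dist9: "n \<in> {3, 4, 5} \<Longrightarrow> dist (map (\<lambda>t. concat (map (bits n) t)) (concat (T9 n))) VZ"
  by (elim insertE emptyE; simp only: TK9 dist9_3[folded n3 ] dist9_4[folded n4 ] dist9_5[folded n5 ])

lemma rel9': "n \<in> {3, 4, 5} \<Longrightarrow> list_all (\<lambda>t. list_all (\<lambda>m. fndb (map (\<lambda>us. (forms n (map (compress m) (map (bits 5) us)), tg9 t)) (R9 t)) n (T9 n) = None) (masks 5 n)) [0,1,2,3]"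
  by (elim insertE emptyE; simp only: TK9 rel9_3[folded n5 n3] rel9_4[folded n5 n4] rel9_5[folded n5 ])

lemma rel9: "kn9 t \<Longrightarrow> n \<in> {3, 4, 5} \<Longrightarrow> list_all (\<lambda>m. fndb (map (\<lambda>us. (forms n (map (compress m) (map (bits 5) us)), tg9 t)) (R9 t)) n (T9 n) = None) (masks 5 n)"
  by (rule list_allD[OF rel9']) (simp_all only: kn9_iff)

lemma tgt9: "kn9 t \<Longrightarrow> annihilates_hits (tg9 t) \<and> (\<forall>c\<in>set (tg9 t). length c = length (hd (tg9 t))) \<and> length (hd (tg9 t)) \<le> 5"
proof
  assume "kn9 t"
  then have t: "t \<in> set [0,1,2,3]" by (simp only: kn9_iff)
  have "list_all (\<lambda>t. annihilates_hits (tg9 t)) [0,1,2,3]" by (simp only: list.pred_inject ann9 simp_thms)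
  then show "annihilates_hits (tg9 t)" by (rule list_allD) (rule t)
qed (auto simp: tg9_def)

lemma R9_free: "list_all (\<lambda>t. list_all (\<lambda>us. same_len us (hd (tg9 t)) \<and> free (map (bits (Suc (Suc (Suc (Suc (Suc 0)))))) us)) (R9 t)) [0,1,2,3]"
  by (simp only: low tg9_unary R9)

lemma R9_ok: "kn9 t \<Longrightarrow> odd (length (R9 t)) \<and> list_all (\<lambda>us. same_len us (hd (tg9 t)) \<and> free (map (bits 5) us)) (R9 t)"
proof
  assume "kn9 t"
  then have t: "t \<in> set [0,1,2,3]" by (simp only: kn9_iff)
  show "list_all (\<lambda>us. same_len us (hd (tg9 t)) \<and> free (map (bits 5) us)) (R9 t)"
    by (rule list_allD[OF R9_free[folded n5]]) (rule t)
qed (auto simp: R9_def)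

lemmas data9 = other9 leads9 ok9 good9 dist9 tgt9 R9_ok rel9

section \<open>Degree 9: relations\<close>

definition "rels9 = prefix_all [1] (exps 5 8) @ prefix_all [2] (exps 5 7) @ prefix_all [4] (exps 5 5)"

text \<open>Sums of rows from \<open>rels9\<close> whose leading terms cancel; the first one leaves
  the single monomial with exponents 0, 0, 0, 2, 7. Only the indices 1, 2, 4 occur, since squares of
  index a power of two generate all others and \<open>Sq 8\<close> is zero in degree 1.\<close>

definition combs9 :: "nat list list list" where
  "combs9 = [[[1,0,0,0,1,7],[2,0,0,0,1,6]],[[1,0,0,0,5,3],[2,0,0,0,3,4]],[[1,0,0,1,0,7],[2,0,0,1,0,6]],
  [[1,0,0,1,4,3],[2,0,0,1,2,4]],[[1,0,0,1,5,2],[2,0,0,1,5,1]],[[1,0,0,1,7,0],[2,0,0,1,6,0]],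
  [[1,0,0,3,3,2],[2,0,0,3,3,1]],[[1,0,0,4,1,3],[2,0,0,2,1,4]],[[1,0,0,5,0,3],[2,0,0,3,0,4]],
  [[1,0,0,5,1,2],[2,0,0,5,1,1]],[[1,0,0,5,3,0],[2,0,0,3,4,0]],[[1,0,1,1,3,3],[2,0,1,1,3,2]],
  [[1,0,1,1,4,2],[2,0,1,2,3,1]],[[1,0,1,3,1,3],[2,0,1,3,1,2]],[[1,0,1,0,0,7],[2,0,1,0,0,6]],
  [[1,0,1,0,4,3],[2,0,1,0,2,4]],[[1,0,1,0,5,2],[2,0,1,0,5,1]],[[1,0,1,0,7,0],[2,0,1,0,6,0]],
  [[1,0,2,1,3,2],[2,0,2,1,3,1]],[[1,0,2,2,1,3],[2,0,2,2,1,2]],[[1,0,1,4,0,3],[2,0,1,2,0,4]],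
  [[1,0,2,3,1,2],[2,0,2,3,1,1]],[[1,0,1,4,3,0],[2,0,1,2,4,0]],[[1,0,1,3,2,2],[2,0,1,4,1,1],[2,0,2,3,1,1]],
  [[1,0,1,5,0,2],[2,0,1,5,0,1]],[[1,0,1,5,2,0],[2,0,1,5,1,0]],[[1,0,1,7,0,0],[2,0,1,6,0,0]],
  [[1,0,3,0,3,2],[2,0,3,0,3,1]],[[1,0,3,1,1,3],[2,0,3,1,1,2]],[[1,0,3,1,2,2],[2,0,3,2,1,1]],
  [[1,0,3,3,0,2],[2,0,3,3,0,1]],[[1,0,3,3,2,0],[2,0,3,3,1,0]],[[1,0,4,0,1,3],[2,0,2,0,1,4]],
  [[1,0,4,1,0,3],[2,0,2,1,0,4]],[[1,0,4,1,1,2],[2,0,4,1,1,1]],[[1,0,4,1,3,0],[2,0,2,1,4,0]],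
  [[1,0,5,0,0,3],[2,0,3,0,0,4]],[[1,0,5,0,1,2],[2,0,5,0,1,1]],[[1,0,5,0,3,0],[2,0,3,0,4,0]],
  [[1,0,5,1,0,2],[2,0,5,1,0,1]],[[1,0,5,1,2,0],[2,0,5,1,1,0]],[[1,0,5,3,0,0],[2,0,3,4,0,0]],
  [[1,1,0,1,3,3],[2,1,0,1,3,2]],[[1,1,0,1,4,2],[2,1,0,2,3,1]],[[1,1,0,3,1,3],[2,1,0,3,1,2]],
  [[1,1,1,0,3,3],[2,1,1,0,3,2]],[[1,1,1,1,3,2],[2,1,1,1,3,1]],[[1,1,1,2,1,3],[2,1,1,2,1,2]],
  [[1,1,1,3,0,3],[2,1,1,3,0,2]],[[1,1,1,3,1,2],[2,1,1,3,1,1]],[[1,1,1,3,3,0],[2,1,1,3,2,0]],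
  [[1,1,1,0,4,2],[2,1,2,0,3,1]],[[1,1,2,1,1,3],[2,1,2,1,1,2]],[[1,1,1,2,2,2],[2,1,2,2,1,1]],
  [[1,1,1,4,0,2],[2,1,2,3,0,1]],[[1,1,1,4,2,0],[2,1,2,3,1,0]],[[1,1,3,0,1,3],[2,1,3,0,1,2]],
  [[1,1,3,1,0,3],[2,1,3,1,0,2]],[[1,1,3,1,1,2],[2,1,3,1,1,1]],[[1,1,3,1,3,0],[2,1,3,1,2,0]],
  [[1,1,0,0,0,7],[2,1,0,0,0,6]],[[1,1,0,0,4,3],[2,1,0,0,2,4]],[[1,1,0,0,5,2],[2,1,0,0,5,1]],
  [[1,1,0,0,7,0],[2,1,0,0,6,0]],[[1,2,0,1,3,2],[2,2,0,1,3,1]],[[1,2,0,2,1,3],[2,2,0,2,1,2]],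
  [[1,1,0,4,0,3],[2,1,0,2,0,4]],[[1,2,0,3,1,2],[2,2,0,3,1,1]],[[1,1,0,4,3,0],[2,1,0,2,4,0]],
  [[1,1,0,3,2,2],[2,1,0,4,1,1],[2,2,0,3,1,1]],[[1,1,0,5,0,2],[2,1,0,5,0,1]],[[1,1,0,5,2,0],[2,1,0,5,1,0]],
  [[1,1,0,7,0,0],[2,1,0,6,0,0]],[[1,2,1,0,3,2],[2,2,1,0,3,1]],[[1,2,1,1,1,3],[2,2,1,1,1,2]],
  [[1,2,1,1,2,2],[2,2,1,2,1,1]],[[1,2,1,3,0,2],[2,2,1,3,0,1]],[[1,2,1,3,2,0],[2,2,1,3,1,0]],
  [[1,2,2,0,1,3],[2,2,2,0,1,2]],[[1,2,2,1,0,3],[2,2,2,1,0,2]],[[1,2,2,1,1,2],[2,2,2,1,1,1]],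
  [[1,2,2,1,3,0],[2,2,2,1,2,0]],[[1,1,4,0,0,3],[2,1,2,0,0,4]],[[1,2,3,0,1,2],[2,2,3,0,1,1]],
  [[1,1,4,0,3,0],[2,1,2,0,4,0]],[[1,1,1,2,2,2],[2,2,2,1,1,1],[4,1,1,1,1,1]],[[1,2,3,1,0,2],[2,2,3,1,0,1]],
  [[1,2,3,1,2,0],[2,2,3,1,1,0]],[[1,1,4,3,0,0],[2,1,2,4,0,0]],[[1,1,3,0,2,2],[2,1,4,0,1,1],[2,2,3,0,1,1]],
  [[1,1,3,2,0,2],[2,1,4,1,0,1],[2,2,3,1,0,1]],[[1,1,3,2,2,0],[2,1,4,1,1,0],[2,2,3,1,1,0]],
  [[1,1,5,0,0,2],[2,1,5,0,0,1]],[[1,1,5,0,2,0],[2,1,5,0,1,0]],[[1,1,5,2,0,0],[2,1,5,1,0,0]],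
  [[1,1,7,0,0,0],[2,1,6,0,0,0]],[[1,3,0,0,3,2],[2,3,0,0,3,1]],[[1,3,0,1,1,3],[2,3,0,1,1,2]],
  [[1,3,0,1,2,2],[2,3,0,2,1,1]],[[1,3,0,3,0,2],[2,3,0,3,0,1]],[[1,3,0,3,2,0],[2,3,0,3,1,0]],
  [[1,3,1,0,1,3],[2,3,1,0,1,2]],[[1,3,1,1,0,3],[2,3,1,1,0,2]],[[1,3,1,1,1,2],[2,3,1,1,1,1]],
  [[1,3,1,1,3,0],[2,3,1,1,2,0]],[[1,3,1,0,2,2],[2,3,2,0,1,1]],[[1,3,1,2,0,2],[2,3,2,1,0,1]],
  [[1,3,1,2,2,0],[2,3,2,1,1,0]],[[1,3,3,0,0,2],[2,3,3,0,0,1]],[[1,3,3,0,2,0],[2,3,3,0,1,0]],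
  [[1,3,3,2,0,0],[2,3,3,1,0,0]],[[1,4,0,0,1,3],[2,2,0,0,1,4]],[[1,4,0,1,0,3],[2,2,0,1,0,4]],
  [[1,4,0,1,1,2],[2,4,0,1,1,1]],[[1,4,0,1,3,0],[2,2,0,1,4,0]],[[1,4,1,0,0,3],[2,2,1,0,0,4]],
  [[1,4,1,0,1,2],[2,4,1,0,1,1]],[[1,4,1,0,3,0],[2,2,1,0,4,0]],[[1,4,1,1,0,2],[2,4,1,1,0,1]],
  [[1,4,1,1,2,0],[2,4,1,1,1,0]],[[1,4,1,3,0,0],[2,2,1,4,0,0]],[[1,5,0,0,0,3],[2,3,0,0,0,4]],
  [[1,5,0,0,1,2],[2,5,0,0,1,1]],[[1,5,0,0,3,0],[2,3,0,0,4,0]],[[1,5,0,1,0,2],[2,5,0,1,0,1]],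
  [[1,5,0,1,2,0],[2,5,0,1,1,0]],[[1,5,0,3,0,0],[2,3,0,4,0,0]],[[1,5,1,0,0,2],[2,5,1,0,0,1]],
  [[1,5,1,0,2,0],[2,5,1,0,1,0]],[[1,5,1,2,0,0],[2,5,1,1,0,0]],[[1,5,3,0,0,0],[2,3,4,0,0,0]]]"

definition "rows9 = map sq_row rels9 @ map (vsum sq_row) combs9"

schematic_goal rows9: "rows9 = ?x" by (simp only: comp rows9_def rels9_def combs9_def)

schematic_goal leads_rows9: "vset (map vlead rows9) = ?x" by (simp only: comp rows9)

schematic_goal nonleads9: "nonleads (exps 5 9) (vset (map vlead rows9)) = ?x" by (simp only: comp leads_rows9)

text \<open>The generators are as many as the members of the detected family, so both bounds are
  sharp.\<close>

lemma length_nonleads9: "length (nonleads (exps 5 9) (vset (map vlead rows9))) = 191"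
  unfolding nonleads9 by simp

lemma rows9_elem: "v \<in> set rows9 \<Longrightarrow> (\<exists>r. v = sq_row r) \<or> (\<exists>r. v = vsum sq_row r)"
  unfolding rows9_def by auto

section \<open>Degree 23: targets, tests and functionals\<close>

definition tg23 :: "nat \<Rightarrow> nat list list" where
  "tg23 t = (if t = 0 then [[15,7,1]] else [[15,3,3,2],[15,3,4,1],[15,5,2,1],[15,6,1,1]])"

lemma tg23: "tg23 0 = [[15,7,1]]" "tg23 1 = [[15,3,3,2],[15,3,4,1],[15,5,2,1],[15,6,1,1]]"
  by (simp_all add: tg23_def)

schematic_goal tg23_0: "tg23 0 = ?x"
  by (rule trans[OF tg23(1)]) (simp only: num_unary)
schematic_goal tg23_1: "tg23 1 = ?x"
  by (rule trans[OF tg23(2)]) (simp only: num_unary)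

lemmas tg23_unary = tg23_0 tg23_1

definition kn23 :: "nat \<Rightarrow> bool" where "kn23 t \<longleftrightarrow> t \<in> set [0,1]"

lemma kn23_iff: "kn23 t \<longleftrightarrow> t \<in> set [0,1]" by (simp only: kn23_def)

lemma kn23: "kn23 0" "kn23 1"
  by (simp_all add: kn23_def)

text \<open>For target 0 the functional is again linear in the row of exponent 1. For target 1 the
  first two rows are fixed, and the seven choices of the other two satisfy a relation on the
  tests.\<close>

definition R23 :: "nat \<Rightarrow> nat list list" where
  "R23 t = (if t = 0 then [[1,2,4],[1,2,8],[1,2,12]]
    else [[16,2,10,5],[16,2,6,7],[16,2,13,12],[16,2,12,5],[16,2,9,8],[16,2,4,12],[16,2,11,4]])"

lemma R23: "R23 0 = [[1,2,4],[1,2,8],[1,2,12]]"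
    "R23 1 = [[16,2,10,5],[16,2,6,7],[16,2,13,12],[16,2,12,5],[16,2,9,8],[16,2,4,12],[16,2,11,4]]"
  by (simp_all add: R23_def)

lemma ann23_0: "annihilates_hits (tg23 0)"
  unfolding tg23
  by (rule annihilates_hits_pad, rule annihilates_hits[where d = 23]) (auto simp: preds1_unary numeral_eq_Suc)

text \<open>The last three exponents cancel as for \<open>tg9 3\<close>; the exponent 15 has itself
  as its only predecessor, like the 1 there.\<close>

lemma ann23_1: "annihilates_hits (tg23 1)"
  unfolding tg23
  by (rule annihilates_hits_pad, rule annihilates_hits[where d = 23]) (auto simp: preds1_unary numeral_eq_Suc)

lemmas ann23 = ann23_0 ann23_1

definition b23_3_a :: "nat list list" where
  "b23_3_a = [[7,3,6,4],[7,3,6,1],[7,3,6,2],[7,3,5,2],[7,3,5,4],[7,3,5,1],[7,3,3,1],[7,3,3,2],[7,5,6,1],[7,5,6,4],[7,6,6,2],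
  [7,6,6,4],[7,5,5,4],[7,5,5,1]]"

definition T23_3 :: "nat list list list" where
  "T23_3 = [b23_3_a]"

definition K23_3 :: "nat list list list" where
  "K23_3 = [[[0,5,2,1]],[[0,3,5,1]],[[0,2,5,1]],[[0,6,1,2]],[[0,5,2,1],[0,5,3,1]],[[0,1,6,2]],[[0,1,2,4]],[[0,2,1,4]],
  [[0,3,4,1]],[[0,4,3,1]],[[0,2,4,1]],[[0,4,2,1]],[[0,4,1,2]],[[0,1,4,2]]]"

lemmas blocks23_3 = b23_3_a_def

lemmas fnd23_3 = b23_3_a_def[THEN fnd_block]

schematic_goal leads23_3: "map (\<lambda>C. fndb (map (pref tg23 (Suc (Suc (Suc 0)))) C) (Suc (Suc (Suc 0))) T23_3) K23_3 = ?x"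
  by (simp only: low tg23_unary T23_3_def fnd23_3 K23_3_def)

lemma ok23_3: "list_all (list_all (okref tg23 kn23 (Suc (Suc (Suc 0))))) K23_3"
  by (simp only: low tg23_unary kn23 K23_3_def)

schematic_goal some23_3: "map Some (concat T23_3) = ?x"
  by (simp only: list.map concat.simps append.simps T23_3_def blocks23_3)

lemma leads23_3_eq: "map (\<lambda>C. fndb (map (pref tg23 (Suc (Suc (Suc 0)))) C) (Suc (Suc (Suc 0))) T23_3) K23_3 = map Some (concat T23_3)"
  by (rule trans[OF leads23_3 some23_3[symmetric]])

lemma good23_3: "list_all (\<lambda>t. good (Suc (Suc (Suc (Suc (Suc (Suc (Suc (Suc (Suc (Suc (Suc (Suc (Suc (Suc (Suc (Suc (Suc (Suc (Suc (Suc (Suc (Suc (Suc 0))))))))))))))))))))))) (bit_exps (Suc (Suc (Suc 0))) (map (bits (Suc (Suc (Suc 0)))) t))) (concat T23_3)"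
  by (simp only: low T23_3_def blocks23_3)

lemma dist23_3: "dist (map (\<lambda>t. concat (map (bits (Suc (Suc (Suc 0)))) t)) (concat T23_3)) VZ"
  by (simp only: low T23_3_def blocks23_3)

lemma rel23_3: "list_all (\<lambda>t. list_all (\<lambda>m. fndb (map (\<lambda>us. (forms (Suc (Suc (Suc 0))) (map (compress m) (map (bits (Suc (Suc (Suc (Suc (Suc 0)))))) us)), tg23 t)) (R23 t)) (Suc (Suc (Suc 0))) T23_3 = None) (masks (Suc (Suc (Suc (Suc (Suc 0))))) (Suc (Suc (Suc 0))))) [0,1]"
  by (simp only: low tg23_unary R23 T23_3_def fnd23_3)

lemma len23_3: "length (concat T23_3) = 14"
  by (simp add: T23_3_def blocks23_3)

definition b23_4_a :: "nat list list" where
  "b23_4_a = [[14,5,6,8],[14,6,15],[14,6,10,1],[14,5,6,2],[14,5,6,1],[14,5,6,4],[14,3,6,4],[14,10,15],[14,9,10,4],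
  [14,6,12,1],[14,9,6,1],[14,3,6,1],[14,9,12,4],[14,9,6,8],[14,3,6,2],[14,9,10,2],[14,9,12,1],[14,9,10,1],
  [14,9,12,8],[14,9,10,8]]"

definition b23_4_b :: "nat list list" where
  "b23_4_b = [[14,5,10,8],[14,5,10,1],[14,3,10,8],[14,3,10,1],[14,12,12,1],[14,5,12,1],[14,5,10,2],[14,5,12,4],[14,3,10,2],
  [14,5,9,1],[14,3,9,1],[14,9,9,1],[14,3,5,1],[14,5,5,1],[14,3,3,1],[14,5,9,2],[14,3,3,4],[14,5,5,8],[14,5,5,4],
  [14,3,9,8]]"

definition b23_4_c :: "nat list list" where
  "b23_4_c = [[14,3,3,2],[14,9,9,8],[11,15,1,2],[11,3,9,4],[7,3,9,4],[7,15,1,2],[13,3,6,1],[7,15,2,1],[11,3,5,8],[11,3,3,4],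
  [13,3,3,2],[7,5,15],[13,15,4,1],[11,15,1,8],[13,3,12,1],[7,6,10,1],[7,6,15],[7,9,6,2],[13,3,6,8],[11,3,6,8]]"

definition b23_4_d :: "nat list list" where
  "b23_4_d = [[13,3,10,8],[11,5,6,2],[13,3,10,2],[11,15,2,2],[13,15,14],[13,10,15],[11,15,13],[13,15,13],[13,12,15],
  [7,15,14],[13,6,12,1],[11,10,15],[7,10,10,1],[11,5,10,4],[7,15,4,8],[7,5,9,4],[7,15,4,4],[13,9,10,8],
  [14,15,14],[14,15,4,8]]"

definition b23_4_e :: "nat list list" where
  "b23_4_e = [[14,15,4,2],[14,15,4,4],[11,6,12,4],[13,6,6,4],[7,10,10,4],[11,10,12,4],[11,6,12,8],[7,6,10,2],[13,6,6,8],
  [13,10,10,2],[7,10,10,2],[11,10,12,8],[13,10,12,8],[11,15,1,1],[11,3,5,1],[11,5,9,1],[13,15,1,1],[7,15,1,1],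
  [7,3,9,1]]"

definition T23_4 :: "nat list list list" where
  "T23_4 = [b23_4_a,b23_4_b,b23_4_c,b23_4_d,b23_4_e]"

definition K23_4 :: "nat list list list" where
  "K23_4 = [[[0,12,3,4]],[[0,13,2,5]],[[0,3,12,4]],[[0,3,4,8]],[[0,5,3,8]],[[0,4,3,8]],[[0,5,2,8]],[[0,7,8,2]],
  [[1,13,15,8,9]],[[1,5,15,2,3]],[[1,11,15,1,9]],[[1,3,4,1,12]],[[0,5,8,2]],[[0,10,5,2]],[[0,2,5,8]],
  [[0,3,8,4]],[[0,9,5,2]],[[0,9,3,4]],[[0,8,5,2]],[[0,8,3,4]],[[0,9,6,2]],[[1,7,14,6,4]],[[0,9,2,4]],
  [[1,3,8,1,7]],[[0,9,4,2]],[[1,5,9,4,6]],[[0,6,9,2]],[[0,4,9,2]],[[0,2,9,4]],[[1,13,1,9,6]],[[1,11,1,2,13]],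
  [[1,9,1,4,6]],[[1,7,1,5,13]],[[1,5,4,3,12]],[[1,3,1,9,7]],[[1,14,7,8,2]],[[1,6,13,12,2]],[[1,12,1,4,7]],
  [[1,4,5,15,7]],[[1,10,1,14,8]],[[1,2,3,7,9]],[[1,8,1,5,6]],[[0,14,1,6]],[[0,13,3,1]],[[0,5,10,1]],
  [[0,11,5,1]],[[0,11,6,1]],[[0,13,2,1]],[[0,9,6,1]],[[0,6,1,8]],[[0,10,1,4]],[[0,11,4,1]],[[1,5,12,11,1]],
  [[1,9,5,7,1]],[[1,9,13,2,1]],[[0,3,12,1]],[[1,14,4,7,5]],[[1,10,14,7,5]],[[1,14,1,4,6],[1,14,7,8,2]],
  [[1,10,15,8,1]],[[1,14,8,5,9]],[[1,6,15,2,7]],[[1,6,14,3,7]],[[0,2,13,1]],[[0,7,8,1]],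
  [[0,3,12,1],[1,11,7,3,1]],[[1,9,5,7,1],[1,13,8,15,12]],[[1,5,12,11,1],[1,13,4,7,12]],[[1,15,8,4,1]],
  [[1,7,11,4,1]],[[1,5,8,14,4],[1,9,13,2,1]],[[1,11,8,7,1]],[[1,3,11,7,2]],[[0,12,3,1]],[[1,12,9,14,1]],
  [[0,12,1,2]],[[0,4,11,1]],[[0,8,7,1]],[[1,14,4,12,7]],[[1,12,4,7,1]],[[1,6,2,13,1]],[[1,4,8,10,1]],
  [[0,6,10,1]],[[0,4,10,1]],[[0,12,2,1]],[[0,6,8,1]],[[0,10,6,1]],[[0,2,12,1]],[[0,10,4,1]],[[1,10,2,6,15]],
  [[1,2,8,6,9]],[[0,8,6,1]],[[1,8,4,7,5]],[[0,1,14,6]],[[0,1,6,8]],[[0,1,12,2]],[[0,1,14,4]],[[1,1,5,6,10]],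
  [[0,1,10,4]]]"

lemmas blocks23_4 = b23_4_a_def b23_4_b_def b23_4_c_def b23_4_d_def b23_4_e_def

lemmas fnd23_4 = b23_4_a_def[THEN fnd_block] b23_4_b_def[THEN fnd_block] b23_4_c_def[THEN fnd_block] b23_4_d_def[THEN fnd_block] b23_4_e_def[THEN fnd_block]

schematic_goal leads23_4: "map (\<lambda>C. fndb (map (pref tg23 (Suc (Suc (Suc (Suc 0))))) C) (Suc (Suc (Suc (Suc 0)))) T23_4) K23_4 = ?x"
  by (simp only: low tg23_unary T23_4_def fnd23_4 K23_4_def)

lemma ok23_4: "list_all (list_all (okref tg23 kn23 (Suc (Suc (Suc (Suc 0)))))) K23_4"
  by (simp only: low tg23_unary kn23 K23_4_def)

schematic_goal some23_4: "map Some (concat T23_4) = ?x"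
  by (simp only: list.map concat.simps append.simps T23_4_def blocks23_4)

lemma leads23_4_eq: "map (\<lambda>C. fndb (map (pref tg23 (Suc (Suc (Suc (Suc 0))))) C) (Suc (Suc (Suc (Suc 0)))) T23_4) K23_4 = map Some (concat T23_4)"
  by (rule trans[OF leads23_4 some23_4[symmetric]])

lemma good23_4: "list_all (\<lambda>t. good (Suc (Suc (Suc (Suc (Suc (Suc (Suc (Suc (Suc (Suc (Suc (Suc (Suc (Suc (Suc (Suc (Suc (Suc (Suc (Suc (Suc (Suc (Suc 0))))))))))))))))))))))) (bit_exps (Suc (Suc (Suc (Suc 0)))) (map (bits (Suc (Suc (Suc (Suc 0))))) t))) (concat T23_4)"
  by (simp only: low T23_4_def blocks23_4)

lemma dist23_4: "dist (map (\<lambda>t. concat (map (bits (Suc (Suc (Suc (Suc 0))))) t)) (concat T23_4)) VZ"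
  by (simp only: low T23_4_def blocks23_4)

lemma rel23_4: "list_all (\<lambda>t. list_all (\<lambda>m. fndb (map (\<lambda>us. (forms (Suc (Suc (Suc (Suc 0)))) (map (compress m) (map (bits (Suc (Suc (Suc (Suc (Suc 0)))))) us)), tg23 t)) (R23 t)) (Suc (Suc (Suc (Suc 0)))) T23_4 = None) (masks (Suc (Suc (Suc (Suc (Suc 0))))) (Suc (Suc (Suc (Suc 0)))))) [0,1]"
  by (simp only: low tg23_unary R23 T23_4_def fnd23_4)

lemma len23_4: "length (concat T23_4) = 99"
  by (simp add: T23_4_def blocks23_4)

definition b23_5_a :: "nat list list" where
  "b23_5_a = [[26,15,4,16],[28,15,8,16],[28,15,8,1],[28,15,8,2],[28,27,8,2],[28,15,8,4],[28,15,8,8],[28,9,10,2],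
  [28,27,8,16],[28,27,8,8],[28,27,8,1],[28,27,8,4],[28,9,10,16],[28,9,10,8],[28,9,10,1],[28,9,10,4],
  [28,10,12,1],[28,10,10,1],[28,3,10,1],[28,10,29]]"

definition b23_5_b :: "nat list list" where
  "b23_5_b = [[28,29,11],[28,15,25],[28,27,13],[28,17,15],[28,17,10,4],[28,12,27],[28,9,17,2],[28,9,27],[28,27,14],
  [28,15,26],[28,18,15],[28,24,15],[28,30,11],[28,5,27],[28,23,11],[28,27,7],[28,27,1,2],[28,27,11],[28,3,27],
  [28,27,2,8]]"

definition b23_5_c :: "nat list list" where
  "b23_5_c = [[28,3,10,16],[28,15,19],[28,17,10,16],[28,15,16,2],[28,27,4,2],[28,27,2,2],[28,15,1,16],[28,30,13],[28,15,28],
  [28,5,30],[28,15,22],[28,23,1,8],[28,23,4,8],[28,23,14],[28,29,8,2],[28,30,7],[28,29,1,2],[28,15,21],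
  [28,23,1,2],[28,15,16,4]]"

definition b23_5_d :: "nat list list" where
  "b23_5_d = [[28,29,7],[28,23,13],[28,18,12,1],[28,3,9,16],[28,27,2,16],[28,5,17,2],[28,23,1,4],[28,23,1,1],[28,5,10,4],
  [28,5,10,2],[28,12,15],[22,29,8,2],[28,15,14],[28,10,15],[28,15,2,1],[28,15,2,4],[28,15,11],[28,3,15],
  [28,6,15],[28,3,5,8]]"

definition b23_5_e :: "nat list list" where
  "b23_5_e = [[28,15,2,2],[28,5,15],[28,15,13],[28,15,7],[28,3,6,8],[28,9,9,2],[28,15,1,4],[28,15,1,1],[28,15,4,4],
  [28,6,12,1],[28,3,9,1],[28,3,24,2],[28,3,24,8],[28,3,10,2],[28,27,25],[28,27,19],[28,17,27],[28,27,26],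
  [28,27,16,2],[28,23,26]]"

definition b23_5_f :: "nat list list" where
  "b23_5_f = [[28,29,26],[28,29,19],[28,30,19],[28,29,2,16],[28,29,16,2],[28,29,22],[28,23,28],[28,23,8,16],[28,23,25],
  [28,30,25],[28,15,16,16],[28,30,1,16],[28,27,4,1],[28,27,16,1],[28,27,1,1],[28,23,1,16],[28,27,16,16],
  [14,29,16,2],[22,29,8,4],[14,27,16,4]]"

definition b23_5_g :: "nat list list" where
  "b23_5_g = [[14,30,16,1],[26,27,4,16],[22,24,23],[22,27,16,4],[26,29,4,16],[22,5,24,16],[28,5,23],[28,5,6,1],[28,23,4,2],
  [28,5,6,2],[28,5,6,16],[28,23,4,16],[28,23,4,4],[28,5,6,4],[22,9,24,2],[22,9,24,4],[26,29,16,2],[22,3,24,16],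
  [22,29,8,1],[26,9,20,1]]"

definition b23_5_h :: "nat list list" where
  "b23_5_h = [[22,30,8,1],[26,15,4,4],[26,15,4,8],[26,15,4,1],[14,27,16,1],[26,15,4,2],[14,27,16,16],[22,5,24,8],
  [26,29,4,1],[22,29,16,4],[26,29,16,1],[26,17,12,2],[26,5,12,8],[26,5,24,1],[26,29,16,8],[22,17,24,16],
  [14,27,16,2],[26,5,20,4],[26,5,20,2],[28,3,5,4]]"

definition b23_5_i :: "nat list list" where
  "b23_5_i = [[28,3,5,2],[28,3,6,16],[28,3,20,16],[26,5,20,16],[28,3,5,16],[14,17,24,4],[26,9,12,16],[14,29,8,1],
  [14,29,8,8],[14,24,15],[26,9,12,2],[26,15,8,1],[14,10,24,1],[26,15,8,8],[26,15,8,2],[26,15,13],[26,15,1,8],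
  [26,5,15],[26,5,17,8],[26,5,10,16]]"

definition b23_5_j :: "nat list list" where
  "b23_5_j = [[26,27,21],[26,15,1,16],[26,5,27],[26,23,1,8],[26,27,13],[26,15,21],[22,24,15],[26,30,1,1],[26,29,1,1],
  [26,15,1,1],[26,5,9,4],[26,5,10,1],[26,5,9,1],[26,5,6,8],[22,27,8,4],[26,23,4,4],[28,3,5,1],[28,23,7],
  [28,6,23],[28,23,19]]"

definition b23_5_k :: "nat list list" where
  "b23_5_k = [[28,23,22],[28,23,21],[28,6,20,1],[28,3,3,4],[28,3,17,1],[26,17,20,1],[28,17,18,2],[28,23,16,2],[28,3,17,16],
  [28,3,17,2],[22,29,16,16],[28,23,16,16],[28,3,6,2],[28,3,3,2],[28,18,18,1],[28,3,3,1],[26,23,4,1],[28,3,18,2],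
  [28,23,2,2],[26,9,6,1]]"

definition b23_5_l :: "nat list list" where
  "b23_5_l = [[26,23,16,1],[22,27,16,16],[26,3,5,16],[26,3,5,1],[26,5,6,1],[26,5,17,2],[26,23,1,1],[26,5,5,4],[26,5,17,1],
  [26,5,6,4],[26,15,14],[26,3,6,4],[26,15,2,8],[26,18,23],[26,5,10,2],[26,5,6,2],[26,5,18,2],[26,23,19],
  [26,23,7],[26,23,11]]"

definition b23_5_m :: "nat list list" where
  "b23_5_m = [[26,30,19],[26,27,22],[26,3,6,2],[26,15,7],[26,3,15],[26,27,7],[26,23,2,16],[26,23,1,2],[26,15,22],
  [26,3,20,2],[26,3,5,2],[26,27,4,2],[26,23,2,4],[26,15,2,2],[26,23,2,2],[26,15,11],[26,15,2,1],[22,15,1,4],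
  [14,23,1,1],[22,15,1,2]]"

definition b23_5_n :: "nat list list" where
  "b23_5_n = [[14,27,1,4],[22,27,1,1],[22,9,6,4],[14,29,1,4],[14,9,18,4],[22,15,16,4],[14,23,8,2],[22,15,4,4],[22,23,8,1],
  [14,17,6,1],[22,29,1,1],[14,29,2,8],[14,17,18,1],[22,9,18,2],[22,15,16,16],[14,9,10,16],[14,17,17,2],
  [22,3,9,2],[14,30,1,2],[22,9,9,1]]"

definition b23_5_o :: "nat list list" where
  "b23_5_o = [[22,9,17,4],[22,9,17,8],[22,3,20,8],[22,23,1,8],[14,17,20,1],[14,29,21],[14,23,11],[14,6,23],[14,23,7],
  [22,27,7],[14,23,13],[14,30,21],[14,23,14],[14,29,4,8],[14,9,20,8],[14,23,4,2],[14,5,18,4],[14,29,4,4],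
  [14,27,2,1],[22,15,2,2]]"

definition b23_5_p :: "nat list list" where
  "b23_5_p = [[14,3,18,2],[25,30,4,1],[25,30,4,4],[21,29,8,2],[13,29,16,2],[13,30,16,2],[21,12,24,2],[13,30,16,8],
  [21,30,8,2],[19,30,8,4],[19,30,8,8],[7,10,12,16],[19,30,4,2],[13,30,22],[21,6,12,4],[11,12,24,16],[7,12,24,2],
  [13,6,24,4],[21,18,12,2],[21,18,12,8]]"

definition b23_5_q :: "nat list list" where
  "b23_5_q = [[19,10,20,16],[11,18,24,4],[25,18,30],[19,30,2,16],[19,30,2,2],[11,20,24,16],[7,6,24,4],[13,6,18,4],
  [11,12,24,8],[21,30,16,16],[11,15,4,16],[13,5,30],[13,17,30],[13,30,19],[13,27,22],[13,3,24,4],[13,9,30],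
  [21,30,11],[25,3,20,4],[7,29,28]]"

definition b23_5_r :: "nat list list" where
  "b23_5_r = [[7,20,29],[25,17,30],[13,30,11],[21,30,7],[13,5,24,2],[21,30,4,1],[21,30,2,1],[7,24,24,1],[21,9,20,2],
  [11,23,4,16],[25,5,18,8],[11,6,23],[13,27,14],[25,3,6,4],[7,5,18,8],[19,29,4,8],[25,15,4,8],[13,23,4,16],
  [19,5,12,16],[19,5,24,16]]"

definition b23_5_s :: "nat list list" where
  "b23_5_s = [[7,29,4,2],[11,6,18,1],[19,29,4,2],[13,27,16,2],[19,9,20,2],[13,27,4,2],[25,23,16,8],[21,15,8,16],[7,27,16,2],
  [25,17,20,2],[11,29,8,2],[13,9,18,2],[13,23,8,8],[13,23,4,4],[19,15,2,2],[11,29,28],[25,23,16,16],[13,27,8,8],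
  [7,23,4,8],[11,5,5,16]]"

definition b23_5_t :: "nat list list" where
  "b23_5_t = [[11,23,7],[13,23,7],[7,27,19],[21,27,19],[25,23,7],[21,29,7],[11,3,17,4],[11,5,18,1],[19,5,5,8],[21,9,9,2],
  [11,29,16,1],[19,15,11],[25,15,11],[11,3,20,1],[21,3,9,16],[21,27,1,16],[21,15,13],[25,9,15],[25,23,21],
  [11,23,25]]"

definition b23_5_u :: "nat list list" where
  "b23_5_u = [[19,29,13],[11,5,27],[11,17,12,1],[25,23,1,16],[11,29,1,4],[19,15,13],[21,23,13],[7,27,21],[21,9,27],
  [7,29,4,1],[7,27,2,1],[13,27,1,8],[7,27,1,1],[7,9,17,1],[7,29,1,1],[13,3,17,1],[13,27,1,1],[25,3,5,1],
  [25,23,1,1]]"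

definition T23_5 :: "nat list list list" where
  "T23_5 = [b23_5_a,b23_5_b,b23_5_c,b23_5_d,b23_5_e,b23_5_f,b23_5_g,b23_5_h,b23_5_i,b23_5_j,b23_5_k,b23_5_l,b23_5_m,
  b23_5_n,b23_5_o,b23_5_p,b23_5_q,b23_5_r,b23_5_s,b23_5_t,b23_5_u]"

definition K23_5_a :: "nat list list list" where
  "K23_5_a = [[[0,20,11,3]],[[0,24,7,8]],[[0,7,8,16]],[[0,10,7,16]],[[0,19,8,4]],[[0,12,7,16]],[[0,8,7,16]],
  [[1,10,21,3,12]],[[0,24,11,4]],[[0,8,19,4]],[[0,8,19,4],[1,9,12,19,10]],[[0,8,19,4],[1,12,28,10,19]],
  [[1,24,30,3,11]],[[1,8,25,15,4]],[[1,10,21,3,12],[1,11,7,15,21]],[[1,8,25,15,4],[1,12,19,16,9]],[[0,9,6,16]],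
  [[0,9,18,4]],[[1,7,11,2,16]],[[0,9,18,4],[0,13,18,4]],[[0,11,21,5]],[[0,11,20,4]],
  [[0,8,19,4],[1,8,25,15,4],[1,9,12,19,10],[1,12,28,10,19],[1,13,7,23,2]],[[1,23,16,24,28]],[[0,22,9,4]],
  [[0,26,5,8]],[[0,26,11,4]],[[0,26,11,4],[1,19,13,16,22]],[[0,9,18,4],[1,31,2,13,8]],[[0,14,17,4]],
  [[1,7,11,2,16],[1,23,11,14,12],[1,23,16,24,28]],
  [[0,9,19,4],[0,11,21,5],[0,13,19,4],[0,14,17,6],[0,24,11,4],[0,26,5,10],[0,28,15,4]],
  [[0,9,6,16],[0,11,20,4],[0,11,22,4]],[[1,23,4,29,12]],
  [[0,11,17,4],[0,11,21,5],[0,12,19,4],[0,13,18,4],[0,13,19,4],[0,14,17,6],[0,15,18,4],[0,26,5,10],[0,28,15,4],[0,29,14,4],[1,19,13,16,22]],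
  [[1,7,16,10,22]],[[1,19,22,29,17]],[[1,27,18,25,28]],[[0,19,8,4],[0,19,10,4],[1,7,11,2,16]],
  [[0,26,11,4],[1,8,25,15,4],[1,10,21,3,12],[1,24,30,3,11],[1,26,3,6,13]],[[0,18,9,4]],[[1,19,15,26,17]],
  [[0,25,14,7],[1,25,30,14,31]],[[1,18,27,30,22]],[[0,6,25,8]],[[0,18,9,4],[0,18,11,4]],[[0,17,14,4]],
  [[0,27,4,11]],[[0,27,4,11],[1,13,20,4,14]],[[0,19,8,4],[0,19,12,4],[1,23,4,29,12]],
  [[1,18,27,30,22],[1,22,4,24,25]],[[1,9,4,27,11]],[[1,30,23,4,3]],
  [[0,11,18,4],[0,11,22,4],[0,15,18,4],[0,15,22,4],[0,27,4,11],[1,9,4,27,11],[1,13,20,4,14]],[[0,10,21,5]],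
  [[1,7,16,24,3]],[[0,19,9,4],[0,19,10,4],[1,19,13,16,22]],[[0,17,14,4],[0,21,14,4]],[[0,22,5,8]],[[0,20,11,4]],
  [[0,21,10,5]],
  [[0,17,14,4],[0,19,9,4],[0,19,10,4],[0,20,11,4],[0,21,14,4],[1,7,16,24,3],[1,18,27,30,22],[1,19,13,16,22],[1,19,15,26,17],[1,22,4,24,25],[1,23,4,29,12],[1,23,19,31,10]],
  [[0,11,21,5],[0,15,17,5],[0,20,11,4],[0,26,5,8],[0,26,11,4],[0,27,4,11],[1,30,23,4,3]],[[0,17,10,4]],
  [[0,6,25,8],[0,22,9,4],[0,22,15,4]],[[0,19,7,8]],[[0,5,19,8]],[[0,17,7,8]],[[0,6,9,16]],
  [[0,9,6,16],[0,11,6,16]],[[0,11,4,16]],[[0,26,15,2]],[[0,9,18,4],[1,15,13,20,29]],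
  [[0,9,6,16],[0,11,6,16],[1,7,11,2,16],[1,8,11,16,14],[1,11,7,15,21],[1,13,14,8,16],[1,14,3,26,18]],
  [[1,7,11,21,4],[1,7,16,24,3]],[[0,6,9,16],[0,6,11,16]],[[1,14,15,17,25]],
  [[0,9,19,4],[0,10,21,5],[0,11,4,16],[1,7,11,2,16],[1,8,25,15,4],[1,9,4,27,11],[1,9,12,19,10],[1,10,21,3,12],[1,11,7,15,21]],
  [[0,6,9,16],[0,7,8,16],[0,7,11,16]],
  [[0,9,18,4],[0,9,19,4],[1,8,25,15,4],[1,9,4,27,11],[1,9,12,19,10],[1,12,19,16,9],[1,13,14,8,16],[1,15,13,20,29]],
  [[0,6,11,16],[0,11,6,16],[0,13,18,4],[0,13,22,6],[1,13,20,4,14],[1,15,13,20,29]],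
  [[0,11,4,16],[0,11,5,16],[1,14,15,17,25]],
  [[0,7,8,16],[0,8,7,16],[0,10,7,16],[0,12,7,16],[0,13,18,4],[0,13,22,6],[1,7,11,2,16],[1,7,11,21,4],[1,7,16,24,3],[1,8,25,15,4],[1,9,4,27,11],[1,9,13,28,30],[1,12,19,16,9],[1,13,14,8,16],[1,13,20,4,14]],
  [[0,9,6,16],[0,9,19,4],[0,11,4,16],[0,11,6,16],[0,13,18,4],[0,13,22,6],[0,21,10,5],[0,26,5,8],[1,7,11,21,4],[1,7,16,24,3],[1,8,25,15,4],[1,9,4,27,11],[1,9,12,19,10],[1,10,21,3,12],[1,11,7,15,21],[1,12,19,16,9],[1,13,14,8,16],[1,13,20,4,14],[1,14,3,26,18],[1,15,5,22,31],[1,15,13,20,29]],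
  [[0,10,5,16]],[[0,10,17,4]],[[0,5,11,16]],[[1,14,15,17,25],[1,15,30,16,11]],[[0,4,11,16]],[[0,5,10,16]],
  [[0,10,17,4],[1,11,10,26,12]],[[0,26,11,4],[1,26,21,20,31]],[[0,9,18,4],[1,11,9,6,29]],
  [[0,9,6,16],[0,9,18,4],[0,9,22,4],[1,9,4,27,11],[1,11,9,6,29]],[[0,11,16,4]],
  [[0,8,19,4],[0,11,16,4],[0,24,11,4],[1,8,25,15,4],[1,13,7,23,2],[1,13,20,4,14],[1,24,30,3,11],[1,29,16,22,12]],
  [[0,7,19,8],[0,11,18,4],[0,22,9,6],[0,22,15,4],[1,6,8,24,23],[1,7,11,2,16],[1,7,21,30,27],[1,11,9,6,29],[1,23,16,24,28],[1,27,18,25,28]],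
  [[0,10,5,16],[0,10,21,5],[0,26,5,8],[0,26,15,5]],
  [[0,6,9,16],[0,6,25,8],[0,8,19,4],[0,9,19,4],[0,10,19,4],[0,10,21,5],[0,19,9,4],[0,22,9,4],[0,22,15,4],[0,24,11,4],[0,26,15,2],[1,8,25,15,4],[1,10,21,3,12],[1,24,30,3,11],[1,26,3,6,13]],
  [[0,11,16,4],[0,15,16,4]]]"

definition K23_5_b :: "nat list list list" where
  "K23_5_b = [
  [[0,11,16,4],[0,11,18,4],[0,13,18,4],[0,15,18,5],[0,18,9,4],[1,11,9,6,29],[1,15,13,20,29],[1,18,27,30,22],[1,27,18,25,28],[1,31,2,13,8]],
  [[1,7,16,24,3],[1,23,19,12,20]],
  [[0,4,11,16],[0,5,10,16],[0,10,5,16],[0,15,17,5],[0,21,10,5],[0,26,15,5],[0,27,4,11],[1,15,30,16,11],[1,31,11,5,10]],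
  [[0,6,9,16],[0,9,6,16],[0,9,22,4],[0,11,16,4],[0,11,18,4],[0,15,22,6],[0,22,9,4],[0,31,6,9],[1,11,9,6,29],[1,27,18,25,28]],
  [[0,11,16,4],[0,15,16,4],[0,26,5,8],[0,26,11,4],[0,26,15,5],[1,7,16,24,3],[1,10,4,16,1],[1,23,19,12,20],[1,26,21,20,31]],
  [[0,11,4,16],[0,11,16,4],[0,11,20,4],[0,15,16,4],[0,27,4,11],[0,27,15,4]],[[1,13,20,4,14],[1,29,25,16,7]],
  [[1,9,4,27,11],[1,25,9,20,30]],
  [[0,8,19,4],[0,24,11,4],[1,8,25,15,4],[1,12,28,10,19],[1,13,20,4,14],[1,24,30,3,11],[1,28,11,12,1],[1,29,25,16,7]],
  [[0,25,7,11],[1,9,4,27,11],[1,9,12,19,10],[1,13,7,23,2],[1,25,30,14,31],[1,29,16,22,12],[1,29,25,16,7]],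
  [[0,5,11,16],[0,11,4,16],[0,11,5,16],[0,11,16,4],[0,11,20,4],[0,14,17,4],[0,14,21,5],[0,15,16,4],[0,26,5,8],[0,26,11,4],[0,26,15,5],[0,27,4,11],[0,27,15,4],[1,10,4,16,1],[1,14,15,17,25],[1,26,21,20,31],[1,30,23,4,3]],
  [[1,21,8,5,27]],[[0,5,10,16],[0,5,26,10]],[[1,17,11,1,21]],
  [[0,10,5,16],[0,10,21,5],[0,14,21,5],[0,17,10,4],[0,21,14,4],[0,27,4,11],[0,27,15,4],[1,10,4,16,1],[1,11,10,26,12],[1,26,21,20,31],[1,27,21,16,31]],
  [[0,7,17,8],[1,23,5,19,28]],[[0,16,11,4]],[[0,22,15,2]],[[0,12,21,2]],[[1,23,21,8,5]],[[0,25,14,2]],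
  [[0,28,15,3]],[[0,15,16,2]],[[1,20,5,27,9]],[[0,20,13,2]],[[0,17,12,2]],[[0,19,4,8]],[[1,7,4,12,17]],
  [[0,6,19,8]],[[1,5,15,12,20],[1,7,4,12,17]],[[0,20,7,8]],[[0,20,11,4],[0,20,15,4]],[[0,4,19,8]],
  [[1,4,7,23,27]],[[0,14,17,2]],[[0,12,17,2]],[[0,18,13,2]],[[1,19,17,28,20]],[[0,12,21,2],[0,13,21,2]],
  [[0,12,17,2],[0,13,17,2]],[[0,13,22,2]],[[1,12,2,19,11]],[[0,11,20,3]],[[0,20,11,3],[0,21,11,3]],
  [[1,27,21,24,26]],[[1,12,2,19,11],[1,14,12,7,27]],[[0,24,15,2]],[[0,13,20,2]],
  [[0,13,21,2],[0,20,13,2],[0,21,12,2]],[[0,13,16,2]],[[0,17,12,2],[0,17,13,2]],[[0,22,9,2]],[[0,9,20,2]],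
  [[0,21,9,2]],[[0,24,13,2]],[[0,16,13,2]],[[0,21,10,5],[1,21,8,18,16],[1,23,21,8,5]],[[0,6,17,8]],
  [[0,19,4,8],[0,19,6,8]],[[1,6,15,14,27]],
  [[0,6,11,16],[0,6,17,8],[0,6,25,8],[1,4,7,23,27],[1,5,15,12,20],[1,6,21,8,7],[1,7,4,12,17]],[[0,18,5,8]],
  [[0,17,6,8]],[[0,6,17,8],[1,23,5,19,28],[1,23,19,15,29],[1,23,19,31,10]],
  [[0,6,17,8],[0,19,4,8],[0,19,6,8],[0,20,7,8],[0,20,11,4],[0,20,15,4],[0,22,9,4],[0,22,13,4],[1,5,15,12,20],[1,7,4,12,17],[1,22,4,24,25]],
  [[0,20,9,2]],[[0,21,8,2]],[[0,9,20,2],[0,9,21,2]],[[0,8,21,2]],[[0,21,8,2],[0,23,8,2]],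
  [[0,8,21,2],[0,10,21,2]],[[0,9,21,2],[0,9,23,2]],[[0,9,20,2],[0,9,22,2]],[[1,10,9,22,8]],
  [[1,8,11,16,14],[1,8,25,15,4],[1,10,9,22,8]],[[0,13,3,16]],
  [[0,8,21,2],[0,9,20,2],[0,9,21,2],[0,10,21,2],[0,11,20,3],[0,11,21,3]],
  [[0,20,9,2],[0,21,8,2],[0,21,9,2],[0,22,9,2],[0,23,8,2],[0,23,9,2]],[[0,28,3,12]],[[1,28,30,1,13]],
  [[0,13,3,16],[0,28,3,12],[0,29,3,13]],
  [[0,16,13,2],[0,17,12,2],[0,17,13,2],[0,18,13,2],[1,19,16,28,23],[1,19,17,28,20]],
  [[0,12,17,2],[0,13,16,2],[0,13,17,2],[0,14,17,2],[1,15,30,29,19]],[[1,15,13,16,30]],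
  [[0,9,20,2],[0,9,21,2],[0,9,22,2],[0,9,23,2],[0,12,19,3],[0,12,21,2],[0,13,3,16],[0,13,16,2],[0,13,17,2],[0,13,21,2],[0,13,22,2],[0,14,19,3],[0,14,21,2],[0,15,20,3],[0,15,23,3],[0,20,9,2],[0,21,8,2],[0,22,9,2],[0,23,8,2],[0,23,9,2],[0,28,3,12],[0,29,3,8],[1,10,9,22,8],[1,12,2,19,11],[1,15,30,29,19],[1,21,29,9,31]],
  [[0,13,16,2],[0,13,18,2]],
  [[0,8,21,2],[0,9,20,2],[0,9,21,2],[0,10,21,2],[0,11,20,3],[0,11,21,3],[0,12,17,2],[0,13,17,2],[0,13,18,2],[0,13,20,2],[0,13,21,2],[0,13,22,2],[0,14,17,2],[0,16,13,2],[0,17,12,2],[0,17,13,2],[0,18,13,2],[0,20,11,3],[0,21,8,2],[0,21,11,3],[0,22,9,2],[0,23,8,2],[0,23,9,2],[0,23,13,3],[0,26,15,2],[1,12,2,19,11],[1,15,13,16,30],[1,15,30,29,19],[1,19,16,28,23],[1,19,17,28,20],[1,27,21,24,26]],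
  [[0,3,28,8]],[[0,28,3,12],[1,28,30,1,13],[1,29,1,27,19]],[[0,3,13,16]],[[0,12,3,16]],[[0,3,12,16]],
  [[0,12,3,16],[0,13,22,2],[1,13,23,27,21]],[[0,12,17,2],[0,12,19,3]],[[0,14,21,2],[0,14,23,2],[1,14,12,7,27]],
  [[0,4,19,8],[0,6,11,16],[0,6,19,8],[0,6,25,8],[0,20,11,4],[0,20,15,4],[0,22,13,4],[1,4,7,23,27],[1,6,15,14,27],[1,6,21,8,7],[1,22,4,24,25],[1,22,13,8,26]],
  [[0,7,8,16],[0,7,10,16],[1,6,15,14,27],[1,7,4,12,17],[1,7,11,2,16],[1,7,11,21,4],[1,7,16,24,3]],[[0,7,18,8]],
  [[0,4,19,8],[0,6,11,16],[0,6,19,8],[0,6,25,8],[0,7,8,16],[0,7,10,16],[0,17,6,8],[0,19,4,8],[0,19,6,8],[0,20,7,8],[0,22,5,8],[0,22,7,8],[1,4,7,23,27],[1,5,15,12,20],[1,6,15,14,27],[1,6,21,8,7],[1,7,11,2,16],[1,7,11,21,4],[1,7,16,24,3]],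
  [[0,7,16,8]]]"

definition K23_5_c :: "nat list list list" where
  "K23_5_c = [
  [[0,6,11,16],[0,6,19,8],[0,6,25,8],[0,7,18,8],[0,17,6,8],[0,19,7,8],[0,20,7,8],[0,22,5,8],[0,22,7,8],[0,22,9,4],[0,22,13,4],[1,6,21,8,7],[1,7,4,12,17],[1,22,4,24,25],[1,23,4,20,14],[1,23,5,19,28],[1,23,19,15,29],[1,23,19,31,10]],
  [[0,5,19,8],[0,7,8,16],[0,7,10,16],[0,13,21,2],[0,17,6,8],[0,17,7,8],[0,19,4,8],[0,20,11,4],[0,20,15,4],[0,21,12,2],[0,22,5,8],[0,22,9,4],[0,24,13,2],[1,4,7,23,27],[1,5,15,12,20],[1,6,15,14,27],[1,7,4,12,17],[1,7,11,2,16],[1,7,11,21,4],[1,7,16,24,3],[1,21,8,5,27],[1,21,26,19,22],[1,22,13,8,26],[1,23,5,19,28]],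
  [[0,5,18,8]],[[1,5,7,14,16]],[[0,17,6,8],[0,17,7,8],[1,17,21,14,5]],
  [[0,19,12,3],[0,19,13,2],[1,19,16,28,23],[1,19,17,28,20]],[[1,18,15,12,26]],[[0,18,5,8],[1,18,4,17,9]],
  [[1,18,19,11,5]],
  [[0,17,6,8],[0,17,7,8],[0,19,8,4],[0,19,10,4],[1,17,21,14,5],[1,18,15,12,26],[1,18,19,11,5],[1,19,15,26,17],[1,19,22,29,17],[1,19,26,17,20]],
  [[1,16,26,14,29]],[[0,16,7,8]],[[0,7,9,16],[0,7,11,16],[1,5,7,14,16],[1,7,11,2,16]],[[1,19,17,20,12]],
  [[0,17,6,8],[1,17,4,6,24]],
  [[0,3,13,16],[0,4,11,16],[0,5,10,16],[0,5,11,16],[0,6,17,8],[0,7,17,8],[0,7,19,8],[0,9,23,2],[0,10,5,16],[0,11,20,4],[0,11,21,5],[0,12,21,2],[0,13,17,2],[0,13,22,2],[0,14,17,6],[0,14,19,3],[0,14,21,2],[0,14,21,4],[0,14,23,2],[0,15,17,4],[0,15,20,4],[0,16,11,4],[0,18,5,8],[0,18,7,8],[0,19,4,8],[0,19,5,8],[0,19,6,8],[0,19,13,2],[0,20,7,8],[0,20,9,2],[0,20,13,2],[0,21,8,2],[0,21,10,4],[0,22,11,4],[0,22,15,4],[0,23,9,2],[0,25,12,2],[0,26,5,10],[0,27,5,8],[1,4,11,8,29],[1,5,15,12,20],[1,6,15,14,27],[1,7,4,12,17],[1,7,11,21,4],[1,7,16,10,22],[1,7,16,24,3],[1,7,20,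14,21],[1,10,4,16,1],[1,11,10,26,12],[1,13,23,27,21],[1,14,12,7,27],[1,14,15,17,25],[1,15,13,16,30],[1,15,30,16,11],[1,16,4,7,27],[1,17,4,6,24],[1,17,11,1,21],[1,17,21,14,5],[1,17,27,2,21],[1,18,19,11,5],[1,19,6,1,28],[1,19,17,20,12],[1,19,17,28,20],[1,20,13,4,14],[1,21,26,19,22],[1,22,2,15,18],[1,22,4,24,25],[1,23,19,15,29],[1,23,19,31,10],[1,26,21,20,31],[1,27,21,16,31],[1,30,23,4,3],[1,31,11,16,1]],
  [[0,6,19,8],[0,7,18,8],[0,18,7,8],[0,19,6,8],[0,21,10,4],[0,21,11,4],[1,21,8,5,27],[1,21,28,18,31],[1,21,29,9,31],[1,22,2,15,18]],
  [[0,7,9,16],[0,7,11,16],[0,21,10,5],[0,24,13,2],[0,24,15,2],[0,26,13,2],[0,26,15,2],[1,5,7,14,16],[1,7,11,2,16],[1,8,11,16,14],[1,8,25,15,4],[1,10,9,22,8],[1,21,8,18,16],[1,23,21,8,5]],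
  [[0,6,11,16],[0,8,21,2],[0,8,23,2],[0,9,6,16],[0,9,20,2],[0,9,22,4],[0,10,21,2],[0,11,6,16],[0,11,16,4],[0,11,18,4],[0,12,17,2],[0,12,19,3],[0,13,18,4],[0,13,20,2],[0,13,22,4],[0,14,19,3],[0,15,16,3],[0,15,18,4],[0,15,22,4],[0,16,11,4],[0,16,13,2],[0,18,5,8],[0,18,7,8],[0,18,9,4],[0,18,13,2],[0,19,12,3],[0,20,9,2],[0,22,15,4],[0,23,8,2],[0,25,6,8],[0,25,15,2],[0,29,3,8],[0,29,14,4],[1,9,4,27,11],[1,11,9,6,29],[1,12,2,19,11],[1,13,20,4,14],[1,14,12,7,27],[1,15,13,20,29],[1,18,15,12,26],[1,18,27,30,22],[1,19,17,20,12],[1,19,17,28,20],[1,25,9,20,30],[1,27,18,25,28],[1,29,3,7,12],[1,29,16,22,12],[1,31,2,13,8]],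
  [[0,21,8,2],[0,21,10,2]],[[1,17,2,30,1]],[[1,18,30,16,23]],[[0,22,3,8]],[[0,3,21,8]],[[0,3,20,8]],
  [[0,3,12,16],[1,3,28,21,25]],[[0,3,12,16],[0,3,13,16],[0,3,28,8],[0,3,29,8]],[[0,20,3,8]],
  [[0,20,3,8],[0,21,9,2],[1,21,29,9,31]],[[1,20,2,9,30]],[[0,13,2,16]],[[0,21,2,8]],
  [[0,9,20,2],[0,9,22,2],[0,11,20,3],[0,11,22,3]],[[0,13,2,16],[0,29,2,13]],
  [[0,29,3,13],[1,29,1,27,19],[1,31,29,30,16]],[[0,21,2,8],[0,22,3,8],[1,20,2,9,30],[1,22,23,10,2]],
  [[0,13,2,16],[0,17,13,2],[0,17,15,2],[0,29,2,13],[1,19,17,20,12],[1,19,17,28,20]],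
  [[1,17,2,30,1],[1,19,2,11,14],[1,19,17,28,20]],[[0,13,16,2],[0,13,18,2],[0,15,16,2],[0,15,18,2]],
  [[0,21,8,2],[0,21,10,2],[0,23,8,2],[0,23,10,2]],
  [[0,12,21,2],[0,13,20,2],[0,20,13,2],[0,21,8,2],[0,21,10,2],[0,21,12,2],[0,23,8,2],[0,23,10,2],[0,24,13,2],[0,24,15,2],[0,25,14,2],[0,25,15,3],[0,26,13,2],[0,26,15,2],[1,17,2,30,1],[1,19,2,11,14],[1,19,17,28,20],[1,27,21,24,26]],
  [[0,12,17,2],[0,12,19,3],[0,14,17,2],[0,14,19,2],[0,17,13,2],[0,17,15,2],[0,29,2,13],[0,29,3,13],[1,19,17,20,12],[1,19,17,28,20],[1,29,1,27,19],[1,31,29,30,16]],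
  [[0,2,21,8]],
  [[0,8,21,2],[0,8,23,2],[0,13,16,2],[0,13,18,2],[0,13,21,2],[0,13,23,2],[0,15,16,3],[0,15,18,2],[0,15,21,2],[0,15,23,3],[1,10,9,22,8]],
  [[0,2,13,16],[0,8,21,2],[0,8,23,2],[0,12,17,2],[0,12,19,3],[0,13,20,2],[0,13,22,2],[0,15,20,3],[0,15,22,2],[1,10,9,22,8],[1,12,2,19,11],[1,14,12,7,27]],
  [[0,3,21,8],[0,5,18,8],[0,6,17,8],[0,6,19,8],[0,7,18,8],[0,13,16,2],[0,13,18,2],[0,13,20,2],[0,13,21,2],[0,13,23,2],[0,15,16,3],[0,15,18,2],[0,15,21,2],[0,15,23,3],[0,17,6,8],[0,18,5,8],[0,18,7,8],[0,19,6,8],[0,20,13,2],[0,21,2,8],[0,21,3,8],[0,21,8,2],[0,21,10,2],[0,21,10,4],[0,21,11,4],[0,23,8,2],[0,23,10,2],[0,25,12,2],[0,25,14,2],[0,25,15,2],[1,20,2,9,30],[1,21,8,5,27],[1,21,25,23,3],[1,21,28,18,31],[1,21,29,9,31],[1,22,23,10,2],[1,23,5,19,28],[1,23,19,15,29],[1,23,19,31,10],[1,23,21,8,5],[1,27,21,24,26]],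
  [[0,16,11,4],[1,16,9,27,31],[1,18,30,16,23]],
  [[0,13,3,16],[0,13,17,2],[0,13,19,3],[0,13,22,2],[1,13,23,27,21],[1,15,13,16,30]],
  [[0,3,21,8],[0,3,28,12],[0,13,3,16],[0,13,17,2],[0,13,22,2],[0,19,13,2],[0,29,2,8],[1,3,20,10,22],[1,13,23,27,21],[1,15,13,16,30],[1,28,30,1,13],[1,29,1,27,19],[1,30,15,12,19],[1,31,29,30,16]],
  [[0,2,21,8],[0,9,21,2],[0,12,17,2],[0,12,19,3],[0,17,13,2],[0,17,15,2],[0,21,9,2],[0,24,13,2],[0,24,15,2],[0,26,13,2],[0,26,15,2],[0,28,11,2],[0,29,2,13],[0,29,3,13],[1,8,11,16,14],[1,8,25,15,4],[1,10,9,22,8],[1,12,2,19,11],[1,14,12,7,27],[1,19,17,20,12],[1,19,17,28,20],[1,28,30,1,13],[1,29,1,27,19],[1,30,28,20,23],[1,31,29,30,16]],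
  [[0,3,12,16],[0,12,3,16],[0,12,17,2],[0,12,19,3],[0,13,2,16],[0,13,3,16],[0,13,22,2],[0,14,17,2],[0,14,19,2],[0,15,16,2],[0,15,19,3],[1,13,23,27,21],[1,15,30,29,19]],
  [[0,12,17,2],[0,12,19,3],[0,12,21,2],[0,12,23,2],[0,14,21,2],[0,14,23,2],[1,12,2,19,11],[1,14,12,7,27]],
  [[0,16,11,4],[0,20,7,8],[0,20,11,4],[0,20,15,4],[1,16,9,27,31],[1,18,30,16,23],[1,20,2,9,30],[1,20,5,27,9],[1,22,2,15,18]],
  [[1,2,8,20,25]],[[1,2,12,30,27]],
  [[0,9,20,2],[0,9,21,2],[0,9,22,2],[0,9,23,2],[0,11,22,3],[1,8,11,16,14],[1,8,25,15,4],[1,10,9,22,8],[1,11,31,9,23]],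
  [[0,2,21,8],[0,3,21,8],[0,5,18,8],[0,6,17,8],[0,9,23,2],[0,11,20,3],[0,17,6,8],[0,18,5,8],[0,21,9,2],[0,21,11,3],[0,23,12,2],[0,23,14,2],[0,28,11,2],[0,29,2,13],[0,29,3,13],[1,11,31,9,23],[1,20,2,9,30],[1,21,29,9,31],[1,22,23,10,2],[1,23,5,19,28],[1,23,19,15,29],[1,23,19,31,10],[1,23,21,8,5],[1,28,30,1,13],[1,29,1,27,19],[1,30,28,20,23],[1,31,29,30,16]],
  [[0,5,27,2]],[[0,3,29,4]],[[0,5,27,2],[1,7,4,28,2]],[[0,5,26,2]],[[0,3,25,4]],[[0,28,3,4]],[[0,5,25,2]],
  [[0,7,24,2]],[[1,30,4,24,7]],[[0,26,7,2]],[[0,4,27,2]],[[0,26,7,2],[0,27,7,3]],[[0,3,28,4]],[[0,25,5,2]],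
  [[0,25,6,2]],[[0,3,24,4]],[[0,26,3,4]],[[0,24,7,2]],[[0,24,3,4]],[[0,26,5,2]],
  [[0,5,26,2],[0,7,24,2],[0,7,26,2]],[[0,26,5,2],[1,26,21,20,12]],[[0,5,24,2]],
  [[0,3,25,4],[0,5,24,2],[0,26,3,4],[1,25,26,24,29]],[[0,24,5,2]],
  [[0,3,24,4],[0,3,25,4],[0,3,29,4],[0,24,3,4],[0,27,7,3],[1,27,4,6,28]],
  [[0,3,24,4],[0,3,25,4],[0,3,29,4],[0,5,24,2],[0,5,26,2],[0,7,24,2],[0,7,26,2],[0,24,5,2],[0,26,3,4],[0,26,5,2],[0,27,5,2],[1,25,26,24,29]],
  [[0,4,27,2],[0,5,24,2],[0,5,25,2],[0,25,6,2],[1,29,3,7,6]],[[0,25,4,2]],[[0,29,2,4]],[[0,25,4,2],[0,27,4,2]],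
  [[0,5,24,2],[0,5,25,2],[0,5,26,2],[0,5,27,2],[0,7,24,2],[0,7,26,2],[0,25,5,2],[0,27,7,3],[0,28,3,4],[0,30,7,2],[1,25,26,24,29],[1,27,4,6,28],[1,30,4,24,7]],
  [[0,3,24,4],[0,3,25,4],[0,3,28,4],[0,4,27,2],[0,5,24,2],[0,5,25,2],[0,5,26,2],[0,5,27,2],[0,7,26,2],[0,24,3,4],[0,24,7,2],[0,25,6,2],[0,26,7,2],[0,30,3,4],[1,27,4,6,28],[1,29,3,7,6],[1,30,4,24,7]],
  [[0,25,6,2],[0,27,6,2],[0,29,2,4]],
  [[0,3,24,4],[0,3,25,4],[0,3,29,4],[0,5,26,2],[0,7,24,3],[0,7,27,3],[0,24,3,4],[0,26,5,2],[0,27,7,3],[1,7,4,28,2],[1,27,6,25,3],[1,31,30,4,29]],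
  [[0,24,3,4],[0,24,7,2],[0,26,3,4],[0,26,5,2],[0,26,7,2],[0,28,3,4],[0,28,7,3],[1,26,21,20,12],[1,30,4,24,7]],
  [[0,5,25,2],[0,25,5,2],[1,28,1,31,27]],[[0,24,5,2],[0,24,7,2],[0,24,7,8],[1,24,31,25,11]],
  [[0,4,27,2],[0,6,27,2]],[[0,6,25,2]],[[0,4,25,2]],[[0,25,2,4]],[[0,2,29,4]]]"

definition K23_5_d :: "nat list list list" where
  "K23_5_d = [[[0,2,25,4]],[[0,21,14,1]],[[0,12,22,1]],[[0,26,13,1]],[[0,22,15,1]],[[0,26,14,1]],[[0,26,12,1]],
  [[0,24,14,1]],[[0,14,22,1],[0,26,14,1]],[[0,22,10,1]],[[0,10,22,1]],[[0,28,6,1]],[[0,6,26,1]],[[0,26,4,1]],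
  [[0,4,26,1]],[[0,22,8,1]],[[0,10,20,1]],[[0,20,10,1]],[[0,6,24,1]],[[0,24,6,1]],[[0,18,14,1]],[[0,14,18,1]],
  [[0,14,16,1]],[[0,28,2,1]],[[0,2,28,1]],[[0,18,12,1]],[[0,12,18,1]],[[0,12,22,1],[0,20,14,1]],[[0,8,22,1]],
  [[0,16,14,1]],[[0,28,6,1],[0,28,7,1]],[[0,22,8,1],[0,22,9,1]],[[0,26,4,1],[0,26,5,1]],
  [[0,22,10,1],[0,23,10,1]],[[0,22,8,1],[0,22,9,1],[0,26,5,1],[0,27,4,1]],[[0,20,10,1],[0,21,10,1]],
  [[0,22,8,1],[0,23,8,1]],[[0,14,16,1],[0,14,17,1]],[[0,12,18,1],[0,13,18,1]],[[0,14,18,1],[0,15,19,1]],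
  [[0,22,10,1],[0,23,11,1],[0,28,6,1],[0,28,7,1]],[[0,14,16,1],[0,15,16,1]],[[0,10,22,1],[0,11,22,1]],
  [[0,6,26,1],[0,7,26,1]],[[0,10,20,1],[0,11,20,1]],[[0,4,26,1],[0,5,26,1]],[[0,18,14,1],[0,19,14,1]],
  [[0,18,12,1],[0,19,12,1]],[[0,6,24,1],[0,7,24,1]],
  [[0,12,22,1],[0,14,22,1],[0,15,22,1],[0,22,8,1],[0,22,9,1],[0,22,10,1],[0,22,11,1],[0,22,13,1],[0,26,12,1]],
  [[0,24,14,1],[0,25,14,1]],[[0,28,2,1],[0,29,2,1]],
  [[0,14,21,1],[0,15,22,1],[0,15,23,1],[0,20,14,1],[0,26,14,1]],
  [[0,14,16,1],[0,14,17,1],[0,14,18,1],[0,14,19,1]],[[0,28,2,1],[0,28,3,1]],[[0,24,6,1],[0,25,6,1]],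
  [[1,12,1,18,9]],[[0,20,14,1],[0,20,15,1]],[[0,20,10,1],[0,20,11,1]],[[0,16,14,1],[0,17,14,1]],
  [[0,6,26,1],[0,6,27,1]],[[0,2,28,1],[0,3,28,1]],[[0,6,24,1],[0,6,25,1]],
  [[0,26,12,1],[0,26,13,1],[0,26,14,1],[0,26,15,1]],[[0,26,14,1],[1,26,13,12,28],[1,26,21,20,31]],
  [[0,22,15,1],[0,23,14,1],[0,26,14,1],[0,26,15,1]],[[0,24,14,1],[0,24,15,1]],[[0,24,6,1],[0,24,7,1]],
  [[0,18,13,2],[1,18,29,3,16]],[[0,18,12,1],[0,18,13,1]],[[0,10,22,1],[0,10,23,1]],[[0,10,20,1],[0,10,21,1]],
  [[0,8,22,1],[0,9,22,1]],[[0,4,26,1],[0,4,27,1]],[[0,2,28,1],[0,2,29,1]],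
  [[0,12,22,1],[0,13,23,1],[0,20,15,1],[0,21,14,1]],[[1,17,16,14,8]],[[1,9,8,27,31]],[[0,12,18,1],[0,12,19,1]],
  [[0,28,1,2]],[[0,28,1,2],[0,30,1,2]],[[0,30,1,4]],[[0,26,1,4]],[[0,30,1,14]],
  [[0,14,16,1],[0,14,17,1],[0,15,16,1],[0,15,17,1]],[[0,6,26,1],[0,6,27,1],[0,7,26,1],[0,7,27,1]],
  [[0,28,2,1],[0,28,3,1],[0,29,2,1],[0,29,3,1]],
  [[0,14,22,1],[0,14,23,1],[0,15,22,1],[0,15,23,1],[0,22,1,8],[0,28,1,2]],[[0,14,1,16]],
  [[0,18,12,1],[0,18,13,1],[0,19,12,1],[0,19,13,1],[0,26,1,4]],
  [[0,24,14,1],[0,24,15,1],[0,25,14,1],[0,25,15,1]],[[0,10,20,1],[0,10,21,1],[0,11,20,1],[0,11,21,1]],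
  [[0,22,1,8],[0,30,1,2],[0,30,1,4],[0,30,1,14]],[[0,26,6,1],[0,26,7,1],[0,27,6,1],[0,27,7,1]],
  [[0,24,6,1],[0,24,7,1],[0,25,6,1],[0,25,7,1]],[[0,16,14,1],[0,16,15,1],[1,17,16,14,8]],
  [[0,12,18,1],[0,12,19,1],[0,13,18,1],[0,13,19,1]],[[0,10,22,1],[0,10,23,1],[0,11,22,1],[0,11,23,1]],
  [[0,20,10,1],[0,20,11,1],[0,21,10,1],[0,21,11,1]],[[0,22,8,1],[0,22,9,1],[0,23,8,1],[0,23,9,1]]]"

definition K23_5_e :: "nat list list list" where
  "K23_5_e = [
  [[0,6,26,1],[0,6,27,1],[0,7,26,1],[0,7,27,1],[0,12,18,1],[0,12,19,1],[0,13,18,1],[0,13,19,1],[0,14,18,1],[0,14,19,1],[0,15,18,1],[0,15,19,1]],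
  [[0,18,14,1],[0,18,15,1],[0,19,14,1],[0,19,15,1],[0,24,6,1],[0,24,7,1],[0,24,14,1],[0,24,15,1],[0,25,6,1],[0,25,7,1],[0,25,14,1],[0,25,15,1],[0,26,6,1],[0,26,7,1],[0,27,6,1],[0,27,7,1]],
  [[0,20,10,1],[0,20,11,1],[0,21,10,1],[0,21,11,1],[0,22,10,1],[0,22,11,1],[0,23,10,1],[0,23,11,1],[0,28,2,1],[0,28,3,1],[0,29,2,1],[0,29,3,1]],
  [[0,16,14,1],[0,16,15,1],[0,20,14,1],[0,20,15,1],[0,21,14,1],[0,21,15,1],[1,17,16,14,8]],
  [[0,12,22,1],[0,13,23,1],[0,18,12,1],[0,18,13,1],[0,19,12,1],[0,19,13,1],[0,22,8,1],[0,22,9,1],[0,22,13,1],[0,23,8,1],[0,23,9,1],[0,23,12,1],[0,26,12,1],[0,26,13,1]],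
  [[0,6,24,1],[0,6,25,1],[0,6,26,1],[0,6,27,1],[0,7,24,1],[0,7,25,1],[0,7,26,1],[0,7,27,1],[0,12,18,1],[0,12,19,1],[0,13,18,1],[0,13,19,1],[0,14,16,1],[0,14,17,1],[0,14,18,1],[0,14,19,1],[0,14,22,1],[0,14,23,1],[0,15,16,1],[0,15,17,1],[0,15,18,1],[0,15,19,1],[0,15,22,1],[0,15,23,1]],
  [[0,10,22,1],[0,10,23,1],[0,11,22,1],[0,11,23,1],[0,12,18,1],[0,12,19,1],[0,13,22,1],[0,13,23,1],[1,12,1,18,9]],
  [[0,26,4,1],[0,26,5,1],[0,27,4,1],[0,27,5,1]],
  [[0,10,20,1],[0,10,21,1],[0,11,20,1],[0,11,21,1],[0,14,21,1],[0,15,20,1],[0,20,14,1],[0,21,15,1],[0,26,14,1],[0,26,15,1]],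
  [[0,4,26,1],[0,4,27,1],[0,5,11,16],[1,5,15,11,27]],[[0,2,28,1],[0,2,29,1],[0,3,28,1],[0,3,29,1]],
  [[0,8,22,1],[0,8,23,1],[1,9,8,27,31]],[[0,1,30,2]],[[0,1,28,2]],[[1,1,5,25,14]],[[0,1,30,6]],[[1,1,15,6,30]],
  [[0,1,14,16]],[[1,1,17,28,18]]]"

definition K23_5 :: "nat list list list" where
  "K23_5 = K23_5_a @ K23_5_b @ K23_5_c @ K23_5_d @ K23_5_e"

lemmas blocks23_5 = b23_5_a_def b23_5_b_def b23_5_c_def b23_5_d_def b23_5_e_def b23_5_f_def b23_5_g_def b23_5_h_def b23_5_i_def b23_5_j_def b23_5_k_def b23_5_l_def b23_5_m_def b23_5_n_def b23_5_o_def b23_5_p_def b23_5_q_def b23_5_r_def b23_5_s_def b23_5_t_def b23_5_u_def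

lemmas fnd23_5 = b23_5_a_def[THEN fnd_block] b23_5_b_def[THEN fnd_block] b23_5_c_def[THEN fnd_block] b23_5_d_def[THEN fnd_block] b23_5_e_def[THEN fnd_block] b23_5_f_def[THEN fnd_block] b23_5_g_def[THEN fnd_block] b23_5_h_def[THEN fnd_block] b23_5_i_def[THEN fnd_block] b23_5_j_def[THEN fnd_block] b23_5_k_def[THEN fnd_block] b23_5_l_def[THEN fnd_block] b23_5_m_def[THEN fnd_block] b23_5_n_def[THEN fnd_block] b23_5_o_def[THEN fnd_block] b23_5_p_def[THEN fnd_block] b23_5_q_def[THEN fnd_block] b23_5_r_def[THEN fnd_block] b23_5_s_def[THEN fnd_block] b23_5_t_def[THEN fnd_block] b23_5_u_def[THEN fnd_block]

schematic_goal some23_5_a: "map Some (concat [b23_5_a, b23_5_b, b23_5_c, b23_5_d, b23_5_e]) = ?x"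
  by (simp only: list.map concat.simps append.simps blocks23_5)

lemma leads23_5_a: "map (\<lambda>C. fndb (map (pref tg23 (Suc (Suc (Suc (Suc (Suc 0)))))) C) (Suc (Suc (Suc (Suc (Suc 0))))) T23_5) K23_5_a = map Some (concat [b23_5_a, b23_5_b, b23_5_c, b23_5_d, b23_5_e])"
  by (rule trans[OF _ some23_5_a[symmetric]]) (simp only: low tg23_unary T23_5_def fnd23_5 K23_5_a_def)

lemma ok23_5_a: "list_all (list_all (okref tg23 kn23 (Suc (Suc (Suc (Suc (Suc 0))))))) K23_5_a"
  by (simp only: low tg23_unary kn23 K23_5_a_def)

schematic_goal some23_5_b: "map Some (concat [b23_5_f, b23_5_g, b23_5_h, b23_5_i, b23_5_j]) = ?x"
  by (simp only: list.map concat.simps append.simps blocks23_5)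

lemma leads23_5_b: "map (\<lambda>C. fndb (map (pref tg23 (Suc (Suc (Suc (Suc (Suc 0)))))) C) (Suc (Suc (Suc (Suc (Suc 0))))) T23_5) K23_5_b = map Some (concat [b23_5_f, b23_5_g, b23_5_h, b23_5_i, b23_5_j])"
  by (rule trans[OF _ some23_5_b[symmetric]]) (simp only: low tg23_unary T23_5_def fnd23_5 K23_5_b_def)

lemma ok23_5_b: "list_all (list_all (okref tg23 kn23 (Suc (Suc (Suc (Suc (Suc 0))))))) K23_5_b"
  by (simp only: low tg23_unary kn23 K23_5_b_def)

schematic_goal some23_5_c: "map Some (concat [b23_5_k, b23_5_l, b23_5_m, b23_5_n, b23_5_o]) = ?x"
  by (simp only: list.map concat.simps append.simps blocks23_5)

lemma leads23_5_c: "map (\<lambda>C. fndb (map (pref tg23 (Suc (Suc (Suc (Suc (Suc 0)))))) C) (Suc (Suc (Suc (Suc (Suc 0))))) T23_5) K23_5_c = map Some (concat [b23_5_k, b23_5_l, b23_5_m, b23_5_n, b23_5_o])"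
  by (rule trans[OF _ some23_5_c[symmetric]]) (simp only: low tg23_unary T23_5_def fnd23_5 K23_5_c_def)

lemma ok23_5_c: "list_all (list_all (okref tg23 kn23 (Suc (Suc (Suc (Suc (Suc 0))))))) K23_5_c"
  by (simp only: low tg23_unary kn23 K23_5_c_def)

schematic_goal some23_5_d: "map Some (concat [b23_5_p, b23_5_q, b23_5_r, b23_5_s, b23_5_t]) = ?x"
  by (simp only: list.map concat.simps append.simps blocks23_5)

lemma leads23_5_d: "map (\<lambda>C. fndb (map (pref tg23 (Suc (Suc (Suc (Suc (Suc 0)))))) C) (Suc (Suc (Suc (Suc (Suc 0))))) T23_5) K23_5_d = map Some (concat [b23_5_p, b23_5_q, b23_5_r, b23_5_s, b23_5_t])"
  by (rule trans[OF _ some23_5_d[symmetric]]) (simp only: low tg23_unary T23_5_def fnd23_5 K23_5_d_def)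

lemma ok23_5_d: "list_all (list_all (okref tg23 kn23 (Suc (Suc (Suc (Suc (Suc 0))))))) K23_5_d"
  by (simp only: low tg23_unary kn23 K23_5_d_def)

schematic_goal some23_5_e: "map Some (concat [b23_5_u]) = ?x"
  by (simp only: list.map concat.simps append.simps blocks23_5)

lemma leads23_5_e: "map (\<lambda>C. fndb (map (pref tg23 (Suc (Suc (Suc (Suc (Suc 0)))))) C) (Suc (Suc (Suc (Suc (Suc 0))))) T23_5) K23_5_e = map Some (concat [b23_5_u])"
  by (rule trans[OF _ some23_5_e[symmetric]]) (simp only: low tg23_unary T23_5_def fnd23_5 K23_5_e_def)

lemma ok23_5_e: "list_all (list_all (okref tg23 kn23 (Suc (Suc (Suc (Suc (Suc 0))))))) K23_5_e"
  by (simp only: low tg23_unary kn23 K23_5_e_def)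

lemma leads23_5_eq: "map (\<lambda>C. fndb (map (pref tg23 (Suc (Suc (Suc (Suc (Suc 0)))))) C) (Suc (Suc (Suc (Suc (Suc 0))))) T23_5) K23_5 = map Some (concat T23_5)"
  unfolding K23_5_def map_append leads23_5_a leads23_5_b leads23_5_c leads23_5_d leads23_5_e
  by (simp only: T23_5_def map_append concat.simps append_assoc append.simps list.map append_Nil2)

lemma ok23_5: "list_all (list_all (okref tg23 kn23 (Suc (Suc (Suc (Suc (Suc 0))))))) K23_5"
  by (simp only: K23_5_def list_all_append ok23_5_a ok23_5_b ok23_5_c ok23_5_d ok23_5_e simp_thms)

lemma good23_5: "list_all (\<lambda>t. good (Suc (Suc (Suc (Suc (Suc (Suc (Suc (Suc (Suc (Suc (Suc (Suc (Suc (Suc (Suc (Suc (Suc (Suc (Suc (Suc (Suc (Suc (Suc 0))))))))))))))))))))))) (bit_exps (Suc (Suc (Suc (Suc (Suc 0))))) (map (bits (Suc (Suc (Suc (Suc (Suc 0)))))) t))) (concat T23_5)"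
  by (simp only: low T23_5_def blocks23_5)

lemma dist23_5: "dist (map (\<lambda>t. concat (map (bits (Suc (Suc (Suc (Suc (Suc 0)))))) t)) (concat T23_5)) VZ"
  by (simp only: low T23_5_def blocks23_5)

lemma rel23_5: "list_all (\<lambda>t. list_all (\<lambda>m. fndb (map (\<lambda>us. (forms (Suc (Suc (Suc (Suc (Suc 0))))) (map (compress m) (map (bits (Suc (Suc (Suc (Suc (Suc 0)))))) us)), tg23 t)) (R23 t)) (Suc (Suc (Suc (Suc (Suc 0))))) T23_5 = None) (masks (Suc (Suc (Suc (Suc (Suc 0))))) (Suc (Suc (Suc (Suc (Suc 0))))))) [0,1]"
  by (simp only: low tg23_unary R23 T23_5_def fnd23_5)

text \<open>The head of a test is the mask of odd exponents. It misses a variable, so a member in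
  all five variables has an even exponent and lies in the kernel of the Kameko map.\<close>

lemma even23_5: "list_all (\<lambda>t. False \<in> set (bits (Suc (Suc (Suc (Suc (Suc 0))))) (hd t))) (concat T23_5)"
  by (simp only: low list.set insert_iff simp_thms T23_5_def blocks23_5)

lemma len23_5: "length (concat T23_5) = 419"
  by (simp add: T23_5_def blocks23_5)

definition "T23 n = (if n = 3 then T23_3 else if n = 4 then T23_4 else if n = 5 then T23_5 else [])" for n :: nat

definition "K23 n = (if n = 3 then K23_3 else if n = 4 then K23_4 else if n = 5 then K23_5 else [])" for n :: nat

lemma TK23: "T23 3 = T23_3" "T23 4 = T23_4" "T23 5 = T23_5" "K23 3 = K23_3" "K23 4 = K23_4" "K23 5 = K23_5"
  by (simp_all add: T23_def K23_def)

lemma other23: "n \<notin> {3, 4, 5} \<Longrightarrow> T23 n = [] \<and> K23 n = []"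
  by (simp add: T23_def K23_def)

lemma leads23: "n \<in> {3, 4, 5} \<Longrightarrow> map (\<lambda>C. fndb (map (pref tg23 n) C) n (T23 n)) (K23 n) = map Some (concat (T23 n))"
  by (elim insertE emptyE; simp only: TK23 leads23_3_eq[folded n3 ] leads23_4_eq[folded n4 ] leads23_5_eq[folded n5 ])

lemma ok23: "n \<in> {3, 4, 5} \<Longrightarrow> list_all (list_all (okref tg23 kn23 n)) (K23 n)"
  by (elim insertE emptyE; simp only: TK23 ok23_3[folded n3 ] ok23_4[folded n4 ] ok23_5[folded n5 ])

lemma good23: "n \<in> {3, 4, 5} \<Longrightarrow> list_all (\<lambda>t. good 23 (bit_exps n (map (bits n) t))) (concat (T23 n))"
  by (elim insertE emptyE; simp only: TK23 good23_3[folded n23 n3] good23_4[folded n23 n4] good23_5[folded n23 n5])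

lemma dist23: "n \<in> {3, 4, 5} \<Longrightarrow> dist (map (\<lambda>t. concat (map (bits n) t)) (concat (T23 n))) VZ"
  by (elim insertE emptyE; simp only: TK23 dist23_3[folded n3 ] dist23_4[folded n4 ] dist23_5[folded n5 ])

lemma rel23': "n \<in> {3, 4, 5} \<Longrightarrow> list_all (\<lambda>t. list_all (\<lambda>m. fndb (map (\<lambda>us. (forms n (map (compress m) (map (bits 5) us)), tg23 t)) (R23 t)) n (T23 n) = None) (masks 5 n)) [0,1]"
  by (elim insertE emptyE; simp only: TK23 rel23_3[folded n5 n3] rel23_4[folded n5 n4] rel23_5[folded n5 ])

lemma rel23: "kn23 t \<Longrightarrow> n \<in> {3, 4, 5} \<Longrightarrow> list_all (\<lambda>m. fndb (map (\<lambda>us. (forms n (map (compress m) (map (bits 5) us)), tg23 t)) (R23 t)) n (T23 n) = None) (masks 5 n)"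
  by (rule list_allD[OF rel23']) (simp_all only: kn23_iff)

lemma tgt23: "kn23 t \<Longrightarrow> annihilates_hits (tg23 t) \<and> (\<forall>c\<in>set (tg23 t). length c = length (hd (tg23 t))) \<and> length (hd (tg23 t)) \<le> 5"
proof
  assume "kn23 t"
  then have t: "t \<in> set [0,1]" by (simp only: kn23_iff)
  have "list_all (\<lambda>t. annihilates_hits (tg23 t)) [0,1]" by (simp only: list.pred_inject ann23 simp_thms)
  then show "annihilates_hits (tg23 t)" by (rule list_allD) (rule t)
qed (auto simp: tg23_def)

lemma R23_free: "list_all (\<lambda>t. list_all (\<lambda>us. same_len us (hd (tg23 t)) \<and> free (map (bits (Suc (Suc (Suc (Suc (Suc 0)))))) us)) (R23 t)) [0,1]"
  by (simp only: low tg23_unary R23)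

lemma R23_ok: "kn23 t \<Longrightarrow> odd (length (R23 t)) \<and> list_all (\<lambda>us. same_len us (hd (tg23 t)) \<and> free (map (bits 5) us)) (R23 t)"
proof
  assume "kn23 t"
  then have t: "t \<in> set [0,1]" by (simp only: kn23_iff)
  show "list_all (\<lambda>us. same_len us (hd (tg23 t)) \<and> free (map (bits 5) us)) (R23 t)"
    by (rule list_allD[OF R23_free[folded n5]]) (rule t)
qed (auto simp: R23_def)

lemmas data23 = other23 leads23 ok23 good23 dist23 tgt23 R23_ok rel23

section \<open>Degrees 10 and 23: relations\<close>

definition "rels10 = prefix_all [1] (exps 5 9) @ prefix_all [2] (exps 5 8) @ prefix_all [4] (exps 5 6)"

definition combs10 :: "nat list list list" where
  "combs10 = [[[1,0,0,1,1,7],[4,0,0,1,1,4]],[[1,0,0,1,5,3],[2,0,0,1,3,4]],[[1,0,0,3,3,3],[2,0,0,3,3,2]],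
  [[1,0,0,1,6,2],[2,0,0,2,5,1]],[[1,0,0,5,1,3],[2,0,0,5,1,2]],[[1,0,1,0,1,7],[4,0,1,0,1,4]],
  [[1,0,1,0,5,3],[2,0,1,0,3,4]],[[1,0,1,1,0,7],[4,0,1,1,0,4]],[[1,0,1,1,4,3],[2,0,1,1,2,4]],
  [[1,0,1,1,5,2],[2,0,1,1,5,1]],[[1,0,1,1,7,0],[4,0,1,1,4,0]],[[1,0,1,3,3,2],[2,0,1,3,3,1]],
  [[1,0,1,4,1,3],[2,0,1,2,1,4]],[[1,0,1,5,0,3],[2,0,1,3,0,4]],[[1,0,1,5,1,2],[2,0,1,5,1,1]],
  [[1,0,1,5,3,0],[2,0,1,3,4,0]],[[1,0,2,1,3,3],[2,0,2,1,3,2]],[[1,0,1,2,4,2],[2,0,2,2,3,1]],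
  [[1,0,2,3,1,3],[2,0,2,3,1,2]],[[1,0,3,0,3,3],[2,0,3,0,3,2]],[[1,0,3,1,3,2],[2,0,3,1,3,1]],
  [[1,0,3,2,1,3],[2,0,3,2,1,2]],[[1,0,3,3,0,3],[2,0,3,3,0,2]],[[1,0,3,3,1,2],[2,0,3,3,1,1]],
  [[1,0,3,3,3,0],[2,0,3,3,2,0]],[[1,0,1,0,6,2],[2,0,2,0,5,1]],[[1,0,4,1,1,3],[2,0,4,1,1,2]],
  [[1,0,1,4,2,2],[2,0,2,4,1,1]],[[1,0,1,6,0,2],[2,0,2,5,0,1]],[[1,0,1,6,2,0],[2,0,2,5,1,0]],
  [[1,0,5,0,1,3],[2,0,5,0,1,2]],[[1,0,5,1,0,3],[2,0,5,1,0,2]],[[1,0,5,1,1,2],[2,0,5,1,1,1]],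
  [[1,0,5,1,3,0],[2,0,5,1,2,0]],[[1,1,0,0,1,7],[4,1,0,0,1,4]],[[1,1,0,0,5,3],[2,1,0,0,3,4]],
  [[1,1,0,1,0,7],[4,1,0,1,0,4]],[[1,1,0,1,4,3],[2,1,0,1,2,4]],[[1,1,0,1,5,2],[2,1,0,1,5,1]],
  [[1,1,0,1,7,0],[4,1,0,1,4,0]],[[1,1,0,3,3,2],[2,1,0,3,3,1]],[[1,1,0,4,1,3],[2,1,0,2,1,4]],
  [[1,1,0,5,0,3],[2,1,0,3,0,4]],[[1,1,0,5,1,2],[2,1,0,5,1,1]],[[1,1,0,5,3,0],[2,1,0,3,4,0]],
  [[1,1,1,1,3,3],[2,1,1,1,3,2]],[[1,1,1,1,4,2],[2,1,1,2,3,1]],[[1,1,1,3,1,3],[2,1,1,3,1,2]],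
  [[1,1,1,0,0,7],[4,1,1,0,0,4]],[[1,1,1,0,4,3],[2,1,1,0,2,4]],[[1,1,1,0,5,2],[2,1,1,0,5,1]],
  [[1,1,1,0,7,0],[4,1,1,0,4,0]],[[1,1,2,1,3,2],[2,1,2,1,3,1]],[[1,1,2,2,1,3],[2,1,2,2,1,2]],
  [[1,1,1,4,0,3],[2,1,1,2,0,4]],[[1,1,2,3,1,2],[2,1,2,3,1,1]],[[1,1,1,4,3,0],[2,1,1,2,4,0]],
  [[1,1,1,3,2,2],[2,1,1,4,1,1],[2,1,2,3,1,1]],[[1,1,1,5,0,2],[2,1,1,5,0,1]],[[1,1,1,5,2,0],[2,1,1,5,1,0]],
  [[1,1,1,7,0,0],[4,1,1,4,0,0]],[[1,1,3,0,3,2],[2,1,3,0,3,1]],[[1,1,3,1,1,3],[2,1,3,1,1,2]],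
  [[1,1,3,1,2,2],[2,1,3,2,1,1]],[[1,1,3,3,0,2],[2,1,3,3,0,1]],[[1,1,3,3,2,0],[2,1,3,3,1,0]],
  [[1,1,4,0,1,3],[2,1,2,0,1,4]],[[1,1,4,1,0,3],[2,1,2,1,0,4]],[[1,1,4,1,1,2],[2,1,4,1,1,1]],
  [[1,1,4,1,3,0],[2,1,2,1,4,0]],[[1,1,5,0,0,3],[2,1,3,0,0,4]],[[1,1,5,0,1,2],[2,1,5,0,1,1]],
  [[1,1,5,0,3,0],[2,1,3,0,4,0]],[[1,1,5,1,0,2],[2,1,5,1,0,1]],[[1,1,5,1,2,0],[2,1,5,1,1,0]],
  [[1,1,5,3,0,0],[2,1,3,4,0,0]],[[1,2,0,1,3,3],[2,2,0,1,3,2]],[[1,1,0,2,4,2],[2,2,0,2,3,1]],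
  [[1,2,0,3,1,3],[2,2,0,3,1,2]],[[1,2,1,0,3,3],[2,2,1,0,3,2]],[[1,2,1,1,3,2],[2,2,1,1,3,1]],
  [[1,2,1,2,1,3],[2,2,1,2,1,2]],[[1,2,1,3,0,3],[2,2,1,3,0,2]],[[1,2,1,3,1,2],[2,2,1,3,1,1]],
  [[1,2,1,3,3,0],[2,2,1,3,2,0]],[[1,1,2,0,4,2],[2,2,2,0,3,1]],[[1,2,2,1,1,3],[2,2,2,1,1,2]],
  [[1,1,2,2,2,2],[2,2,2,2,1,1]],[[1,1,2,4,0,2],[2,2,2,3,0,1]],[[1,1,2,4,2,0],[2,2,2,3,1,0]],
  [[1,2,3,0,1,3],[2,2,3,0,1,2]],[[1,2,3,1,0,3],[2,2,3,1,0,2]],[[1,2,3,1,1,2],[2,2,3,1,1,1]],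
  [[1,2,3,1,3,0],[2,2,3,1,2,0]],[[1,3,0,0,3,3],[2,3,0,0,3,2]],[[1,3,0,1,3,2],[2,3,0,1,3,1]],
  [[1,3,0,2,1,3],[2,3,0,2,1,2]],[[1,3,0,3,0,3],[2,3,0,3,0,2]],[[1,3,0,3,1,2],[2,3,0,3,1,1]],
  [[1,3,0,3,3,0],[2,3,0,3,2,0]],[[1,3,1,0,3,2],[2,3,1,0,3,1]],[[1,3,1,1,1,3],[2,3,1,1,1,2]],
  [[1,3,1,1,2,2],[2,3,1,2,1,1]],[[1,3,1,3,0,2],[2,3,1,3,0,1]],[[1,3,1,3,2,0],[2,3,1,3,1,0]],
  [[1,3,2,0,1,3],[2,3,2,0,1,2]],[[1,3,2,1,0,3],[2,3,2,1,0,2]],[[1,3,2,1,1,2],[2,3,2,1,1,1]],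
  [[1,3,2,1,3,0],[2,3,2,1,2,0]],[[1,3,3,0,0,3],[2,3,3,0,0,2]],[[1,3,3,0,1,2],[2,3,3,0,1,1]],
  [[1,3,3,0,3,0],[2,3,3,0,2,0]],[[1,3,3,1,0,2],[2,3,3,1,0,1]],[[1,3,3,1,2,0],[2,3,3,1,1,0]],
  [[1,3,3,3,0,0],[2,3,3,2,0,0]],[[1,1,0,0,6,2],[2,2,0,0,5,1]],[[1,4,0,1,1,3],[2,4,0,1,1,2]],
  [[1,1,0,4,2,2],[2,2,0,4,1,1]],[[1,1,0,6,0,2],[2,2,0,5,0,1]],[[1,1,0,6,2,0],[2,2,0,5,1,0]],
  [[1,4,1,0,1,3],[2,4,1,0,1,2]],[[1,4,1,1,0,3],[2,4,1,1,0,2]],[[1,4,1,1,1,2],[2,4,1,1,1,1]],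
  [[1,4,1,1,3,0],[2,4,1,1,2,0]],[[1,1,4,0,2,2],[2,2,4,0,1,1]],[[1,1,4,2,0,2],[2,2,4,1,0,1]],
  [[1,1,4,2,2,0],[2,2,4,1,1,0]],[[1,1,6,0,0,2],[2,2,5,0,0,1]],[[1,1,6,0,2,0],[2,2,5,0,1,0]],
  [[1,1,6,2,0,0],[2,2,5,1,0,0]],[[1,5,0,0,1,3],[2,5,0,0,1,2]],[[1,5,0,1,0,3],[2,5,0,1,0,2]],
  [[1,5,0,1,1,2],[2,5,0,1,1,1]],[[1,5,0,1,3,0],[2,5,0,1,2,0]],[[1,5,1,0,0,3],[2,5,1,0,0,2]],
  [[1,5,1,0,1,2],[2,5,1,0,1,1]],[[1,5,1,0,3,0],[2,5,1,0,2,0]],[[1,5,1,1,0,2],[2,5,1,1,0,1]],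
  [[1,5,1,1,2,0],[2,5,1,1,1,0]],[[1,5,1,3,0,0],[2,5,1,2,0,0]]]"

text \<open>Four odd variables and the square of a root of degree 9 give degree 4 + 18 = 22, which
  \<open>Sq 1\<close> raises to 23. The prefix names the variable left out of the odd part.\<close>

definition "rels23 = prefix_all [0, 1, 2, 3, 4] (exps 5 9)"

definition combs23 :: "nat list list list" where
  "combs23 = [[[3,0,0,2,7,0],[4,0,0,1,6,2]],[[0,0,0,3,3,3],[0,0,0,3,4,2]],[[1,0,0,3,3,3],[1,0,0,3,4,2]],
  [[2,0,0,7,2,0],[4,0,0,6,1,2]],[[1,0,2,1,6,0],[4,0,1,1,3,4],[4,0,2,0,5,2]],[[2,0,1,2,6,0],[4,0,2,0,5,2]],
  [[0,0,1,2,4,2],[0,0,2,1,3,3]],[[1,0,1,2,4,2],[1,0,2,1,3,3]],[[1,0,2,4,0,3],[3,0,1,3,2,3],[3,0,2,3,1,3]],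
  [[1,0,2,4,3,0],[1,0,2,5,2,0],[4,0,1,3,3,2],[4,0,2,3,3,1]],[[1,0,2,5,2,0],[2,0,2,5,2,0],[4,0,1,5,1,2]],
  [[3,0,2,4,3,0],[4,0,1,4,2,2]],[[2,0,1,6,1,1],[2,0,2,5,1,1]],[[3,0,2,5,2,0],[3,0,2,6,1,0],[4,0,2,5,0,2]],
  [[0,0,3,0,2,4],[0,0,3,0,3,3]],[[1,0,3,0,3,3],[1,0,3,0,4,2]],[[2,0,3,0,3,3],[2,0,3,0,4,2]],
  [[1,0,4,2,0,3],[2,0,3,5,0,1],[2,0,3,6,0,0],[2,0,4,1,1,3],[3,0,3,1,2,3],[3,0,3,4,2,0]],
  [[3,0,3,3,0,3],[3,0,3,4,0,2]],
  [[1,0,4,2,3,0],[2,0,3,5,1,0],[2,0,4,1,3,1],[3,0,3,4,2,0],[4,0,3,1,3,2],[4,0,4,2,1,2]],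
  [[1,0,4,3,2,0],[2,0,3,5,1,0],[3,0,3,4,2,0],[3,0,4,3,1,1],[4,0,3,3,1,2],[4,0,4,2,1,2]],
  [[4,0,3,3,3,0],[4,0,3,4,2,0]],[[2,0,4,3,2,0],[4,0,4,2,1,2]],[[1,0,6,1,2,0],[2,0,5,2,2,0],[4,0,5,1,1,2]],
  [[2,0,5,2,2,0],[4,0,6,0,1,2]],[[2,0,5,2,1,1],[3,0,6,0,2,1],[4,0,6,0,1,2]],
  [[3,0,6,1,2,0],[3,0,6,2,1,0],[4,0,6,1,0,2]],
  [[1,0,5,2,1,1],[1,0,6,1,1,1],[1,0,6,2,0,1],[1,0,6,2,1,0],[1,0,7,0,1,1],[2,0,3,4,1,1],[2,0,3,5,0,1],[2,0,3,5,1,0],[2,0,3,6,0,0],[2,0,4,3,1,1],[2,0,5,2,1,1],[2,0,5,3,0,1],[2,0,5,3,1,0],[2,0,6,2,0,1],[2,0,6,2,1,0],[2,0,6,3,0,0],[3,0,6,0,2,1],[4,0,6,0,1,2]],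
  [[1,1,1,1,6,0],[4,1,0,1,3,4]],[[2,1,1,1,6,0],[4,1,1,0,3,4]],[[0,1,1,1,3,3],[0,1,1,1,4,2]],
  [[1,1,1,4,0,3],[3,1,0,3,2,3]],[[1,1,1,4,3,0],[1,1,1,5,2,0],[4,1,0,3,3,2]],[[1,1,1,5,2,0],[4,1,0,5,1,2]],
  [[2,1,1,5,2,0],[4,1,1,4,1,2]],[[3,1,1,5,2,0],[3,1,1,6,1,0],[4,1,1,3,0,4]],[[1,1,3,2,0,3],[3,1,2,1,2,3]],
  [[1,1,3,2,3,0],[4,1,2,1,3,2]],[[1,1,3,3,2,0],[4,1,2,3,1,2]],[[2,1,3,3,2,0],[4,1,3,2,1,2]],
  [[2,1,3,2,0,3],[2,1,4,1,0,3],[3,1,3,0,2,3]],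
  [[1,1,4,1,3,0],[2,1,4,1,3,0],[2,1,5,1,2,0],[4,1,3,0,3,2],[4,1,3,1,3,1],[4,1,5,1,1,1]],
  [[1,1,5,1,2,0],[4,1,4,1,1,2]],[[2,1,5,1,2,0],[4,1,5,0,1,2]],
  [[3,1,3,3,2,0],[3,1,4,3,1,0],[3,1,5,2,1,0],[4,1,3,3,0,2]],
  [[2,1,5,2,1,0],[3,1,5,2,1,0],[4,1,5,1,0,2],[4,1,5,1,1,1]],[[3,2,0,0,7,0],[4,1,0,0,6,2]],
  [[0,1,0,2,4,2],[0,2,0,1,3,3]],[[1,1,0,2,4,2],[1,2,0,1,3,3]],[[2,1,0,6,2,0],[4,2,0,4,1,2]],
  [[2,2,0,7,0,0],[3,2,0,5,2,0],[4,1,0,6,0,2]],[[0,2,1,0,3,3],[0,2,1,0,4,2]],[[1,1,2,0,2,4],[1,2,1,0,3,3]],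
  [[2,1,2,0,4,2],[2,2,1,0,3,3]],
  [[1,2,2,2,0,3],[2,1,2,4,0,2],[2,2,1,6,0,0],[3,1,2,4,2,0],[3,2,1,1,2,3],[3,2,2,1,1,3]],
  [[3,1,2,4,0,2],[3,2,1,3,0,3]],[[1,2,2,2,3,0],[2,1,2,4,2,0],[3,1,2,4,2,0],[4,2,1,1,3,2],[4,2,2,1,3,1]],
  [[1,2,2,3,2,0],[2,1,2,4,2,0],[3,1,2,4,2,0],[4,2,1,3,1,2],[4,2,2,3,1,1]],[[4,1,2,4,2,0],[4,2,1,3,3,0]],
  [[2,2,2,3,2,0],[4,2,2,2,1,2]],[[1,1,4,2,2,0],[2,1,4,2,2,0],[4,2,3,1,1,2]],[[3,2,4,0,3,0],[4,1,4,0,2,2]],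
  [[2,2,3,2,1,1],[2,2,4,1,1,1]],[[2,2,4,3,0,0],[3,2,4,1,2,0],[4,1,4,2,0,2]],
  [[2,2,5,2,0,0],[3,2,5,0,2,0],[4,1,6,0,0,2]],[[0,3,0,0,2,4],[0,3,0,0,3,3]],[[1,3,0,0,2,4],[1,3,0,0,3,3]],
  [[2,3,0,0,2,4],[2,3,0,0,3,3]],[[1,3,1,2,0,3],[3,3,0,1,2,3],[3,3,0,3,2,1]],[[3,3,0,2,0,4],[3,3,0,3,0,3]],
  [[1,3,1,2,3,0],[4,3,0,1,3,2],[4,3,0,4,1,1]],[[1,3,1,3,2,0],[4,3,0,3,1,2],[4,3,0,4,1,1]],
  [[4,3,0,2,4,0],[4,3,0,3,3,0]],[[3,3,1,2,3,0],[4,3,1,1,2,2]],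
  [[1,3,2,1,0,3],[2,3,2,1,0,3],[3,3,1,0,2,3],[3,3,1,1,1,3]],
  [[1,3,2,1,3,0],[2,3,2,1,3,0],[4,3,1,0,3,2],[4,3,1,1,3,1]],[[1,3,3,1,2,0],[4,3,2,1,1,2]],
  [[2,3,3,1,2,0],[4,3,3,0,1,2]],[[1,3,2,3,1,0],[3,3,2,3,1,0],[4,3,1,3,0,2],[4,3,1,3,1,1]],
  [[2,3,3,2,1,0],[3,3,3,2,1,0],[4,3,3,1,0,2],[4,3,3,1,1,1]],
  [[0,3,2,2,1,1],[1,2,3,2,1,1],[1,2,4,1,1,1],[1,2,4,2,0,1],[1,2,4,2,1,0],[1,2,5,1,0,1],[1,2,5,1,1,0],[1,2,5,2,0,0],[1,2,6,1,0,0],[2,1,2,4,0,2],[2,1,2,4,2,0],[2,2,1,4,1,1],[2,2,1,6,0,0],[2,2,2,3,0,2],[2,2,2,3,1,1],[2,2,2,3,2,0],[2,2,4,2,0,1],[2,2,4,2,1,0],[2,2,4,3,0,0]],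
  [[2,4,0,3,2,0],[4,4,0,2,1,2]],[[1,4,2,1,2,0],[2,4,1,2,2,0],[4,4,1,1,1,2]],[[2,4,1,2,2,0],[4,4,2,0,1,2]],
  [[2,4,1,2,1,1],[3,4,2,0,2,1],[4,4,2,0,1,2]],[[3,4,2,1,2,0],[3,4,2,2,1,0],[4,4,2,1,0,2]],
  [[0,4,0,3,1,1],[1,3,1,3,1,1],[1,3,4,0,1,1],[1,3,4,1,0,1],[1,3,4,1,1,0],[1,3,5,0,0,1],[1,3,5,0,1,0],[1,3,5,1,0,0],[1,3,6,0,0,0],[1,4,2,1,1,1],[1,4,3,0,1,1],[3,3,0,1,4,1],[3,3,0,3,2,1],[4,3,0,3,1,2],[4,3,0,4,1,1],[4,4,0,2,1,2]],
  [[1,5,1,1,2,0],[4,5,0,1,1,2]],[[2,5,1,1,2,0],[4,5,1,0,1,2]],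
  [[2,5,1,2,1,0],[3,5,1,2,1,0],[4,5,1,1,0,2],[4,5,1,1,1,1]],[[3,6,0,0,3,0],[4,5,0,0,2,2]],
  [[2,6,0,3,0,0],[3,6,0,1,2,0],[4,5,0,2,0,2]],[[2,6,1,2,0,0],[3,6,1,0,2,0],[4,5,2,0,0,2]]]"

definition "rows10 = map sq_row rels10 @ map (vsum sq_row) combs10"

schematic_goal rows10: "rows10 = ?x" by (simp only: comp rows10_def rels10_def combs10_def)

schematic_goal store10: "sbuild rows10 = ?x" by (simp only: comp rows10)

definition tab10 where "tab10 k = slookup k (sbuild rows10)"

schematic_goal keys10: "map enc (exps 5 10) = ?x" by (simp only: comp)

\<comment> \<open>Tabulates the lookup for all 1001 roots, so that each lookup in a reduction is a
  single rewrite.\<close>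
schematic_goal tab10_keys: "map tab10 (map enc (exps 5 10)) = ?x"
  by (simp only: comp tab10_def[abs_def] store10)

lemmas tab10 = tab10_keys[unfolded keys10 list.map list.inject]

text \<open>The number 10 is the fuel of the reduction. A remainder stays in the row, so the row is
  a valid relation in any case.\<close>

definition "rows23 = map (sq1_row tab10 10) rels23 @ map (vsum (sq1_row tab10 10)) combs23"

schematic_goal leads23_rels: "map (\<lambda>r. vlead (sq1_row tab10 10 r)) rels23 = ?x" by (simp only: comp tab10 rels23_def)

schematic_goal leads23_combs: "map (\<lambda>r. vlead (vsum (sq1_row tab10 10) r)) combs23 = ?x"
  by (simp only: comp tab10 combs23_def)

lemma leads23_rows: "map vlead rows23 = map (\<lambda>r. vlead (sq1_row tab10 10 r)) rels23 @ map (\<lambda>r. vlead (vsum (sq1_row tab10 10) r)) combs23"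
  by (simp add: rows23_def)

definition "lead_set23 = vset (map vlead rows23)"

schematic_goal lead_set23: "lead_set23 = ?x" by (simp only: lead_set23_def leads23_rows leads23_rels leads23_combs vset.simps vinsert.simps vsingle.simps append.simps)

lemma vat_cong: "L = L' \<Longrightarrow> vat p L = vat p L'" by simp

lemmas vat_lead_set23 = lead_set23[THEN vat_cong]

schematic_goal leads10: "vset (map vlead rows10) = ?x" by (simp only: comp rows10)

definition "nonleads10 = nonleads (exps 5 10) (vset (map vlead rows10))"

schematic_goal nonleads10: "nonleads10 = ?x" by (simp only: comp nonleads10_def leads10)

text \<open>Looks only at the subtrie of leading keys below the root y, for those y that lead no row
  of degree 10.\<close>

definition "rest23 y = nonleads (sub01 5 3) (vat (enc y) lead_set23)"

schematic_goal rest23: "map rest23 nonleads10 = ?x" by (simp only: comp nonleads10 rest23_def vat_lead_set23)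

lemma length_rest23: "sum_list (map length (map rest23 nonleads10)) = 1054"
  unfolding rest23 by simp

lemma rows10_elem: "v \<in> set rows10 \<Longrightarrow> (\<exists>r. v = sq_row r) \<or> (\<exists>r. v = vsum sq_row r)"
  unfolding rows10_def by auto

lemma rows23_elem: "v \<in> set rows23 \<Longrightarrow> (\<exists>r. v = sq1_row tab10 10 r) \<or> (\<exists>r. v = vsum (sq1_row tab10 10) r)"
  unfolding rows23_def by auto

section \<open>The theorem\<close>

abbreviation "family9 \<equiv> family (tests T9)"
abbreviation "family23 \<equiv> family (tests T23)"

lemma independent9: "D \<subseteq> family9 \<Longrightarrow> (\<Sum>i\<in>D. member i) \<in> hit \<Longrightarrow> D = {}"
  by (rule data_independent[OF data9])

lemma invariant9:
  assumes "D \<subseteq> family9"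
    and inv: "\<And>A. invertible A \<Longrightarrow> lin_subst A (\<Sum>i\<in>D. member i) + (\<Sum>i\<in>D. member i) \<in> hit"
  shows "D = {}"
  by (rule data_invariant[OF data9 assms(1)]) (assumption | rule inv)+

lemma homogeneous9: "i \<in> family9 \<Longrightarrow> homogeneous 9 (member i)"
  by (rule data_homogeneous[OF data9])

lemma card9: "card family9 = 10 * length (concat (T9 3)) + 5 * length (concat (T9 4)) + length (concat (T9 5))"
  by (rule data_card[OF data9])

lemma independent23: "D \<subseteq> family23 \<Longrightarrow> (\<Sum>i\<in>D. member i) \<in> hit \<Longrightarrow> D = {}"
  by (rule data_independent[OF data23])

lemma invariant23:
  assumes "D \<subseteq> family23"
    and inv: "\<And>A. invertible A \<Longrightarrow> lin_subst A (\<Sum>i\<in>D. member i) + (\<Sum>i\<in>D. member i) \<in> hit"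
  shows "D = {}"
  by (rule data_invariant[OF data23 assms(1)]) (assumption | rule inv)+

lemma homogeneous23: "i \<in> family23 \<Longrightarrow> homogeneous 23 (member i)"
  by (rule data_homogeneous[OF data23])

lemma card23: "card family23 = 10 * length (concat (T23 3)) + 5 * length (concat (T23 4)) + length (concat (T23 5))"
  by (rule data_card[OF data23])

lemma tests23_elem: "ms \<in> set (tests T23 n) \<Longrightarrow>
    (\<forall>m\<in>set ms. length m = n) \<and> 0 \<notin> set (bit_exps n ms) \<and> sum_list (bit_exps n ms) = 23"
  by (rule tests_elem[OF data23])

definition U9 :: "5 pol set" where
  "U9 = mn vars ` set (nonleads (exps 5 9) (vset (map vlead rows9)))"

lemma card_family9: "card family9 = 191"
  unfolding card9 by (simp add: TK9 len9_3 len9_4 len9_5)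

lemma card_family23: "card family23 = 1054"
  unfolding card23 by (simp add: TK23 len23_3 len23_4 len23_5)

lemma U9: "finite U9" "card U9 \<le> card family9" "\<And>e. deg e = 9 \<Longrightarrow> mono e \<in> span_of U9"
proof -
  let ?L = "nonleads (exps 5 9) (vset (map vlead rows9))"
  show "finite U9" unfolding U9_def by blast
  have "card U9 \<le> card (set ?L)" unfolding U9_def by (rule card_image_le) blast
  also have "\<dots> \<le> 191" using card_length[of ?L] unfolding length_nonleads9 .
  finally show "card U9 \<le> card family9" unfolding card_family9 .
  show "mono e \<in> span_of U9" if "deg e = 9" for e
    unfolding U9_def by (rule mono_in_span_of_nonleads[OF rows9_elem that])
qed

lemma dim9: "qp.dim (qp_part 9 :: 5 qp set) = 191"
proof -
  have "qp.dim (qp_part 9 :: 5 qp set) = card family9"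
    by (rule part_basis(1)[OF finite_family independent9 homogeneous9 U9])
  then show ?thesis unfolding card_family9 .
qed

lemma span9: "homogeneous 9 p \<Longrightarrow> \<exists>D\<subseteq>family9. p + (\<Sum>i\<in>D. member i) \<in> hit"
  by (rule part_basis(2)[OF finite_family independent9 homogeneous9 U9])

lemma invariants9: "gl_invariants (qp_part 9 :: 5 qp set) = {0}"
proof (rule part_invariants[OF finite_family independent9 homogeneous9 U9])
  fix D assume D: "D \<subseteq> family9"
    and inv: "\<And>A. invertible A \<Longrightarrow> lin_subst A (\<Sum>i\<in>D. member i) + (\<Sum>i\<in>D. member i) \<in> hit"
  show "D = {}" by (rule invariant9[OF D]) (rule inv)
qed

lemma kameko_family23: "i \<in> family23 \<Longrightarrow> kameko (member i) = 0"
proof -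
  assume i: "i \<in> family23"
  obtain m ms where im: "i = (m, ms)" by (cases i)
  have m: "m \<in> supports" "ms \<in> set (tests T23 (cnt m))" "length m = 5" using i im by (auto simp: family_def supports)
  let ?xs = "compress m vars"
  have xs: "distinct ?xs" "length ?xs = cnt m" using m by (auto simp: distinct_compress vars length_compress)
  have el: "\<forall>v\<in>set ms. length v = cnt m" using tests23_elem[OF m(2)] by blast
  then have len: "length (bit_exps (cnt m) ms) = length ?xs" using xs by (simp add: length_bit_exps)
  have "(\<exists>x. x \<notin> set ?xs) \<or> (\<exists>b<length (bit_exps (cnt m) ms). even (bit_exps (cnt m) ms ! b))"
  proof (cases "cnt m = 5")
    case True
    have "ms \<in> map (bits 5) ` set (concat T23_5)" using m(2) unfolding True tests_def TK23 set_map .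
    then obtain t where t: "t \<in> set (concat T23_5)" "ms = map (bits 5) t" by blast
    have even: "False \<in> set (bits 5 (hd t))"
      using even23_5[folded n5] t(1) unfolding list_all_iff by blast
    \<comment> \<open>Excludes the empty test, for which \<open>hd t\<close> is arbitrary: all its
      exponents would be 0.\<close>
    have "t \<noteq> []"
    proof
      assume "t = []"
      then have "set (bit_exps 5 ms) = {0}" using t(2) by simp
      then show False using tests23_elem[OF m(2)] True by simp
    qed
    then obtain k t' where k: "t = k # t'" by (cases t) auto
    then obtain b where b: "b < 5" "\<not> bits 5 k ! b" using even by (auto simp: in_set_conv_nth)
    have "length (bit_exps 5 (map (bits 5) t')) = 5" by (rule length_bit_exps) auto
    then have "bit_exps 5 ms ! b = 2 * (bit_exps 5 (map (bits 5) t') ! b)" using b t(2) k by simp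
    then show ?thesis using len xs True b by (intro disjI2 exI[of _ b]) simp
  next
    case False
    have "cnt m < 5" using m(1) False by (auto simp: supports_def dest: set_masks)
    then have "card (set ?xs) < card (UNIV :: 5 set)" using xs by (simp add: distinct_card)
    then show ?thesis by (metis UNIV_eq_I less_irrefl)
  qed
  then show "kameko (member i) = 0"
    using kameko_mn_0[OF xs(1) len] unfolding im member.simps by blast
qed

definition "pairs23 = concat (map (\<lambda>y. map (\<lambda>u. (u, y)) (rest23 y)) nonleads10)"

lemma card_pairs23: "finite (set pairs23)" "card (set pairs23) \<le> card family23"
proof -
  have "length pairs23 = 1054"
    using length_rest23 unfolding pairs23_def by (simp add: length_concat o_def)
  then show "card (set pairs23) \<le> card family23" using card_length[of pairs23] unfolding card_family23 by simp
qed blast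

lemma tab10_elem: "tab10 k \<in> insert VZ (set rows10)"
  unfolding tab10_def by (rule slookup_sbuild)

lemma pair_mn_in_if_pairs23:
  assumes "add_closed H" "hit \<subseteq> H" "\<And>u y. (u, y) \<in> set pairs23 \<Longrightarrow> pair_mn u y \<in> H"
    "y \<in> set (exps 5 10)" "u \<in> set (sub01 5 3)"
  shows "pair_mn u y \<in> H"
proof (rule pair_mn_in[OF assms(1,2) rows10_elem tab10_elem rows23_elem _ assms(4,5)])
  fix y u
  assume y: "y \<in> set (nonleads (exps 5 10) (vset (map vlead rows10)))" and u: "u \<in> set (sub01 5 3)"
    and "\<not> vmem (enc (y @ u)) (vset (map vlead rows23))"
  then have "u \<in> set (rest23 y)"
    unfolding rest23_def lead_set23_def by (simp add: set_nonleads enc_append vmem_append)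
  then show "pair_mn u y \<in> H" using y by (intro assms(3)) (auto simp: pairs23_def nonleads10_def)
qed

lemma dim23: "qp.dim (qp_part 23 :: 5 qp set) = 1245"
proof -
  have "qp.dim (qp_part 23 :: 5 qp set) = card family23 + card family9"
  proof (rule dim_23[OF finite_family finite_family independent9 independent23 homogeneous9 homogeneous23
    kameko_family23 finite_set[of pairs23] card_pairs23(2) _ span9])
  fix H u y assume "add_closed H" "hit \<subseteq> H" and p: "\<And>u y. (u, y) \<in> set pairs23 \<Longrightarrow> pair_mn u y \<in> H"
    and "y \<in> set (exps 5 10)" "u \<in> set (sub01 5 3)"
  then show "pair_mn u y \<in> H" by (intro pair_mn_in_if_pairs23[of H y u]) (assumption | rule p)+
  qed
  then show ?thesis unfolding card_family9 card_family23 by simp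
qed

lemma invariants23: "gl_invariants (qp_part 23 :: 5 qp set) = {0}"
proof (rule invariants_23[OF finite_family finite_family independent9 independent23 homogeneous9 homogeneous23
    kameko_family23 finite_set[of pairs23] card_pairs23(2) _ span9 invariants9])
  fix H u y assume "add_closed H" "hit \<subseteq> H" and p: "\<And>u y. (u, y) \<in> set pairs23 \<Longrightarrow> pair_mn u y \<in> H"
    and "y \<in> set (exps 5 10)" "u \<in> set (sub01 5 3)"
  then show "pair_mn u y \<in> H" by (intro pair_mn_in_if_pairs23[of H y u]) (assumption | rule p)+
next
  fix D assume D: "D \<subseteq> family23"
    and inv: "\<And>A. invertible A \<Longrightarrow> lin_subst A (\<Sum>i\<in>D. member i) + (\<Sum>i\<in>D. member i) \<in> hit"
  show "D = {}" by (rule invariant23[OF D]) (rule inv)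
qed

theorem theorem1p3:
  fixes s m :: nat
  assumes "s > 0" and "m = 7 * 2 ^ s - 5"
  shows "(s = 1 \<longrightarrow> qp.dim (qp_part m :: 5 qp set) = 191)
    \<and> (s \<ge> 2 \<longrightarrow> qp.dim (qp_part m :: 5 qp set) = 1245)
    \<and> gl_invariants (qp_part m :: 5 qp set) = {0}"
proof -
  \<comment> \<open>Ensures 5 \<le> 7 * 2 ^ s, so the subtraction that defines m does not
    truncate.\<close>
  have "(2::nat) ^ 1 \<le> 2 ^ s" using assms(1) by (intro power_increasing) auto
  then have "m + 5 = 7 * 2 ^ s" using assms(2) by simp
  then show ?thesis using theorem_from_9_23[OF dim9 invariants9 dim23 invariants23 assms(1)] by auto
qed

end
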